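(* Let $r\ge 2$ be an integer. Let $u$ be the solution of $$\frac{\partial}{\partial t}\Big(\frac{1}{\kappa(x,t)}\frac{\partial u}{\partial t}\Big)-\nabla\cdot\Big(\frac{1}{\rho(x,t)}\nabla u\Big)=f(x,t)\quad\text{in }\Omega\times(0,T),$$ with $u=0$ on $\partial\Omega\times(0,T)$ and $u(\cdot,0)=u_0$, $u_t(\cdot,0)=v_0$ in $\Omega$, and suppose that $u_t,u_{tt}\in L^\infty(0,T;H^r(\Omega))$. For each mesh size $h$ let $U_h:[0,T)\to S_h$ be the semi-discrete Galerkin finite element solution, that is, the solution of $$\Big(\tfrac{1}{\kappa(\cdot,t)}U_{h,tt}(t),\chi\Big)+\big(a(\cdot,t)\nabla U_h(t),\nabla\chi\big)+\big(b(\cdot,t)U_{h,t}(t),\chi\big)=(f(t),\chi)\qquad\forall \chi\in S_h,\ t\in(0,T),$$ with $a=1/\rho$, $b=-\kappa_t/\kappa^2$, and initial data $U_h(0)=u_{0,h}\in S_h$, $U_{h,t}(0)=v_{0,h}\in S_h$ satisfying $$\|u_{0,h}-u_0\|_1\le C_0h^{r-1}\|u_0\|_r,\qquad \|v_{0,h}-v_0\|\le C_0h^r\|v_0\|_r$$ with $C_0$ independent of $h$. Then there exists a constant $C>0$, independent of $h$, such that $$\|u-U_h\|_{L^\infty(0,T;H^1(\Omega))}\le C\,h^{r-1}.$$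
   Context: $\Omega\subset\mathbb{R}^d$, $d\ge1$, is an open bounded Lipschitz domain which is either convex or has smooth boundary; $T>0$ and $J=(0,T)$. The coefficients $\kappa(x,t)>0$ and $\rho(x,t)>0$ are sufficiently smooth, and there are constants $C_\star,C^\star>0$ with $0<C_\star\le 1/\kappa(x,t),\,1/\rho(x,t)\le C^\star$ for all $(x,t)\in\Omega\times J$. No sign is assumed for $b=-\kappa_t/\kappa^2$. The data satisfy $u_0,v_0\in H^r(\Omega)$. Notation: $(\cdot,\cdot)$ and $\|\cdot\|$ are the $L^2(\Omega)$ inner product and norm; $\|\cdot\|_s$ is the norm of the Sobolev space $H^s(\Omega)$, $\|\phi\|_s^2=\sum_{|\alpha|\le s}\|\partial^\alpha\phi\|^2$; $H^1_0(\Omega)$ is the closure of $C_0^\infty(\Omega)$ in $H^1(\Omega)$; a subscript $t$ denotes the time derivative. $\{S_h\}_{h>0}$ is a family of finite-dimensional subspaces of $H_0^1(\Omega)$, associated with regular simplicial partitions of $\Omega$ of mesh size $h$, with the approximation property: there is a constant $c>0$ independent of $h$ such that $$\min_{\chi\in S_h}\big(\|v-\chi\|+h\|v-\chi\|_1\big)\le c\,h^r\|v\|_r\qquad\forall v\in H_0^1(\Omega)\cap H^r(\Omega).$$ *)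

theory Defs
  imports "HOL-Analysis.Analysis" "HOL-Probability.Essential_Supremum" "HOL-Library.Multiset"
begin

text \<open>
  Multi-indices over an orthonormal basis are multisets of basis vectors: the multi-index
  \<open>\<alpha>\<close> has order \<open>|\<alpha>| = size \<alpha>\<close>.  Elements of Lebesgue and Sobolev spaces
  are represented by functions; nothing below depends on the representative up to null sets.
  Functions of time and space take the time as their first argument.
\<close>

fun iter_partial :: "'a::euclidean_space list \<Rightarrow> ('a \<Rightarrow> real) \<Rightarrow> 'a \<Rightarrow> real" where
  "iter_partial [] f = f"
| "iter_partial (v # vs) f = (\<lambda>x. frechet_derivative (iter_partial vs f) (at x) v)"

definition smooth :: "('a::euclidean_space \<Rightarrow> real) \<Rightarrow> bool" where
  "smooth f \<longleftrightarrow> (\<forall>vs. set vs \<subseteq> Basis \<longrightarrow> iter_partial vs f differentiable_on UNIV)"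

text \<open>The space \<open>C\<^sup>k\<close> of the closure of an open set \<open>Q\<close>: all partial derivatives of order at
  most \<open>k\<close> exist in \<open>Q\<close> and extend continuously to the closure.\<close>

definition Ck_closure :: "nat \<Rightarrow> 'a::euclidean_space set \<Rightarrow> ('a \<Rightarrow> real) \<Rightarrow> bool" where
  "Ck_closure k Q f \<longleftrightarrow> (\<forall>vs. set vs \<subseteq> Basis \<longrightarrow>
     (length vs < k \<longrightarrow> iter_partial vs f differentiable_on Q) \<and>
     (length vs \<le> k \<longrightarrow>
        (\<exists>g. continuous_on (closure Q) g \<and> (\<forall>x\<in>Q. g x = iter_partial vs f x))))"

definition test_functions :: "'a::euclidean_space set \<Rightarrow> ('a \<Rightarrow> real) set" where
  "test_functions \<Omega> = {\<phi>. smooth \<phi> \<and> compact (closure {x. \<phi> x \<noteq> 0}) \<and> closure {x. \<phi> x \<noteq> 0} \<subseteq> \<Omega>}"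

text \<open>Near each boundary point, \<open>\<Omega>\<close> is the strict epigraph, in some direction \<open>e\<close>, of a function
  \<open>g\<close> of the components orthogonal to \<open>e\<close>.  Only the values of \<open>g\<close> on the hyperplane
  orthogonal to \<open>e\<close> matter.\<close>

definition boundary_of_graphs :: "(('a::euclidean_space \<Rightarrow> real) \<Rightarrow> bool) \<Rightarrow> 'a set \<Rightarrow> bool" where
  "boundary_of_graphs P \<Omega> \<longleftrightarrow> (\<forall>p\<in>frontier \<Omega>. \<exists>\<delta>>0. \<exists>e g. norm e = 1 \<and> P g \<and>
     \<Omega> \<inter> ball p \<delta> = {x \<in> ball p \<delta>. g (x - (x \<bullet> e) *\<^sub>R e) < x \<bullet> e})"

definition lipschitz_boundary :: "'a::euclidean_space set \<Rightarrow> bool" where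
  "lipschitz_boundary = boundary_of_graphs (\<lambda>g. \<exists>L. L-lipschitz_on UNIV g)"

definition smooth_boundary :: "'a::euclidean_space set \<Rightarrow> bool" where
  "smooth_boundary = boundary_of_graphs smooth"

definition L2 :: "'a::euclidean_space set \<Rightarrow> ('a \<Rightarrow> real) set" where
  "L2 \<Omega> = {f. f \<in> borel_measurable (lebesgue_on \<Omega>) \<and> integrable (lebesgue_on \<Omega>) (\<lambda>x. (f x)\<^sup>2)}"

definition L2_inner :: "'a::euclidean_space set \<Rightarrow> ('a \<Rightarrow> real) \<Rightarrow> ('a \<Rightarrow> real) \<Rightarrow> real" where
  "L2_inner \<Omega> f g = (LINT x|lebesgue_on \<Omega>. f x * g x)"

definition L2_norm :: "'a::euclidean_space set \<Rightarrow> ('a \<Rightarrow> real) \<Rightarrow> real" where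
  "L2_norm \<Omega> f = sqrt (L2_inner \<Omega> f f)"

definition locally_integrable :: "'a::euclidean_space set \<Rightarrow> ('a \<Rightarrow> real) \<Rightarrow> bool" where
  "locally_integrable \<Omega> f \<longleftrightarrow> (\<forall>K. compact K \<longrightarrow> K \<subseteq> \<Omega> \<longrightarrow> f absolutely_integrable_on K)"

definition has_weak_partial ::
    "'a::euclidean_space set \<Rightarrow> 'a multiset \<Rightarrow> ('a \<Rightarrow> real) \<Rightarrow> ('a \<Rightarrow> real) \<Rightarrow> bool" where
  "has_weak_partial \<Omega> \<alpha> f g \<longleftrightarrow> locally_integrable \<Omega> f \<and> locally_integrable \<Omega> g \<and>
     (\<forall>\<phi>\<in>test_functions \<Omega>. \<forall>vs. mset vs = \<alpha> \<longrightarrow>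
        (LINT x|lebesgue_on \<Omega>. f x * iter_partial vs \<phi> x) =
        (-1) ^ size \<alpha> * (LINT x|lebesgue_on \<Omega>. g x * \<phi> x))"

definition multi_indices :: "nat \<Rightarrow> 'a::euclidean_space multiset set" where
  "multi_indices s = {\<alpha>. set_mset \<alpha> \<subseteq> Basis \<and> size \<alpha> \<le> s}"

definition sobolev :: "'a::euclidean_space set \<Rightarrow> nat \<Rightarrow> ('a \<Rightarrow> real) set" where
  "sobolev \<Omega> s = {f \<in> L2 \<Omega>. \<forall>\<alpha>\<in>multi_indices s. \<exists>g\<in>L2 \<Omega>. has_weak_partial \<Omega> \<alpha> f g}"

definition weak_partial ::
    "'a::euclidean_space set \<Rightarrow> 'a multiset \<Rightarrow> ('a \<Rightarrow> real) \<Rightarrow> 'a \<Rightarrow> real" where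
  "weak_partial \<Omega> \<alpha> f = (SOME g. g \<in> L2 \<Omega> \<and> has_weak_partial \<Omega> \<alpha> f g)"

definition weak_grad :: "'a::euclidean_space set \<Rightarrow> ('a \<Rightarrow> real) \<Rightarrow> 'a \<Rightarrow> 'a" where
  "weak_grad \<Omega> f x = (\<Sum>e\<in>Basis. weak_partial \<Omega> {#e#} f x *\<^sub>R e)"

text \<open>Meaningful only on \<^term>\<open>sobolev \<Omega> s\<close>.\<close>

definition sobolev_norm :: "'a::euclidean_space set \<Rightarrow> nat \<Rightarrow> ('a \<Rightarrow> real) \<Rightarrow> real" where
  "sobolev_norm \<Omega> s f = sqrt (\<Sum>\<alpha>\<in>multi_indices s. (L2_norm \<Omega> (weak_partial \<Omega> \<alpha> f))\<^sup>2)"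

definition H1_0 :: "'a::euclidean_space set \<Rightarrow> ('a \<Rightarrow> real) set" where
  "H1_0 \<Omega> = {f \<in> sobolev \<Omega> 1.
     \<forall>\<epsilon>>0. \<exists>\<phi>\<in>test_functions \<Omega>. sobolev_norm \<Omega> 1 (\<lambda>x. f x - \<phi> x) < \<epsilon>}"

text \<open>Bochner measurability: almost everywhere limit of measurable functions with finitely many
  values.\<close>

definition strongly_measurable ::
    "real \<Rightarrow> 'a::euclidean_space set \<Rightarrow> nat \<Rightarrow> (real \<Rightarrow> 'a \<Rightarrow> real) \<Rightarrow> bool" where
  "strongly_measurable T \<Omega> s v \<longleftrightarrow> (\<exists>\<sigma> :: nat \<Rightarrow> real \<Rightarrow> 'a \<Rightarrow> real.
     (\<forall>n. finite (\<sigma> n ` {0<..<T}) \<and> \<sigma> n ` {0<..<T} \<subseteq> sobolev \<Omega> s \<and>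
          (\<forall>w. {t \<in> {0<..<T}. \<sigma> n t = w} \<in> sets lebesgue)) \<and>
     (AE t in lebesgue_on {0<..<T}.
        (\<lambda>n. sobolev_norm \<Omega> s (\<lambda>x. v t x - \<sigma> n t x)) \<longlonglongrightarrow> 0))"

definition Linfty_norm ::
    "real \<Rightarrow> 'a::euclidean_space set \<Rightarrow> nat \<Rightarrow> (real \<Rightarrow> 'a \<Rightarrow> real) \<Rightarrow> ereal" where
  "Linfty_norm T \<Omega> s v = esssup (lebesgue_on {0<..<T}) (\<lambda>t. ereal (sobolev_norm \<Omega> s (v t)))"

definition Linfty_sobolev ::
    "real \<Rightarrow> 'a::euclidean_space set \<Rightarrow> nat \<Rightarrow> (real \<Rightarrow> 'a \<Rightarrow> real) set" where
  "Linfty_sobolev T \<Omega> s = {v. (AE t in lebesgue_on {0<..<T}. v t \<in> sobolev \<Omega> s) \<and>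
     strongly_measurable T \<Omega> s v \<and> Linfty_norm T \<Omega> s v < \<infinity>}"

text \<open>The weak time derivative on \<open>(0,T)\<close> of a function with values in \<open>L\<^sup>2(\<Omega>)\<close>; the vector-valued
  identity is tested with the elements of the dual space.\<close>

definition has_weak_time_derivative ::
    "real \<Rightarrow> 'a::euclidean_space set \<Rightarrow> (real \<Rightarrow> 'a \<Rightarrow> real) \<Rightarrow> (real \<Rightarrow> 'a \<Rightarrow> real) \<Rightarrow> bool" where
  "has_weak_time_derivative T \<Omega> v w \<longleftrightarrow> (\<forall>\<phi>\<in>L2 \<Omega>.
     has_weak_partial {0<..<T} {#1#} (\<lambda>t. L2_inner \<Omega> (v t) \<phi>) (\<lambda>t. L2_inner \<Omega> (w t) \<phi>))"

definition continuous_on_sobolev ::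
    "'a::euclidean_space set \<Rightarrow> nat \<Rightarrow> real set \<Rightarrow> (real \<Rightarrow> 'a \<Rightarrow> real) \<Rightarrow> bool" where
  "continuous_on_sobolev \<Omega> s I v \<longleftrightarrow> (\<forall>t\<in>I. v t \<in> sobolev \<Omega> s \<and>
     ((\<lambda>\<tau>. sobolev_norm \<Omega> s (\<lambda>x. v \<tau> x - v t x)) \<longlongrightarrow> 0) (at t within I))"

definition has_derivative_on_sobolev ::
    "'a::euclidean_space set \<Rightarrow> nat \<Rightarrow> real set \<Rightarrow> (real \<Rightarrow> 'a \<Rightarrow> real) \<Rightarrow> (real \<Rightarrow> 'a \<Rightarrow> real) \<Rightarrow> bool"
  where
  "has_derivative_on_sobolev \<Omega> s I v w \<longleftrightarrow> (\<forall>t\<in>I. v t \<in> sobolev \<Omega> s \<and> w t \<in> sobolev \<Omega> s \<and>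
     ((\<lambda>\<tau>. sobolev_norm \<Omega> s (\<lambda>x. (v \<tau> x - v t x) / (\<tau> - t) - w t x)) \<longlongrightarrow> 0) (at t within I))"

definition stiffness ::
    "'a::euclidean_space set \<Rightarrow> ('a \<Rightarrow> real) \<Rightarrow> ('a \<Rightarrow> real) \<Rightarrow> ('a \<Rightarrow> real) \<Rightarrow> real" where
  "stiffness \<Omega> a v w = (LINT x|lebesgue_on \<Omega>. a x * (weak_grad \<Omega> v x \<bullet> weak_grad \<Omega> w x))"

text \<open>
  \<open>u\<close> solves \<open>(u\<^sub>t / \<kappa>)\<^sub>t - div ((1 / \<rho>) \<nabla>u) = f\<close> in the sense of distributions on
  \<open>\<Omega> \<times> (0,T)\<close>: paired with a test function \<open>\<phi>\<close> in space the equation becomes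
  \<open>d/dt (u\<^sub>t / \<kappa>, \<phi>) = (f, \<phi>) - ((1 / \<rho>) \<nabla>u, \<nabla>\<phi>)\<close>, weakly on \<open>(0,T)\<close>.  The boundary condition
  is membership in \<open>H\<^sup>1\<^sub>0\<close>.  For the initial conditions, \<open>u\<close> and \<open>u\<^sub>t\<close> are the representatives that are
  continuous on \<open>[0,T)\<close> with values in \<open>L\<^sup>2(\<Omega>)\<close>.
\<close>

definition wave_solution ::
    "real \<Rightarrow> 'a::euclidean_space set \<Rightarrow> (real \<Rightarrow> 'a \<Rightarrow> real) \<Rightarrow> (real \<Rightarrow> 'a \<Rightarrow> real) \<Rightarrow>
     (real \<Rightarrow> 'a \<Rightarrow> real) \<Rightarrow> ('a \<Rightarrow> real) \<Rightarrow> ('a \<Rightarrow> real) \<Rightarrow>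
     (real \<Rightarrow> 'a \<Rightarrow> real) \<Rightarrow> (real \<Rightarrow> 'a \<Rightarrow> real) \<Rightarrow> bool" where
  "wave_solution T \<Omega> \<kappa> \<rho> f u0 v0 u u\<^sub>t \<longleftrightarrow>
     u \<in> Linfty_sobolev T \<Omega> 1 \<and>
     (AE t in lebesgue_on {0<..<T}. u t \<in> H1_0 \<Omega>) \<and>
     has_weak_time_derivative T \<Omega> u u\<^sub>t \<and>
     (\<forall>\<phi>\<in>test_functions \<Omega>.
        has_weak_partial {0<..<T} {#1#}
          (\<lambda>t. L2_inner \<Omega> (\<lambda>x. 1 / \<kappa> t x * u\<^sub>t t x) \<phi>)
          (\<lambda>t. L2_inner \<Omega> (f t) \<phi> - stiffness \<Omega> (\<lambda>x. 1 / \<rho> t x) (u t) \<phi>)) \<and>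
     continuous_on_sobolev \<Omega> 0 {0..<T} u \<and>
     continuous_on_sobolev \<Omega> 0 {0..<T} u\<^sub>t \<and>
     (AE x in lebesgue_on \<Omega>. u 0 x = u0 x) \<and>
     (AE x in lebesgue_on \<Omega>. u\<^sub>t 0 x = v0 x)"

definition finite_dim_space :: "('a \<Rightarrow> real) set \<Rightarrow> bool" where
  "finite_dim_space S \<longleftrightarrow> (\<exists>B. finite B \<and> S = {(\<lambda>x. \<Sum>b\<in>B. c b * b x) | c. True})"

definition b_coeff :: "(real \<Rightarrow> 'a \<Rightarrow> real) \<Rightarrow> real \<Rightarrow> 'a \<Rightarrow> real" where
  "b_coeff \<kappa> t x = - deriv (\<lambda>\<tau>. \<kappa> \<tau> x) t / (\<kappa> t x)\<^sup>2"

definition galerkin_solution ::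
    "real \<Rightarrow> 'a::euclidean_space set \<Rightarrow> (real \<Rightarrow> 'a \<Rightarrow> real) \<Rightarrow> (real \<Rightarrow> 'a \<Rightarrow> real) \<Rightarrow>
     (real \<Rightarrow> 'a \<Rightarrow> real) \<Rightarrow> ('a \<Rightarrow> real) set \<Rightarrow> ('a \<Rightarrow> real) \<Rightarrow> ('a \<Rightarrow> real) \<Rightarrow>
     (real \<Rightarrow> 'a \<Rightarrow> real) \<Rightarrow> bool" where
  "galerkin_solution T \<Omega> \<kappa> \<rho> f S u0 v0 U \<longleftrightarrow> (\<exists>U\<^sub>t U\<^sub>t\<^sub>t.
     (\<forall>t\<in>{0..<T}. U t \<in> S \<and> U\<^sub>t t \<in> S) \<and> (\<forall>t\<in>{0<..<T}. U\<^sub>t\<^sub>t t \<in> S) \<and>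
     has_derivative_on_sobolev \<Omega> 1 {0..<T} U U\<^sub>t \<and>
     continuous_on_sobolev \<Omega> 1 {0..<T} U\<^sub>t \<and>
     has_derivative_on_sobolev \<Omega> 1 {0<..<T} U\<^sub>t U\<^sub>t\<^sub>t \<and>
     (\<forall>t\<in>{0<..<T}. \<forall>w\<in>S.
        L2_inner \<Omega> (\<lambda>x. 1 / \<kappa> t x * U\<^sub>t\<^sub>t t x) w
        + stiffness \<Omega> (\<lambda>x. 1 / \<rho> t x) (U t) w
        + L2_inner \<Omega> (\<lambda>x. b_coeff \<kappa> t x * U\<^sub>t t x) w
        = L2_inner \<Omega> (f t) w) \<and>
     (AE x in lebesgue_on \<Omega>. U 0 x = u0 x) \<and>
     (AE x in lebesgue_on \<Omega>. U\<^sub>t 0 x = v0 x))"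

end

theory Submission
  imports Defs "HOL-Library.Function_Algebras" "HOL-Computational_Algebra.Polynomial"
begin

text \<open>
  Let \<open>P\<close> be the orthogonal projection of \<open>H\<^sup>1(\<Omega>)\<close> onto \<open>S\<^sub>h\<close>.  Unlike the elliptic projection it does
  not depend on time, so it commutes with time differences.  Put \<open>\<theta> = U\<^sub>h - P u\<close>, \<open>\<omega> = \<theta>\<^sub>t\<close>,
  \<open>\<eta> = u - P u\<close> and \<open>\<zeta> = \<eta>\<^sub>t\<close>.  Since \<open>u\<close> and \<open>u\<^sub>t\<close> are bounded and Lipschitz in time with values in
  \<open>H\<^sup>r\<close>, the approximation property makes \<open>\<eta>\<close> and \<open>\<zeta>\<close> bounded and Lipschitz with values in \<open>H\<^sup>1\<close>, with
  constants \<open>\<epsilon> = O(h\<^sup>r\<^sup>-\<^sup>1)\<close>.  Subtracting the two equations gives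
  \<open>d/dt ((\<omega> - \<zeta>) / \<kappa>, \<xi>) = - ((1 / \<rho>) \<nabla>(\<theta> - \<eta>), \<nabla>\<xi>)\<close> for \<open>\<xi>\<close> in \<open>S\<^sub>h\<close>; the derivative exists at
  every time, although the equation for \<open>u\<close> holds only weakly, because the right-hand side is
  continuous.  Testing with \<open>\<xi> = \<omega>\<close> produces \<open>((1 / \<rho>) \<nabla>\<eta>, \<nabla>\<omega>)\<close>, and \<open>\<nabla>\<omega>\<close> is not controlled by the
  energy; the term \<open>- 2 ((1 / \<rho>) \<nabla>\<eta>, \<nabla>\<theta>)\<close> added to the energy moves the time derivative onto \<open>\<eta>\<close>,
  and the \<open>L\<^sup>2\<close> norm of \<open>\<theta>\<close> added to it replaces Poincare's inequality.  As \<open>\<eta>\<close> and \<open>\<zeta>\<close> are only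
  Lipschitz in time, Gronwall's lemma is applied to the upper right Dini derivative of the energy.
\<close>

section \<open>Semi-inner products\<close>

text \<open>The term with b needs no sign: it is exactly what completes (1/\<kappa>) u_tt to the
  time derivative of u_t/\<kappa>, and both equations are used in that conservative form. The rate
  is r - 1 because the approximation property is divided by h to control the H^1 norm. Two obstacles
  shape the development. Functions that agree almost everywhere are not identified, so every norm is
  only a seminorm, and forms that are bilinear on a subspace have to be carried over to all
  functions. Moreover, u_t and u_tt are controlled only weakly and at almost every time, whereas the
  energy argument needs values, increments and Taylor remainders in H^r at every time. These are
  bounded without integrating H^r-valued functions: pairing with derivatives of test functions
  leaves scalar integrals, and a bounded functional on test functions is represented in L^2 by a
  minimising sequence and completeness. Computing with norms of chosen weak derivatives requires
  their uniqueness, hence the fundamental lemma and its bump functions.\<close>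

instantiation "fun" :: (type, real_vector) real_vector
begin
definition scaleR_fun :: "real \<Rightarrow> ('a \<Rightarrow> 'b) \<Rightarrow> 'a \<Rightarrow> 'b" where
  "scaleR_fun c f = (\<lambda>x. c *\<^sub>R f x)"
instance
  by standard (simp_all add: scaleR_fun_def plus_fun_def fun_eq_iff algebra_simps)
end

lemma scaleR_apply [simp]: "(c *\<^sub>R f) x = c *\<^sub>R f x"
  by (simp add: scaleR_fun_def)

text \<open>Definiteness is left out on purpose: a function that vanishes almost everywhere has norm
  zero without being zero.\<close>

locale semi_inner =
  fixes ip :: "'v::real_vector \<Rightarrow> 'v \<Rightarrow> real"
  assumes bilin: "bilinear ip"
    and sym: "ip x y = ip y x"
    and nonneg: "0 \<le> ip x x"
begin

definition nrm :: "'v \<Rightarrow> real" where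
  "nrm x = sqrt (ip x x)"

lemmas ip_simps = bilinear_ladd[OF bilin] bilinear_radd[OF bilin] bilinear_lsub[OF bilin]
  bilinear_rsub[OF bilin] bilinear_lmul[OF bilin] bilinear_rmul[OF bilin]
  bilinear_lzero[OF bilin] bilinear_rzero[OF bilin]

lemma nrm_nonneg [simp]: "0 \<le> nrm x"
  by (simp add: nrm_def nonneg)

lemma nrm_sq: "(nrm x)\<^sup>2 = ip x x"
  by (simp add: nrm_def nonneg)

lemma nrm_zero [simp]: "nrm 0 = 0"
  by (simp add: nrm_def ip_simps)

lemma ip_sq_le: "(ip x y)\<^sup>2 \<le> ip x x * ip y y"
proof (cases "ip y y = 0")
  case True
  have "ip x y = 0"
  proof (rule ccontr)
    assume ne: "ip x y \<noteq> 0"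
    \<comment> \<open>With \<open>ip y y = 0\<close> the quadratic form is affine along the
      direction \<open>y\<close>, and this coefficient makes it equal to -1.\<close>
    define c where "c = - (ip x x + 1) / (2 * ip x y)"
    have "ip (x + c *\<^sub>R y) (x + c *\<^sub>R y) = ip x x + 2 * c * ip x y"
      using True by (simp add: ip_simps sym[of y x] algebra_simps)
    also have "\<dots> = -1"
      using ne by (simp add: c_def field_simps)
    finally show False
      using nonneg[of "x + c *\<^sub>R y"] by simp
  qed
  then show ?thesis using True by simp
next
  case False
  then have pos: "ip y y > 0" using nonneg[of y] by simp
  \<comment> \<open>This is \<open>ip y y\<close> times the part of \<open>x\<close> orthogonal to
    \<open>y\<close>; clearing the denominator keeps the computation polynomial.\<close>
  let ?z = "ip y y *\<^sub>R x - ip x y *\<^sub>R y"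
  have "ip ?z ?z = ip y y * (ip x x * ip y y - (ip x y)\<^sup>2)"
    by (simp add: ip_simps sym[of y x] algebra_simps power2_eq_square)
  then show ?thesis
    using nonneg[of ?z] pos by (simp add: zero_le_mult_iff)
qed

lemma cauchy_schwarz: "\<bar>ip x y\<bar> \<le> nrm x * nrm y"
proof -
  have "\<bar>ip x y\<bar> = sqrt ((ip x y)\<^sup>2)" by simp
  also have "\<dots> \<le> sqrt (ip x x * ip y y)"
    using ip_sq_le by (simp del: real_sqrt_abs)
  finally show ?thesis by (simp add: nrm_def real_sqrt_mult)
qed

lemma nrm_triangle: "nrm (x + y) \<le> nrm x + nrm y"
proof (rule power2_le_imp_le)
  have "(nrm (x + y))\<^sup>2 = (nrm x)\<^sup>2 + 2 * ip x y + (nrm y)\<^sup>2"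
    by (simp add: nrm_sq ip_simps sym[of y x])
  also have "\<dots> \<le> (nrm x + nrm y)\<^sup>2"
    using cauchy_schwarz[of x y] by (simp add: power2_sum)
  finally show "(nrm (x + y))\<^sup>2 \<le> (nrm x + nrm y)\<^sup>2" .
qed simp

lemma nrm_scale: "nrm (c *\<^sub>R x) = \<bar>c\<bar> * nrm x"
  by (simp add: nrm_def ip_simps real_sqrt_mult flip: mult.assoc)

lemma nrm_minus: "nrm (- x) = nrm x"
  using nrm_scale[of "-1" x] by simp

lemma nrm_diff_commute: "nrm (x - y) = nrm (y - x)"
  using nrm_minus[of "x - y"] by simp

lemma nrm_triangle_diff: "nrm (x - y) \<le> nrm x + nrm y"
  using nrm_triangle[of x "- y"] by (simp add: nrm_minus)

lemma nrm_diff_triangle: "nrm (x - z) \<le> nrm (x - y) + nrm (y - z)"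
  using nrm_triangle[of "x - y" "y - z"] by simp

lemma nrm_rev_triangle: "\<bar>nrm x - nrm y\<bar> \<le> nrm (x - y)"
  using nrm_triangle[of "x - y" y] nrm_triangle[of "y - x" x] nrm_diff_commute[of x y] by simp

lemma nrm_tendsto:
  assumes "((\<lambda>t. nrm (X t - x)) \<longlongrightarrow> 0) F"
  shows "((\<lambda>t. nrm (X t)) \<longlongrightarrow> nrm x) F"
proof -
  have "((\<lambda>t. nrm (X t) - nrm x) \<longlongrightarrow> 0) F"
    by (rule Lim_null_comparison[OF _ assms]) (simp add: nrm_rev_triangle)
  then show ?thesis by (simp add: LIM_zero_iff)
qed

lemma nrm_null_add:
  assumes "((\<lambda>t. nrm (X t - x)) \<longlongrightarrow> 0) F" "((\<lambda>t. nrm (Y t - y)) \<longlongrightarrow> 0) F"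
  shows "((\<lambda>t. nrm ((X t + Y t) - (x + y))) \<longlongrightarrow> 0) F"
proof (rule Lim_null_comparison)
  show "((\<lambda>t. nrm (X t - x) + nrm (Y t - y)) \<longlongrightarrow> 0) F"
    using tendsto_add[OF assms] by simp
  show "\<forall>\<^sub>F t in F. norm (nrm ((X t + Y t) - (x + y))) \<le> nrm (X t - x) + nrm (Y t - y)"
    using nrm_triangle by (auto simp: add_diff_add)
qed

text \<open>The two arguments are moved one at a time. The form is arbitrary, so that the result
  also serves the mass and stiffness forms at a frozen time.\<close>

lemma bounded_form_tendsto:
  assumes B: "bilinear B" and bd: "\<And>x y. \<bar>B x y\<bar> \<le> C * nrm x * nrm y"
    and X: "((\<lambda>t. nrm (X t - x)) \<longlongrightarrow> 0) F" and Y: "((\<lambda>t. nrm (Y t - y)) \<longlongrightarrow> 0) F"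
  shows "((\<lambda>t. B (X t) (Y t)) \<longlongrightarrow> B x y) F"
proof -
  have eq: "B (X t) (Y t) - B x y = B (X t - x) (Y t) + B x (Y t - y)" for t
    by (simp add: bilinear_lsub[OF B] bilinear_rsub[OF B])
  have "((\<lambda>t. C * nrm (X t - x) * nrm (Y t) + C * nrm x * nrm (Y t - y)) \<longlongrightarrow> C * 0 * nrm y + C * nrm x * 0) F"
    by (intro tendsto_intros X Y nrm_tendsto)
  then have lim: "((\<lambda>t. C * nrm (X t - x) * nrm (Y t) + C * nrm x * nrm (Y t - y)) \<longlongrightarrow> 0) F"
    by simp
  have "((\<lambda>t. B (X t) (Y t) - B x y) \<longlongrightarrow> 0) F"
  proof (rule Lim_null_comparison[OF always_eventually lim], rule allI)
    fix t
    show "norm (B (X t) (Y t) - B x y) \<le> C * nrm (X t - x) * nrm (Y t) + C * nrm x * nrm (Y t - y)"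
      unfolding eq using bd[of "X t - x" "Y t"] bd[of x "Y t - y"] by simp
  qed
  then show ?thesis by (simp add: LIM_zero_iff)
qed

lemma ip_tendsto:
  assumes "((\<lambda>t. nrm (X t - x)) \<longlongrightarrow> 0) F" "((\<lambda>t. nrm (Y t - y)) \<longlongrightarrow> 0) F"
  shows "((\<lambda>t. ip (X t) (Y t)) \<longlongrightarrow> ip x y) F"
  using bounded_form_tendsto[OF bilin _ assms, of 1] cauchy_schwarz by simp

text \<open>The approximants minimise \<open>(nrm x)\<^sup>2 - 2 l x\<close>; the parallelogram law makes a
  minimising sequence Cauchy, and the first variation identifies \<open>l\<close>.\<close>

lemma riesz_approximation:
  assumes D: "subspace D"
    and add: "\<And>x y. x \<in> D \<Longrightarrow> y \<in> D \<Longrightarrow> l (x + y) = l x + l y"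
    and scale: "\<And>c x. x \<in> D \<Longrightarrow> l (c *\<^sub>R x) = c * l x"
    and bd: "\<And>x. x \<in> D \<Longrightarrow> \<bar>l x\<bar> \<le> K * nrm x"
  obtains X :: "nat \<Rightarrow> 'v" where "\<And>n. X n \<in> D"
    "\<And>e. 0 < e \<Longrightarrow> \<exists>N. \<forall>m\<ge>N. \<forall>n\<ge>N. nrm (X m - X n) < e"
    "\<And>x. x \<in> D \<Longrightarrow> (\<lambda>n. ip (X n) x) \<longlonglongrightarrow> l x"
proof -
  define J where "J x = (nrm x)\<^sup>2 - 2 * l x" for x
  have J_lower: "- K\<^sup>2 \<le> J x" if "x \<in> D" for x
  proof -
    \<comment> \<open>The bound on \<open>l\<close> gives J x >= (nrm x)^2 - 2 K nrm x, and
      completing the square bounds the right-hand side below by -K^2.\<close>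
    have "0 \<le> (nrm x - K)\<^sup>2" by simp
    then show ?thesis using bd[OF that] by (simp add: J_def power2_diff abs_le_iff mult.commute)
  qed
  define m where "m = Inf (J ` D)"
  have bdd: "bdd_below (J ` D)" using J_lower by (rule bdd_belowI2)
  have ne: "J ` D \<noteq> {}" using subspace_0[OF D] by auto
  have m_le: "m \<le> J x" if "x \<in> D" for x
    unfolding m_def using bdd that by (simp add: cInf_lower)
  have "\<exists>x\<in>D. J x < m + 1 / real (Suc n)" for n
    using cInf_lessD[OF ne, of "m + 1 / real (Suc n)"] by (auto simp: m_def)
  then obtain X where XD: "\<And>n. X n \<in> D" and XJ: "\<And>n. J (X n) < m + 1 / real (Suc n)"
    by metis
  have l_diff: "l (x - y) = l x - l y" if "x \<in> D" "y \<in> D" for x y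
    using add[of x "(-1) *\<^sub>R y"] scale[of y "-1"] subspace_scale[OF D, of y "-1"] that by simp
  have par: "(nrm (X j - X k))\<^sup>2 \<le> 2 / real (Suc j) + 2 / real (Suc k)" for j k
  proof -
    define c where "c = (1/2) *\<^sub>R (X j + X k)"
    have c: "c \<in> D" using XD D by (simp add: c_def subspace_add subspace_scale)
    have lc: "l c = (l (X j) + l (X k)) / 2"
      using scale[of "X j + X k" "1/2"] add[OF XD XD, of j k] subspace_add[OF D XD XD, of j k]
      by (simp add: c_def del: scaleR_add_right)
    have nc: "(nrm c)\<^sup>2 = (ip (X j) (X j) + 2 * ip (X j) (X k) + ip (X k) (X k)) / 4"
      by (simp add: c_def nrm_sq ip_simps sym[of "X k" "X j"] field_simps)
    have "(nrm (X j - X k))\<^sup>2 = 2 * J (X j) + 2 * J (X k) - 4 * J c"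
      by (simp add: J_def lc nc) (simp add: nrm_sq ip_simps sym[of "X k" "X j"] field_simps)
    then show ?thesis using XJ[of j] XJ[of k] m_le[OF c] by simp
  qed
  have cauchy: "\<exists>N. \<forall>j\<ge>N. \<forall>k\<ge>N. nrm (X j - X k) < e" if "0 < e" for e
  proof -
    obtain N where N: "4 / e\<^sup>2 < real (Suc N)"
      using reals_Archimedean2 by (metis less_trans of_nat_less_iff lessI)
    have "nrm (X j - X k) < e" if "j \<ge> N" "k \<ge> N" for j k
    proof (rule power2_less_imp_less)
      have "2 / real (Suc j) \<le> 2 / real (Suc N)" "2 / real (Suc k) \<le> 2 / real (Suc N)"
        using that by (auto intro!: divide_left_mono)
      then have "(nrm (X j - X k))\<^sup>2 \<le> 4 / real (Suc N)"
        using par[of j k] by simp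
      also have "\<dots> < e\<^sup>2"
        using N \<open>0 < e\<close> by (simp add: field_simps)
      finally show "(nrm (X j - X k))\<^sup>2 < e\<^sup>2" .
    qed (use \<open>0 < e\<close> in simp)
    then show ?thesis by blast
  qed
  have lim: "(\<lambda>n. ip (X n) x) \<longlonglongrightarrow> l x" if x: "x \<in> D" for x
  proof -
    have key: "\<bar>ip (X n) x - l x\<bar> \<le> (1 / sqrt (real (Suc n))) * (1 + ip x x) / 2" for n
    proof -
      \<comment> \<open>The value of \<open>J\<close> at \<open>X n\<close> exceeds the infimum by
        less than s^2, so a variation of size s balances this deficit against the linear term, whose
        coefficient must then be of order s.\<close>
      define s where "s = 1 / sqrt (real (Suc n))"
      have s: "s > 0" "s\<^sup>2 = 1 / real (Suc n)" by (simp_all add: s_def power_divide)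
      have "0 \<le> s\<^sup>2 + 2 * c * (ip (X n) x - l x) + c\<^sup>2 * ip x x" for c
      proof -
        have "m \<le> J (X n + c *\<^sub>R x)"
          using m_le XD x D by (simp add: subspace_add subspace_scale)
        also have "\<dots> = J (X n) + 2 * c * (ip (X n) x - l x) + c\<^sup>2 * ip x x"
          unfolding J_def nrm_sq
          by (simp add: ip_simps add scale XD x subspace_scale[OF D] sym[of x "X n"]
              power2_eq_square algebra_simps)
        finally show ?thesis using XJ[of n] s by simp
      qed
      from this[of s] this[of "-s"]
      have "s * (2 * \<bar>ip (X n) x - l x\<bar>) \<le> s * (s * (1 + ip x x))"
        by (simp add: abs_if power2_eq_square algebra_simps)
      then have "\<bar>ip (X n) x - l x\<bar> \<le> s * (1 + ip x x) / 2"
        using s(1) by (simp only: mult_le_cancel_left_pos) simp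
      then show ?thesis by (simp add: s_def)
    qed
    have "(\<lambda>n. sqrt (1 / real (Suc n))) \<longlonglongrightarrow> sqrt 0"
      by (intro tendsto_real_sqrt LIMSEQ_Suc lim_1_over_n)
    then have "(\<lambda>n. (1 / sqrt (real (Suc n)))) \<longlonglongrightarrow> 0"
      by (simp add: real_sqrt_divide)
    then have null: "(\<lambda>n. (1 / sqrt (real (Suc n))) * ((1 + ip x x) / 2)) \<longlonglongrightarrow> 0"
      by (rule tendsto_mult_left_zero)
    have "(\<lambda>n. ip (X n) x - l x) \<longlonglongrightarrow> 0"
      by (rule Lim_null_comparison[OF always_eventually null]) (use key in simp)
    then show ?thesis by (simp add: LIM_zero_iff)
  qed
  show ?thesis by (rule that[OF XD cauchy lim])
qed

text \<open>One Gram-Schmidt step per basis vector: the induction hypothesis is applied both to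
  \<open>v\<close> and to the new vector \<open>b\<close>, which is first made orthogonal to the old
  span. Finite dimension takes the place of completeness.\<close>

lemma projection_exists:
  assumes "finite B"
  shows "\<exists>p\<in>span B. \<forall>\<xi>\<in>span B. ip (v - p) \<xi> = 0"
  using assms
proof (induction B arbitrary: v)
  case empty
  then show ?case by (auto simp: ip_simps)
next
  case (insert b B)
  obtain q where q: "q \<in> span B" "\<forall>\<xi>\<in>span B. ip (b - q) \<xi> = 0"
    using insert.IH by blast
  obtain p where p: "p \<in> span B" "\<forall>\<xi>\<in>span B. ip (v - p) \<xi> = 0"
    using insert.IH by blast
  define d where "d = b - q"
  define c where "c = ip v d / ip d d"
  have d: "ip d \<xi> = 0" "ip \<xi> d = 0" if "\<xi> \<in> span B" for \<xi>
    using q that sym by (simp_all add: d_def)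
  \<comment> \<open>If \<open>d\<close> has seminorm zero, division by zero makes \<open>c\<close>
    equal to 0; Cauchy-Schwarz then makes \<open>ip v d\<close> vanish as well, so the equation
    survives.\<close>
  have cd: "c * ip d d = ip v d"
  proof (cases "ip d d = 0")
    case True
    then have "ip v d = 0" using ip_sq_le[of v d] by simp
    then show ?thesis by (simp add: c_def)
  qed (simp add: c_def)
  have sub: "span B \<subseteq> span (insert b B)" by (simp add: span_mono subset_insertI)
  have d_in: "d \<in> span (insert b B)"
    unfolding d_def using q(1) sub by (intro span_diff) (auto intro: span_base)
  show ?case
  proof (intro bexI[of _ "p + c *\<^sub>R d"] ballI)
    show "p + c *\<^sub>R d \<in> span (insert b B)"
      using p(1) d_in sub by (auto intro!: span_add span_scale)
    fix \<xi> assume "\<xi> \<in> span (insert b B)"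
    then obtain k where k: "\<xi> - k *\<^sub>R b \<in> span B"
      using span_breakdown_eq[of \<xi> b B] by blast
    define \<psi> where "\<psi> = \<xi> - k *\<^sub>R d"
    have \<psi>: "\<psi> \<in> span B"
    proof -
      have "\<psi> = (\<xi> - k *\<^sub>R b) + k *\<^sub>R q" by (simp add: \<psi>_def d_def algebra_simps)
      then show ?thesis using k q(1) by (simp add: span_add span_scale)
    qed
    have \<xi>: "\<xi> = \<psi> + k *\<^sub>R d" by (simp add: \<psi>_def)
    show "ip (v - (p + c *\<^sub>R d)) \<xi> = 0"
      using p d[OF \<psi>] d[OF p(1)] \<psi> cd unfolding \<xi> by (simp add: ip_simps algebra_simps)
  qed
qed

end

section \<open>Dini derivatives\<close>

text \<open>Fix a slope \<open>e\<close>. The times satisfying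
  \<open>z t \<le> z a + e * (t - a)\<close> form a closed set; if its supremum were less than
  \<open>b\<close>, the Dini bound would produce a later element. Finally \<open>e\<close> tends to
  0.\<close>

lemma dini_nonincreasing:
  fixes z :: "real \<Rightarrow> real"
  assumes "a \<le> b" and cont: "continuous_on {a..b} z"
    and dini: "\<And>s e. s \<in> {a..<b} \<Longrightarrow> 0 < e \<Longrightarrow>
      \<forall>\<^sub>F t in at_right s. z t - z s \<le> e * (t - s)"
  shows "z b \<le> z a"
proof -
  have bound: "z b \<le> z a + e * (b - a)" if e: "0 < e" for e
  proof -
    define G where "G = {t \<in> {a..b}. z t \<le> z a + e * (t - a)}"
    have "closed G"
    proof -
      have "G = {a..b} \<inter> (\<lambda>t. z t - (z a + e * (t - a))) -` {..0}"
        by (auto simp: G_def)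
      then show ?thesis
        by (simp only:) (intro continuous_closed_preimage continuous_intros cont; simp)
    qed
    have aG: "a \<in> G" using \<open>a \<le> b\<close> by (simp add: G_def)
    have bdd: "bdd_above G" by (auto simp: G_def intro: bdd_aboveI[of _ b])
    define s where "s = Sup G"
    have sG: "s \<in> G"
      unfolding s_def using closed_contains_Sup[OF _ bdd \<open>closed G\<close>] aG by auto
    have "s = b"
    proof (rule ccontr)
      assume "s \<noteq> b"
      then have s: "s \<in> {a..<b}" using sG by (auto simp: G_def)
      have "\<forall>\<^sub>F t in at_right s. t \<in> {s<..<b}"
        using s by (intro eventually_at_right_real) auto
      then have "\<forall>\<^sub>F t in at_right s. t \<in> {s<..<b} \<and> z t - z s \<le> e * (t - s)"
        using dini[OF s e] by eventually_elim auto
      then obtain t where t: "t \<in> {s<..<b}" "z t - z s \<le> e * (t - s)"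
        using eventually_happens'[of "at_right s"] by (metis (no_types, lifting) trivial_limit_at_right_real)
      have "t \<in> G" using t s sG by (auto simp: G_def algebra_simps)
      then have "t \<le> s" unfolding s_def using bdd by (rule cSup_upper)
      then show False using t by simp
    qed
    then show ?thesis using sG by (simp add: G_def)
  qed
  have "z b \<le> z a + e" if "0 < e" for e
  proof (cases "a = b")
    case False
    then have ba: "b - a > 0" using \<open>a \<le> b\<close> by simp
    show ?thesis using bound[of "e / (b - a)"] ba that by simp
  qed (use that in simp)
  then show ?thesis by (rule field_le_epsilon)
qed

text \<open>Instead of a derivative of \<open>y\<close>, the hypothesis asks for a majorant
  \<open>R\<close> of the right difference quotients that has a limit; terms that are merely
  Lipschitz can enter \<open>R\<close> through their Lipschitz bounds. Multiplication by exp (- K t)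
  reduces the claim to the nonincreasing case.\<close>

lemma dini_gronwall:
  fixes y :: "real \<Rightarrow> real"
  assumes "a \<le> b" and cont: "continuous_on {a..b} y"
    and dini: "\<And>s. s \<in> {a..<b} \<Longrightarrow> \<exists>R l. (R \<longlongrightarrow> l) (at_right s) \<and> l \<le> K * y s \<and>
      (\<forall>\<^sub>F t in at_right s. y t - y s \<le> (t - s) * R t)"
  shows "y b \<le> exp (K * (b - a)) * y a"
proof -
  define z where "z t = exp (- K * t) * y t" for t
  have "z b \<le> z a"
  proof (rule dini_nonincreasing[OF \<open>a \<le> b\<close>])
    show "continuous_on {a..b} z" unfolding z_def by (intro continuous_intros cont)
    fix s e :: real assume s: "s \<in> {a..<b}" and e: "0 < e"
    obtain R l where R: "(R \<longlongrightarrow> l) (at_right s)" "l \<le> K * y s"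
      "\<forall>\<^sub>F t in at_right s. y t - y s \<le> (t - s) * R t"
      using dini[OF s] by blast
    have "((\<lambda>t. exp (- K * t)) has_real_derivative - K * exp (- K * s)) (at s)"
      by (auto intro!: derivative_eq_intros)
    then have der: "((\<lambda>t. (exp (- K * t) - exp (- K * s)) / (t - s)) \<longlongrightarrow> - K * exp (- K * s)) (at_right s)"
      unfolding has_field_derivative_iff by (rule filterlim_mono) (auto simp: at_le)
    \<comment> \<open>The majorant for the quotients of \<open>z\<close> that the product rule
      yields. Its limit exp (- K s) * (l - K * y s) is at most 0.\<close>
    define Q where "Q t = exp (- K * t) * R t + y s * ((exp (- K * t) - exp (- K * s)) / (t - s))" for t
    have "(Q \<longlongrightarrow> exp (- K * s) * l + y s * (- K * exp (- K * s))) (at_right s)"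
      unfolding Q_def by (intro tendsto_intros R der)
    moreover have "exp (- K * s) * l + y s * (- K * exp (- K * s)) < e"
    proof -
      have "exp (- K * s) * l + y s * (- K * exp (- K * s)) = exp (- K * s) * (l - K * y s)"
        by (simp add: algebra_simps)
      also have "\<dots> \<le> 0" using R(2) by (simp add: mult_nonneg_nonpos)
      finally show ?thesis using e by linarith
    qed
    ultimately have "\<forall>\<^sub>F t in at_right s. Q t < e" by (rule order_tendstoD(2))
    moreover have "\<forall>\<^sub>F t in at_right s. t > s" by (simp add: eventually_at_right_less)
    ultimately show "\<forall>\<^sub>F t in at_right s. z t - z s \<le> e * (t - s)"
      using R(3)
    proof eventually_elim
      case (elim t)
      have "z t - z s = exp (- K * t) * (y t - y s) + y s * (exp (- K * t) - exp (- K * s))"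
        by (simp add: z_def algebra_simps)
      also have "\<dots> \<le> exp (- K * t) * ((t - s) * R t) + y s * (exp (- K * t) - exp (- K * s))"
        using elim by (intro add_right_mono mult_left_mono) auto
      also have "\<dots> = (t - s) * Q t" using elim(2) by (simp add: Q_def field_simps)
      also have "\<dots> \<le> (t - s) * e" using elim by (intro mult_left_mono) auto
      finally show ?case by (simp add: mult.commute)
    qed
  qed
  then have "exp (K * b) * (exp (- K * b) * y b) \<le> exp (K * b) * (exp (- K * a) * y a)"
    unfolding z_def by (rule mult_left_mono) simp
  then show ?thesis by (simp add: exp_diff exp_minus right_diff_distrib field_simps)
qed

section \<open>The energy estimate\<close>

text \<open>\<open>M\<close> and \<open>A\<close> stand for the mass and stiffness forms. They are
  available only on the open time interval, like the coefficients, and their dependence on time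
  enters only as a Lipschitz bound. \<open>A_lower\<close> is Garding's inequality: the stiffness
  controls the gradient, so the weaker norm is added.\<close>

locale wave_forms = H0: semi_inner ip0 + H1: semi_inner ip1
  for ip0 ip1 :: "'v::real_vector \<Rightarrow> 'v \<Rightarrow> real" +
  fixes M A :: "real \<Rightarrow> 'v \<Rightarrow> 'v \<Rightarrow> real" and T lo hi L :: real
  assumes nrm_le: "H0.nrm x \<le> H1.nrm x"
    and constants: "0 < T" "0 < lo" "0 \<le> hi" "0 \<le> L"
    and M_bilinear: "t \<in> {0<..<T} \<Longrightarrow> bilinear (M t)"
    and M_sym: "t \<in> {0<..<T} \<Longrightarrow> M t x y = M t y x"
    and M_lower: "t \<in> {0<..<T} \<Longrightarrow> lo * (H0.nrm x)\<^sup>2 \<le> M t x x"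
    and M_upper: "t \<in> {0<..<T} \<Longrightarrow> \<bar>M t x y\<bar> \<le> hi * H0.nrm x * H0.nrm y"
    and M_lipschitz: "s \<in> {0<..<T} \<Longrightarrow> t \<in> {0<..<T} \<Longrightarrow>
      \<bar>M t x y - M s x y\<bar> \<le> L * \<bar>t - s\<bar> * H0.nrm x * H0.nrm y"
    and A_bilinear: "t \<in> {0<..<T} \<Longrightarrow> bilinear (A t)"
    and A_sym: "t \<in> {0<..<T} \<Longrightarrow> A t x y = A t y x"
    and A_lower: "t \<in> {0<..<T} \<Longrightarrow> lo * (H1.nrm x)\<^sup>2 \<le> A t x x + lo * (H0.nrm x)\<^sup>2"
    and A_upper: "t \<in> {0<..<T} \<Longrightarrow> \<bar>A t x y\<bar> \<le> hi * H1.nrm x * H1.nrm y"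
    and A_lipschitz: "s \<in> {0<..<T} \<Longrightarrow> t \<in> {0<..<T} \<Longrightarrow>
      \<bar>A t x y - A s x y\<bar> \<le> L * \<bar>t - s\<bar> * H1.nrm x * H1.nrm y"
begin

abbreviation "n0 \<equiv> H0.nrm"
abbreviation "n1 \<equiv> H1.nrm"

text \<open>Replacing the form at time t by the form at time s costs a multiple of \<bar>t -
  s\<bar>; what remains is convergence for one fixed bounded form.\<close>

lemma M_tendsto:
  assumes s: "s \<in> {0<..<T}"
    and X: "((\<lambda>t. n0 (X t - x)) \<longlongrightarrow> 0) (at s within G)"
    and Y: "((\<lambda>t. n0 (Y t - y)) \<longlongrightarrow> 0) (at s within G)"
  shows "((\<lambda>t. M t (X t) (Y t)) \<longlongrightarrow> M s x y) (at s within G)"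
proof -
  have "((\<lambda>t. L * \<bar>t - s\<bar> * n0 (X t) * n0 (Y t)) \<longlongrightarrow> L * \<bar>s - s\<bar> * n0 x * n0 y) (at s within G)"
    by (intro tendsto_intros H0.nrm_tendsto X Y)
  then have null: "((\<lambda>t. L * \<bar>t - s\<bar> * n0 (X t) * n0 (Y t)) \<longlongrightarrow> 0) (at s within G)" by simp
  have "\<forall>\<^sub>F t in at s within G. t \<in> {0<..<T}"
    using s by (intro filter_leD[OF at_within_le_nhds] eventually_nhds_in_open) auto
  then have "\<forall>\<^sub>F t in at s within G. norm (M t (X t) (Y t) - M s (X t) (Y t))
      \<le> L * \<bar>t - s\<bar> * n0 (X t) * n0 (Y t)"
    by eventually_elim (use M_lipschitz[OF s] in simp)
  then have "((\<lambda>t. M t (X t) (Y t) - M s (X t) (Y t)) \<longlongrightarrow> 0) (at s within G)"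
    by (rule Lim_null_comparison[OF _ null])
  from tendsto_add[OF this H0.bounded_form_tendsto[OF M_bilinear[OF s] M_upper[OF s] X Y]]
  show ?thesis by simp
qed

lemma A_tendsto:
  assumes s: "s \<in> {0<..<T}"
    and X: "((\<lambda>t. n1 (X t - x)) \<longlongrightarrow> 0) (at s within G)"
    and Y: "((\<lambda>t. n1 (Y t - y)) \<longlongrightarrow> 0) (at s within G)"
  shows "((\<lambda>t. A t (X t) (Y t)) \<longlongrightarrow> A s x y) (at s within G)"
proof -
  have "((\<lambda>t. L * \<bar>t - s\<bar> * n1 (X t) * n1 (Y t)) \<longlongrightarrow> L * \<bar>s - s\<bar> * n1 x * n1 y) (at s within G)"
    by (intro tendsto_intros H1.nrm_tendsto X Y)
  then have null: "((\<lambda>t. L * \<bar>t - s\<bar> * n1 (X t) * n1 (Y t)) \<longlongrightarrow> 0) (at s within G)" by simp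
  have "\<forall>\<^sub>F t in at s within G. t \<in> {0<..<T}"
    using s by (intro filter_leD[OF at_within_le_nhds] eventually_nhds_in_open) auto
  then have "\<forall>\<^sub>F t in at s within G. norm (A t (X t) (Y t) - A s (X t) (Y t))
      \<le> L * \<bar>t - s\<bar> * n1 (X t) * n1 (Y t)"
    by eventually_elim (use A_lipschitz[OF s] in simp)
  then have "((\<lambda>t. A t (X t) (Y t) - A s (X t) (Y t)) \<longlongrightarrow> 0) (at s within G)"
    by (rule Lim_null_comparison[OF _ null])
  from tendsto_add[OF this H1.bounded_form_tendsto[OF A_bilinear[OF s] A_upper[OF s] X Y]]
  show ?thesis by simp
qed

lemma n0_null: "((\<lambda>t. n1 (X t)) \<longlongrightarrow> 0) F \<Longrightarrow> ((\<lambda>t. n0 (X t)) \<longlongrightarrow> 0) F"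
  by (rule Lim_null_comparison[OF always_eventually]) (simp_all add: nrm_le)

text \<open>The first summand turns the coefficient 2 L + hi + lo of the squared norms into a
  multiple of lo n0^2 + lo/2 n1^2, and the second collects the \<epsilon>^2 terms. In
  \<open>energy_const\<close>, 2 / lo inverts the coefficient of n1^2 in
  \<open>energy_lower\<close>, the exponential is Gronwall's, and the last factor is that of
  \<open>energy_upper\<close>.\<close>

definition "growth_rate = (2 * L + hi + lo) * 2 / lo + 2 * (L + hi)"
definition "energy_const = (2 / lo) * exp (growth_rate * T) * (2 * hi + lo + 2 * hi\<^sup>2 / lo + 1)"

lemma growth_rate_nonneg: "0 \<le> growth_rate"
  using constants by (simp add: growth_rate_def)

lemma energy_const_pos: "0 < energy_const"
proof -
  have "0 < 2 * hi + lo + 2 * hi\<^sup>2 / lo + 1"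
    using constants by (intro add_nonneg_pos add_nonneg_nonneg) auto
  then show ?thesis using constants by (simp add: energy_const_def)
qed

end

text \<open>In the application \<open>\<theta>\<close> is the difference between the discrete solution and the projection of
  the exact one, \<open>\<omega>\<close> its time derivative, \<open>\<eta>\<close> the projection error and \<open>\<zeta>\<close> the projection error
  of the time derivative.\<close>

locale wave_error = wave_forms +
  fixes S :: "'a set" and \<theta> \<omega> \<eta> \<zeta> :: "real \<Rightarrow> 'a" and \<epsilon> :: real
  assumes S: "subspace S"
    and \<theta>_in: "t \<in> {0..<T} \<Longrightarrow> \<theta> t \<in> S"
    and \<omega>_in: "t \<in> {0..<T} \<Longrightarrow> \<omega> t \<in> S"
    and \<theta>_deriv: "s \<in> {0<..<T} \<Longrightarrow>
      ((\<lambda>t. n1 ((1 / (t - s)) *\<^sub>R (\<theta> t - \<theta> s) - \<omega> s)) \<longlongrightarrow> 0) (at s within {0..<T})"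
    and \<theta>_cont: "s \<in> {0..<T} \<Longrightarrow> ((\<lambda>t. n1 (\<theta> t - \<theta> s)) \<longlongrightarrow> 0) (at s within {0..<T})"
    and \<omega>_cont: "s \<in> {0..<T} \<Longrightarrow> ((\<lambda>t. n1 (\<omega> t - \<omega> s)) \<longlongrightarrow> 0) (at s within {0..<T})"
    and \<epsilon>: "0 \<le> \<epsilon>"
    and \<eta>_bound: "t \<in> {0<..<T} \<Longrightarrow> n1 (\<eta> t) \<le> \<epsilon>"
    and \<eta>_lipschitz: "s \<in> {0<..<T} \<Longrightarrow> t \<in> {0<..<T} \<Longrightarrow> n1 (\<eta> t - \<eta> s) \<le> \<epsilon> * \<bar>t - s\<bar>"
    and \<zeta>_bound: "t \<in> {0<..<T} \<Longrightarrow> n0 (\<zeta> t) \<le> \<epsilon>"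
    and \<zeta>_lipschitz: "s \<in> {0<..<T} \<Longrightarrow> t \<in> {0<..<T} \<Longrightarrow> n0 (\<zeta> t - \<zeta> s) \<le> \<epsilon> * \<bar>t - s\<bar>"
    and error_eq: "t \<in> {0<..<T} \<Longrightarrow> \<xi> \<in> S \<Longrightarrow>
      ((\<lambda>t. M t (\<omega> t - \<zeta> t) \<xi>) has_real_derivative - A t (\<theta> t - \<eta> t) \<xi>) (at t)"
begin

text \<open>Young's inequality splits the mixed term, at most 2 hi \<epsilon> n1(\<theta>) in
  absolute value, into lo/2 n1(\<theta>)^2 and 2 hi^2/lo \<epsilon>^2. The constant summand pays for
  the second part and leaves a surplus \<epsilon>^2, so that the energy dominates the \<epsilon>^2
  terms appearing in its own growth.\<close>

definition energy :: "real \<Rightarrow> real" where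
  "energy t = M t (\<omega> t) (\<omega> t) + A t (\<theta> t) (\<theta> t) + lo * (n0 (\<theta> t))\<^sup>2 - 2 * A t (\<eta> t) (\<theta> t)
     + (2 * hi\<^sup>2 / lo + 1) * \<epsilon>\<^sup>2"

lemma A_\<eta>_\<theta>: "t \<in> {0<..<T} \<Longrightarrow> \<bar>A t (\<eta> t) (\<theta> t)\<bar> \<le> hi * \<epsilon> * n1 (\<theta> t)"
  using A_upper[of t "\<eta> t" "\<theta> t"] \<eta>_bound[of t] constants \<epsilon>
  by (meson H1.nrm_nonneg mult_left_mono mult_right_mono order_trans)

lemma energy_lower:
  assumes t: "t \<in> {0<..<T}"
  shows "lo * (n0 (\<omega> t))\<^sup>2 + lo / 2 * (n1 (\<theta> t))\<^sup>2 + \<epsilon>\<^sup>2 \<le> energy t"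
proof -
  have "0 \<le> (lo * n1 (\<theta> t) - 2 * hi * \<epsilon>)\<^sup>2 / (2 * lo)" using constants by simp
  also have "\<dots> = lo / 2 * (n1 (\<theta> t))\<^sup>2 - 2 * (hi * \<epsilon> * n1 (\<theta> t)) + 2 * hi\<^sup>2 / lo * \<epsilon>\<^sup>2"
    using constants by (simp add: power2_eq_square field_simps)
  finally show ?thesis
    using M_lower[OF t, of "\<omega> t"] A_lower[OF t, of "\<theta> t"] A_\<eta>_\<theta>[OF t]
    unfolding energy_def by (simp add: algebra_simps)
qed

lemma energy_upper:
  assumes t: "t \<in> {0<..<T}"
  shows "energy t \<le> (2 * hi + lo + 2 * hi\<^sup>2 / lo + 1) * ((n0 (\<omega> t))\<^sup>2 + (n1 (\<theta> t))\<^sup>2 + \<epsilon>\<^sup>2)"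
proof -
  define a b where "a = n0 (\<omega> t)" and "b = n1 (\<theta> t)"
  define c where "c = 2 * hi\<^sup>2 / lo + 1"
  have c: "0 \<le> c" using constants by (simp add: c_def)
  have "M t (\<omega> t) (\<omega> t) \<le> hi * a\<^sup>2" "A t (\<theta> t) (\<theta> t) \<le> hi * b\<^sup>2"
    unfolding a_def b_def power2_eq_square mult.assoc[symmetric]
    using abs_le_D1[OF M_upper[OF t]] abs_le_D1[OF A_upper[OF t]] by blast+
  moreover have "lo * (n0 (\<theta> t))\<^sup>2 \<le> lo * b\<^sup>2"
    using nrm_le[of "\<theta> t"] constants by (simp add: b_def power_mono)
  moreover have "- 2 * A t (\<eta> t) (\<theta> t) \<le> hi * (b\<^sup>2 + \<epsilon>\<^sup>2)"
  proof -
    have "hi * (2 * b * \<epsilon>) = 2 * (hi * \<epsilon> * n1 (\<theta> t))"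
      unfolding b_def by algebra
    then have "- 2 * A t (\<eta> t) (\<theta> t) \<le> hi * (2 * b * \<epsilon>)"
      using abs_le_D2[OF A_\<eta>_\<theta>[OF t]] by linarith
    also have "\<dots> \<le> hi * (b\<^sup>2 + \<epsilon>\<^sup>2)"
      using constants sum_squares_bound[of b \<epsilon>] by (intro mult_left_mono) auto
    finally show ?thesis .
  qed
  ultimately have "energy t \<le> hi * a\<^sup>2 + hi * b\<^sup>2 + lo * b\<^sup>2 + hi * (b\<^sup>2 + \<epsilon>\<^sup>2) + c * \<epsilon>\<^sup>2"
    unfolding energy_def c_def by linarith
  also have "\<dots> \<le> (2 * hi + lo + c) * (a\<^sup>2 + b\<^sup>2 + \<epsilon>\<^sup>2)"
  proof -
    have "0 \<le> (hi + lo + c) * a\<^sup>2 + c * b\<^sup>2 + (hi + lo) * \<epsilon>\<^sup>2" using c constants by simp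
    then show ?thesis by (simp add: algebra_simps)
  qed
  finally show ?thesis by (simp add: a_def b_def c_def add.assoc)
qed

lemma \<eta>_cont:
  assumes "s \<in> {0<..<T}"
  shows "((\<lambda>t. n1 (\<eta> t - \<eta> s)) \<longlongrightarrow> 0) (at s)"
proof -
  have "((\<lambda>t. \<epsilon> * \<bar>t - s\<bar>) \<longlongrightarrow> \<epsilon> * \<bar>s - s\<bar>) (at s)" by (intro tendsto_intros)
  then have null: "((\<lambda>t. \<epsilon> * \<bar>t - s\<bar>) \<longlongrightarrow> 0) (at s)" by simp
  have "\<forall>\<^sub>F t in at s. t \<in> {0<..<T}" using assms by (intro eventually_at_in_open') auto
  then have "\<forall>\<^sub>F t in at s. norm (n1 (\<eta> t - \<eta> s)) \<le> \<epsilon> * \<bar>t - s\<bar>"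
    by eventually_elim (use \<eta>_lipschitz[OF assms] in simp)
  then show ?thesis by (rule Lim_null_comparison[OF _ null])
qed

lemma at_within_Ico_eq_at: "s \<in> {0<..<T} \<Longrightarrow> at s within {0..<T} = at s"
  by (rule at_within_open_subset[of _ "{0<..<T}"]) auto

lemma interior_limits:
  assumes "s \<in> {0<..<T}"
  shows "((\<lambda>t. n1 ((1 / (t - s)) *\<^sub>R (\<theta> t - \<theta> s) - \<omega> s)) \<longlongrightarrow> 0) (at s)"
    and "((\<lambda>t. n1 (\<theta> t - \<theta> s)) \<longlongrightarrow> 0) (at s)"
    and "((\<lambda>t. n1 (\<omega> t - \<omega> s)) \<longlongrightarrow> 0) (at s)"
  using \<theta>_deriv[OF assms] \<theta>_cont[of s] \<omega>_cont[of s] assms at_within_Ico_eq_at[OF assms] by auto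

lemma energy_isCont:
  assumes s: "s \<in> {0<..<T}"
  shows "isCont energy s"
  unfolding isCont_def energy_def using s
  by (intro tendsto_intros M_tendsto A_tendsto H0.nrm_tendsto n0_null interior_limits \<eta>_cont)

text \<open>The difficulty is the mass term: \<omega> - \<zeta> is differentiable only when paired
  with a fixed vector of \<open>S\<close>, while \<omega> itself is merely continuous. The increment
  is therefore expressed by \<open>p\<close> at the fixed vector 2 \<omega>(s), where
  \<open>error_eq\<close> applies, and by \<open>p\<close> at \<omega>(t) - \<omega>(s), whose
  contribution is of lower order because \<open>p\<close> is Lipschitz in time uniformly with
  respect to its second argument.\<close>

lemma energy_dini:
  assumes s: "s \<in> {0<..<T}"
  shows "\<exists>R l. (R \<longlongrightarrow> l) (at_right s) \<and> l \<le> growth_rate * energy s \<and>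
    (\<forall>\<^sub>F t in at_right s. energy t - energy s \<le> (t - s) * R t)"
proof -
  have mono: "at_right s \<le> at s" by (simp add: at_le)
  note lims = interior_limits[OF s, THEN tendsto_mono[OF mono]]
  note \<eta>_lim = \<eta>_cont[OF s, THEN tendsto_mono[OF mono]]
  define p where "p t \<xi> = M t (\<omega> t - \<zeta> t) \<xi>" for t \<xi>
  define e where "e t = \<theta> t - \<eta> t" for t
  define \<delta> where "\<delta> t = (1 / (t - s)) *\<^sub>R (\<theta> t - \<theta> s)" for t
  define Cp where "Cp = hi * (n1 (e s) + 1)"
  have \<omega>s: "\<omega> s \<in> S" using \<omega>_in s by simp
  have e_lim: "((\<lambda>t. n1 (e t - e s)) \<longlongrightarrow> 0) (at_right s)"
  proof (rule Lim_null_comparison[OF always_eventually])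
    show "((\<lambda>t. n1 (\<theta> t - \<theta> s) + n1 (\<eta> t - \<eta> s)) \<longlongrightarrow> 0) (at_right s)"
      using tendsto_add[OF lims(2) \<eta>_lim] by simp
    show "\<forall>t. norm (n1 (e t - e s)) \<le> n1 (\<theta> t - \<theta> s) + n1 (\<eta> t - \<eta> s)"
      using H1.nrm_triangle_diff[of "\<theta> _ - \<theta> s" "\<eta> _ - \<eta> s"] by (simp add: e_def algebra_simps)
  qed
  \<comment> \<open>On one interval to the right of s, valid for every \<xi> in \<open>S\<close>,
    the derivative of \<open>p\<close> is now bounded by \<open>Cp * n1 \<xi>\<close>; the mean
    value theorem turns this into the Lipschitz bound.\<close>
  have "\<forall>\<^sub>F t in at_right s. n1 (e t) < n1 (e s) + 1"
    using H1.nrm_tendsto[OF e_lim] by (rule order_tendstoD) simp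
  then obtain b where b: "b > s" "\<And>t. s < t \<Longrightarrow> t < b \<Longrightarrow> n1 (e t) < n1 (e s) + 1"
    unfolding eventually_at_right[OF less_add_one[of s]] by blast
  have p_lip: "\<bar>p t \<xi> - p s \<xi>\<bar> \<le> (t - s) * (Cp * n1 \<xi>)"
    if t: "s < t" "t < b" "t < T" and \<xi>: "\<xi> \<in> S" for t \<xi>
  proof -
    have der: "((\<lambda>t. p t \<xi>) has_real_derivative - A \<tau> (e \<tau>) \<xi>) (at \<tau>)" if "s \<le> \<tau>" "\<tau> \<le> t" for \<tau>
      unfolding p_def e_def using that t s \<xi> by (intro error_eq) auto
    obtain \<tau> where \<tau>: "s < \<tau>" "\<tau> < t" "p t \<xi> - p s \<xi> = (t - s) * (- A \<tau> (e \<tau>) \<xi>)"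
      using MVT2[OF t(1), of "\<lambda>t. p t \<xi>" "\<lambda>\<tau>. - A \<tau> (e \<tau>) \<xi>"] der by blast
    have "\<bar>A \<tau> (e \<tau>) \<xi>\<bar> \<le> hi * n1 (e \<tau>) * n1 \<xi>"
      using \<tau> s t by (intro A_upper) auto
    also have "\<dots> \<le> Cp * n1 \<xi>"
      unfolding Cp_def using b(2)[of \<tau>] \<tau> t constants by (intro mult_right_mono mult_left_mono) auto
    finally show ?thesis using \<tau>(3) t(1) by (simp add: abs_mult)
  qed
  \<comment> \<open>Each summand majorises one piece of the energy increment after division by t -
    s. Since \<delta>(t) tends to \<omega>(s), all of them have limits, and these add up to
    \<open>l\<close>.\<close>
  define R where "R t = (p t (2 *\<^sub>R \<omega> s) - p s (2 *\<^sub>R \<omega> s)) / (t - s) + Cp * n1 (\<omega> t - \<omega> s)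
    + (L + hi) * \<epsilon> * n0 (\<omega> t + \<omega> s) + L * n0 (\<omega> t) * n0 (\<omega> s)
    + L * (n1 (\<theta> t))\<^sup>2 + A s (\<delta> t) (\<theta> t + \<theta> s) + lo * ip0 (\<delta> t) (\<theta> t + \<theta> s)
    + 2 * (L + hi) * \<epsilon> * n1 (\<theta> t) - 2 * A s (\<eta> s) (\<delta> t)" for t
  define l where "l = - A s (e s) (2 *\<^sub>R \<omega> s) + Cp * 0
    + (L + hi) * \<epsilon> * n0 (\<omega> s + \<omega> s) + L * n0 (\<omega> s) * n0 (\<omega> s)
    + L * (n1 (\<theta> s))\<^sup>2 + A s (\<omega> s) (\<theta> s + \<theta> s) + lo * ip0 (\<omega> s) (\<theta> s + \<theta> s)
    + 2 * (L + hi) * \<epsilon> * n1 (\<theta> s) - 2 * A s (\<eta> s) (\<omega> s)"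
  have const: "((\<lambda>t. n1 (x - x)) \<longlongrightarrow> 0) F" for x :: 'a and F :: "real filter" by simp
  have p_der: "((\<lambda>t. (p t (2 *\<^sub>R \<omega> s) - p s (2 *\<^sub>R \<omega> s)) / (t - s)) \<longlongrightarrow> - A s (e s) (2 *\<^sub>R \<omega> s)) (at_right s)"
    using error_eq[OF s subspace_scale[OF S \<omega>s]] unfolding has_field_derivative_iff p_def e_def
    by (rule tendsto_mono[OF mono])
  have "(R \<longlongrightarrow> l) (at_right s)"
    unfolding R_def l_def \<delta>_def
    by (intro tendsto_intros p_der lims H0.nrm_tendsto H1.nrm_tendsto n0_null H1.nrm_null_add const
        H1.bounded_form_tendsto[OF A_bilinear[OF s] A_upper[OF s]] H0.ip_tendsto)
  moreover have "l \<le> growth_rate * energy s"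
  proof -
    note A = A_bilinear[OF s]
    define a b where "a = n0 (\<omega> s)" and "b = n1 (\<theta> s)"
    have ab: "0 \<le> a" "0 \<le> b" by (simp_all add: a_def b_def)
    have "n0 (\<omega> s + \<omega> s) = 2 * a"
      using H0.nrm_scale[of 2 "\<omega> s"] by (simp add: a_def scaleR_2)
    moreover have "ip0 (\<omega> s) (\<theta> s + \<theta> s) \<le> 2 * (a * b)"
    proof -
      have "ip0 (\<omega> s) (\<theta> s) \<le> n0 (\<omega> s) * n0 (\<theta> s)" using H0.cauchy_schwarz[of "\<omega> s" "\<theta> s"] by simp
      also have "\<dots> \<le> a * b" unfolding a_def b_def by (intro mult_left_mono nrm_le) simp
      finally show ?thesis by (simp add: H0.ip_simps)
    qed
    then have "lo * ip0 (\<omega> s) (\<theta> s + \<theta> s) \<le> lo * (2 * (a * b))"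
      using constants by (intro mult_left_mono) auto
    \<comment> \<open>Here the correction in the energy pays off: every term that pairs \<omega>
      under the stiffness form cancels.\<close>
    moreover have "- A s (e s) (2 *\<^sub>R \<omega> s) + A s (\<omega> s) (\<theta> s + \<theta> s) - 2 * A s (\<eta> s) (\<omega> s) = 0"
      using A_sym[OF s, of "\<omega> s" "\<theta> s"]
      by (simp add: e_def bilinear_lsub[OF A] bilinear_rmul[OF A] bilinear_radd[OF A])
    ultimately have "l \<le> (L + hi) * (2 * a * \<epsilon>) + L * a\<^sup>2 + L * b\<^sup>2 + lo * (2 * a * b) + (L + hi) * (2 * b * \<epsilon>)"
      unfolding l_def by (simp add: a_def b_def power2_eq_square algebra_simps)
    also have "\<dots> \<le> (L + hi) * (a\<^sup>2 + \<epsilon>\<^sup>2) + L * a\<^sup>2 + L * b\<^sup>2 + lo * (a\<^sup>2 + b\<^sup>2) + (L + hi) * (b\<^sup>2 + \<epsilon>\<^sup>2)"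
      using constants sum_squares_bound[of a \<epsilon>] sum_squares_bound[of b \<epsilon>] sum_squares_bound[of a b]
      by (intro add_mono mult_left_mono) auto
    also have "\<dots> = (2 * L + hi + lo) * (a\<^sup>2 + b\<^sup>2) + 2 * (L + hi) * \<epsilon>\<^sup>2"
      by (simp add: algebra_simps)
    also have "\<dots> \<le> growth_rate * (lo * a\<^sup>2 + lo / 2 * b\<^sup>2 + \<epsilon>\<^sup>2)"
    proof -
      \<comment> \<open>The weight 2 on a^2 matches the ratio between the coefficients lo and lo/2
        in \<open>energy_lower\<close>.\<close>
      have "(2 * L + hi + lo) * (a\<^sup>2 + b\<^sup>2) \<le> (2 * L + hi + lo) * (2 * a\<^sup>2 + b\<^sup>2)"
        using constants by (intro mult_left_mono) auto
      also have "\<dots> = (2 * L + hi + lo) * 2 / lo * (lo * a\<^sup>2 + lo / 2 * b\<^sup>2)"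
        using constants by (simp add: field_simps)
      finally have 1: "(2 * L + hi + lo) * (a\<^sup>2 + b\<^sup>2) \<le> (2 * L + hi + lo) * 2 / lo * (lo * a\<^sup>2 + lo / 2 * b\<^sup>2)" .
      have 2: "0 \<le> (2 * L + hi + lo) * 2 / lo * \<epsilon>\<^sup>2" "0 \<le> 2 * (L + hi) * (lo * a\<^sup>2 + lo / 2 * b\<^sup>2)"
        using constants by simp_all
      show ?thesis using 1 2 unfolding growth_rate_def by (simp only: distrib_left distrib_right)
    qed
    also have "\<dots> \<le> growth_rate * energy s"
      using energy_lower[OF s] growth_rate_nonneg by (intro mult_left_mono) (simp_all add: a_def b_def)
    finally show ?thesis .
  qed
  moreover have "\<forall>\<^sub>F t in at_right s. energy t - energy s \<le> (t - s) * R t"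
  proof -
    have "\<forall>\<^sub>F t in at_right s. t \<in> {s<..<min b T}"
      using s b by (intro eventually_at_right_real) auto
    then show ?thesis
    proof eventually_elim
      case (elim t)
      then have st: "s < t" "t < b" "t < T" and t: "t \<in> {0<..<T}" using s by auto
      note Ms = M_bilinear[OF s] and Mt = M_bilinear[OF t]
        and As = A_bilinear[OF s] and At = A_bilinear[OF t]
      have \<omega>t: "\<omega> t \<in> S" using \<omega>_in t by simp
      have \<theta>\<delta>: "\<theta> t - \<theta> s = (t - s) *\<^sub>R \<delta> t" using st by (simp add: \<delta>_def)
      \<comment> \<open>This is the increment of \<open>p\<close> at the vector \<omega>(t) +
        \<omega>(s) = 2 \<omega>(s) + (\<omega>(t) - \<omega>(s)), with the part containing \<zeta>
        added back and the increment of the form itself removed. Symmetry of \<open>M s\<close>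
        cancels the mixed terms.\<close>
      have "M t (\<omega> t) (\<omega> t) - M s (\<omega> s) (\<omega> s) =
          (p t (2 *\<^sub>R \<omega> s) - p s (2 *\<^sub>R \<omega> s)) + (p t (\<omega> t - \<omega> s) - p s (\<omega> t - \<omega> s))
          + (M t (\<zeta> t) (\<omega> t + \<omega> s) - M s (\<zeta> t) (\<omega> t + \<omega> s)) + M s (\<zeta> t - \<zeta> s) (\<omega> t + \<omega> s)
          - (M t (\<omega> t) (\<omega> s) - M s (\<omega> t) (\<omega> s))"
        using M_sym[OF s, of "\<omega> t" "\<omega> s"]
        by (simp add: p_def bilinear_lsub[OF Ms] bilinear_rsub[OF Ms] bilinear_lsub[OF Mt] bilinear_rsub[OF Mt]
            bilinear_radd[OF Ms] bilinear_radd[OF Mt] bilinear_rmul[OF Ms] bilinear_rmul[OF Mt])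
      moreover have "p t (2 *\<^sub>R \<omega> s) - p s (2 *\<^sub>R \<omega> s)
          = (t - s) * ((p t (2 *\<^sub>R \<omega> s) - p s (2 *\<^sub>R \<omega> s)) / (t - s))"
        using st by simp
      moreover have "p t (\<omega> t - \<omega> s) - p s (\<omega> t - \<omega> s) \<le> (t - s) * (Cp * n1 (\<omega> t - \<omega> s))"
        using p_lip[OF st subspace_diff[OF S \<omega>t \<omega>s]] by simp
      moreover have "M t (\<zeta> t) (\<omega> t + \<omega> s) - M s (\<zeta> t) (\<omega> t + \<omega> s) \<le> (t - s) * (L * \<epsilon> * n0 (\<omega> t + \<omega> s))"
      proof -
        have "M t (\<zeta> t) (\<omega> t + \<omega> s) - M s (\<zeta> t) (\<omega> t + \<omega> s) \<le> L * \<bar>t - s\<bar> * n0 (\<zeta> t) * n0 (\<omega> t + \<omega> s)"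
          using M_lipschitz[OF s t, of "\<zeta> t" "\<omega> t + \<omega> s"] by simp
        also have "\<dots> \<le> L * \<bar>t - s\<bar> * \<epsilon> * n0 (\<omega> t + \<omega> s)"
          using constants \<zeta>_bound[OF t] by (intro mult_right_mono mult_left_mono) auto
        finally show ?thesis using st by (simp add: algebra_simps)
      qed
      moreover have "M s (\<zeta> t - \<zeta> s) (\<omega> t + \<omega> s) \<le> (t - s) * (hi * \<epsilon> * n0 (\<omega> t + \<omega> s))"
      proof -
        have "M s (\<zeta> t - \<zeta> s) (\<omega> t + \<omega> s) \<le> hi * n0 (\<zeta> t - \<zeta> s) * n0 (\<omega> t + \<omega> s)"
          using M_upper[OF s, of "\<zeta> t - \<zeta> s" "\<omega> t + \<omega> s"] by simp
        also have "\<dots> \<le> hi * (\<epsilon> * \<bar>t - s\<bar>) * n0 (\<omega> t + \<omega> s)"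
          using constants \<zeta>_lipschitz[OF s t] by (intro mult_right_mono mult_left_mono) auto
        finally show ?thesis using st by (simp add: algebra_simps)
      qed
      moreover have "- (M t (\<omega> t) (\<omega> s) - M s (\<omega> t) (\<omega> s)) \<le> (t - s) * (L * n0 (\<omega> t) * n0 (\<omega> s))"
        using M_lipschitz[OF s t, of "\<omega> t" "\<omega> s"] st by (simp add: algebra_simps)
      ultimately have 1: "M t (\<omega> t) (\<omega> t) - M s (\<omega> s) (\<omega> s) \<le>
          (t - s) * ((p t (2 *\<^sub>R \<omega> s) - p s (2 *\<^sub>R \<omega> s)) / (t - s))
          + (t - s) * (Cp * n1 (\<omega> t - \<omega> s)) + (t - s) * (L * \<epsilon> * n0 (\<omega> t + \<omega> s))
          + (t - s) * (hi * \<epsilon> * n0 (\<omega> t + \<omega> s)) + (t - s) * (L * n0 (\<omega> t) * n0 (\<omega> s))"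
        by linarith
      have 2: "A t (\<theta> t) (\<theta> t) - A s (\<theta> s) (\<theta> s) \<le> (t - s) * (L * (n1 (\<theta> t))\<^sup>2) + (t - s) * A s (\<delta> t) (\<theta> t + \<theta> s)"
      proof -
        have "A t (\<theta> t) (\<theta> t) - A s (\<theta> s) (\<theta> s) = (A t (\<theta> t) (\<theta> t) - A s (\<theta> t) (\<theta> t)) + A s (\<theta> t - \<theta> s) (\<theta> t + \<theta> s)"
          using A_sym[OF s, of "\<theta> t" "\<theta> s"] by (simp add: bilinear_lsub[OF As] bilinear_radd[OF As])
        also have "A s (\<theta> t - \<theta> s) (\<theta> t + \<theta> s) = (t - s) * A s (\<delta> t) (\<theta> t + \<theta> s)"
          unfolding \<theta>\<delta> by (simp add: bilinear_lmul[OF As])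
        finally show ?thesis
          using A_lipschitz[OF s t, of "\<theta> t" "\<theta> t"] st by (simp add: power2_eq_square algebra_simps)
      qed
      have 3: "lo * (n0 (\<theta> t))\<^sup>2 - lo * (n0 (\<theta> s))\<^sup>2 = (t - s) * (lo * ip0 (\<delta> t) (\<theta> t + \<theta> s))"
      proof -
        have "(n0 (\<theta> t))\<^sup>2 - (n0 (\<theta> s))\<^sup>2 = ip0 (\<theta> t - \<theta> s) (\<theta> t + \<theta> s)"
          by (simp add: H0.nrm_sq H0.ip_simps H0.sym[of "\<theta> s" "\<theta> t"])
        also have "\<dots> = (t - s) * ip0 (\<delta> t) (\<theta> t + \<theta> s)"
          unfolding \<theta>\<delta> by (simp add: H0.ip_simps distrib_left)
        finally show ?thesis by (simp flip: right_diff_distrib)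
      qed
      have 4: "- 2 * A t (\<eta> t) (\<theta> t) + 2 * A s (\<eta> s) (\<theta> s)
          \<le> (t - s) * (2 * (L + hi) * \<epsilon> * n1 (\<theta> t)) - (t - s) * (2 * A s (\<eta> s) (\<delta> t))"
      proof -
        have "A t (\<eta> t) (\<theta> t) - A s (\<eta> s) (\<theta> s) =
            (A t (\<eta> t) (\<theta> t) - A s (\<eta> t) (\<theta> t)) + A s (\<eta> t - \<eta> s) (\<theta> t) + A s (\<eta> s) (\<theta> t - \<theta> s)"
          by (simp add: bilinear_lsub[OF As] bilinear_rsub[OF As])
        moreover have "A s (\<eta> s) (\<theta> t - \<theta> s) = (t - s) * A s (\<eta> s) (\<delta> t)"
          unfolding \<theta>\<delta> by (simp add: bilinear_rmul[OF As])
        moreover have "\<bar>A t (\<eta> t) (\<theta> t) - A s (\<eta> t) (\<theta> t)\<bar> \<le> (t - s) * (L * \<epsilon> * n1 (\<theta> t))"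
        proof -
          have "\<bar>A t (\<eta> t) (\<theta> t) - A s (\<eta> t) (\<theta> t)\<bar> \<le> L * \<bar>t - s\<bar> * n1 (\<eta> t) * n1 (\<theta> t)"
            by (rule A_lipschitz[OF s t])
          also have "\<dots> \<le> L * \<bar>t - s\<bar> * \<epsilon> * n1 (\<theta> t)"
            using constants \<eta>_bound[OF t] by (intro mult_right_mono mult_left_mono) auto
          finally show ?thesis using st by (simp add: algebra_simps)
        qed
        moreover have "\<bar>A s (\<eta> t - \<eta> s) (\<theta> t)\<bar> \<le> (t - s) * (hi * \<epsilon> * n1 (\<theta> t))"
        proof -
          have "\<bar>A s (\<eta> t - \<eta> s) (\<theta> t)\<bar> \<le> hi * n1 (\<eta> t - \<eta> s) * n1 (\<theta> t)"
            by (rule A_upper[OF s])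
          also have "\<dots> \<le> hi * (\<epsilon> * \<bar>t - s\<bar>) * n1 (\<theta> t)"
            using constants \<eta>_lipschitz[OF s t] by (intro mult_right_mono mult_left_mono) auto
          finally show ?thesis using st by (simp add: algebra_simps)
        qed
        moreover have "(t - s) * (2 * (L + hi) * \<epsilon> * n1 (\<theta> t)) =
            2 * ((t - s) * (L * \<epsilon> * n1 (\<theta> t))) + 2 * ((t - s) * (hi * \<epsilon> * n1 (\<theta> t)))"
          by (simp add: algebra_simps)
        ultimately show ?thesis by (simp only: abs_le_iff) linarith
      qed
      have "energy t - energy s = (M t (\<omega> t) (\<omega> t) - M s (\<omega> s) (\<omega> s)) + (A t (\<theta> t) (\<theta> t) - A s (\<theta> s) (\<theta> s))
          + (lo * (n0 (\<theta> t))\<^sup>2 - lo * (n0 (\<theta> s))\<^sup>2) + (- 2 * A t (\<eta> t) (\<theta> t) + 2 * A s (\<eta> s) (\<theta> s))"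
        by (simp add: energy_def)
      moreover have "(t - s) * R t = (t - s) * ((p t (2 *\<^sub>R \<omega> s) - p s (2 *\<^sub>R \<omega> s)) / (t - s))
          + (t - s) * (Cp * n1 (\<omega> t - \<omega> s)) + (t - s) * (L * \<epsilon> * n0 (\<omega> t + \<omega> s))
          + (t - s) * (hi * \<epsilon> * n0 (\<omega> t + \<omega> s)) + (t - s) * (L * n0 (\<omega> t) * n0 (\<omega> s))
          + (t - s) * (L * (n1 (\<theta> t))\<^sup>2) + (t - s) * A s (\<delta> t) (\<theta> t + \<theta> s)
          + (t - s) * (lo * ip0 (\<delta> t) (\<theta> t + \<theta> s))
          + ((t - s) * (2 * (L + hi) * \<epsilon> * n1 (\<theta> t)) - (t - s) * (2 * A s (\<eta> s) (\<delta> t)))"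
        unfolding R_def by (simp only: distrib_left right_diff_distrib distrib_right)
      ultimately show ?case using 1 2 3 4 by linarith
    qed
  qed
  ultimately show ?thesis by blast
qed

text \<open>Gronwall's lemma has to start at a positive time s, because the forms exist only inside
  the interval; then s tends to 0. The bound at time s involves only \<theta>, \<omega> and
  \<epsilon>, so continuity of \<theta> and \<omega> at 0 suffices.\<close>

theorem energy_estimate:
  assumes t: "t \<in> {0<..<T}"
  shows "(n1 (\<theta> t))\<^sup>2 \<le> energy_const * ((n0 (\<omega> 0))\<^sup>2 + (n1 (\<theta> 0))\<^sup>2 + \<epsilon>\<^sup>2)"
proof -
  define Cu where "Cu = 2 * hi + lo + 2 * hi\<^sup>2 / lo + 1"
  have Cu: "0 \<le> Cu" using constants by (simp add: Cu_def)
  have bound: "(n1 (\<theta> t))\<^sup>2 \<le> energy_const * ((n0 (\<omega> s))\<^sup>2 + (n1 (\<theta> s))\<^sup>2 + \<epsilon>\<^sup>2)"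
    if s: "0 < s" "s < t" for s
  proof -
    have sT: "s \<in> {0<..<T}" using s t by auto
    have "energy t \<le> exp (growth_rate * (t - s)) * energy s"
    proof (rule dini_gronwall)
      show "s \<le> t" using s by simp
      show "continuous_on {s..t} energy"
        using s t by (intro continuous_at_imp_continuous_on ballI energy_isCont) auto
      show "\<exists>R l. (R \<longlongrightarrow> l) (at_right s') \<and> l \<le> growth_rate * energy s' \<and>
          (\<forall>\<^sub>F t in at_right s'. energy t - energy s' \<le> (t - s') * R t)" if "s' \<in> {s..<t}" for s'
        using that s t by (intro energy_dini) auto
    qed
    also have "\<dots> \<le> exp (growth_rate * T) * (Cu * ((n0 (\<omega> s))\<^sup>2 + (n1 (\<theta> s))\<^sup>2 + \<epsilon>\<^sup>2))"
    proof (rule mult_mono)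
      show "exp (growth_rate * (t - s)) \<le> exp (growth_rate * T)"
        using s t growth_rate_nonneg by (simp add: mult_left_mono)
      show "energy s \<le> Cu * ((n0 (\<omega> s))\<^sup>2 + (n1 (\<theta> s))\<^sup>2 + \<epsilon>\<^sup>2)"
        unfolding Cu_def by (rule energy_upper[OF sT])
      have "0 \<le> lo * (n0 (\<omega> s))\<^sup>2 + lo / 2 * (n1 (\<theta> s))\<^sup>2 + \<epsilon>\<^sup>2" using constants by simp
      then show "0 \<le> energy s" using energy_lower[OF sT] by linarith
    qed simp
    finally have "energy t \<le> exp (growth_rate * T) * (Cu * ((n0 (\<omega> s))\<^sup>2 + (n1 (\<theta> s))\<^sup>2 + \<epsilon>\<^sup>2))" .
    moreover have "lo / 2 * (n1 (\<theta> t))\<^sup>2 \<le> energy t"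
    proof -
      have "0 \<le> lo * (n0 (\<omega> t))\<^sup>2 + \<epsilon>\<^sup>2" using constants by simp
      then show ?thesis using energy_lower[OF t] by linarith
    qed
    ultimately have "lo / 2 * (n1 (\<theta> t))\<^sup>2 \<le> exp (growth_rate * T) * (Cu * ((n0 (\<omega> s))\<^sup>2 + (n1 (\<theta> s))\<^sup>2 + \<epsilon>\<^sup>2))"
      by linarith
    then have "(n1 (\<theta> t))\<^sup>2 \<le> 2 / lo * (exp (growth_rate * T) * (Cu * ((n0 (\<omega> s))\<^sup>2 + (n1 (\<theta> s))\<^sup>2 + \<epsilon>\<^sup>2)))"
      using constants by (simp add: field_simps)
    then show ?thesis by (simp add: energy_const_def Cu_def mult.assoc)
  qed
  have mono: "at_right 0 \<le> at 0 within {0..<T}"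
  proof -
    have "at_right 0 = at 0 within {0..T / 2}" using constants by (simp add: at_within_Icc_at_right)
    also have "\<dots> \<le> at 0 within {0..<T}" using constants by (intro at_le) auto
    finally show ?thesis .
  qed
  have 0: "0 \<in> {0..<T}" using constants by simp
  have "((\<lambda>s. energy_const * ((n0 (\<omega> s))\<^sup>2 + (n1 (\<theta> s))\<^sup>2 + \<epsilon>\<^sup>2)) \<longlongrightarrow>
      energy_const * ((n0 (\<omega> 0))\<^sup>2 + (n1 (\<theta> 0))\<^sup>2 + \<epsilon>\<^sup>2)) (at_right 0)"
    by (intro tendsto_intros H0.nrm_tendsto H1.nrm_tendsto n0_null tendsto_mono[OF mono] \<theta>_cont \<omega>_cont 0)
  moreover have "\<forall>\<^sub>F s in at_right 0. (n1 (\<theta> t))\<^sup>2 \<le> energy_const * ((n0 (\<omega> s))\<^sup>2 + (n1 (\<theta> s))\<^sup>2 + \<epsilon>\<^sup>2)"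
    using eventually_at_right_real[of 0 t] t by (auto elim!: eventually_mono intro!: bound)
  ultimately show ?thesis
    by (rule tendsto_lowerbound) simp
qed

end

section \<open>Smooth bump functions\<close>

text \<open>The functions p(1/x) exp(-1/x), extended by 0, form a family closed under
  differentiation, so a single derivative formula gives derivatives of all orders.
  \<open>flat 1\<close> is the classical flat function.\<close>

definition flat :: "real poly \<Rightarrow> real \<Rightarrow> real" where
  "flat p x = (if x \<le> 0 then 0 else poly p (1 / x) * exp (- (1 / x)))"

lemma poly_times_exp_minus_tendsto_0:
  fixes p :: "real poly"
  shows "((\<lambda>y. poly p y * exp (- y)) \<longlongrightarrow> 0) at_top"
proof -
  have "((\<lambda>y. \<Sum>i\<le>degree p. coeff p i * (y ^ i / exp y)) \<longlongrightarrow> (\<Sum>i\<le>degree p. coeff p i * 0)) at_top"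
    by (intro tendsto_intros tendsto_power_div_exp_0)
  moreover have "(\<lambda>y. poly p y * exp (- y)) = (\<lambda>y. \<Sum>i\<le>degree p. coeff p i * (y ^ i / exp y))"
    by (simp add: poly_altdef exp_minus sum_distrib_right sum_divide_distrib field_simps)
  ultimately show ?thesis by simp
qed

lemma flat_has_derivative:
  "(flat p has_real_derivative flat (monom 1 2 * (p - pderiv p)) x) (at x)"
proof -
  consider "x < 0" | "x = 0" | "x > 0" by linarith
  then show ?thesis
  proof cases
    case 1
    have "((\<lambda>_. 0) has_real_derivative 0) (at x)" by simp
    then have "(flat p has_real_derivative 0) (at x)"
      by (rule has_field_derivative_transform_within_open[of _ _ _ "{..<0}"]) (use 1 in \<open>auto simp: flat_def\<close>)
    then show ?thesis using 1 by (simp add: flat_def)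
  next
    case 2
    have "((\<lambda>t. flat p t / t) \<longlongrightarrow> 0) (at 0)"
    proof (rule filterlim_split_at)
      show "((\<lambda>t. flat p t / t) \<longlongrightarrow> 0) (at_left 0)"
        by (rule tendsto_eventually) (auto simp: flat_def eventually_at_filter)
      \<comment> \<open>Dividing by t multiplies the polynomial in 1/t by its variable, which is the
        effect of \<open>pCons 0\<close>.\<close>
      have "((\<lambda>t. poly (pCons 0 p) (inverse t) * exp (- inverse t)) \<longlongrightarrow> 0) (at_right 0)"
        by (rule filterlim_compose[OF poly_times_exp_minus_tendsto_0 filterlim_inverse_at_top_right])
      then show "((\<lambda>t. flat p t / t) \<longlongrightarrow> 0) (at_right 0)"
        by (rule Lim_transform_eventually) (auto simp: flat_def eventually_at_filter field_simps)
    qed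
    then show ?thesis using 2 by (simp add: has_field_derivative_iff flat_def)
  next
    case 3
    have "((\<lambda>t. poly p (1 / t) * exp (- (1 / t))) has_real_derivative
        flat (monom 1 2 * (p - pderiv p)) x) (at x)"
      using 3
      by (auto intro!: derivative_eq_intros poly_DERIV[THEN DERIV_chain2]
          simp: flat_def poly_monom field_simps power2_eq_square)
    then show ?thesis
      by (rule has_field_derivative_transform_within_open[of _ _ _ "{0<..}"]) (use 3 in \<open>auto simp: flat_def\<close>)
  qed
qed

text \<open>A class of functions that is closed under partial derivatives, hence consists of smooth functions.\<close>

inductive smooth_alg :: "('a::euclidean_space \<Rightarrow> real) \<Rightarrow> bool" where
  flat: "smooth_alg (\<lambda>x. flat p (c * (x \<bullet> e) + d))"
| const: "smooth_alg (\<lambda>x. c)"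
| add: "smooth_alg f \<Longrightarrow> smooth_alg g \<Longrightarrow> smooth_alg (\<lambda>x. f x + g x)"
| mult: "smooth_alg f \<Longrightarrow> smooth_alg g \<Longrightarrow> smooth_alg (\<lambda>x. f x * g x)"
| inverse: "smooth_alg f \<Longrightarrow> (\<And>x. f x \<noteq> 0) \<Longrightarrow> smooth_alg (\<lambda>x. inverse (f x))"

lemma smooth_alg_derivative:
  "smooth_alg f \<Longrightarrow> \<exists>f'. (\<forall>x. (f has_derivative f' x) (at x)) \<and> (\<forall>v. smooth_alg (\<lambda>x. f' x v))"
proof (induction rule: smooth_alg.induct)
  case (flat p c e d)
  let ?q = "monom 1 2 * (p - pderiv p)"
  show ?case
  proof (intro exI[of _ "\<lambda>x v. flat ?q (c * (x \<bullet> e) + d) * (c * (v \<bullet> e))"] conjI allI)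
    fix x
    have "((\<lambda>x. c * (x \<bullet> e) + d) has_derivative (\<lambda>v. c * (v \<bullet> e))) (at x)"
      by (auto intro!: derivative_eq_intros)
    from has_derivative_compose[OF this flat_has_derivative[unfolded has_field_derivative_def]]
    show "((\<lambda>x. flat p (c * (x \<bullet> e) + d)) has_derivative (\<lambda>v. flat ?q (c * (x \<bullet> e) + d) * (c * (v \<bullet> e)))) (at x)" .
  qed (intro smooth_alg.intros)
next
  case (const c)
  show ?case by (rule exI[of _ "\<lambda>x v. 0"]) (auto intro: smooth_alg.const)
next
  case (add f g)
  then obtain f' g' where "\<forall>x. (f has_derivative f' x) (at x)" "\<forall>v. smooth_alg (\<lambda>x. f' x v)"
    "\<forall>x. (g has_derivative g' x) (at x)" "\<forall>v. smooth_alg (\<lambda>x. g' x v)" by blast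
  then show ?case
    by (intro exI[of _ "\<lambda>x v. f' x v + g' x v"]) (auto intro!: smooth_alg.add has_derivative_add)
next
  case (mult f g)
  then obtain f' g' where "\<forall>x. (f has_derivative f' x) (at x)" "\<forall>v. smooth_alg (\<lambda>x. f' x v)"
    "\<forall>x. (g has_derivative g' x) (at x)" "\<forall>v. smooth_alg (\<lambda>x. g' x v)" by blast
  with mult.hyps show ?case
    by (intro exI[of _ "\<lambda>x v. f x * g' x v + f' x v * g x"])
      (auto intro!: smooth_alg.add smooth_alg.mult has_derivative_mult)
next
  case (inverse f)
  then obtain f' where f': "\<forall>x. (f has_derivative f' x) (at x)" "\<forall>v. smooth_alg (\<lambda>x. f' x v)" by blast
  show ?case
  proof (intro exI[of _ "\<lambda>x v. (-1) * (inverse (f x) * f' x v * inverse (f x))"] conjI allI)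
    fix x
    show "((\<lambda>x. inverse (f x)) has_derivative (\<lambda>v. (-1) * (inverse (f x) * f' x v * inverse (f x)))) (at x)"
      using Deriv.has_derivative_inverse[OF _ f'(1)[rule_format]] inverse.hyps by simp
    show "smooth_alg (\<lambda>x. (-1) * (inverse (f x) * f' x v * inverse (f x)))" for v
      using f'(2) inverse.hyps by (intro smooth_alg.mult smooth_alg.const smooth_alg.inverse) auto
  qed
qed

lemma smooth_alg_iter_partial: "smooth_alg f \<Longrightarrow> smooth_alg (iter_partial vs f)"
proof (induction vs)
  case (Cons v vs)
  then obtain f' where f': "\<forall>x. (iter_partial vs f has_derivative f' x) (at x)" "smooth_alg (\<lambda>x. f' x v)"
    using smooth_alg_derivative by blast
  have "frechet_derivative (iter_partial vs f) (at x) = f' x" for x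
    using f'(1) frechet_derivative_at by metis
  then show ?case using f'(2) by simp
qed simp

lemma smooth_alg_smooth: "smooth_alg f \<Longrightarrow> smooth f"
  unfolding smooth_def differentiable_on_def differentiable_def
  by (metis smooth_alg_iter_partial smooth_alg_derivative has_derivative_at_withinI)

lemma smooth_alg_prod:
  "finite I \<Longrightarrow> (\<And>i. i \<in> I \<Longrightarrow> smooth_alg (F i)) \<Longrightarrow> smooth_alg (\<lambda>x. \<Prod>i\<in>I. F i x)"
  by (induction I rule: finite_induct) (auto intro: smooth_alg.const smooth_alg.mult)

section \<open>Smooth cut-off functions of boxes\<close>

definition step :: "real \<Rightarrow> real" where
  "step y = flat 1 y * inverse (flat 1 y + flat 1 (1 - y))"

lemma flat_one_nonneg: "0 \<le> flat 1 y"
  by (simp add: flat_def)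

lemma flat_one_pos: "0 < y \<Longrightarrow> 0 < flat 1 y"
  by (simp add: flat_def)

lemma step_denom_pos: "0 < flat 1 y + flat 1 (1 - y)"
  using flat_one_pos[of y] flat_one_pos[of "1 - y"] flat_one_nonneg[of y] flat_one_nonneg[of "1 - y"]
  by (cases "0 < y") auto

lemma smooth_alg_step: "smooth_alg (\<lambda>x. step (c * (x \<bullet> e) + d))"
proof -
  have "smooth_alg (\<lambda>x::'a. flat 1 (c * (x \<bullet> e) + d) * inverse (flat 1 (c * (x \<bullet> e) + d) + flat 1 ((- c) * (x \<bullet> e) + (1 - d))))"
  proof (intro smooth_alg.intros)
    show "flat 1 (c * (x \<bullet> e) + d) + flat 1 (- c * (x \<bullet> e) + (1 - d)) \<noteq> 0" for x
      using step_denom_pos[of "c * (x \<bullet> e) + d"] by (simp add: algebra_simps)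
  qed
  then show ?thesis by (simp add: step_def algebra_simps)
qed

lemma step_0: "y \<le> 0 \<Longrightarrow> step y = 0"
  by (simp add: step_def flat_def)

lemma step_1: "1 \<le> y \<Longrightarrow> step y = 1"
  by (simp add: step_def flat_def)

lemma step_nonneg: "0 \<le> step y"
  using flat_one_nonneg step_denom_pos[of y] by (simp add: step_def)

lemma step_le_1: "step y \<le> 1"
  using flat_one_nonneg[of "1 - y"] step_denom_pos[of y] by (simp add: step_def field_simps)

lemma step_has_derivative:
  obtains step' where "\<And>y. (step has_real_derivative step' y) (at y)" "continuous_on UNIV step'"
proof -
  have "smooth_alg (\<lambda>x::real. step (1 * (x \<bullet> 1) + 0))" by (rule smooth_alg_step)
  then have s: "smooth_alg step" by simp
  obtain f' where f': "\<And>x. (step has_derivative f' x) (at x)" "\<And>v. smooth_alg (\<lambda>x. f' x v)"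
    using smooth_alg_derivative[OF s] by blast
  have deriv: "(step has_real_derivative f' y 1) (at y)" for y
  proof -
    have "f' y = (\<lambda>v. f' y 1 * v)"
    proof
      fix v :: real
      have "linear (f' y)" using f'(1) has_derivative_linear by blast
      from linear_cmul[OF this, of v 1] show "f' y v = f' y 1 * v" by simp
    qed
    then show ?thesis unfolding has_field_derivative_def using f'(1)[of y] by metis
  qed
  have cont: "continuous_on UNIV (\<lambda>y. f' y 1)"
  proof -
    obtain g where "\<And>x. ((\<lambda>y. f' y 1) has_derivative g x) (at x)"
      using smooth_alg_derivative[OF f'(2)[of 1]] by blast
    then show ?thesis
      by (intro continuous_at_imp_continuous_on ballI) (meson has_derivative_continuous)
  qed
  show ?thesis by (rule that[OF deriv cont])
qed

text \<open>A smooth function that vanishes outside the box and equals 1 at points whose distance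
  from every face is at least 1/n, so that growing \<open>n\<close> sharpens the edges. In one
  dimension and for large \<open>n\<close> its derivative is a kernel at the left end minus a kernel
  at the right end.\<close>

definition box_bump :: "nat \<Rightarrow> 'a::euclidean_space \<Rightarrow> 'a \<Rightarrow> 'a \<Rightarrow> real" where
  "box_bump n a b x =
     (\<Prod>e\<in>Basis. step (real n * (x \<bullet> e - a \<bullet> e)) * step (real n * (b \<bullet> e - x \<bullet> e)))"

lemma smooth_box_bump: "smooth (box_bump n a b)"
proof (rule smooth_alg_smooth)
  have "smooth_alg (\<lambda>x. step (real n * (x \<bullet> e) + (- real n * (a \<bullet> e))) * step ((- real n) * (x \<bullet> e) + real n * (b \<bullet> e)))"
    for e :: 'a
    by (intro smooth_alg.mult smooth_alg_step)
  then have "smooth_alg (\<lambda>x. step (real n * (x \<bullet> e - a \<bullet> e)) * step (real n * (b \<bullet> e - x \<bullet> e)))" for e :: 'a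
    by (simp add: algebra_simps)
  then show "smooth_alg (box_bump n a b)"
    unfolding box_bump_def by (intro smooth_alg_prod) auto
qed

lemma box_bump_outside: "x \<notin> box a b \<Longrightarrow> box_bump n a b x = 0"
  by (force simp: box_bump_def mem_box not_less step_0 mult_nonneg_nonpos)

lemma box_bump_nonneg: "0 \<le> box_bump n a b x"
  by (simp add: box_bump_def prod_nonneg step_nonneg)

lemma box_bump_le_1: "box_bump n a b x \<le> 1"
  unfolding box_bump_def
  by (intro prod_le_1) (auto simp: step_nonneg intro!: mult_le_one step_le_1)

lemma step_eventually_1:
  assumes "0 < y"
  shows "\<forall>\<^sub>F n in sequentially. step (real n * y) = 1"
proof -
  obtain N where "1 < real N * y" using assms reals_Archimedean3 by blast
  then have "1 \<le> real n * y" if "n \<ge> N" for n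
    using that assms by (meson less_imp_le mult_right_mono of_nat_le_iff order_trans)
  then show ?thesis unfolding eventually_sequentially using step_1 by blast
qed

lemma box_bump_tendsto: "(\<lambda>n. box_bump n a b x) \<longlonglongrightarrow> indicator (box a b) x"
proof (cases "x \<in> box a b")
  case True
  have "\<forall>\<^sub>F n in sequentially. \<forall>e\<in>Basis. step (real n * (x \<bullet> e - a \<bullet> e)) * step (real n * (b \<bullet> e - x \<bullet> e)) = 1"
    unfolding eventually_ball_finite_distrib[OF finite_Basis]
  proof
    fix e :: 'a assume "e \<in> Basis"
    then have "0 < x \<bullet> e - a \<bullet> e" "0 < b \<bullet> e - x \<bullet> e" using True by (auto simp: mem_box)
    from step_eventually_1[OF this(1)] step_eventually_1[OF this(2)]
    show "\<forall>\<^sub>F n in sequentially. step (real n * (x \<bullet> e - a \<bullet> e)) * step (real n * (b \<bullet> e - x \<bullet> e)) = 1"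
      by eventually_elim simp
  qed
  then have "\<forall>\<^sub>F n in sequentially. box_bump n a b x = indicator (box a b) x"
    by eventually_elim (use True in \<open>simp add: box_bump_def\<close>)
  then show ?thesis by (rule tendsto_eventually)
qed (simp add: box_bump_outside)

lemma box_bump_support: "closure {x. box_bump n a b x \<noteq> 0} \<subseteq> cbox a b"
proof (rule closure_minimal)
  show "{x. box_bump n a b x \<noteq> 0} \<subseteq> cbox a b"
    using box_bump_outside box_subset_cbox by fastforce
qed (rule closed_cbox)

lemma box_bump_test_function: "cbox a b \<subseteq> \<Omega> \<Longrightarrow> box_bump n a b \<in> test_functions \<Omega>"
  unfolding test_functions_def
  using smooth_box_bump[of n a b] box_bump_support[of n a b]
  by (auto intro: bounded_subset[OF bounded_cbox] simp: compact_eq_bounded_closed)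

section \<open>The fundamental lemma of the calculus of variations\<close>

lemma integral_lebesgue_on_eq:
  fixes g :: "'a::euclidean_space \<Rightarrow> real"
  assumes "\<Omega> \<in> sets lebesgue" "\<And>x. x \<notin> \<Omega> \<Longrightarrow> g x = 0"
  shows "(LINT x|lebesgue_on \<Omega>. g x) = (LINT x|lebesgue. g x)"
proof -
  have "(\<lambda>x. indicator \<Omega> x *\<^sub>R g x) = g" using assms(2) by (auto simp: indicator_def fun_eq_iff)
  then show ?thesis using assms(1) by (simp add: integral_restrict_space)
qed

text \<open>Boxes with disjoint interiors meet only in their frontiers, which are negligible, so the
  integrals over finitely many of them add up; dominated convergence along an enumeration handles
  the whole family.\<close>

lemma integral_Union_boxes_nonneg:
  fixes f :: "'a::euclidean_space \<Rightarrow> real"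
  assumes f: "f absolutely_integrable_on cbox a b"
    and nonneg: "\<And>c d. cbox c d \<subseteq> cbox a b \<Longrightarrow> 0 \<le> integral (cbox c d) f"
    and D: "countable D" "\<And>K. K \<in> D \<Longrightarrow> \<exists>c d. K = cbox c d" "\<Union>D \<subseteq> cbox a b"
      "pairwise (\<lambda>A B. interior A \<inter> interior B = {}) D"
  shows "0 \<le> (LINT x|lebesgue. indicator (\<Union>D) x * (indicator (cbox a b) x * f x))"
proof (cases "D = {}")
  case False
  let ?F = "\<lambda>x. indicator (cbox a b) x * f x"
  have F: "integrable lebesgue ?F" using f by (simp add: set_integrable_def)
  define E where "E n = \<Union>(from_nat_into D ` {..n})" for n :: nat
  have DE: "from_nat_into D n \<in> D" for n using from_nat_into[OF False] .
  have meas: "K \<in> sets lebesgue" if "K \<in> D" for K using D(2)[OF that] by auto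
  have E_meas: "E n \<in> sets lebesgue" for n unfolding E_def using DE meas by auto
  have UD_meas: "\<Union>D \<in> sets lebesgue" using D(1) meas by (simp add: sets.countable_Union subset_iff)
  have nn: "0 \<le> (LINT x|lebesgue. indicator (E n) x * ?F x)" for n
  proof -
    let ?G = "from_nat_into D ` {..n}"
    have GD: "?G \<subseteq> D" using DE by auto
    have sub: "E n \<subseteq> cbox a b" using GD D(3) by (auto simp: E_def)
    have fE: "f absolutely_integrable_on E n" by (rule set_integrable_subset[OF f E_meas sub])
    have int: "(f has_integral integral K f) K" if "K \<in> ?G" for K
    proof -
      have "f absolutely_integrable_on K"
        using that GD D(3) meas by (intro set_integrable_subset[OF f]) auto
      then show ?thesis using absolutely_integrable_on_def integrable_integral by blast
    qed
    have "pairwise (\<lambda>S S'. negligible (S \<inter> S')) ?G"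
    proof (rule pairwiseI)
      fix A B assume AB: "A \<in> ?G" "B \<in> ?G" "A \<noteq> B"
      obtain c d where A: "A = cbox c d" using AB GD D(2) by blast
      obtain c' d' where B: "B = cbox c' d'" using AB GD D(2) by blast
      have "interior A \<inter> interior B = {}" using AB GD D(4) by (auto simp: pairwise_def)
      then have "A \<inter> B \<subseteq> (cbox c d - box c d) \<union> (cbox c' d' - box c' d')"
        using A B by (auto simp: interior_cbox)
      then show "negligible (A \<inter> B)"
        by (rule negligible_subset[rotated]) (intro negligible_Un negligible_frontier_interval)
    qed
    then have "(f has_integral (\<Sum>K\<in>?G. integral K f)) (\<Union>?G)"
      by (intro has_integral_Union int) auto
    then have "integral (E n) f = (\<Sum>K\<in>?G. integral K f)"
      unfolding E_def by (rule integral_unique)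
    also have "\<dots> \<ge> 0"
    proof (rule sum_nonneg)
      fix K assume K: "K \<in> ?G"
      then obtain c d where Kcd: "K = cbox c d" using GD D(2) by blast
      have "K \<subseteq> cbox a b" using K GD D(3) by blast
      then show "0 \<le> integral K f" using nonneg unfolding Kcd by blast
    qed
    finally have "0 \<le> integral (E n) f" .
    also have "integral (E n) f = (LINT x:E n|lebesgue. f x)"
      using set_lebesgue_integral_eq_integral(2)[OF fE] by simp
    also have "\<dots> = (LINT x|lebesgue. indicator (E n) x * ?F x)"
      unfolding set_lebesgue_integral_def using sub
      by (intro Bochner_Integration.integral_cong) (auto simp: indicator_def)
    finally show ?thesis .
  qed
  have "(\<lambda>n. LINT x|lebesgue. indicator (E n) x * ?F x) \<longlonglongrightarrow> (LINT x|lebesgue. indicator (\<Union>D) x * ?F x)"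
  proof (rule integral_dominated_convergence[where w="\<lambda>x. \<bar>?F x\<bar>"])
    show "(\<lambda>x. indicator (\<Union>D) x * ?F x) \<in> borel_measurable lebesgue"
      using UD_meas F by (intro borel_measurable_times borel_measurable_indicator borel_measurable_integrable)
    show "(\<lambda>x. indicator (E n) x * ?F x) \<in> borel_measurable lebesgue" for n
      using E_meas F by (intro borel_measurable_times borel_measurable_indicator borel_measurable_integrable)
    show "integrable lebesgue (\<lambda>x. \<bar>?F x\<bar>)" using F by (rule integrable_abs)
    show "AE x in lebesgue. norm (indicator (E n) x * ?F x) \<le> \<bar>?F x\<bar>" for n
      by (auto simp: indicator_def)
    show "AE x in lebesgue. (\<lambda>n. indicator (E n) x * ?F x) \<longlonglongrightarrow> indicator (\<Union>D) x * ?F x"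
    proof (rule AE_I2, rule tendsto_mult_right)
      fix x
      show "(\<lambda>n. indicator (E n) x :: real) \<longlonglongrightarrow> indicator (\<Union>D) x"
      proof (cases "x \<in> \<Union>D")
        case True
        then obtain K where K: "K \<in> D" "x \<in> K" by blast
        obtain m where m: "from_nat_into D m = K" using from_nat_into_surj[OF D(1) K(1)] by blast
        have "x \<in> E n" if "n \<ge> m" for n using that m K by (auto simp: E_def)
        then have "\<forall>\<^sub>F n in sequentially. indicator (E n) x = (indicator (\<Union>D) x :: real)"
          unfolding eventually_sequentially using True by (intro exI[of _ m]) (auto simp: indicator_def)
        then show ?thesis by (rule tendsto_eventually)
      next
        case False
        then have "x \<notin> E n" for n using DE by (auto simp: E_def)
        then show ?thesis using False by simp
      qed
    qed
  qed
  then show ?thesis by (rule LIMSEQ_le_const) (use nn in auto)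
qed simp

text \<open>Let \<open>A\<close> be the set where \<open>f\<close> is negative. The covering lemma,
  with a gauge that keeps the boxes inside an open neighbourhood of \<open>A\<close>, provides
  unions of boxes over which the integral is nonnegative. As the neighbourhoods shrink to
  \<open>A\<close> up to a null set, the integral over \<open>A\<close> is nonnegative too, which
  forces \<open>A\<close> to be null.\<close>

lemma box_integrals_nonneg_imp_AE_nonneg:
  fixes f :: "'a::euclidean_space \<Rightarrow> real"
  assumes f: "f absolutely_integrable_on cbox a b"
    and nonneg: "\<And>c d. cbox c d \<subseteq> cbox a b \<Longrightarrow> 0 \<le> integral (cbox c d) f"
  shows "AE x in lebesgue. x \<in> cbox a b \<longrightarrow> 0 \<le> f x"
proof (cases "box a b = {}")
  case True
  then have "negligible (cbox a b)" by (simp add: negligible_interval)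
  then have "cbox a b \<in> null_sets lebesgue" by (simp add: negligible_iff_null_sets)
  from AE_not_in[OF this] show ?thesis by eventually_elim simp
next
  case False
  let ?F = "\<lambda>x. indicator (cbox a b) x * f x"
  have F: "integrable lebesgue ?F" using f by (simp add: set_integrable_def)
  define A where "A = {x. ?F x < 0}"
  have A_meas: "A \<in> sets lebesgue"
    using borel_measurable_integrable[OF F] by (simp add: A_def borel_measurable_iff_less)
  have A_sub: "A \<subseteq> cbox a b" by (auto simp: A_def indicator_def split: if_splits)
  have "\<exists>V. open V \<and> A \<subseteq> V \<and> emeasure lebesgue (V - A) < ennreal (1 / real (Suc k))" for k
  proof -
    have "0 < 1 / real (Suc k)" by simp
    from sets_lebesgue_outer_open[OF A_meas this] show ?thesis by blast
  qed
  then have "\<exists>V. \<forall>k. open (V k) \<and> A \<subseteq> V k \<and> emeasure lebesgue (V k - A) < ennreal (1 / real (Suc k))"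
    by (intro choice) blast
  then obtain V where V: "\<And>k. open (V k)" "\<And>k. A \<subseteq> V k"
    "\<And>k. emeasure lebesgue (V k - A) < ennreal (1 / real (Suc k))" by blast
  \<comment> \<open>Intersecting makes the neighbourhoods decrease, so a point missed by one
    \<open>V m\<close> is missed by all later covers.\<close>
  define W where "W k = (\<Inter>j\<le>k. V j)" for k
  have W_open: "open (W k)" for k unfolding W_def using V by (intro open_INT) auto
  have A_W: "A \<subseteq> W k" for k using V by (auto simp: W_def)
  define N where "N = (\<Inter>k. V k)"
  have "emeasure lebesgue (N - A) = 0"
  proof -
    have "emeasure lebesgue (N - A) \<le> ennreal e" if "0 < e" for e
    proof -
      obtain k where k: "1 / real (Suc k) < e" using \<open>0 < e\<close> nat_approx_posE by blast
      have "emeasure lebesgue (N - A) \<le> emeasure lebesgue (V k - A)"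
        using V(1) A_meas by (intro emeasure_mono) (auto simp: N_def)
      also have "\<dots> \<le> ennreal (1 / real (Suc k))" using V(3) by (simp add: less_imp_le)
      also have "\<dots> \<le> ennreal e" using k by (intro ennreal_leI) simp
      finally show ?thesis .
    qed
    then show ?thesis
      by (metis ennreal_le_epsilon ennreal_zero_less_top add.left_neutral le_zero_eq)
  qed
  moreover have NA_meas: "N - A \<in> sets lebesgue"
    unfolding N_def using V(1) A_meas by (intro sets.Diff sets.countable_INT) auto
  ultimately have NA: "N - A \<in> null_sets lebesgue" by (simp add: null_sets_def)
  have "\<exists>E. A \<subseteq> E \<and> E \<subseteq> W k \<and> E \<in> sets lebesgue \<and> 0 \<le> (LINT x|lebesgue. indicator E x * ?F x)" for k
  proof -
    \<comment> \<open>The covering lemma uses the gauge only at points of \<open>A\<close>, all of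
      which lie in \<open>W k\<close>; elsewhere any open set containing the point will do.\<close>
    define g where "g x = (if x \<in> W k then W k else UNIV)" for x
    have "gauge g" unfolding gauge_def g_def using W_open by auto
    from covering_lemma[OF A_sub False this]
    obtain D where D: "countable D" "\<Union>D \<subseteq> cbox a b"
      "\<And>K. K \<in> D \<Longrightarrow> interior K \<noteq> {} \<and> (\<exists>c d. K = cbox c d)"
      "pairwise (\<lambda>A B. interior A \<inter> interior B = {}) D"
      "\<And>K. K \<in> D \<Longrightarrow> \<exists>x\<in>A \<inter> K. K \<subseteq> g x" "A \<subseteq> \<Union>D" by metis
    have "\<Union>D \<subseteq> W k"
    proof
      fix y assume "y \<in> \<Union>D"
      then obtain K where "K \<in> D" "y \<in> K" by blast
      with D(5)[of K] obtain x where "x \<in> A" "K \<subseteq> g x" by blast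
      then show "y \<in> W k" using \<open>y \<in> K\<close> A_W[of k] by (auto simp: g_def split: if_splits)
    qed
    moreover have "0 \<le> (LINT x|lebesgue. indicator (\<Union>D) x * ?F x)"
      using D by (intro integral_Union_boxes_nonneg[OF f nonneg]) auto
    moreover have "\<Union>D \<in> sets lebesgue"
    proof (rule sets.countable_Union[OF D(1)])
      show "D \<subseteq> sets lebesgue" using D(3) by (metis cbox_borel sets_completionI_sets sets_lborel subsetI)
    qed
    ultimately show ?thesis using D(6) by blast
  qed
  then obtain E where E: "\<And>k. A \<subseteq> E k" "\<And>k. E k \<subseteq> W k" "\<And>k. E k \<in> sets lebesgue"
    "\<And>k. 0 \<le> (LINT x|lebesgue. indicator (E k) x * ?F x)" by metis
  have "(\<lambda>k. LINT x|lebesgue. indicator (E k) x * ?F x) \<longlonglongrightarrow> (LINT x|lebesgue. indicator A x * ?F x)"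
  proof (rule integral_dominated_convergence[where w="\<lambda>x. \<bar>?F x\<bar>"])
    show "(\<lambda>x. indicator A x * ?F x) \<in> borel_measurable lebesgue"
      using A_meas F by (intro borel_measurable_times borel_measurable_indicator borel_measurable_integrable)
    show "(\<lambda>x. indicator (E n) x * ?F x) \<in> borel_measurable lebesgue" for n
      using E(3) F by (intro borel_measurable_times borel_measurable_indicator borel_measurable_integrable)
    show "integrable lebesgue (\<lambda>x. \<bar>?F x\<bar>)" using F by (rule integrable_abs)
    show "AE x in lebesgue. norm (indicator (E n) x * ?F x) \<le> \<bar>?F x\<bar>" for n
      by (auto simp: indicator_def)
    have "AE x in lebesgue. x \<notin> N - A" using NA by (rule AE_not_in)
    then show "AE x in lebesgue. (\<lambda>k. indicator (E k) x * ?F x) \<longlonglongrightarrow> indicator A x * ?F x"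
    proof eventually_elim
      case (elim x)
      have "(\<lambda>k. indicator (E k) x :: real) \<longlonglongrightarrow> indicator A x"
      proof (cases "x \<in> A")
        case True
        then show ?thesis using E(1) by (simp add: subset_iff)
      next
        case False
        then obtain m where "x \<notin> V m" using elim by (auto simp: N_def)
        then have "x \<notin> E n" if "n \<ge> m" for n using that E(2)[of n] by (auto simp: W_def)
        then show ?thesis
          by (intro tendsto_eventually) (auto simp: eventually_sequentially False intro!: exI[of _ m])
      qed
      then show ?case by (rule tendsto_mult_right)
    qed
  qed
  then have "0 \<le> (LINT x|lebesgue. indicator A x * ?F x)"
    by (rule LIMSEQ_le_const) (use E(4) in auto)
  moreover have "integrable lebesgue (\<lambda>x. indicator A x * ?F x)"
    using F A_meas integrable_real_mult_indicator[of A lebesgue ?F] by (simp add: mult.commute)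
  moreover have nonpos: "AE x in lebesgue. 0 \<le> - (indicator A x * ?F x)"
    by (auto simp: A_def indicator_def)
  ultimately have "AE x in lebesgue. - (indicator A x * ?F x) = 0"
    using integral_nonneg_eq_0_iff_AE[of lebesgue "\<lambda>x. - (indicator A x * ?F x)"]
      integral_nonneg_AE[OF nonpos] by simp
  then show ?thesis
    by eventually_elim (auto simp: A_def indicator_def split: if_splits)
qed

lemma integral_box_bump_tendsto:
  fixes f :: "'a::euclidean_space \<Rightarrow> real"
  assumes \<Omega>: "\<Omega> \<in> sets lebesgue" and f: "f absolutely_integrable_on cbox c d" and sub: "cbox c d \<subseteq> \<Omega>"
  shows "(\<lambda>n. LINT x|lebesgue_on \<Omega>. f x * box_bump n c d x) \<longlonglongrightarrow> integral (cbox c d) f"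
proof -
  let ?F = "\<lambda>x. indicator (cbox c d) x * f x"
  have F: "integrable lebesgue ?F" using f by (simp add: set_integrable_def)
  have bump_meas: "box_bump n c d \<in> borel_measurable lebesgue" for n
  proof -
    have "iter_partial [] (box_bump n c d) differentiable_on UNIV"
      using smooth_box_bump[of n c d] unfolding smooth_def by (auto dest: spec[of _ "[]"])
    then have "box_bump n c d \<in> borel_measurable borel"
      by (simp add: differentiable_imp_continuous_on borel_measurable_continuous_onI)
    then show ?thesis by (simp add: measurable_completion)
  qed
  have eq: "(LINT x|lebesgue_on \<Omega>. f x * box_bump n c d x) = (LINT x|lebesgue. ?F x * box_bump n c d x)" for n
  proof -
    have out: "box_bump n c d x = 0" if "x \<notin> cbox c d" for x
      using that box_bump_outside box_subset_cbox by blast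
    have "(LINT x|lebesgue_on \<Omega>. f x * box_bump n c d x) = (LINT x|lebesgue. f x * box_bump n c d x)"
      using sub by (intro integral_lebesgue_on_eq[OF \<Omega>]) (auto intro: out)
    also have "\<dots> = (LINT x|lebesgue. ?F x * box_bump n c d x)"
      by (intro Bochner_Integration.integral_cong) (auto simp: indicator_def out)
    finally show ?thesis .
  qed
  have "(\<lambda>n. LINT x|lebesgue. ?F x * box_bump n c d x) \<longlonglongrightarrow> (LINT x|lebesgue. ?F x)"
  proof (rule integral_dominated_convergence[where w="\<lambda>x. \<bar>?F x\<bar>"])
    show "?F \<in> borel_measurable lebesgue" using F by (rule borel_measurable_integrable)
    show "(\<lambda>x. ?F x * box_bump n c d x) \<in> borel_measurable lebesgue" for n
      by (rule borel_measurable_times[OF borel_measurable_integrable[OF F] bump_meas])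
    show "integrable lebesgue (\<lambda>x. \<bar>?F x\<bar>)" using F by (rule integrable_abs)
    show "AE x in lebesgue. norm (?F x * box_bump n c d x) \<le> \<bar>?F x\<bar>" for n
      using box_bump_le_1[of n c d] box_bump_nonneg[of n c d] by (auto simp: abs_mult mult_left_le)
    \<comment> \<open>The bumps converge to the indicator of the open box; the faces it omits are a
      null set.\<close>
    have "AE x in lebesgue. x \<notin> cbox c d - box c d"
      by (rule AE_not_in) (simp add: negligible_frontier_interval flip: negligible_iff_null_sets)
    then show "AE x in lebesgue. (\<lambda>n. ?F x * box_bump n c d x) \<longlonglongrightarrow> ?F x"
    proof eventually_elim
      case (elim x)
      have "(\<lambda>n. ?F x * box_bump n c d x) \<longlonglongrightarrow> ?F x * indicator (box c d) x"
        by (intro tendsto_mult_left box_bump_tendsto)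
      moreover have "?F x * indicator (box c d) x = ?F x" using elim by (auto simp: indicator_def)
      ultimately show ?case by simp
    qed
  qed
  also have "(LINT x|lebesgue. ?F x) = integral (cbox c d) f"
    using set_lebesgue_integral_eq_integral(2)[OF f] by (simp add: set_lebesgue_integral_def)
  finally show ?thesis by (simp add: eq)
qed

text \<open>Testing with box bumps makes the integral of \<open>f\<close> over every closed box in
  \<Omega> vanish. The sign criterion, applied to \<open>f\<close> and to its negative, gives zero
  almost everywhere on each such box, and countably many of them fill \<Omega>.\<close>

theorem fundamental_lemma:
  fixes f :: "'a::euclidean_space \<Rightarrow> real"
  assumes \<Omega>: "open \<Omega>" and f: "locally_integrable \<Omega> f"
    and zero: "\<And>\<phi>. \<phi> \<in> test_functions \<Omega> \<Longrightarrow> (LINT x|lebesgue_on \<Omega>. f x * \<phi> x) = 0"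
  shows "AE x in lebesgue_on \<Omega>. f x = 0"
proof -
  have f_box: "f absolutely_integrable_on cbox a b" if "cbox a b \<subseteq> \<Omega>" for a b
    using f that by (simp add: locally_integrable_def)
  have int_0: "integral (cbox c d) f = 0" if "cbox c d \<subseteq> \<Omega>" for c d
    using integral_box_bump_tendsto[OF _ f_box[OF that] that] \<Omega> zero[OF box_bump_test_function[OF that]]
    by (simp add: LIMSEQ_const_iff)
  have box: "AE x in lebesgue. x \<in> cbox a b \<longrightarrow> f x = 0" if sub: "cbox a b \<subseteq> \<Omega>" for a b
  proof -
    have "AE x in lebesgue. x \<in> cbox a b \<longrightarrow> 0 \<le> f x"
      using int_0 sub by (intro box_integrals_nonneg_imp_AE_nonneg f_box) auto
    moreover have "AE x in lebesgue. x \<in> cbox a b \<longrightarrow> 0 \<le> - f x"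
    proof (rule box_integrals_nonneg_imp_AE_nonneg)
      show "(\<lambda>x. - f x) absolutely_integrable_on cbox a b"
        using f_box[OF sub] by (simp add: set_integrable_def)
      show "0 \<le> integral (cbox c d) (\<lambda>x. - f x)" if "cbox c d \<subseteq> cbox a b" for c d
        using int_0[of c d] that sub by simp
    qed
    ultimately show ?thesis by eventually_elim auto
  qed
  obtain D where D: "countable D" "D \<subseteq> Pow \<Omega>" "\<And>X. X \<in> D \<Longrightarrow> \<exists>a b. X = cbox a b" "\<Union>D = \<Omega>"
    using open_countable_Union_open_cbox[OF \<Omega>] by metis
  have "AE x in lebesgue. \<forall>K\<in>D. x \<in> K \<longrightarrow> f x = 0"
    unfolding AE_ball_countable[OF D(1)]
  proof
    fix K assume "K \<in> D"
    then obtain a b where "K = cbox a b" "K \<subseteq> \<Omega>" using D(2,3) by blast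
    then show "AE x in lebesgue. x \<in> K \<longrightarrow> f x = 0" using box by simp
  qed
  then have "AE x in lebesgue. x \<in> \<Omega> \<longrightarrow> f x = 0"
    by eventually_elim (use D(4) in auto)
  then show ?thesis using \<Omega> by (simp add: AE_restrict_space_iff)
qed

section \<open>Test functions\<close>

lemma iter_partial_append: "iter_partial (vs @ ws) f = iter_partial vs (iter_partial ws f)"
  by (induction vs) auto

lemma smooth_differentiable:
  "smooth f \<Longrightarrow> set vs \<subseteq> Basis \<Longrightarrow> iter_partial vs f differentiable (at x)"
  unfolding smooth_def differentiable_on_def by simp

lemma smooth_has_derivative:
  "smooth f \<Longrightarrow> (f has_derivative frechet_derivative f (at x)) (at x)"
  using smooth_differentiable[of f "[]" x] by (simp add: frechet_derivative_works)

lemma smooth_iter_partial: "smooth f \<Longrightarrow> set vs \<subseteq> Basis \<Longrightarrow> smooth (iter_partial vs f)"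
  unfolding smooth_def by (auto simp flip: iter_partial_append)

lemma smooth_continuous: "smooth f \<Longrightarrow> continuous_on UNIV f"
  using smooth_differentiable[of f "[]"]
  by (simp add: continuous_at_imp_continuous_on differentiable_imp_continuous_within)

lemma iter_partial_add:
  assumes "smooth f" "smooth g" "set vs \<subseteq> Basis"
  shows "iter_partial vs (f + g) = iter_partial vs f + iter_partial vs g"
  using assms(3)
proof (induction vs)
  case (Cons v vs)
  have IH: "iter_partial vs (f + g) = iter_partial vs f + iter_partial vs g"
    by (rule Cons.IH) (use Cons.prems in auto)
  have "frechet_derivative (iter_partial vs f + iter_partial vs g) (at x) =
      (\<lambda>v. frechet_derivative (iter_partial vs f) (at x) v + frechet_derivative (iter_partial vs g) (at x) v)" for x
    unfolding plus_fun_def using Cons.prems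
    by (intro frechet_derivative_at[symmetric] has_derivative_add)
      (auto simp: assms smooth_differentiable simp flip: frechet_derivative_works)
  then show ?case unfolding iter_partial.simps IH by (simp only:) (simp only: plus_fun_def)
qed simp

lemma iter_partial_scaleR:
  assumes "smooth f" "set vs \<subseteq> Basis"
  shows "iter_partial vs (c *\<^sub>R f) = c *\<^sub>R iter_partial vs f"
  using assms(2)
proof (induction vs)
  case (Cons v vs)
  have IH: "iter_partial vs (c *\<^sub>R f) = c *\<^sub>R iter_partial vs f"
    by (rule Cons.IH) (use Cons.prems in auto)
  have "frechet_derivative (c *\<^sub>R iter_partial vs f) (at x) =
      (\<lambda>v. c *\<^sub>R frechet_derivative (iter_partial vs f) (at x) v)" for x
    unfolding scaleR_fun_def using Cons.prems
    by (intro frechet_derivative_at[symmetric] has_derivative_scaleR_right)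
      (auto simp: assms smooth_differentiable simp flip: frechet_derivative_works)
  then show ?case unfolding iter_partial.simps IH by (simp only:) (simp only: scaleR_fun_def)
qed simp

lemma smooth_add:
  assumes "smooth f" "smooth g"
  shows "smooth (f + g)"
  unfolding smooth_def differentiable_on_def
proof (intro allI impI ballI)
  fix vs :: "'a list" and x assume "set vs \<subseteq> Basis"
  then have "(\<lambda>x. iter_partial vs f x + iter_partial vs g x) differentiable (at x)"
    using assms by (intro differentiable_add smooth_differentiable)
  then show "iter_partial vs (f + g) differentiable (at x)"
    unfolding iter_partial_add[OF assms \<open>set vs \<subseteq> Basis\<close>] unfolding plus_fun_def .
qed

lemma smooth_scaleR:
  assumes "smooth f"
  shows "smooth (c *\<^sub>R f)"
  unfolding smooth_def differentiable_on_def
proof (intro allI impI ballI)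
  fix vs :: "'a list" and x assume "set vs \<subseteq> Basis"
  then have "(\<lambda>x. c *\<^sub>R iter_partial vs f x) differentiable (at x)"
    using assms by (intro differentiable_scaleR smooth_differentiable) auto
  then show "iter_partial vs (c *\<^sub>R f) differentiable (at x)"
    unfolding iter_partial_scaleR[OF assms \<open>set vs \<subseteq> Basis\<close>] unfolding scaleR_fun_def .
qed

lemma smooth_zero: "smooth 0"
  using smooth_alg_smooth[OF smooth_alg.const[of 0]] by (simp add: zero_fun_def)

lemma test_functions_smooth: "\<phi> \<in> test_functions \<Omega> \<Longrightarrow> smooth \<phi>"
  by (simp add: test_functions_def)

lemma test_functions_outside: "\<phi> \<in> test_functions \<Omega> \<Longrightarrow> x \<notin> \<Omega> \<Longrightarrow> \<phi> x = 0"
  using closure_subset[of "{x. \<phi> x \<noteq> 0}"] by (auto simp: test_functions_def)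

lemma test_functionsI:
  assumes "smooth \<psi>" "{x. \<psi> x \<noteq> 0} \<subseteq> K" "compact K" "K \<subseteq> \<Omega>"
  shows "\<psi> \<in> test_functions \<Omega>"
proof -
  have "closure {x. \<psi> x \<noteq> 0} \<subseteq> K"
    using assms by (intro closure_minimal) (auto simp: compact_imp_closed)
  moreover have "bounded {x. \<psi> x \<noteq> 0}"
    using compact_imp_bounded[OF assms(3)] assms(2) by (rule bounded_subset)
  ultimately show ?thesis using assms by (simp add: test_functions_def)
qed

lemma subspace_test_functions: "subspace (test_functions \<Omega>)"
proof (rule subspaceI)
  show "0 \<in> test_functions \<Omega>"
    by (rule test_functionsI[of _ "{}"]) (auto simp: smooth_zero)
  fix \<phi> assume \<phi>: "\<phi> \<in> test_functions \<Omega>"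
  show "c *\<^sub>R \<phi> \<in> test_functions \<Omega>" for c
    using \<phi> closure_subset[of "{x. \<phi> x \<noteq> 0}"]
    by (intro test_functionsI[of _ "closure {x. \<phi> x \<noteq> 0}"]) (auto simp: test_functions_def smooth_scaleR)
  fix \<psi> assume \<psi>: "\<psi> \<in> test_functions \<Omega>"
  show "\<phi> + \<psi> \<in> test_functions \<Omega>"
  proof (rule test_functionsI[of _ "closure {x. \<phi> x \<noteq> 0} \<union> closure {x. \<psi> x \<noteq> 0}"])
    have "{x. (\<phi> + \<psi>) x \<noteq> 0} \<subseteq> {x. \<phi> x \<noteq> 0} \<union> {x. \<psi> x \<noteq> 0}" by auto
    then show "{x. (\<phi> + \<psi>) x \<noteq> 0} \<subseteq> closure {x. \<phi> x \<noteq> 0} \<union> closure {x. \<psi> x \<noteq> 0}"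
      using closure_subset by blast
  qed (use \<phi> \<psi> in \<open>auto simp: test_functions_def smooth_add\<close>)
qed

text \<open>Off the closed support the function is zero on an open set, hence so is its derivative;
  the support cannot grow.\<close>

lemma test_functions_partial:
  assumes \<phi>: "\<phi> \<in> test_functions \<Omega>" and e: "e \<in> Basis"
  shows "iter_partial [e] \<phi> \<in> test_functions \<Omega>"
proof (rule test_functionsI[of _ "closure {x. \<phi> x \<noteq> 0}"])
  show "smooth (iter_partial [e] \<phi>)" using \<phi> e by (intro smooth_iter_partial) (auto simp: test_functions_smooth)
  show "{x. iter_partial [e] \<phi> x \<noteq> 0} \<subseteq> closure {x. \<phi> x \<noteq> 0}"
  proof (rule subsetI, rule ccontr)
    fix x assume x: "x \<in> {x. iter_partial [e] \<phi> x \<noteq> 0}" "x \<notin> closure {x. \<phi> x \<noteq> 0}"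
    have "((\<lambda>_. 0) has_derivative (\<lambda>_. 0)) (at x)" by simp
    then have "(\<phi> has_derivative (\<lambda>_. 0)) (at x)"
    proof (rule has_derivative_transform_within_open)
      show "open (- closure {x. \<phi> x \<noteq> 0})" by (simp add: open_Compl)
      show "x \<in> - closure {x. \<phi> x \<noteq> 0}" using x(2) by simp
      show "0 = \<phi> y" if "y \<in> - closure {x. \<phi> x \<noteq> 0}" for y
        using that closure_subset[of "{x. \<phi> x \<noteq> 0}"] by auto
    qed
    then have "frechet_derivative \<phi> (at x) = (\<lambda>_. 0)" by (metis frechet_derivative_at)
    then show False using x(1) by simp
  qed
qed (use \<phi> in \<open>auto simp: test_functions_def\<close>)

lemma test_functions_iter_partial:
  "\<phi> \<in> test_functions \<Omega> \<Longrightarrow> set vs \<subseteq> Basis \<Longrightarrow> iter_partial vs \<phi> \<in> test_functions \<Omega>"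
proof (induction vs)
  case (Cons v vs)
  then have "iter_partial vs \<phi> \<in> test_functions \<Omega>" "v \<in> Basis" by auto
  then have "iter_partial [v] (iter_partial vs \<phi>) \<in> test_functions \<Omega>" by (rule test_functions_partial)
  then show ?case by simp
qed simp

section \<open>Integration by parts for test functions\<close>

lemma continuous_compact_support_bounded:
  fixes f :: "'a::euclidean_space \<Rightarrow> real"
  assumes "continuous_on UNIV f" "bounded {x. f x \<noteq> 0}"
  obtains C where "\<And>x. \<bar>f x\<bar> \<le> C"
proof -
  obtain B where B: "\<And>x. f x \<noteq> 0 \<Longrightarrow> norm x \<le> B" using assms(2) by (auto simp: bounded_iff)
  have "bounded (f ` cball 0 B)"
    using assms(1) by (intro compact_imp_bounded compact_continuous_image) (auto intro: continuous_on_subset)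
  then obtain C where C: "\<forall>y\<in>f ` cball 0 B. norm y \<le> C" unfolding bounded_iff by blast
  have "\<bar>f x\<bar> \<le> max C 0" for x
  proof (cases "f x = 0")
    case False
    then have "f x \<in> f ` cball 0 B" using B by simp
    then show ?thesis using C by auto
  qed simp
  then show ?thesis by (rule that)
qed

lemma integrable_indicator_cball:
  "integrable lborel (indicator (cball x r :: 'a::euclidean_space set) :: 'a \<Rightarrow> real)"
  by (rule integrable_real_indicator) (use emeasure_bounded_finite[of "cball x r"] in simp_all)

lemma integrable_bounded_support:
  fixes f :: "'a::euclidean_space \<Rightarrow> real"
  assumes "f \<in> borel_measurable borel" "\<And>x. \<bar>f x\<bar> \<le> C" "bounded {x. f x \<noteq> 0}"
  shows "integrable lborel f"
proof -
  obtain B where B: "\<And>x. f x \<noteq> 0 \<Longrightarrow> norm x \<le> B" using assms(3) by (auto simp: bounded_iff)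
  have "integrable lborel (\<lambda>x. C * indicator (cball 0 B) x :: real)"
    by (intro integrable_mult_right integrable_indicator_cball)
  then show ?thesis
  proof (rule Bochner_Integration.integrable_bound)
    show "f \<in> borel_measurable lborel" using assms(1) by simp
    show "AE x in lborel. norm (f x) \<le> norm (C * indicator (cball 0 B) x)"
    proof (rule AE_I2)
      fix x show "norm (f x) \<le> norm (C * indicator (cball 0 B) x)"
        using B[of x] assms(2)[of x] by (cases "f x = 0") (auto simp: indicator_def)
    qed
  qed
qed

lemma integral_lborel_translation:
  fixes f :: "'a::euclidean_space \<Rightarrow> real"
  assumes "f \<in> borel_measurable borel"
  shows "(LINT x|lborel. f (c + x)) = (LINT x|lborel. f x)"
proof -
  have "(LINT x|lborel. f x) = (LINT x|distr lborel borel ((+) c). f x)" by (simp add: lborel_distr_plus)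
  also have "\<dots> = (LINT x|lborel. f (c + x))" using assms by (intro integral_distr) auto
  finally show ?thesis by simp
qed

text \<open>The integrals of the difference quotients vanish by translation invariance.\<close>

lemma integral_directional_derivative_zero:
  fixes F :: "'a::euclidean_space \<Rightarrow> real"
  assumes der: "\<And>x. (F has_derivative F' x) (at x)"
    and cont: "continuous_on UNIV (\<lambda>x. F' x e)" and supp: "bounded {x. F x \<noteq> 0}"
    and supp': "bounded {x. F' x e \<noteq> 0}"
  shows "(LINT x|lborel. F' x e) = 0"
proof -
  have F_cont: "continuous_on UNIV F"
    by (intro continuous_at_imp_continuous_on ballI) (meson der has_derivative_continuous)
  then have F_meas [measurable]: "F \<in> borel_measurable borel" by (rule borel_measurable_continuous_onI)
  have F'_meas [measurable]: "(\<lambda>x. F' x e) \<in> borel_measurable borel"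
    using cont by (rule borel_measurable_continuous_onI)
  obtain C0 where C0: "\<And>x. \<bar>F x\<bar> \<le> C0" using continuous_compact_support_bounded[OF F_cont supp] by blast
  obtain C where C: "\<And>x. \<bar>F' x e\<bar> \<le> C" using continuous_compact_support_bounded[OF cont supp'] by blast
  obtain B where B: "\<And>x. F x \<noteq> 0 \<Longrightarrow> norm x \<le> B" using supp by (auto simp: bounded_iff)
  have line: "((\<lambda>h. F (h *\<^sub>R e + x)) has_real_derivative F' (h *\<^sub>R e + x) e) (at h)" for x h
  proof -
    have "((\<lambda>h. h *\<^sub>R e + x) has_derivative (\<lambda>k. k *\<^sub>R e)) (at h)"
      by (auto intro!: derivative_eq_intros)
    from has_derivative_compose[OF this der]
    have "((\<lambda>h. F (h *\<^sub>R e + x)) has_derivative (\<lambda>k. F' (h *\<^sub>R e + x) (k *\<^sub>R e))) (at h)" .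
    moreover have "F' y (k *\<^sub>R e) = F' y e * k" for y k
      using linear_cmul[OF has_derivative_linear[OF der[of y]], of k e] by simp
    ultimately show ?thesis by (simp add: has_field_derivative_def)
  qed
  define \<delta> where "\<delta> n = 1 / real (Suc n)" for n
  have \<delta>: "0 < \<delta> n" "\<delta> n \<le> 1" for n by (auto simp: \<delta>_def)
  define D where "D n x = (F (\<delta> n *\<^sub>R e + x) - F x) / \<delta> n" for n x
  have F_int: "integrable lborel F" by (rule integrable_bounded_support[OF F_meas C0 supp])
  have F_int': "integrable lborel (\<lambda>x. F (c + x))" for c
  proof -
    have "{x. F (c + x) \<noteq> 0} \<subseteq> (\<lambda>x. x - c) ` {x. F x \<noteq> 0}" by (auto simp: image_iff intro!: exI[of _ "c + _"])
    then have "bounded {x. F (c + x) \<noteq> 0}"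
      by (rule bounded_subset[rotated]) (use bounded_translation_minus[OF supp] in simp)
    then show ?thesis using C0 by (intro integrable_bounded_support) auto
  qed
  have D_int: "(LINT x|lborel. D n x) = 0" for n
    using integral_lborel_translation[OF F_meas, of "\<delta> n *\<^sub>R e"] F_int F_int' by (simp add: D_def)
  \<comment> \<open>By the mean value theorem each quotient is a value of the derivative, hence
    bounded by \<open>C\<close>. The increments have length at most \<open>norm e\<close>, so all
    quotients vanish outside the ball of radius \<open>B + norm e\<close>.\<close>
  have "(\<lambda>n. LINT x|lborel. D n x) \<longlonglongrightarrow> (LINT x|lborel. F' x e)"
  proof (rule integral_dominated_convergence[where w="\<lambda>x. C * indicator (cball 0 (B + norm e)) x"])
    show "integrable lborel (\<lambda>x::'a. C * indicator (cball 0 (B + norm e)) x)"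
      by (intro integrable_mult_right integrable_indicator_cball)
    show "AE x in lborel. norm (D n x) \<le> C * indicator (cball 0 (B + norm e)) x" for n
    proof (rule AE_I2)
      fix x
      show "norm (D n x) \<le> C * indicator (cball 0 (B + norm e)) x"
      proof (cases "x \<in> cball 0 (B + norm e)")
        case True
        obtain z where "F (\<delta> n *\<^sub>R e + x) - F (0 *\<^sub>R e + x) = (\<delta> n - 0) * F' (z *\<^sub>R e + x) e"
          using MVT2[OF \<delta>(1)[of n], of "\<lambda>h. F (h *\<^sub>R e + x)" "\<lambda>h. F' (h *\<^sub>R e + x) e"] line by blast
        then have "D n x = F' (z *\<^sub>R e + x) e" using \<delta>(1)[of n] by (simp add: D_def field_simps)
        then show ?thesis using C True by simp
      next
        case False
        have far: "norm x > B + norm e" using False by simp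
        then have "norm x > B" using norm_ge_zero[of e] by linarith
        moreover have "norm (\<delta> n *\<^sub>R e + x) > B"
        proof -
          have "norm (\<delta> n *\<^sub>R e) \<le> norm e" using \<delta>[of n] by (simp add: mult_left_le_one_le)
          moreover have "norm x \<le> norm (\<delta> n *\<^sub>R e + x) + norm (\<delta> n *\<^sub>R e)"
            using norm_triangle_ineq4[of "\<delta> n *\<^sub>R e + x" "\<delta> n *\<^sub>R e"] by simp
          ultimately show ?thesis using far by linarith
        qed
        ultimately have "F x = 0" "F (\<delta> n *\<^sub>R e + x) = 0" using B by (meson not_le)+
        then show ?thesis using False by (simp add: D_def)
      qed
    qed
    show "AE x in lborel. (\<lambda>n. D n x) \<longlonglongrightarrow> F' x e"
    proof (rule AE_I2)
      fix x
      have "((\<lambda>h. (F (h *\<^sub>R e + x) - F (0 *\<^sub>R e + x)) / (h - 0)) \<longlongrightarrow> F' (0 *\<^sub>R e + x) e) (at 0)"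
        using line[of x 0] unfolding has_field_derivative_iff .
      then have lim: "((\<lambda>h. (F (h *\<^sub>R e + x) - F x) / h) \<longlongrightarrow> F' x e) (at 0)" by simp
      have "filterlim \<delta> (at 0) sequentially"
      proof (rule filterlim_atI)
        show "\<delta> \<longlonglongrightarrow> 0" unfolding \<delta>_def using LIMSEQ_Suc[OF lim_1_over_n] .
        show "\<forall>\<^sub>F n in sequentially. \<delta> n \<noteq> 0" using \<delta>(1) by (simp add: less_imp_neq[symmetric])
      qed
      from filterlim_compose[OF lim this] show "(\<lambda>n. D n x) \<longlonglongrightarrow> F' x e" by (simp add: D_def)
    qed
  qed (auto simp: D_def)
  then show ?thesis by (simp add: D_int LIMSEQ_const_iff)
qed

lemma test_functions_support_bounded: "\<phi> \<in> test_functions \<Omega> \<Longrightarrow> bounded {x. \<phi> x \<noteq> 0}"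
  using bounded_subset[OF compact_imp_bounded closure_subset, of "{x. \<phi> x \<noteq> 0}"]
  by (simp add: test_functions_def)

lemma test_functions_borel: "\<phi> \<in> test_functions \<Omega> \<Longrightarrow> \<phi> \<in> borel_measurable borel"
  by (intro borel_measurable_continuous_onI smooth_continuous test_functions_smooth)

lemma test_functions_bounded:
  assumes "\<phi> \<in> test_functions \<Omega>"
  obtains C where "\<And>x. \<bar>\<phi> x\<bar> \<le> C"
  using assms by (rule continuous_compact_support_bounded[OF smooth_continuous[OF test_functions_smooth]
      test_functions_support_bounded]) (rule assms, rule that)

lemma test_functions_measurable:
  "\<phi> \<in> test_functions \<Omega> \<Longrightarrow> \<phi> \<in> borel_measurable (lebesgue_on A)"
  by (intro measurable_restrict_space1 measurable_completion) (simp add: test_functions_borel)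

text \<open>The derivative along \<open>e\<close> of the product of the two test functions has
  integral zero; the product rule separates its two parts.\<close>

lemma integration_by_parts_test:
  assumes \<Omega>: "open \<Omega>" and \<phi>: "\<phi> \<in> test_functions \<Omega>" and \<psi>: "\<psi> \<in> test_functions \<Omega>" and e: "e \<in> Basis"
  shows "(LINT x|lebesgue_on \<Omega>. \<phi> x * iter_partial [e] \<psi> x) = - (LINT x|lebesgue_on \<Omega>. iter_partial [e] \<phi> x * \<psi> x)"
proof -
  define \<phi>' \<psi>' where "\<phi>' = iter_partial [e] \<phi>" and "\<psi>' = iter_partial [e] \<psi>"
  have \<phi>': "\<phi>' \<in> test_functions \<Omega>" and \<psi>': "\<psi>' \<in> test_functions \<Omega>"
    unfolding \<phi>'_def \<psi>'_def using \<phi> \<psi> e by (auto intro: test_functions_partial simp del: iter_partial.simps)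
  have prod_int: "integrable lborel (\<lambda>x. f x * g x)" if f: "f \<in> test_functions \<Omega>" and g: "g \<in> test_functions \<Omega>" for f g
  proof -
    obtain C where C: "\<And>x. \<bar>f x\<bar> \<le> C" using test_functions_bounded[OF f] by blast
    obtain C' where C': "\<And>x. \<bar>g x\<bar> \<le> C'" using test_functions_bounded[OF g] by blast
    show ?thesis
    proof (rule integrable_bounded_support)
      show "\<bar>f x * g x\<bar> \<le> C * C'" for x
        using C[of x] C'[of x] by (simp add: abs_mult mult_mono')
      show "bounded {x. f x * g x \<noteq> 0}"
        using test_functions_support_bounded[OF f] by (rule bounded_subset) auto
    qed (intro borel_measurable_times test_functions_borel[OF f] test_functions_borel[OF g])
  qed
  have to_lborel: "(LINT x|lebesgue_on \<Omega>. f x * g x) = (LINT x|lborel. f x * g x)"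
    if f: "f \<in> test_functions \<Omega>" and g: "g \<in> test_functions \<Omega>" for f g
    using \<Omega> test_functions_outside[OF f] test_functions_borel[OF f] test_functions_borel[OF g]
    by (subst integral_lebesgue_on_eq) (auto simp: integral_completion)
  have "(LINT x|lborel. (\<lambda>x v. \<phi> x * frechet_derivative \<psi> (at x) v + frechet_derivative \<phi> (at x) v * \<psi> x) x e) = 0"
  proof (rule integral_directional_derivative_zero[where F="\<lambda>x. \<phi> x * \<psi> x"])
    show "((\<lambda>x. \<phi> x * \<psi> x) has_derivative
        (\<lambda>v. \<phi> x * frechet_derivative \<psi> (at x) v + frechet_derivative \<phi> (at x) v * \<psi> x)) (at x)" for x
      using \<phi> \<psi> by (intro has_derivative_mult smooth_has_derivative test_functions_smooth)
    show "continuous_on UNIV (\<lambda>x. \<phi> x * frechet_derivative \<psi> (at x) e + frechet_derivative \<phi> (at x) e * \<psi> x)"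
      using smooth_continuous[OF test_functions_smooth[OF \<phi>]] smooth_continuous[OF test_functions_smooth[OF \<psi>]]
        smooth_continuous[OF test_functions_smooth[OF \<phi>']] smooth_continuous[OF test_functions_smooth[OF \<psi>']]
      by (simp add: \<phi>'_def \<psi>'_def continuous_intros)
    show "bounded {x. \<phi> x * \<psi> x \<noteq> 0}"
      using test_functions_support_bounded[OF \<phi>] by (rule bounded_subset) auto
    show "bounded {x. \<phi> x * frechet_derivative \<psi> (at x) e + frechet_derivative \<phi> (at x) e * \<psi> x \<noteq> 0}"
    proof (rule bounded_subset)
      show "bounded ({x. \<phi> x \<noteq> 0} \<union> {x. \<psi> x \<noteq> 0})"
        using test_functions_support_bounded[OF \<phi>] test_functions_support_bounded[OF \<psi>] by simp
    qed auto
  qed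
  then have "(LINT x|lborel. \<phi> x * \<psi>' x + \<phi>' x * \<psi> x) = 0" by (simp add: \<phi>'_def \<psi>'_def)
  then have "(LINT x|lborel. \<phi> x * \<psi>' x) + (LINT x|lborel. \<phi>' x * \<psi> x) = 0"
    using prod_int[OF \<phi> \<psi>'] prod_int[OF \<phi>' \<psi>] by simp
  then show ?thesis
    using to_lborel[OF \<phi> \<psi>'] to_lborel[OF \<phi>' \<psi>] by (simp add: \<phi>'_def \<psi>'_def)
qed

section \<open>Square-integrable functions on a bounded open set\<close>

text \<open>Such a map exists because the identity on \<open>V\<close> extends linearly to the whole
  space. It carries a form given on \<open>V\<close> over to the whole type without changing it on
  \<open>V\<close>.\<close>

definition retraction_onto :: "'v::real_vector set \<Rightarrow> 'v \<Rightarrow> 'v" where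
  "retraction_onto V = (SOME p. range p \<subseteq> V \<and> linear p \<and> (\<forall>v\<in>V. p v = v))"

lemma
  assumes "subspace V"
  shows retraction_in: "retraction_onto V x \<in> V"
    and linear_retraction: "linear (retraction_onto V)"
    and retraction_id: "v \<in> V \<Longrightarrow> retraction_onto V v = v"
proof -
  have "\<exists>p. range p \<subseteq> V \<and> linear p \<and> (\<forall>v\<in>V. p v = v)"
    using real_vector.linear_exists_left_inverse_on[OF real_vector.linear_ident assms] by simp
  then have "range (retraction_onto V) \<subseteq> V \<and> linear (retraction_onto V) \<and> (\<forall>v\<in>V. retraction_onto V v = v)"
    unfolding retraction_onto_def by (rule someI_ex)
  then show "retraction_onto V x \<in> V" "linear (retraction_onto V)" "v \<in> V \<Longrightarrow> retraction_onto V v = v"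
    by auto
qed

text \<open>The \<open>L\<^sup>2\<close> and \<open>H\<^sup>1\<close> forms are bilinear only on subspaces of the space of all functions, whereas
  \<^const>\<open>bilinear\<close> refers to a whole type.\<close>

definition extend_form :: "'v::real_vector set \<Rightarrow> ('v \<Rightarrow> 'v \<Rightarrow> real) \<Rightarrow> 'v \<Rightarrow> 'v \<Rightarrow> real" where
  "extend_form V B x y = B (retraction_onto V x) (retraction_onto V y)"

lemma extend_form_eq:
  "subspace V \<Longrightarrow> x \<in> V \<Longrightarrow> y \<in> V \<Longrightarrow> extend_form V B x y = B x y"
  by (simp add: extend_form_def retraction_id)

lemma bilinear_extend_form:
  assumes V: "subspace V"
    and add: "\<And>x y z. x \<in> V \<Longrightarrow> y \<in> V \<Longrightarrow> z \<in> V \<Longrightarrow> B (x + y) z = B x z + B y z"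
    and scale: "\<And>c x z. x \<in> V \<Longrightarrow> z \<in> V \<Longrightarrow> B (c *\<^sub>R x) z = c * B x z"
    and sym: "\<And>x y. x \<in> V \<Longrightarrow> y \<in> V \<Longrightarrow> B x y = B y x"
  shows "bilinear (extend_form V B)"
proof -
  note lin = linear_add[OF linear_retraction[OF V]] linear_cmul[OF linear_retraction[OF V]]
  have in_V: "retraction_onto V x \<in> V" for x by (rule retraction_in[OF V])
  have add': "extend_form V B (x + y) z = extend_form V B x z + extend_form V B y z" for x y z
    by (simp add: extend_form_def lin add in_V)
  have scale': "extend_form V B (c *\<^sub>R x) z = c * extend_form V B x z" for c x z
    by (simp add: extend_form_def lin scale in_V)
  have sym': "extend_form V B x y = extend_form V B y x" for x y
    by (simp add: extend_form_def sym in_V)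
  show ?thesis unfolding bilinear_def
  proof (intro conjI allI linearI)
    show "extend_form V B x (y + z) = extend_form V B x y + extend_form V B x z" for x y z
      using add'[of y z x] by (simp add: sym'[of x])
    show "extend_form V B x (c *\<^sub>R y) = c *\<^sub>R extend_form V B x y" for x y c
      using scale'[of c y x] by (simp add: sym'[of x])
  qed (simp_all add: add' scale')
qed

lemma semi_inner_extend_form:
  assumes V: "subspace V"
    and add: "\<And>x y z. x \<in> V \<Longrightarrow> y \<in> V \<Longrightarrow> z \<in> V \<Longrightarrow> B (x + y) z = B x z + B y z"
    and scale: "\<And>c x z. x \<in> V \<Longrightarrow> z \<in> V \<Longrightarrow> B (c *\<^sub>R x) z = c * B x z"
    and sym: "\<And>x y. x \<in> V \<Longrightarrow> y \<in> V \<Longrightarrow> B x y = B y x"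
    and nonneg: "\<And>x. x \<in> V \<Longrightarrow> 0 \<le> B x x"
  shows "semi_inner (extend_form V B)"
proof
  show "bilinear (extend_form V B)" by (rule bilinear_extend_form[OF V add scale sym])
  show "extend_form V B x y = extend_form V B y x" for x y
    by (simp add: extend_form_def sym retraction_in[OF V])
  show "0 \<le> extend_form V B x x" for x
    by (simp add: extend_form_def nonneg retraction_in[OF V])
qed

locale domain =
  fixes \<Omega> :: "'a::euclidean_space set"
  assumes open_\<Omega>: "open \<Omega>" and bounded_\<Omega>: "bounded \<Omega>"
begin

abbreviation "leb \<equiv> lebesgue_on \<Omega>"

lemma \<Omega>_sets [simp]: "\<Omega> \<in> sets lebesgue" "\<Omega> \<inter> space lebesgue \<in> sets lebesgue"
  using open_\<Omega> by auto

lemma finite_leb: "finite_measure leb"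
proof
  have "emeasure leb (space leb) = emeasure lebesgue \<Omega>"
    by (simp add: emeasure_restrict_space)
  also have "\<dots> \<noteq> \<infinity>"
    using emeasure_bounded_finite[OF bounded_\<Omega>] open_\<Omega> by simp
  finally show "emeasure leb (space leb) \<noteq> \<infinity>" .
qed

lemma L2_measurable: "f \<in> L2 \<Omega> \<Longrightarrow> f \<in> borel_measurable leb"
  by (simp add: L2_def)

lemma L2_sq_integrable: "f \<in> L2 \<Omega> \<Longrightarrow> integrable leb (\<lambda>x. (f x)\<^sup>2)"
  by (simp add: L2_def)

lemma L2I: "f \<in> borel_measurable leb \<Longrightarrow> integrable leb (\<lambda>x. (f x)\<^sup>2) \<Longrightarrow> f \<in> L2 \<Omega>"
  by (simp add: L2_def)

lemma L2_mult_integrable: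
  assumes f: "f \<in> L2 \<Omega>" and g: "g \<in> L2 \<Omega>"
  shows "integrable leb (\<lambda>x. f x * g x)"
proof (rule Bochner_Integration.integrable_bound)
  show "integrable leb (\<lambda>x. (f x)\<^sup>2 + (g x)\<^sup>2)"
    using L2_sq_integrable f g by (intro Bochner_Integration.integrable_add)
  show "(\<lambda>x. f x * g x) \<in> borel_measurable leb"
    using L2_measurable f g by (intro borel_measurable_times)
  have "\<bar>a * b\<bar> \<le> a\<^sup>2 + b\<^sup>2" for a b :: real
  proof -
    have "2 * \<bar>a * b\<bar> \<le> a\<^sup>2 + b\<^sup>2"
      using sum_squares_bound[of "\<bar>a\<bar>" "\<bar>b\<bar>"] by (simp add: abs_mult mult.assoc)
    then show ?thesis using abs_ge_zero[of "a * b"] by linarith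
  qed
  then show "AE x in leb. norm (f x * g x) \<le> norm ((f x)\<^sup>2 + (g x)\<^sup>2)" by simp
qed

lemma L2_bounded_mult:
  assumes f: "f \<in> L2 \<Omega>" and a: "a \<in> borel_measurable leb" and bd: "\<And>x. x \<in> \<Omega> \<Longrightarrow> \<bar>a x\<bar> \<le> C"
  shows "(\<lambda>x. a x * f x) \<in> L2 \<Omega>"
proof (rule L2I)
  show meas: "(\<lambda>x. a x * f x) \<in> borel_measurable leb"
    using L2_measurable[OF f] a by (intro borel_measurable_times)
  show "integrable leb (\<lambda>x. (a x * f x)\<^sup>2)"
  proof (rule Bochner_Integration.integrable_bound)
    show "integrable leb (\<lambda>x. C\<^sup>2 * (f x)\<^sup>2)" using L2_sq_integrable[OF f] by simp
    show "(\<lambda>x. (a x * f x)\<^sup>2) \<in> borel_measurable leb" using meas by (rule borel_measurable_power)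
    show "AE x in leb. norm ((a x * f x)\<^sup>2) \<le> norm (C\<^sup>2 * (f x)\<^sup>2)"
    proof (rule AE_I2)
      fix x assume "x \<in> space leb"
      then have "\<bar>a x\<bar> \<le> C" using bd by simp
      then have "(a x)\<^sup>2 \<le> C\<^sup>2" by (metis abs_ge_zero power2_abs power_mono)
      then show "norm ((a x * f x)\<^sup>2) \<le> norm (C\<^sup>2 * (f x)\<^sup>2)"
        by (simp add: power_mult_distrib mult_right_mono)
    qed
  qed
qed

lemma subspace_L2: "subspace (L2 \<Omega>)"
proof (rule subspaceI)
  show "0 \<in> L2 \<Omega>" by (simp add: L2_def zero_fun_def)
  fix f assume f: "f \<in> L2 \<Omega>"
  show "c *\<^sub>R f \<in> L2 \<Omega>" for c
    using L2_bounded_mult[OF f, of "\<lambda>_. c" "\<bar>c\<bar>"] by (simp add: scaleR_fun_def)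
  fix g assume g: "g \<in> L2 \<Omega>"
  show "f + g \<in> L2 \<Omega>"
  proof (rule L2I)
    show "f + g \<in> borel_measurable leb"
      unfolding plus_fun_def using f g by (intro borel_measurable_add L2_measurable)
    have "integrable leb (\<lambda>x. (f x)\<^sup>2 + 2 * (f x * g x) + (g x)\<^sup>2)"
      using f g by (intro Bochner_Integration.integrable_add L2_sq_integrable integrable_mult_right L2_mult_integrable)
    then show "integrable leb (\<lambda>x. ((f + g) x)\<^sup>2)"
      by (simp add: power2_sum algebra_simps)
  qed
qed

lemma L2_diff: "f \<in> L2 \<Omega> \<Longrightarrow> g \<in> L2 \<Omega> \<Longrightarrow> f - g \<in> L2 \<Omega>"
  by (rule subspace_diff[OF subspace_L2])

lemma L2_inner_sym: "L2_inner \<Omega> f g = L2_inner \<Omega> g f"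
  by (simp add: L2_inner_def mult.commute)

lemma L2_inner_add:
  "f \<in> L2 \<Omega> \<Longrightarrow> g \<in> L2 \<Omega> \<Longrightarrow> h \<in> L2 \<Omega> \<Longrightarrow> L2_inner \<Omega> (f + g) h = L2_inner \<Omega> f h + L2_inner \<Omega> g h"
  by (simp add: L2_inner_def distrib_right L2_mult_integrable)

lemma L2_inner_diff:
  "f \<in> L2 \<Omega> \<Longrightarrow> g \<in> L2 \<Omega> \<Longrightarrow> h \<in> L2 \<Omega> \<Longrightarrow> L2_inner \<Omega> (f - g) h = L2_inner \<Omega> f h - L2_inner \<Omega> g h"
  by (simp add: L2_inner_def left_diff_distrib L2_mult_integrable)

lemma L2_inner_scaleR: "L2_inner \<Omega> (c *\<^sub>R f) g = c * L2_inner \<Omega> f g"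
  by (simp add: L2_inner_def mult.assoc)

lemma L2_inner_nonneg: "0 \<le> L2_inner \<Omega> f f"
  by (simp add: L2_inner_def)

definition "ipL2 = extend_form (L2 \<Omega>) (L2_inner \<Omega>)"

sublocale L2: semi_inner ipL2
  unfolding ipL2_def
  by (rule semi_inner_extend_form[OF subspace_L2])
    (rule L2_inner_add L2_inner_scaleR L2_inner_sym L2_inner_nonneg; assumption)+

lemma ipL2_eq: "f \<in> L2 \<Omega> \<Longrightarrow> g \<in> L2 \<Omega> \<Longrightarrow> ipL2 f g = L2_inner \<Omega> f g"
  by (simp add: ipL2_def extend_form_eq subspace_L2)

lemma L2_nrm_eq: "f \<in> L2 \<Omega> \<Longrightarrow> L2.nrm f = L2_norm \<Omega> f"
  by (simp add: L2.nrm_def L2_norm_def ipL2_eq)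

lemma L2_norm_nonneg [simp]: "0 \<le> L2_norm \<Omega> f"
  by (simp add: L2_norm_def L2_inner_nonneg)

lemma L2_norm_sq: "(L2_norm \<Omega> f)\<^sup>2 = L2_inner \<Omega> f f"
  by (simp add: L2_norm_def L2_inner_nonneg)

lemma L2_cauchy_schwarz:
  "f \<in> L2 \<Omega> \<Longrightarrow> g \<in> L2 \<Omega> \<Longrightarrow> \<bar>L2_inner \<Omega> f g\<bar> \<le> L2_norm \<Omega> f * L2_norm \<Omega> g"
  using L2.cauchy_schwarz[of f g] by (simp add: ipL2_eq L2_nrm_eq)

lemma L2_inner_cong_AE:
  assumes "f \<in> L2 \<Omega>" "f' \<in> L2 \<Omega>" "g \<in> L2 \<Omega>" "g' \<in> L2 \<Omega>" "AE x in leb. f x = f' x" "AE x in leb. g x = g' x"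
  shows "L2_inner \<Omega> f g = L2_inner \<Omega> f' g'"
  unfolding L2_inner_def
proof (rule integral_cong_AE)
  show "AE x in leb. f x * g x = f' x * g' x" using assms(5,6) by eventually_elim simp
qed (rule borel_measurable_times[OF L2_measurable L2_measurable]; fact)+

lemma L2_locally_integrable:
  assumes "f \<in> L2 \<Omega>"
  shows "locally_integrable \<Omega> f"
  unfolding locally_integrable_def
proof (intro allI impI)
  interpret finite_measure leb by (rule finite_leb)
  fix K assume K: "compact K" "K \<subseteq> \<Omega>"
  have "integrable leb f"
  proof (rule Bochner_Integration.integrable_bound)
    show "integrable leb (\<lambda>x. 1 + (f x)\<^sup>2)" using L2_sq_integrable[OF assms] by simp
    have "\<bar>a\<bar> \<le> 1 + a\<^sup>2" for a :: real
      using sum_squares_bound[of 1 "\<bar>a\<bar>"] abs_ge_zero[of a] by (simp del: abs_ge_zero)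
    then show "AE x in leb. norm (f x) \<le> norm (1 + (f x)\<^sup>2)" by simp
  qed (rule L2_measurable[OF assms])
  then have "f absolutely_integrable_on \<Omega>"
    by (simp add: integrable_restrict_space set_integrable_def)
  moreover have "K \<in> sets lebesgue"
    using lmeasurable_compact[OF K(1)] by (rule fmeasurableD)
  ultimately show "f absolutely_integrable_on K"
    using K(2) by (rule set_integrable_subset)
qed

lemma test_functions_L2: "\<phi> \<in> test_functions \<Omega> \<Longrightarrow> \<phi> \<in> L2 \<Omega>"
proof -
  assume \<phi>: "\<phi> \<in> test_functions \<Omega>"
  interpret finite_measure leb by (rule finite_leb)
  obtain C where C: "\<And>x. \<bar>\<phi> x\<bar> \<le> C" using test_functions_bounded[OF \<phi>] by blast
  have one: "(\<lambda>x. 1) \<in> L2 \<Omega>" by (rule L2I) auto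
  from L2_bounded_mult[OF one test_functions_measurable[OF \<phi>] C] show "\<phi> \<in> L2 \<Omega>" by simp
qed

text \<open>Riesz-Fischer. A subsequence with increments below (1/2)^k converges almost everywhere,
  because Cauchy-Schwarz against the constant 1 makes the increments summable in L^1 on a bounded
  domain. Fatou's lemma then gives convergence of the full sequence in L^2.\<close>

theorem L2_complete:
  assumes X: "\<And>n. X n \<in> L2 \<Omega>"
    and cauchy: "\<And>e. 0 < e \<Longrightarrow> \<exists>N. \<forall>m\<ge>N. \<forall>n\<ge>N. L2_norm \<Omega> (X m - X n) < e"
  obtains g where "g \<in> L2 \<Omega>" "(\<lambda>n. L2_norm \<Omega> (X n - g)) \<longlonglongrightarrow> 0"
proof -
  interpret finite_measure leb by (rule finite_leb)
  have one: "(\<lambda>x. 1) \<in> L2 \<Omega>" by (rule L2I) auto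
  have "\<exists>N. \<forall>k. \<forall>m\<ge>N k. \<forall>n\<ge>N k. L2_norm \<Omega> (X m - X n) < (1/2) ^ k"
    by (rule choice, rule allI, rule cauchy) simp
  then obtain N where N: "\<And>k m n. m \<ge> N k \<Longrightarrow> n \<ge> N k \<Longrightarrow> L2_norm \<Omega> (X m - X n) < (1/2) ^ k" by blast
  \<comment> \<open>Partial sums exceed all the thresholds \<open>N j\<close> with j \<le> k at
    once.\<close>
  define r where "r k = (\<Sum>j\<le>k. N j)" for k
  have r_ge: "N j \<le> r k" if "j \<le> k" for j k
    unfolding r_def using that by (intro member_le_sum) auto
  define Y where "Y k = X (r k)" for k
  define d where "d k x = \<bar>Y (Suc k) x - Y k x\<bar>" for k x
  have YL: "Y k \<in> L2 \<Omega>" for k by (simp add: Y_def X)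
  have d_L2: "d k \<in> L2 \<Omega>" for k
  proof (rule L2I)
    have D: "Y (Suc k) - Y k \<in> L2 \<Omega>" using L2_diff[OF YL YL] .
    show "d k \<in> borel_measurable leb"
      using L2_measurable[OF D] unfolding d_def by (simp add: fun_diff_def)
    show "integrable leb (\<lambda>x. (d k x)\<^sup>2)" using L2_sq_integrable[OF D] by (simp add: d_def)
  qed
  have d_meas: "d k \<in> borel_measurable leb" for k by (rule L2_measurable[OF d_L2])
  have d_int: "integrable leb (d k)" for k using L2_mult_integrable[OF d_L2 one] by simp
  have d_bound: "(LINT x|leb. d k x) \<le> L2_norm \<Omega> (\<lambda>x. 1) * (1/2) ^ k" for k
  proof -
    have "(LINT x|leb. d k x) = L2_inner \<Omega> (d k) (\<lambda>x. 1)" by (simp add: L2_inner_def)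
    also have "\<dots> \<le> L2_norm \<Omega> (d k) * L2_norm \<Omega> (\<lambda>x. 1)"
      using L2_cauchy_schwarz[OF d_L2 one, of k] by linarith
    also have "L2_norm \<Omega> (d k) = L2_norm \<Omega> (Y (Suc k) - Y k)"
      by (simp add: L2_norm_def L2_inner_def d_def)
    also have "\<dots> * L2_norm \<Omega> (\<lambda>x. 1) \<le> (1/2) ^ k * L2_norm \<Omega> (\<lambda>x. 1)"
      using N[of k "r (Suc k)" "r k"] r_ge by (intro mult_right_mono) (simp_all add: Y_def less_imp_le)
    finally show ?thesis by (simp add: mult.commute)
  qed
  have "(\<integral>\<^sup>+x. (\<Sum>k. ennreal (d k x)) \<partial>leb) = (\<Sum>k. \<integral>\<^sup>+x. ennreal (d k x) \<partial>leb)"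
    using d_meas by (intro nn_integral_suminf) auto
  also have "\<dots> = (\<Sum>k. ennreal (LINT x|leb. d k x))"
    by (intro suminf_cong nn_integral_eq_integral d_int) (simp add: d_def)
  also have "\<dots> \<le> (\<Sum>k. ennreal (L2_norm \<Omega> (\<lambda>x. 1) * (1/2) ^ k))"
    by (intro suminf_le ennreal_leI d_bound) auto
  also have "\<dots> = ennreal (\<Sum>k. L2_norm \<Omega> (\<lambda>x. 1) * (1/2) ^ k)"
    by (intro suminf_ennreal2) (auto intro: summable_mult)
  also have "\<dots> < \<infinity>" by simp
  finally have fin: "(\<integral>\<^sup>+x. (\<Sum>k. ennreal (d k x)) \<partial>leb) \<noteq> \<infinity>" by simp
  have "AE x in leb. (\<Sum>k. ennreal (d k x)) \<noteq> \<infinity>"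
    using d_meas by (intro nn_integral_PInf_AE[OF _ fin]) auto
  then have conv: "AE x in leb. convergent (\<lambda>k. Y k x)"
  proof eventually_elim
    case (elim x)
    have "summable (\<lambda>k. d k x)"
      using elim by (intro summable_suminf_not_top) (auto simp: d_def top_ennreal_def infinity_ennreal_def)
    then have "summable (\<lambda>k. Y (Suc k) x - Y k x)"
      unfolding d_def by (rule summable_rabs_cancel)
    then have "convergent (\<lambda>n. \<Sum>k<n. Y (Suc k) x - Y k x)"
      by (simp add: summable_iff_convergent)
    then have "convergent (\<lambda>n. Y n x - Y 0 x)"
      unfolding sum_lessThan_telescope[of "\<lambda>k. Y k x"] .
    then have "convergent (\<lambda>n. (Y n x - Y 0 x) + Y 0 x)"
      by (intro convergent_add convergent_const)
    then show ?case by simp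
  qed
  \<comment> \<open>On the exceptional null set \<open>lim\<close> takes an unspecified value, which
    does not affect measurability or the norms.\<close>
  define g where "g x = lim (\<lambda>k. Y k x)" for x
  have g_meas: "g \<in> borel_measurable leb"
    unfolding g_def using L2_measurable[OF YL] by (intro borel_measurable_lim_metric)
  have lim: "AE x in leb. (\<lambda>k. Y k x) \<longlonglongrightarrow> g x"
    using conv by eventually_elim (simp add: g_def convergent_LIMSEQ_iff)
  have fatou: "integrable leb (\<lambda>x. ((X n - g) x)\<^sup>2) \<and> L2_norm \<Omega> (X n - g) \<le> (1/2) ^ j" if n: "n \<ge> N j" for n j
  proof -
    have XY: "X n - Y k \<in> L2 \<Omega>" for k using L2_diff[OF X YL] .
    have Xg_meas: "X n - g \<in> borel_measurable leb"
      unfolding fun_diff_def using L2_measurable[OF X] g_meas by (intro borel_measurable_diff)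
    have "(\<integral>\<^sup>+x. ennreal (((X n - g) x)\<^sup>2) \<partial>leb) = (\<integral>\<^sup>+x. liminf (\<lambda>k. ennreal (((X n - Y k) x)\<^sup>2)) \<partial>leb)"
    proof (rule nn_integral_cong_AE)
      show "AE x in leb. ennreal (((X n - g) x)\<^sup>2) = liminf (\<lambda>k. ennreal (((X n - Y k) x)\<^sup>2))"
        using lim
      proof eventually_elim
        case (elim x)
        have "(\<lambda>k. ennreal ((X n x - Y k x)\<^sup>2)) \<longlonglongrightarrow> ennreal ((X n x - g x)\<^sup>2)"
          by (intro tendsto_intros elim)
        from lim_imp_Liminf[OF _ this] show ?case by simp
      qed
    qed
    also have "\<dots> \<le> liminf (\<lambda>k. \<integral>\<^sup>+x. ennreal (((X n - Y k) x)\<^sup>2) \<partial>leb)"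
    proof (rule nn_integral_liminf)
      show "(\<lambda>x. ennreal (((X n - Y k) x)\<^sup>2)) \<in> borel_measurable leb" for k
        using L2_measurable[OF XY] by (intro measurable_compose[OF _ measurable_ennreal] borel_measurable_power)
    qed
    also have "\<dots> \<le> ennreal (((1/2) ^ j)\<^sup>2)"
    proof (rule Liminf_le)
      show "\<forall>\<^sub>F k in sequentially. (\<integral>\<^sup>+x. ennreal (((X n - Y k) x)\<^sup>2) \<partial>leb) \<le> ennreal (((1/2) ^ j)\<^sup>2)"
        using eventually_ge_at_top[of j]
      proof eventually_elim
        case (elim k)
        have "(\<integral>\<^sup>+x. ennreal (((X n - Y k) x)\<^sup>2) \<partial>leb) = ennreal (LINT x|leb. ((X n - Y k) x)\<^sup>2)"
          by (intro nn_integral_eq_integral L2_sq_integrable XY) simp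
        also have "(LINT x|leb. ((X n - Y k) x)\<^sup>2) = (L2_norm \<Omega> (X n - Y k))\<^sup>2"
          unfolding L2_norm_sq L2_inner_def by (simp add: power2_eq_square)
        also have "ennreal \<dots> \<le> ennreal (((1/2) ^ j)\<^sup>2)"
          using N[OF n, of "r k"] r_ge[OF elim] by (intro ennreal_leI power_mono) (simp_all add: Y_def less_imp_le)
        finally show ?case .
      qed
    qed simp
    finally have le: "(\<integral>\<^sup>+x. ennreal (((X n - g) x)\<^sup>2) \<partial>leb) \<le> ennreal (((1/2) ^ j)\<^sup>2)" .
    have int: "integrable leb (\<lambda>x. ((X n - g) x)\<^sup>2)"
    proof (rule integrableI_bounded)
      show "(\<lambda>x. ((X n - g) x)\<^sup>2) \<in> borel_measurable leb" using Xg_meas by (rule borel_measurable_power)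
      have "ennreal (((1/2) ^ j)\<^sup>2) < \<infinity>" by simp
      with le have "(\<integral>\<^sup>+x. ennreal (((X n - g) x)\<^sup>2) \<partial>leb) < \<infinity>" by (rule order.strict_trans1)
      then show "(\<integral>\<^sup>+x. ennreal (norm (((X n - g) x)\<^sup>2)) \<partial>leb) < \<infinity>" by simp
    qed
    have "ennreal (LINT x|leb. ((X n - g) x)\<^sup>2) \<le> ennreal (((1/2) ^ j)\<^sup>2)"
      using le nn_integral_eq_integral[OF int] by simp
    then have "(L2_norm \<Omega> (X n - g))\<^sup>2 \<le> ((1/2) ^ j)\<^sup>2"
      unfolding L2_norm_sq L2_inner_def by (simp add: power2_eq_square)
    then have "L2_norm \<Omega> (X n - g) \<le> (1/2) ^ j" by (rule power2_le_imp_le) simp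
    with int show ?thesis by blast
  qed
  have "X (N 0) - g \<in> L2 \<Omega>"
  proof (rule L2I)
    show "X (N 0) - g \<in> borel_measurable leb"
      unfolding fun_diff_def using L2_measurable[OF X] g_meas by (intro borel_measurable_diff)
  qed (use fatou[of 0 "N 0"] in blast)
  then have "X (N 0) - (X (N 0) - g) \<in> L2 \<Omega>" by (rule L2_diff[OF X])
  moreover have "X (N 0) - (X (N 0) - g) = g" by (rule ext) simp
  ultimately have gL: "g \<in> L2 \<Omega>" by (simp only:)
  have "(\<lambda>n. L2_norm \<Omega> (X n - g)) \<longlonglongrightarrow> 0"
  proof (rule LIMSEQ_I)
    fix e :: real assume "0 < e"
    then obtain j where j: "(1/2 :: real) ^ j < e" using real_arch_pow_inv[of e "1/2"] by auto
    show "\<exists>no. \<forall>n\<ge>no. norm (L2_norm \<Omega> (X n - g) - 0) < e"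
      using fatou[of j] j by (intro exI[of _ "N j"]) force
  qed
  with gL show ?thesis by (rule that)
qed

end

section \<open>Sobolev spaces\<close>

declare One_nat_def [simp del]

lemma finite_multi_indices: "finite (multi_indices s :: 'a::euclidean_space multiset set)"
proof (rule finite_subset)
  show "multi_indices s \<subseteq> mset ` {xs :: 'a list. set xs \<subseteq> Basis \<and> length xs \<le> s}"
  proof
    fix \<alpha> :: "'a multiset" assume \<alpha>: "\<alpha> \<in> multi_indices s"
    obtain xs where "mset xs = \<alpha>" using ex_mset by blast
    with \<alpha> show "\<alpha> \<in> mset ` {xs. set xs \<subseteq> Basis \<and> length xs \<le> s}"
      by (auto simp: multi_indices_def intro!: image_eqI[of _ _ xs])
  qed
qed (simp add: finite_lists_length_le)

lemma multi_indices_mono: "s \<le> s' \<Longrightarrow> multi_indices s \<subseteq> multi_indices s'"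
  by (auto simp: multi_indices_def)

lemma multi_indices_0: "multi_indices 0 = {{#}}"
  by (auto simp: multi_indices_def)

lemma multi_indices_1:
  "multi_indices 1 = insert {#} ((\<lambda>e. {#e#}) ` (Basis :: 'a::euclidean_space set))"
proof (rule set_eqI)
  fix \<alpha> :: "'a multiset"
  show "\<alpha> \<in> multi_indices 1 \<longleftrightarrow> \<alpha> \<in> insert {#} ((\<lambda>e. {#e#}) ` Basis)"
  proof (cases "size \<alpha> = 1")
    case True
    then obtain e where "\<alpha> = {#e#}" using size_1_singleton_mset by auto
    then show ?thesis by (auto simp: multi_indices_def)
  next
    case False
    then have "size \<alpha> \<le> 1 \<longleftrightarrow> \<alpha> = {#}" by (cases "size \<alpha>") auto
    then show ?thesis using False by (auto simp: multi_indices_def)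
  qed
qed

context domain
begin

lemma iter_partial_test_L2: "\<phi> \<in> test_functions \<Omega> \<Longrightarrow> set vs \<subseteq> Basis \<Longrightarrow> iter_partial vs \<phi> \<in> L2 \<Omega>"
  by (intro test_functions_L2 test_functions_iter_partial)

lemma has_weak_partial_iff:
  "f \<in> L2 \<Omega> \<Longrightarrow> g \<in> L2 \<Omega> \<Longrightarrow> has_weak_partial \<Omega> \<alpha> f g \<longleftrightarrow>
    (\<forall>\<phi>\<in>test_functions \<Omega>. \<forall>vs. mset vs = \<alpha> \<longrightarrow>
      L2_inner \<Omega> f (iter_partial vs \<phi>) = (-1) ^ size \<alpha> * L2_inner \<Omega> g \<phi>)"
  by (simp add: has_weak_partial_def L2_locally_integrable L2_inner_def)

lemma set_in_Basis: "\<alpha> \<in> multi_indices s \<Longrightarrow> mset vs = \<alpha> \<Longrightarrow> set vs \<subseteq> Basis"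
  by (auto simp: multi_indices_def)

text \<open>Two candidates have equal pairings with all test functions, so the fundamental lemma
  applies to their difference. This is why the arbitrarily chosen \<open>weak_partial\<close> is
  linear up to null sets.\<close>

lemma weak_partial_unique:
  assumes f: "f \<in> L2 \<Omega>" and g: "g \<in> L2 \<Omega>" "has_weak_partial \<Omega> \<alpha> f g"
    and h: "h \<in> L2 \<Omega>" "has_weak_partial \<Omega> \<alpha> f h"
  shows "AE x in leb. g x = h x"
proof -
  have d: "g - h \<in> L2 \<Omega>" using g h by (intro L2_diff)
  have "AE x in leb. (g - h) x = 0"
  proof (rule fundamental_lemma[OF open_\<Omega> L2_locally_integrable[OF d]])
    fix \<phi> assume \<phi>: "\<phi> \<in> test_functions \<Omega>"
    obtain vs where vs: "mset vs = \<alpha>" using ex_mset by blast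
    have "(-1) ^ size \<alpha> * L2_inner \<Omega> g \<phi> = (-1) ^ size \<alpha> * L2_inner \<Omega> h \<phi>"
      using g h \<phi> vs by (metis f has_weak_partial_iff)
    then have "L2_inner \<Omega> g \<phi> = L2_inner \<Omega> h \<phi>" by simp
    then have "L2_inner \<Omega> (g - h) \<phi> = 0" using g h test_functions_L2[OF \<phi>] by (simp only: L2_inner_diff)
    then show "(LINT x|leb. (g - h) x * \<phi> x) = 0" by (simp only: L2_inner_def)
  qed
  then show ?thesis by simp
qed

lemma sobolev_L2: "f \<in> sobolev \<Omega> s \<Longrightarrow> f \<in> L2 \<Omega>"
  by (simp add: sobolev_def)

lemma
  assumes "f \<in> sobolev \<Omega> s" "\<alpha> \<in> multi_indices s"
  shows weak_partial_L2: "weak_partial \<Omega> \<alpha> f \<in> L2 \<Omega>"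
    and has_weak_partial_weak_partial: "has_weak_partial \<Omega> \<alpha> f (weak_partial \<Omega> \<alpha> f)"
proof -
  have "\<exists>g. g \<in> L2 \<Omega> \<and> has_weak_partial \<Omega> \<alpha> f g" using assms by (auto simp: sobolev_def)
  then have "weak_partial \<Omega> \<alpha> f \<in> L2 \<Omega> \<and> has_weak_partial \<Omega> \<alpha> f (weak_partial \<Omega> \<alpha> f)"
    unfolding weak_partial_def by (rule someI_ex)
  then show "weak_partial \<Omega> \<alpha> f \<in> L2 \<Omega>" "has_weak_partial \<Omega> \<alpha> f (weak_partial \<Omega> \<alpha> f)" by auto
qed

lemma weak_partial_eq_AE:
  assumes f: "f \<in> L2 \<Omega>" and g: "g \<in> L2 \<Omega>" "has_weak_partial \<Omega> \<alpha> f g"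
  shows "weak_partial \<Omega> \<alpha> f \<in> L2 \<Omega>" "AE x in leb. weak_partial \<Omega> \<alpha> f x = g x"
proof -
  have "\<exists>g. g \<in> L2 \<Omega> \<and> has_weak_partial \<Omega> \<alpha> f g" using g by blast
  then have *: "weak_partial \<Omega> \<alpha> f \<in> L2 \<Omega> \<and> has_weak_partial \<Omega> \<alpha> f (weak_partial \<Omega> \<alpha> f)"
    unfolding weak_partial_def by (rule someI_ex)
  then show "weak_partial \<Omega> \<alpha> f \<in> L2 \<Omega>" by blast
  from weak_partial_unique[OF f _ _ g] * show "AE x in leb. weak_partial \<Omega> \<alpha> f x = g x" by blast
qed

lemma sobolev_weak_partial_inner:
  assumes "f \<in> sobolev \<Omega> s" "set vs \<subseteq> Basis" "length vs \<le> s" "\<phi> \<in> test_functions \<Omega>"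
  shows "L2_inner \<Omega> f (iter_partial vs \<phi>) = (-1) ^ length vs * L2_inner \<Omega> (weak_partial \<Omega> (mset vs) f) \<phi>"
proof -
  have \<alpha>: "mset vs \<in> multi_indices s" using assms by (simp add: multi_indices_def)
  show ?thesis
    using has_weak_partial_weak_partial[OF assms(1) \<alpha>] has_weak_partial_iff[OF sobolev_L2 weak_partial_L2]
      assms \<alpha> by (metis size_mset)
qed

lemma has_weak_partial_add:
  assumes "\<alpha> \<in> multi_indices s" "f \<in> L2 \<Omega>" "g \<in> L2 \<Omega>" "f' \<in> L2 \<Omega>" "g' \<in> L2 \<Omega>"
    "has_weak_partial \<Omega> \<alpha> f f'" "has_weak_partial \<Omega> \<alpha> g g'"
  shows "has_weak_partial \<Omega> \<alpha> (f + g) (f' + g')"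
proof -
  have 1: "f + g \<in> L2 \<Omega>" "f' + g' \<in> L2 \<Omega>" using assms by (auto intro: subspace_add[OF subspace_L2])
  show ?thesis
    unfolding has_weak_partial_iff[OF 1]
  proof (intro ballI allI impI)
    fix \<phi> and vs :: "'a list" assume \<phi>: "\<phi> \<in> test_functions \<Omega>" and vs: "mset vs = \<alpha>"
    have \<phi>2: "\<phi> \<in> L2 \<Omega>" "iter_partial vs \<phi> \<in> L2 \<Omega>"
      using test_functions_L2[OF \<phi>] iter_partial_test_L2[OF \<phi> set_in_Basis[OF assms(1) vs]] by auto
    have "L2_inner \<Omega> f (iter_partial vs \<phi>) = (-1) ^ size \<alpha> * L2_inner \<Omega> f' \<phi>"
      "L2_inner \<Omega> g (iter_partial vs \<phi>) = (-1) ^ size \<alpha> * L2_inner \<Omega> g' \<phi>"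
      using assms \<phi> vs by (auto simp: has_weak_partial_iff)
    then show "L2_inner \<Omega> (f + g) (iter_partial vs \<phi>) = (-1) ^ size \<alpha> * L2_inner \<Omega> (f' + g') \<phi>"
      using assms \<phi>2 by (simp only: L2_inner_add distrib_left)
  qed
qed

lemma has_weak_partial_scaleR:
  assumes "f \<in> L2 \<Omega>" "f' \<in> L2 \<Omega>" "has_weak_partial \<Omega> \<alpha> f f'"
  shows "has_weak_partial \<Omega> \<alpha> (c *\<^sub>R f) (c *\<^sub>R f')"
proof -
  have 1: "c *\<^sub>R f \<in> L2 \<Omega>" "c *\<^sub>R f' \<in> L2 \<Omega>" using assms by (auto intro: subspace_scale[OF subspace_L2])
  show ?thesis
    using assms unfolding has_weak_partial_iff[OF 1] has_weak_partial_iff[OF assms(1,2)]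
    by (simp only: L2_inner_scaleR) (simp add: mult.left_commute)
qed

lemma has_weak_partial_cong:
  assumes "\<alpha> \<in> multi_indices s" "f \<in> L2 \<Omega>" "f' \<in> L2 \<Omega>" "AE x in leb. f x = f' x"
    "g \<in> L2 \<Omega>" "has_weak_partial \<Omega> \<alpha> f g"
  shows "has_weak_partial \<Omega> \<alpha> f' g"
  unfolding has_weak_partial_iff[OF assms(3,5)]
proof (intro ballI allI impI)
  fix \<phi> and vs :: "'a list" assume \<phi>: "\<phi> \<in> test_functions \<Omega>" and vs: "mset vs = \<alpha>"
  have "L2_inner \<Omega> f (iter_partial vs \<phi>) = (-1) ^ size \<alpha> * L2_inner \<Omega> g \<phi>"
    using assms \<phi> vs by (auto simp: has_weak_partial_iff)
  moreover have "L2_inner \<Omega> f' (iter_partial vs \<phi>) = L2_inner \<Omega> f (iter_partial vs \<phi>)"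
    using assms iter_partial_test_L2[OF \<phi> set_in_Basis[OF assms(1) vs]]
    by (intro L2_inner_cong_AE) auto
  ultimately show "L2_inner \<Omega> f' (iter_partial vs \<phi>) = (-1) ^ size \<alpha> * L2_inner \<Omega> g \<phi>" by simp
qed

lemma subspace_sobolev: "subspace (sobolev \<Omega> s)"
proof (rule subspaceI)
  show "0 \<in> sobolev \<Omega> s"
    unfolding sobolev_def using subspace_0[OF subspace_L2]
    by (auto intro!: bexI[of _ 0] simp: has_weak_partial_iff) (simp add: L2_inner_def)
  fix f assume f: "f \<in> sobolev \<Omega> s"
  show "c *\<^sub>R f \<in> sobolev \<Omega> s" for c
    unfolding sobolev_def
    using f has_weak_partial_scaleR[OF sobolev_L2[OF f] weak_partial_L2[OF f] has_weak_partial_weak_partial[OF f]]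
      subspace_scale[OF subspace_L2 weak_partial_L2[OF f]] subspace_scale[OF subspace_L2 sobolev_L2[OF f]]
    by blast
  fix g assume g: "g \<in> sobolev \<Omega> s"
  show "f + g \<in> sobolev \<Omega> s"
    unfolding sobolev_def
  proof (intro CollectI conjI ballI)
    show "f + g \<in> L2 \<Omega>" using f g by (intro subspace_add[OF subspace_L2] sobolev_L2)
    fix \<alpha> :: "'a multiset" assume \<alpha>: "\<alpha> \<in> multi_indices s"
    show "\<exists>h\<in>L2 \<Omega>. has_weak_partial \<Omega> \<alpha> (f + g) h"
    proof
      show "has_weak_partial \<Omega> \<alpha> (f + g) (weak_partial \<Omega> \<alpha> f + weak_partial \<Omega> \<alpha> g)"
        using f g \<alpha> by (intro has_weak_partial_add sobolev_L2 weak_partial_L2 has_weak_partial_weak_partial)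
      show "weak_partial \<Omega> \<alpha> f + weak_partial \<Omega> \<alpha> g \<in> L2 \<Omega>"
        using f g \<alpha> by (intro subspace_add[OF subspace_L2] weak_partial_L2)
    qed
  qed
qed

lemma weak_partial_add:
  assumes "f \<in> sobolev \<Omega> s" "g \<in> sobolev \<Omega> s" "\<alpha> \<in> multi_indices s"
  shows "AE x in leb. weak_partial \<Omega> \<alpha> (f + g) x = (weak_partial \<Omega> \<alpha> f + weak_partial \<Omega> \<alpha> g) x"
proof (rule weak_partial_eq_AE(2))
  show "f + g \<in> L2 \<Omega>" using assms by (intro subspace_add[OF subspace_L2] sobolev_L2)
  show "weak_partial \<Omega> \<alpha> f + weak_partial \<Omega> \<alpha> g \<in> L2 \<Omega>"
    using assms by (intro subspace_add[OF subspace_L2] weak_partial_L2)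
  show "has_weak_partial \<Omega> \<alpha> (f + g) (weak_partial \<Omega> \<alpha> f + weak_partial \<Omega> \<alpha> g)"
    using assms by (intro has_weak_partial_add sobolev_L2 weak_partial_L2 has_weak_partial_weak_partial)
qed

lemma weak_partial_scaleR:
  assumes "f \<in> sobolev \<Omega> s" "\<alpha> \<in> multi_indices s"
  shows "AE x in leb. weak_partial \<Omega> \<alpha> (c *\<^sub>R f) x = (c *\<^sub>R weak_partial \<Omega> \<alpha> f) x"
proof (rule weak_partial_eq_AE(2))
  show "c *\<^sub>R f \<in> L2 \<Omega>" "c *\<^sub>R weak_partial \<Omega> \<alpha> f \<in> L2 \<Omega>"
    using assms by (auto intro: subspace_scale[OF subspace_L2] sobolev_L2 weak_partial_L2)
  show "has_weak_partial \<Omega> \<alpha> (c *\<^sub>R f) (c *\<^sub>R weak_partial \<Omega> \<alpha> f)"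
    using assms by (intro has_weak_partial_scaleR sobolev_L2 weak_partial_L2 has_weak_partial_weak_partial)
qed

section \<open>The Sobolev inner product\<close>

definition inner_H :: "nat \<Rightarrow> ('a \<Rightarrow> real) \<Rightarrow> ('a \<Rightarrow> real) \<Rightarrow> real" where
  "inner_H s f g = (\<Sum>\<alpha>\<in>multi_indices s. L2_inner \<Omega> (weak_partial \<Omega> \<alpha> f) (weak_partial \<Omega> \<alpha> g))"

definition ipH :: "nat \<Rightarrow> ('a \<Rightarrow> real) \<Rightarrow> ('a \<Rightarrow> real) \<Rightarrow> real" where
  "ipH s = extend_form (sobolev \<Omega> s) (inner_H s)"

lemma semi_inner_ipH: "semi_inner (ipH s)"
  unfolding ipH_def
proof (rule semi_inner_extend_form[OF subspace_sobolev])
  fix f g h assume fgh: "f \<in> sobolev \<Omega> s" "g \<in> sobolev \<Omega> s" "h \<in> sobolev \<Omega> s"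
  have "L2_inner \<Omega> (weak_partial \<Omega> \<alpha> (f + g)) (weak_partial \<Omega> \<alpha> h) =
      L2_inner \<Omega> (weak_partial \<Omega> \<alpha> f) (weak_partial \<Omega> \<alpha> h) + L2_inner \<Omega> (weak_partial \<Omega> \<alpha> g) (weak_partial \<Omega> \<alpha> h)"
    if \<alpha>: "\<alpha> \<in> multi_indices s" for \<alpha>
  proof -
    have "L2_inner \<Omega> (weak_partial \<Omega> \<alpha> (f + g)) (weak_partial \<Omega> \<alpha> h) =
        L2_inner \<Omega> (weak_partial \<Omega> \<alpha> f + weak_partial \<Omega> \<alpha> g) (weak_partial \<Omega> \<alpha> h)"
      using fgh \<alpha> subspace_add[OF subspace_sobolev, of f s g]
      by (intro L2_inner_cong_AE weak_partial_add subspace_add[OF subspace_L2] weak_partial_L2) auto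
    also have "\<dots> = L2_inner \<Omega> (weak_partial \<Omega> \<alpha> f) (weak_partial \<Omega> \<alpha> h) + L2_inner \<Omega> (weak_partial \<Omega> \<alpha> g) (weak_partial \<Omega> \<alpha> h)"
      using fgh \<alpha> by (intro L2_inner_add weak_partial_L2)
    finally show ?thesis .
  qed
  then show "inner_H s (f + g) h = inner_H s f h + inner_H s g h"
    unfolding inner_H_def by (simp add: sum.distrib)
next
  fix c and f h assume fh: "f \<in> sobolev \<Omega> s" "h \<in> sobolev \<Omega> s"
  have "L2_inner \<Omega> (weak_partial \<Omega> \<alpha> (c *\<^sub>R f)) (weak_partial \<Omega> \<alpha> h) =
      c * L2_inner \<Omega> (weak_partial \<Omega> \<alpha> f) (weak_partial \<Omega> \<alpha> h)" if \<alpha>: "\<alpha> \<in> multi_indices s" for \<alpha>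
  proof -
    have "L2_inner \<Omega> (weak_partial \<Omega> \<alpha> (c *\<^sub>R f)) (weak_partial \<Omega> \<alpha> h) =
        L2_inner \<Omega> (c *\<^sub>R weak_partial \<Omega> \<alpha> f) (weak_partial \<Omega> \<alpha> h)"
      using fh \<alpha> subspace_scale[OF subspace_sobolev, of f s c]
      by (intro L2_inner_cong_AE weak_partial_scaleR subspace_scale[OF subspace_L2] weak_partial_L2) auto
    then show ?thesis by (simp only: L2_inner_scaleR)
  qed
  then show "inner_H s (c *\<^sub>R f) h = c * inner_H s f h"
    unfolding inner_H_def by (simp add: sum_distrib_left)
next
  show "inner_H s f g = inner_H s g f" for f g
    unfolding inner_H_def by (intro sum.cong refl L2_inner_sym)
  show "0 \<le> inner_H s f f" for f
    unfolding inner_H_def by (intro sum_nonneg L2_inner_nonneg)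
qed

lemma ipH_eq: "f \<in> sobolev \<Omega> s \<Longrightarrow> g \<in> sobolev \<Omega> s \<Longrightarrow> ipH s f g = inner_H s f g"
  by (simp add: ipH_def extend_form_eq subspace_sobolev)

lemma nrmH_eq: "f \<in> sobolev \<Omega> s \<Longrightarrow> semi_inner.nrm (ipH s) f = sobolev_norm \<Omega> s f"
  by (simp add: semi_inner.nrm_def[OF semi_inner_ipH] ipH_eq inner_H_def sobolev_norm_def L2_norm_sq)

lemma sobolev_norm_nonneg [simp]: "0 \<le> sobolev_norm \<Omega> s f"
  by (simp add: sobolev_norm_def sum_nonneg)

sublocale H1: semi_inner "ipH 1"
  by (rule semi_inner_ipH)

lemma H1_nrm_eq: "f \<in> sobolev \<Omega> 1 \<Longrightarrow> H1.nrm f = sobolev_norm \<Omega> 1 f"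
  by (rule nrmH_eq)

lemma sobolev_mono: "s \<le> s' \<Longrightarrow> f \<in> sobolev \<Omega> s' \<Longrightarrow> f \<in> sobolev \<Omega> s"
  using multi_indices_mono[of s s'] unfolding sobolev_def by blast

lemma sobolev_norm_mono: "s \<le> s' \<Longrightarrow> sobolev_norm \<Omega> s f \<le> sobolev_norm \<Omega> s' f"
  unfolding sobolev_norm_def
  by (intro real_sqrt_le_mono sum_mono2 multi_indices_mono finite_multi_indices) auto

lemma L2_norm_cong_AE:
  "f \<in> L2 \<Omega> \<Longrightarrow> g \<in> L2 \<Omega> \<Longrightarrow> AE x in leb. f x = g x \<Longrightarrow> L2_norm \<Omega> f = L2_norm \<Omega> g"
  unfolding L2_norm_def by (simp add: L2_inner_cong_AE[of f g f g])

lemma has_weak_partial_empty: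
  assumes "f \<in> L2 \<Omega>"
  shows "has_weak_partial \<Omega> {#} f f"
  unfolding has_weak_partial_iff[OF assms assms] by simp

lemma weak_partial_empty: "f \<in> L2 \<Omega> \<Longrightarrow> AE x in leb. weak_partial \<Omega> {#} f x = f x"
  by (rule weak_partial_eq_AE(2)[OF _ _ has_weak_partial_empty])

lemma L2_norm_weak_partial_empty: "f \<in> L2 \<Omega> \<Longrightarrow> L2_norm \<Omega> (weak_partial \<Omega> {#} f) = L2_norm \<Omega> f"
  by (rule L2_norm_cong_AE[OF weak_partial_eq_AE(1) _ weak_partial_empty])
    (auto intro: has_weak_partial_empty)

lemma sobolev_0: "sobolev \<Omega> 0 = L2 \<Omega>"
  using has_weak_partial_empty by (auto simp: sobolev_def multi_indices_0)

lemma sobolev_norm_0: "f \<in> L2 \<Omega> \<Longrightarrow> sobolev_norm \<Omega> 0 f = L2_norm \<Omega> f"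
  by (simp add: sobolev_norm_def multi_indices_0 L2_norm_weak_partial_empty)

lemma L2_norm_le_sobolev_norm: "f \<in> L2 \<Omega> \<Longrightarrow> L2_norm \<Omega> f \<le> sobolev_norm \<Omega> s f"
  using sobolev_norm_mono[of 0 s f] by (simp add: sobolev_norm_0)

lemma L2_norm_weak_partial_le:
  assumes "\<alpha> \<in> multi_indices s"
  shows "L2_norm \<Omega> (weak_partial \<Omega> \<alpha> f) \<le> sobolev_norm \<Omega> s f"
proof -
  have "(L2_norm \<Omega> (weak_partial \<Omega> \<alpha> f))\<^sup>2 \<le> (\<Sum>\<alpha>\<in>multi_indices s. (L2_norm \<Omega> (weak_partial \<Omega> \<alpha> f))\<^sup>2)"
    using assms by (intro member_le_sum finite_multi_indices) auto
  then show ?thesis unfolding sobolev_norm_def by (rule real_le_rsqrt)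
qed

lemma
  assumes f: "f \<in> sobolev \<Omega> s" and g: "g \<in> L2 \<Omega>" and eq: "AE x in leb. f x = g x"
  shows sobolev_cong_AE: "g \<in> sobolev \<Omega> s"
    and sobolev_norm_cong_AE: "sobolev_norm \<Omega> s f = sobolev_norm \<Omega> s g"
proof -
  have wp: "has_weak_partial \<Omega> \<alpha> g (weak_partial \<Omega> \<alpha> f)" if "\<alpha> \<in> multi_indices s" for \<alpha>
    using that f g eq
    by (intro has_weak_partial_cong[OF that sobolev_L2[OF f] g eq] weak_partial_L2 has_weak_partial_weak_partial)
  show "g \<in> sobolev \<Omega> s"
    unfolding sobolev_def using g wp weak_partial_L2[OF f] by blast
  have "L2_norm \<Omega> (weak_partial \<Omega> \<alpha> f) = L2_norm \<Omega> (weak_partial \<Omega> \<alpha> g)" if \<alpha>: "\<alpha> \<in> multi_indices s" for \<alpha>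
    using weak_partial_eq_AE[OF g weak_partial_L2[OF f \<alpha>] wp[OF \<alpha>]] weak_partial_L2[OF f \<alpha>]
    by (intro L2_norm_cong_AE[symmetric]) auto
  then show "sobolev_norm \<Omega> s f = sobolev_norm \<Omega> s g" by (simp add: sobolev_norm_def)
qed

text \<open>Integration by parts turns the classical first partial derivative into the weak one.
  Order one suffices, since test functions are measured in Sobolev norms only in
  \<open>H1_0\<close>.\<close>

lemma test_functions_sobolev: "\<phi> \<in> test_functions \<Omega> \<Longrightarrow> \<phi> \<in> sobolev \<Omega> 1"
proof -
  assume \<phi>: "\<phi> \<in> test_functions \<Omega>"
  have "\<exists>g\<in>L2 \<Omega>. has_weak_partial \<Omega> \<alpha> \<phi> g" if \<alpha>: "\<alpha> \<in> multi_indices 1" for \<alpha>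
  proof (cases "\<alpha> = {#}")
    case True
    then show ?thesis using has_weak_partial_empty test_functions_L2[OF \<phi>] by blast
  next
    case False
    then obtain e where e: "e \<in> Basis" "\<alpha> = {#e#}" using \<alpha> unfolding multi_indices_1 by auto
    have L: "iter_partial [e] \<phi> \<in> L2 \<Omega>" using e by (intro iter_partial_test_L2 \<phi>) auto
    have "has_weak_partial \<Omega> {#e#} \<phi> (iter_partial [e] \<phi>)"
      unfolding has_weak_partial_iff[OF test_functions_L2[OF \<phi>] L]
    proof (intro ballI allI impI)
      fix \<psi> and vs :: "'a list" assume \<psi>: "\<psi> \<in> test_functions \<Omega>" and "mset vs = {#e#}"
      then have "vs = [e]" by simp
      then show "L2_inner \<Omega> \<phi> (iter_partial vs \<psi>) = (-1) ^ size {#e#} * L2_inner \<Omega> (iter_partial [e] \<phi>) \<psi>"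
        using integration_by_parts_test[OF open_\<Omega> \<phi> \<psi> e(1)] by (simp add: L2_inner_def)
    qed
    then show ?thesis using L e(2) by blast
  qed
  then show "\<phi> \<in> sobolev \<Omega> 1" using test_functions_L2[OF \<phi>] by (simp add: sobolev_def)
qed

text \<open>The symmetry assumption replaces the equality of mixed partial derivatives of test functions.\<close>

lemma sobolev_of_bounded_functionals:
  assumes v: "v \<in> L2 \<Omega>" and K: "0 \<le> K"
    and bd: "\<And>vs \<phi>. set vs \<subseteq> Basis \<Longrightarrow> length vs \<le> s \<Longrightarrow> \<phi> \<in> test_functions \<Omega> \<Longrightarrow>
      \<bar>L2_inner \<Omega> v (iter_partial vs \<phi>)\<bar> \<le> K * L2_norm \<Omega> \<phi>"
    and sym: "\<And>vs ws \<phi>. set vs \<subseteq> Basis \<Longrightarrow> length vs \<le> s \<Longrightarrow> \<phi> \<in> test_functions \<Omega> \<Longrightarrow> mset vs = mset ws \<Longrightarrow>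
      L2_inner \<Omega> v (iter_partial vs \<phi>) = L2_inner \<Omega> v (iter_partial ws \<phi>)"
  shows "v \<in> sobolev \<Omega> s" "sobolev_norm \<Omega> s v \<le> sqrt (card (multi_indices s :: 'a multiset set)) * K"
proof -
  have ex: "\<exists>g\<in>L2 \<Omega>. has_weak_partial \<Omega> \<alpha> v g \<and> L2_norm \<Omega> g \<le> K" if \<alpha>: "\<alpha> \<in> multi_indices s" for \<alpha>
  proof -
    obtain vs where vs: "mset vs = \<alpha>" using ex_mset by blast
    have vs': "set vs \<subseteq> Basis" "length vs \<le> s" using \<alpha> vs by (auto simp: multi_indices_def)
    \<comment> \<open>With this sign a representer of \<open>l\<close> in L^2 is the weak derivative
      itself.\<close>
    define l where "l \<phi> = (-1) ^ size \<alpha> * L2_inner \<Omega> v (iter_partial vs \<phi>)" for \<phi>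
    let ?D = "test_functions \<Omega>"
    have D_L2: "\<And>\<phi>. \<phi> \<in> ?D \<Longrightarrow> iter_partial vs \<phi> \<in> L2 \<Omega>" using vs'(1) by (intro iter_partial_test_L2)
    have l_add: "l (\<phi> + \<psi>) = l \<phi> + l \<psi>" if "\<phi> \<in> ?D" "\<psi> \<in> ?D" for \<phi> \<psi>
      unfolding l_def iter_partial_add[OF test_functions_smooth[OF that(1)] test_functions_smooth[OF that(2)] vs'(1)]
        L2_inner_sym[of v] L2_inner_add[OF D_L2[OF that(1)] D_L2[OF that(2)] v] by (rule distrib_left)
    have l_scale: "l (c *\<^sub>R \<phi>) = c * l \<phi>" if "\<phi> \<in> ?D" for c \<phi>
      unfolding l_def iter_partial_scaleR[OF test_functions_smooth[OF that] vs'(1)]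
        L2_inner_sym[of v] L2_inner_scaleR by (rule mult.left_commute)
    have l_bd: "\<bar>l \<phi>\<bar> \<le> K * L2.nrm \<phi>" if "\<phi> \<in> ?D" for \<phi>
      using bd[OF vs' that] by (simp add: l_def abs_mult power_abs L2_nrm_eq[OF test_functions_L2[OF that]])
    \<comment> \<open>Test functions are not complete in the L^2 norm, so the representer is
      obtained as the limit of approximate ones.\<close>
    obtain X where X: "\<And>n. X n \<in> ?D"
      "\<And>e. 0 < e \<Longrightarrow> \<exists>N. \<forall>m\<ge>N. \<forall>n\<ge>N. L2.nrm (X m - X n) < e"
      "\<And>\<phi>. \<phi> \<in> ?D \<Longrightarrow> (\<lambda>n. ipL2 (X n) \<phi>) \<longlonglongrightarrow> l \<phi>"
      by (rule L2.riesz_approximation[OF subspace_test_functions l_add l_scale l_bd]) blast+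
    have XL: "X n \<in> L2 \<Omega>" for n by (rule test_functions_L2[OF X(1)])
    have cauchy: "\<exists>N. \<forall>m\<ge>N. \<forall>n\<ge>N. L2_norm \<Omega> (X m - X n) < e" if "0 < e" for e
      using X(2)[OF that] by (simp only: L2_nrm_eq[OF L2_diff[OF XL XL]])
    obtain g where g: "g \<in> L2 \<Omega>" "(\<lambda>n. L2_norm \<Omega> (X n - g)) \<longlonglongrightarrow> 0"
      by (rule L2_complete[OF XL cauchy])
    have g': "(\<lambda>n. L2.nrm (X n - g)) \<longlonglongrightarrow> 0"
      using g(2) by (simp only: L2_nrm_eq[OF L2_diff[OF XL g(1)]])
    have const: "(\<lambda>n. L2.nrm (x - x)) \<longlonglongrightarrow> 0" for x by simp
    have rep: "L2_inner \<Omega> g \<phi> = l \<phi>" if \<phi>: "\<phi> \<in> ?D" for \<phi>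
    proof -
      have "(\<lambda>n. ipL2 (X n) \<phi>) \<longlonglongrightarrow> ipL2 g \<phi>" by (rule L2.ip_tendsto[OF g' const])
      from LIMSEQ_unique[OF this X(3)[OF \<phi>]] show ?thesis
        by (simp add: ipL2_eq[OF g(1) test_functions_L2[OF \<phi>]])
    qed
    \<comment> \<open>The bound on \<open>l\<close> is known for test functions only, whereas
      \<open>g\<close> need not be one; \<open>ipL2 g g\<close> is therefore reached as the limit of
      \<open>l (X n)\<close>.\<close>
    have "L2.nrm g \<le> K"
    proof -
      have lim1: "(\<lambda>n. ipL2 g (X n)) \<longlonglongrightarrow> ipL2 g g" by (rule L2.ip_tendsto[OF const g'])
      have lim2: "(\<lambda>n. K * L2.nrm (X n)) \<longlonglongrightarrow> K * L2.nrm g" by (intro tendsto_intros L2.nrm_tendsto g')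
      have "ipL2 g (X n) \<le> K * L2.nrm (X n)" for n
        using rep[OF X(1)[of n]] l_bd[OF X(1)[of n]] by (simp add: ipL2_eq[OF g(1) XL])
      then have "ipL2 g g \<le> K * L2.nrm g" by (intro LIMSEQ_le[OF lim1 lim2]) auto
      then have "L2.nrm g * L2.nrm g \<le> K * L2.nrm g" by (simp add: power2_eq_square flip: L2.nrm_sq)
      then show ?thesis using K L2.nrm_nonneg[of g] by (cases "L2.nrm g = 0") (auto simp: mult_le_cancel_right)
    qed
    then have "L2_norm \<Omega> g \<le> K" by (simp add: L2_nrm_eq[OF g(1)])
    moreover have "has_weak_partial \<Omega> \<alpha> v g"
      unfolding has_weak_partial_iff[OF v g(1)]
    proof (intro ballI allI impI)
      fix \<phi> and ws :: "'a list" assume \<phi>: "\<phi> \<in> ?D" and ws: "mset ws = \<alpha>"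
      have "L2_inner \<Omega> v (iter_partial vs \<phi>) = (-1) ^ size \<alpha> * L2_inner \<Omega> g \<phi>"
        unfolding rep[OF \<phi>] l_def by (simp add: power_mult_distrib[symmetric] flip: mult.assoc)
      then show "L2_inner \<Omega> v (iter_partial ws \<phi>) = (-1) ^ size \<alpha> * L2_inner \<Omega> g \<phi>"
        using sym[OF vs' \<phi>, of ws] vs ws by simp
    qed
    ultimately show ?thesis using g(1) by blast
  qed
  then show "v \<in> sobolev \<Omega> s" using v by (auto simp: sobolev_def)
  have "(L2_norm \<Omega> (weak_partial \<Omega> \<alpha> v))\<^sup>2 \<le> K\<^sup>2" if \<alpha>: "\<alpha> \<in> multi_indices s" for \<alpha>
  proof -
    obtain g where g: "g \<in> L2 \<Omega>" "has_weak_partial \<Omega> \<alpha> v g" "L2_norm \<Omega> g \<le> K" using ex[OF \<alpha>] by blast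
    have "L2_norm \<Omega> (weak_partial \<Omega> \<alpha> v) = L2_norm \<Omega> g"
      using weak_partial_eq_AE[OF v g(1,2)] g(1) by (intro L2_norm_cong_AE)
    then show ?thesis using g(3) by (intro power_mono) auto
  qed
  then have "(\<Sum>\<alpha>\<in>multi_indices s. (L2_norm \<Omega> (weak_partial \<Omega> \<alpha> v))\<^sup>2)
      \<le> real (card (multi_indices s :: 'a multiset set)) * K\<^sup>2"
    by (rule sum_bounded_above)
  then have "sobolev_norm \<Omega> s v \<le> sqrt (real (card (multi_indices s :: 'a multiset set)) * K\<^sup>2)"
    unfolding sobolev_norm_def by (rule real_sqrt_le_mono)
  then show "sobolev_norm \<Omega> s v \<le> sqrt (card (multi_indices s :: 'a multiset set)) * K"
    using K by (simp add: real_sqrt_mult)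
qed

section \<open>The space with vanishing boundary values\<close>

lemma H1_0_sobolev: "f \<in> H1_0 \<Omega> \<Longrightarrow> f \<in> sobolev \<Omega> 1"
  by (simp add: H1_0_def)

lemma H1_0_iff:
  "f \<in> H1_0 \<Omega> \<longleftrightarrow> f \<in> sobolev \<Omega> 1 \<and> (\<forall>\<epsilon>>0. \<exists>\<phi>\<in>test_functions \<Omega>. H1.nrm (f - \<phi>) < \<epsilon>)"
proof -
  have "sobolev_norm \<Omega> 1 (\<lambda>x. f x - \<phi> x) = H1.nrm (f - \<phi>)"
    if "f \<in> sobolev \<Omega> 1" "\<phi> \<in> test_functions \<Omega>" for \<phi>
    unfolding H1_nrm_eq[OF subspace_diff[OF subspace_sobolev that(1) test_functions_sobolev[OF that(2)]]]
    by (simp only: fun_diff_def)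
  then show ?thesis unfolding H1_0_def by auto
qed

text \<open>Carries the boundary condition from almost every time to every time, and from difference
  quotients to the time derivative.\<close>

lemma H1_0_closed:
  assumes f: "f \<in> sobolev \<Omega> 1" and approx: "\<And>\<epsilon>. 0 < \<epsilon> \<Longrightarrow> \<exists>g\<in>H1_0 \<Omega>. H1.nrm (f - g) < \<epsilon>"
  shows "f \<in> H1_0 \<Omega>"
  unfolding H1_0_iff
proof (intro conjI allI impI)
  fix \<epsilon> :: real assume "0 < \<epsilon>"
  then obtain g where g: "g \<in> H1_0 \<Omega>" "H1.nrm (f - g) < \<epsilon> / 2" using approx[of "\<epsilon> / 2"] by auto
  then obtain \<phi> where \<phi>: "\<phi> \<in> test_functions \<Omega>" "H1.nrm (g - \<phi>) < \<epsilon> / 2"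
    using \<open>0 < \<epsilon>\<close> unfolding H1_0_iff by (meson half_gt_zero)
  have "H1.nrm (f - \<phi>) < \<epsilon>" using H1.nrm_diff_triangle[of f \<phi> g] g \<phi> by linarith
  with \<phi>(1) show "\<exists>\<phi>\<in>test_functions \<Omega>. H1.nrm (f - \<phi>) < \<epsilon>" by blast
qed (rule f)

lemma subspace_H1_0: "subspace (H1_0 \<Omega>)"
proof (rule subspaceI)
  show "0 \<in> H1_0 \<Omega>"
    unfolding H1_0_iff using subspace_0[OF subspace_sobolev] subspace_0[OF subspace_test_functions]
    by (auto intro!: bexI[of _ 0])
  fix f assume f: "f \<in> H1_0 \<Omega>"
  show "c *\<^sub>R f \<in> H1_0 \<Omega>" for c
    unfolding H1_0_iff
  proof (intro conjI allI impI)
    show "c *\<^sub>R f \<in> sobolev \<Omega> 1" using f by (intro subspace_scale[OF subspace_sobolev] H1_0_sobolev)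
    fix \<epsilon> :: real assume "0 < \<epsilon>"
    then have "0 < \<epsilon> / (\<bar>c\<bar> + 1)" by simp
    then obtain \<phi> where \<phi>: "\<phi> \<in> test_functions \<Omega>" "H1.nrm (f - \<phi>) < \<epsilon> / (\<bar>c\<bar> + 1)"
      using f unfolding H1_0_iff by blast
    have "H1.nrm (c *\<^sub>R f - c *\<^sub>R \<phi>) = \<bar>c\<bar> * H1.nrm (f - \<phi>)"
      by (simp only: H1.nrm_scale flip: scaleR_diff_right)
    also have "\<dots> \<le> (\<bar>c\<bar> + 1) * H1.nrm (f - \<phi>)" by (intro mult_right_mono) auto
    also have "\<dots> < \<epsilon>" using \<phi>(2) by (simp add: field_simps)
    finally show "\<exists>\<phi>\<in>test_functions \<Omega>. H1.nrm (c *\<^sub>R f - \<phi>) < \<epsilon>"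
      using subspace_scale[OF subspace_test_functions \<phi>(1)] by blast
  qed
  fix g assume g: "g \<in> H1_0 \<Omega>"
  show "f + g \<in> H1_0 \<Omega>"
    unfolding H1_0_iff
  proof (intro conjI allI impI)
    show "f + g \<in> sobolev \<Omega> 1" using f g by (intro subspace_add[OF subspace_sobolev] H1_0_sobolev)
    fix \<epsilon> :: real assume "0 < \<epsilon>"
    then have e: "0 < \<epsilon> / 2" by simp
    obtain \<phi> where \<phi>: "\<phi> \<in> test_functions \<Omega>" "H1.nrm (f - \<phi>) < \<epsilon> / 2"
      using f e unfolding H1_0_iff by blast
    obtain \<psi> where \<psi>: "\<psi> \<in> test_functions \<Omega>" "H1.nrm (g - \<psi>) < \<epsilon> / 2"
      using g e unfolding H1_0_iff by blast
    have "H1.nrm ((f + g) - (\<phi> + \<psi>)) \<le> H1.nrm (f - \<phi>) + H1.nrm (g - \<psi>)"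
      using H1.nrm_triangle[of "f - \<phi>" "g - \<psi>"] by (simp only: add_diff_add)
    then show "\<exists>\<phi>\<in>test_functions \<Omega>. H1.nrm (f + g - \<phi>) < \<epsilon>"
      using \<phi> \<psi> subspace_add[OF subspace_test_functions \<phi>(1) \<psi>(1)] by force
  qed
qed

lemma H1_0_test_sequence:
  assumes "f \<in> H1_0 \<Omega>"
  obtains \<phi> where "\<And>n. \<phi> n \<in> test_functions \<Omega>" "(\<lambda>n. H1.nrm (\<phi> n - f)) \<longlonglongrightarrow> 0"
proof -
  have "\<exists>\<phi>. \<forall>n. \<phi> n \<in> test_functions \<Omega> \<and> H1.nrm (f - \<phi> n) < 1 / real (Suc n)"
  proof (rule choice, rule allI)
    fix n show "\<exists>\<phi>. \<phi> \<in> test_functions \<Omega> \<and> H1.nrm (f - \<phi>) < 1 / real (Suc n)"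
      using assms unfolding H1_0_iff by (meson of_nat_0_less_iff zero_less_Suc zero_less_divide_1_iff)
  qed
  then obtain \<phi> where \<phi>: "\<And>n. \<phi> n \<in> test_functions \<Omega>" "\<And>n. H1.nrm (f - \<phi> n) < 1 / real (Suc n)" by blast
  have "(\<lambda>n. H1.nrm (\<phi> n - f)) \<longlonglongrightarrow> 0"
  proof (rule Lim_null_comparison[OF always_eventually LIMSEQ_Suc[OF lim_1_over_n]], rule allI)
    fix n show "norm (H1.nrm (\<phi> n - f)) \<le> 1 / real (Suc n)"
      using \<phi>(2)[of n] H1.nrm_diff_commute[of f "\<phi> n"] H1.nrm_nonneg[of "\<phi> n - f"] by simp
  qed
  with \<phi>(1) show ?thesis by (rule that)
qed

end

section \<open>Weak derivatives on an interval\<close>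

text \<open>The kernel m step'(m (x - s)) has integral 1 and lives on [s, s + 1/m], so it averages
  \<open>g\<close> just to the right of s. A bound on the derivative of \<open>step\<close>, from
  compactness, makes its sign irrelevant.\<close>

lemma integral_bump_edge:
  fixes g :: "real \<Rightarrow> real"
  assumes step': "\<And>y. (step has_real_derivative step' y) (at y)" "continuous_on UNIV step'"
    and g: "continuous_on {s..s + d} g" and d: "0 < d"
  shows "(\<lambda>n. integral {s..s + 1 / real (Suc n)} (\<lambda>x. g x * (real (Suc n) * step' (real (Suc n) * (x - s))))) \<longlonglongrightarrow> g s"
proof -
  have "bounded (step' ` {0..1})"
    using step'(2) by (intro compact_imp_bounded compact_continuous_image) (auto intro: continuous_on_subset)
  then obtain C where C0: "\<forall>y\<in>step' ` {0..1}. norm y \<le> C" unfolding bounded_iff by blast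
  have C: "\<bar>step' y\<bar> \<le> C" if "0 \<le> y" "y \<le> 1" for y using C0 that by auto
  have Cnn: "0 \<le> C" using C[of 0] by simp
  show ?thesis
  proof (rule LIMSEQ_I)
    fix e :: real assume e: "0 < e"
    \<comment> \<open>The kernel is at most m C on an interval of length 1/m, so an oscillation e'
      of \<open>g\<close> costs e' C. The excess in the denominator makes the final inequality
      strict even if C = 0.\<close>
    define e' where "e' = e / (2 * (C + 1))"
    have e': "0 < e'" using e Cnn by (simp add: e'_def)
    have "(g \<longlongrightarrow> g s) (at s within {s..s + d})" using g d by (simp add: continuous_on_def)
    then obtain \<delta> where \<delta>: "0 < \<delta>" "\<And>x. x \<in> {s..s + d} \<Longrightarrow> \<bar>x - s\<bar> < \<delta> \<Longrightarrow> \<bar>g x - g s\<bar> \<le> e'"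
      using e' unfolding tendsto_iff eventually_at by (force simp: dist_real_def)
    obtain N where N: "1 / real (Suc N) < min \<delta> d" using nat_approx_posE[of "min \<delta> d"] \<delta>(1) d by auto
    have "norm (integral {s..s + 1 / real (Suc n)} (\<lambda>x. g x * (real (Suc n) * step' (real (Suc n) * (x - s)))) - g s) < e"
      if "n \<ge> N" for n
    proof -
      define m where "m = real (Suc n)"
      have m: "m > 0" by (simp add: m_def)
      have "1 / m \<le> 1 / real (Suc N)" using that by (simp add: m_def frac_le)
      then have small: "1 / m < \<delta>" "1 / m < d" using N by auto
      define p where "p x = m * step' (m * (x - s))" for x
      have p_cont: "continuous_on A p" for A
        unfolding p_def by (intro continuous_intros continuous_on_compose2[OF step'(2)]) auto
      have g_cont: "continuous_on {s..s + 1 / m} g" using g small by (auto intro: continuous_on_subset)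
      have p_int: "(p has_integral 1) {s..s + 1 / m}"
      proof -
        have "((\<lambda>x. step (m * (x - s))) has_vector_derivative p x) (at x within {s..s + 1 / m})" for x
        proof -
          have "((\<lambda>x. step (m * (x - s))) has_real_derivative step' (m * (x - s)) * m) (at x)"
            by (rule DERIV_chain2[OF step'(1)]) (auto intro!: derivative_eq_intros)
          then have "((\<lambda>x. step (m * (x - s))) has_real_derivative p x) (at x)"
            by (simp add: p_def mult.commute)
          then show ?thesis
            unfolding has_real_derivative_iff_has_vector_derivative
            by (rule has_vector_derivative_at_within)
        qed
        then have "(p has_integral step (m * (s + 1 / m - s)) - step (m * (s - s))) {s..s + 1 / m}"
          using m by (intro fundamental_theorem_of_calculus) auto
        moreover have "step (m * (s + 1 / m - s)) - step (m * (s - s)) = 1"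
          using m by (simp add: step_0 step_1)
        ultimately show ?thesis by metis
      qed
      have gp_int: "(\<lambda>x. g x * p x) integrable_on {s..s + 1 / m}"
        by (intro integrable_continuous_real continuous_intros g_cont p_cont)
      have diff_int: "((\<lambda>x. g x * p x - g s * p x) has_integral integral {s..s + 1 / m} (\<lambda>x. g x * p x) - g s * 1) {s..s + 1 / m}"
        by (intro has_integral_diff integrable_integral gp_int has_integral_mult_right p_int)
      have "norm (integral {s..s + 1 / m} (\<lambda>x. g x * p x) - g s * 1) \<le> (e' * (m * C)) * measure lborel (cbox s (s + 1 / m))"
      proof (rule has_integral_bound)
        show "0 \<le> e' * (m * C)" using e' m Cnn by simp
        show "((\<lambda>x. g x * p x - g s * p x) has_integral integral {s..s + 1 / m} (\<lambda>x. g x * p x) - g s * 1) (cbox s (s + 1 / m))"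
          using diff_int by simp
        fix x assume "x \<in> cbox s (s + 1 / m)"
        then have x: "s \<le> x" "x \<le> s + 1 / m" by auto
        then have "m * (x - s) \<le> m * (1 / m)" using m by (intro mult_left_mono) auto
        then have "\<bar>p x\<bar> \<le> m * C"
          using C[of "m * (x - s)"] x m by (simp add: p_def abs_mult)
        moreover have "\<bar>g x - g s\<bar> \<le> e'" using \<delta>(2)[of x] x small by auto
        ultimately have "\<bar>g x - g s\<bar> * \<bar>p x\<bar> \<le> e' * (m * C)" by (intro mult_mono) auto
        then show "norm (g x * p x - g s * p x) \<le> e' * (m * C)"
          by (simp add: abs_mult flip: left_diff_distrib)
      qed
      also have "\<dots> = e' * C" using m by simp
      also have "\<dots> < e' * (2 * (C + 1))" using e' Cnn by (intro mult_strict_left_mono) auto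
      also have "\<dots> = e" using Cnn by (simp add: e'_def)
      finally show ?thesis by (simp add: p_def m_def)
    qed
    then show "\<exists>no. \<forall>n\<ge>no. norm (integral {s..s + 1 / real (Suc n)}
        (\<lambda>x. g x * (real (Suc n) * step' (real (Suc n) * (x - s)))) - g s) < e" by blast
  qed
qed

lemma step_derivative_support:
  assumes "\<And>y. (step has_real_derivative step' y) (at y)" "step' y \<noteq> 0"
  shows "0 \<le> y" "y \<le> 1"
proof -
  have "step' y = 0" if "y < 0"
  proof -
    have "((\<lambda>_. 0) has_real_derivative 0) (at y)" by simp
    then have "(step has_real_derivative 0) (at y)"
      by (rule has_field_derivative_transform_within_open[of _ _ _ "{..<0}"]) (use that in \<open>auto simp: step_0\<close>)
    then show ?thesis using assms(1) DERIV_unique by blast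
  qed
  then show "0 \<le> y" using assms(2) by force
  have "step' y = 0" if "y > 1"
  proof -
    have "((\<lambda>_. 1) has_real_derivative 0) (at y)" by simp
    then have "(step has_real_derivative 0) (at y)"
      by (rule has_field_derivative_transform_within_open[of _ _ _ "{1<..}"]) (use that in \<open>auto simp: step_1\<close>)
    then show ?thesis using assms(1) DERIV_unique by blast
  qed
  then show "y \<le> 1" using assms(2) by force
qed

text \<open>Test with the box bump of [s, t]: its derivative is an averaging kernel at s minus one
  at t, so that pairing tends to g s - g t, while the bump itself tends to the indicator of the
  interval. The sign in the weak derivative reverses the difference.\<close>

theorem weak_derivative_integral:
  fixes g F :: "real \<Rightarrow> real"
  assumes weak: "has_weak_partial {a<..<b} {#1#} g F" and cont: "continuous_on {a<..<b} g"
    and st: "a < s" "s \<le> t" "t < b"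
  shows "F absolutely_integrable_on {s..t}" "integral {s..t} F = g t - g s"
proof -
  have sub: "{s..t} \<subseteq> {a<..<b}" using st by auto
  show F: "F absolutely_integrable_on {s..t}"
    using weak sub unfolding has_weak_partial_def locally_integrable_def by simp
  show "integral {s..t} F = g t - g s"
  proof (cases "s = t")
    case False
    then have lt: "s < t" using st by simp
    obtain step' where step': "\<And>y. (step has_real_derivative step' y) (at y)" "continuous_on UNIV step'"
      by (rule step_has_derivative) (rule that)
    have g_cont: "continuous_on {s..t} g" using cont sub by (rule continuous_on_subset)
    define I1 where "I1 n = integral {s..s + 1 / real (Suc n)} (\<lambda>x. g x * (real (Suc n) * step' (real (Suc n) * (x - s))))" for n
    define I2 where "I2 n = integral {t - 1 / real (Suc n)..t} (\<lambda>x. g x * (real (Suc n) * step' (real (Suc n) * (t - x))))" for n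
    have lim1: "I1 \<longlonglongrightarrow> g s"
      unfolding I1_def by (rule integral_bump_edge[OF step', of s "t - s"]) (use g_cont lt in auto)
    have lim2: "I2 \<longlonglongrightarrow> g t"
    proof -
      \<comment> \<open>Reflection turns the right end of the interval into a left end, so the same
        averaging result applies.\<close>
      have "continuous_on {- t..- t + (t - s)} (\<lambda>x. g (- x))"
        by (intro continuous_on_compose2[OF g_cont] continuous_intros) auto
      from integral_bump_edge[OF step' this] lt
      have "(\<lambda>n. integral {- t..- t + 1 / real (Suc n)} (\<lambda>x. g (- x) * (real (Suc n) * step' (real (Suc n) * (x - - t))))) \<longlonglongrightarrow> g t"
        by simp
      moreover have "integral {- t..- t + 1 / real (Suc n)} (\<lambda>x. g (- x) * (real (Suc n) * step' (real (Suc n) * (x - - t)))) = I2 n" for n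
      proof -
        define m where "m = real (Suc n)"
        have "integral {- t..- (t - 1 / m)} (\<lambda>x. g (- x) * (m * step' (m * (t - - x)))) =
            integral {t - 1 / m..t} (\<lambda>x. g x * (m * step' (m * (t - x))))"
          by (rule Henstock_Kurzweil_Integration.integral_reflect_real[where f="\<lambda>x. g x * (m * step' (m * (t - x)))"])
        moreover have "- (t - 1 / m) = - t + 1 / m" "\<And>x. t - - x = x - - t" by simp_all
        ultimately show ?thesis unfolding I2_def m_def by (simp only:)
      qed
      ultimately show ?thesis by simp
    qed
    have "(\<lambda>n. LINT x|lebesgue_on {a<..<b}. F x * box_bump n s t x) \<longlonglongrightarrow> integral (cbox s t) F"
      using F sub by (intro integral_box_bump_tendsto) auto
    from LIMSEQ_Suc[OF this] have lim3: "(\<lambda>n. LINT x|lebesgue_on {a<..<b}. F x * box_bump (Suc n) s t x) \<longlonglongrightarrow> integral {s..t} F"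
      by simp
    \<comment> \<open>Each transition of the bump has width 1 / Suc n; under the condition on n the
      two transitions do not overlap.\<close>
    have key: "(LINT x|lebesgue_on {a<..<b}. F x * box_bump (Suc n) s t x) = I2 n - I1 n"
      if n: "2 / (t - s) \<le> real (Suc n)" for n
    proof -
      define m where "m = real (Suc n)"
      have m: "m > 0" by (simp add: m_def)
      have mts: "2 \<le> m * (t - s)" using n lt by (simp add: m_def field_simps)
      have inv: "1 / m \<le> t - s" using mts m lt by (simp add: field_simps)
      define \<psi> where "\<psi> = box_bump (Suc n) s t"
      have \<psi>_eq: "\<psi> x = step (m * (x - s)) * step (m * (t - x))" for x
        by (simp add: \<psi>_def box_bump_def m_def)
      define p where "p x = m * step' (m * (x - s))" for x
      define q where "q x = m * step' (m * (t - x))" for x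
      have p_supp: "s \<le> x \<and> x \<le> s + 1 / m" if "p x \<noteq> 0" for x
      proof -
        have "step' (m * (x - s)) \<noteq> 0" using that by (simp add: p_def)
        from step_derivative_support[OF step'(1) this] show ?thesis using m by (simp add: field_simps zero_le_mult_iff)
      qed
      have q_supp: "t - 1 / m \<le> x \<and> x \<le> t" if "q x \<noteq> 0" for x
      proof -
        have "step' (m * (t - x)) \<noteq> 0" using that by (simp add: q_def)
        from step_derivative_support[OF step'(1) this] show ?thesis using m by (simp add: field_simps zero_le_mult_iff)
      qed
      have \<psi>_der: "(\<psi> has_real_derivative p x - q x) (at x)" for x
      proof -
        have "((\<lambda>x. step (m * (x - s))) has_real_derivative step' (m * (x - s)) * m) (at x)"
          by (rule DERIV_chain2[OF step'(1)]) (auto intro!: derivative_eq_intros)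
        moreover have "((\<lambda>x. step (m * (t - x))) has_real_derivative step' (m * (t - x)) * - m) (at x)"
          by (rule DERIV_chain2[OF step'(1)]) (auto intro!: derivative_eq_intros)
        ultimately have "((\<lambda>x. step (m * (x - s)) * step (m * (t - x))) has_real_derivative
            p x * step (m * (t - x)) - q x * step (m * (x - s))) (at x)"
          by (rule DERIV_cong[OF DERIV_mult]) (simp add: p_def q_def algebra_simps)
        \<comment> \<open>Wherever one factor of the bump has a nonzero derivative, the other factor
          is already 1, so the product rule leaves the bare kernels.\<close>
        moreover have "p x * step (m * (t - x)) = p x"
        proof (cases "p x = 0")
          case False
          then have "x \<le> s + 1 / m" using p_supp by blast
          then have "m * x \<le> m * (s + 1 / m)" using m by simp
          then have "m * (t - x) \<ge> 1" using mts m by (simp add: algebra_simps)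
          then show ?thesis by (simp add: step_1)
        qed simp
        moreover have "q x * step (m * (x - s)) = q x"
        proof (cases "q x = 0")
          case False
          then have "t - 1 / m \<le> x" using q_supp by blast
          then have "m * (t - 1 / m) \<le> m * x" using m by simp
          then have "m * (x - s) \<ge> 1" using mts m by (simp add: algebra_simps)
          then show ?thesis by (simp add: step_1)
        qed simp
        ultimately show ?thesis by (simp add: \<psi>_eq[abs_def])
      qed
      have ip: "iter_partial [1] \<psi> x = p x - q x" for x
        using frechet_derivative_at[OF \<psi>_der[of x, unfolded has_field_derivative_def]] by (metis iter_partial.simps mult.right_neutral)
      have \<psi>: "\<psi> \<in> test_functions {a<..<b}" unfolding \<psi>_def using sub by (intro box_bump_test_function) auto
      have p_cont: "continuous_on A p" for A
        unfolding p_def by (intro continuous_intros continuous_on_compose2[OF step'(2)]) auto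
      have q_cont: "continuous_on A q" for A
        unfolding q_def by (intro continuous_intros continuous_on_compose2[OF step'(2)]) auto
      have abs_int: "(\<lambda>x. g x * (p x - q x)) absolutely_integrable_on {s..t}"
        by (intro absolutely_integrable_continuous_real continuous_intros g_cont p_cont q_cont)
      have "(LINT x|lebesgue_on {a<..<b}. g x * (p x - q x)) = (LINT x|lebesgue. g x * (p x - q x))"
      proof (rule integral_lebesgue_on_eq)
        fix x assume "x \<notin> {a<..<b}"
        then have "x \<notin> {s..t}" using sub by blast
        then have "p x = 0" "q x = 0" using p_supp[of x] q_supp[of x] inv by force+
        then show "g x * (p x - q x) = 0" by simp
      qed simp
      also have "\<dots> = (LINT x:{s..t}|lebesgue. g x * (p x - q x))"
        unfolding set_lebesgue_integral_def
      proof (intro Bochner_Integration.integral_cong refl)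
        fix x
        have "p x = 0 \<and> q x = 0" if "x \<notin> {s..t}"
          using that p_supp[of x] q_supp[of x] inv by force
        then show "g x * (p x - q x) = indicator {s..t} x *\<^sub>R (g x * (p x - q x))"
          by (cases "x \<in> {s..t}") simp_all
      qed
      also have "\<dots> = integral {s..t} (\<lambda>x. g x * (p x - q x))"
        using abs_int by (rule set_lebesgue_integral_eq_integral(2))
      also have "\<dots> = I1 n - I2 n"
      proof -
        have gp: "((\<lambda>x. g x * p x) has_integral I1 n) {s..s + 1 / m}"
        proof -
          have "(\<lambda>x. g x * p x) integrable_on {s..s + 1 / m}"
            using inv by (intro integrable_continuous_real continuous_on_mult p_cont continuous_on_subset[OF g_cont]) auto
          moreover have "I1 n = integral {s..s + 1 / m} (\<lambda>x. g x * p x)" unfolding I1_def p_def m_def ..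
          ultimately show ?thesis by (simp only: integrable_integral)
        qed
        have gq: "((\<lambda>x. g x * q x) has_integral I2 n) {t - 1 / m..t}"
        proof -
          have "(\<lambda>x. g x * q x) integrable_on {t - 1 / m..t}"
            using inv by (intro integrable_continuous_real continuous_on_mult q_cont continuous_on_subset[OF g_cont]) auto
          moreover have "I2 n = integral {t - 1 / m..t} (\<lambda>x. g x * q x)" unfolding I2_def q_def m_def ..
          ultimately show ?thesis by (simp only: integrable_integral)
        qed
        have "((\<lambda>x. g x * p x) has_integral I1 n) {s..t}"
          by (rule has_integral_on_superset[OF gp]) (use p_supp inv in force)+
        moreover have "((\<lambda>x. g x * q x) has_integral I2 n) {s..t}"
          by (rule has_integral_on_superset[OF gq]) (use q_supp inv in force)+
        ultimately have "((\<lambda>x. g x * p x - g x * q x) has_integral I1 n - I2 n) {s..t}"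
          by (rule has_integral_diff)
        then show ?thesis by (simp add: integral_unique right_diff_distrib)
      qed
      finally have "(LINT x|lebesgue_on {a<..<b}. g x * iter_partial [1] \<psi> x) = I1 n - I2 n"
        by (simp only: ip)
      moreover have "(LINT x|lebesgue_on {a<..<b}. g x * iter_partial [1] \<psi> x) =
          (-1) ^ size {#1::real#} * (LINT x|lebesgue_on {a<..<b}. F x * \<psi> x)"
        using weak \<psi> unfolding has_weak_partial_def by (metis mset_single_iff_right)
      ultimately show ?thesis by (simp add: \<psi>_def)
    qed
    have "\<forall>\<^sub>F n in sequentially. (LINT x|lebesgue_on {a<..<b}. F x * box_bump (Suc n) s t x) = I2 n - I1 n"
    proof -
      obtain N where "2 / (t - s) \<le> real N" using real_arch_simple by blast
      then show ?thesis unfolding eventually_sequentially by (intro exI[of _ N] allI impI key) linarith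
    qed
    then have "(\<lambda>n. I2 n - I1 n) \<longlonglongrightarrow> integral {s..t} F"
      by (rule Lim_transform_eventually[OF lim3])
    from LIMSEQ_unique[OF this tendsto_diff[OF lim2 lim1]] show ?thesis by simp
  qed simp
qed

lemma integral_abs_le_AE:
  fixes F :: "real \<Rightarrow> real"
  assumes F: "F absolutely_integrable_on {s..t}" and "s \<le> t"
    and bd: "AE x in lebesgue. x \<in> {s..t} \<longrightarrow> \<bar>F x\<bar> \<le> B"
  shows "\<bar>integral {s..t} F\<bar> \<le> B * (t - s)"
proof -
  have int: "integrable (lebesgue_on {s..t}) F" using F by (intro absolutely_integrable_imp_integrable) auto
  interpret finite_measure "lebesgue_on {s..t}"
    by (rule finite_measureI) (use \<open>s \<le> t\<close> in \<open>simp add: emeasure_restrict_space\<close>)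
  have "\<bar>integral {s..t} F\<bar> = \<bar>LINT x|lebesgue_on {s..t}. F x\<bar>"
    using lebesgue_integral_eq_integral[OF int] by simp
  also have "\<dots> \<le> (LINT x|lebesgue_on {s..t}. \<bar>F x\<bar>)" by (rule integral_abs_bound)
  also have "\<dots> \<le> (LINT x|lebesgue_on {s..t}. B)"
    using int bd by (intro integral_mono_AE) (auto simp: AE_restrict_space_iff)
  also have "\<dots> = B * (t - s)" using \<open>s \<le> t\<close> by (simp add: measure_restrict_space)
  finally show ?thesis .
qed

text \<open>A countable exhaustion by compact subintervals; weak derivatives are integrable only on
  compact subsets, so the estimates start there.\<close>

lemma AE_interval:
  fixes P :: "real \<Rightarrow> bool"
  assumes "\<And>c d. a < c \<Longrightarrow> d < b \<Longrightarrow> AE x in lebesgue. x \<in> {c..d} \<longrightarrow> P x"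
  shows "AE x in lebesgue_on {a<..<b}. P x"
proof -
  have "AE x in lebesgue. \<forall>n. x \<in> {a + 1 / real (Suc n)..b - 1 / real (Suc n)} \<longrightarrow> P x"
    unfolding AE_all_countable by (intro allI assms) auto
  then have "AE x in lebesgue. x \<in> {a<..<b} \<longrightarrow> P x"
  proof eventually_elim
    case (elim x)
    show ?case
    proof
      assume x: "x \<in> {a<..<b}"
      then obtain n where n: "1 / real (Suc n) < min (x - a) (b - x)"
        using nat_approx_posE[of "min (x - a) (b - x)"] by auto
      from elim[rule_format, of n] n show "P x" by auto
    qed
  qed
  then show ?thesis by (simp add: AE_restrict_space_iff)
qed

text \<open>By the fundamental theorem the integrals of L + F and L - F over compact subintervals
  are nonnegative, so the sign criterion for box integrals applies to both.\<close>

theorem weak_derivative_AE_bounded: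
  fixes g F :: "real \<Rightarrow> real"
  assumes weak: "has_weak_partial {a<..<b} {#1#} g F"
    and lip: "\<And>s t. s \<in> {a<..<b} \<Longrightarrow> t \<in> {a<..<b} \<Longrightarrow> \<bar>g t - g s\<bar> \<le> L * \<bar>t - s\<bar>"
  shows "AE t in lebesgue_on {a<..<b}. \<bar>F t\<bar> \<le> L"
proof (rule AE_interval)
  fix c d assume cd: "a < c" "d < b"
  have cont: "continuous_on {a<..<b} g"
  proof (cases "a < b")
    case True
    \<comment> \<open>\<open>lipschitz_on\<close> includes nonnegativity of the constant; it follows
      from comparing two distinct interior points, here those that trisect the interval.\<close>
    have "0 \<le> L * \<bar>(a + 2 * b) / 3 - (2 * a + b) / 3\<bar>"
      using lip[of "(2 * a + b) / 3" "(a + 2 * b) / 3"] True by (intro order_trans[OF abs_ge_zero]) auto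
    then have "0 \<le> L" using True by (simp add: zero_le_mult_iff)
    then have "L-lipschitz_on {a<..<b} g" using lip by (intro lipschitz_onI) (auto simp: dist_real_def)
    then show ?thesis by (rule lipschitz_on_continuous_on)
  qed simp
  have sub: "{c..d} \<subseteq> {a<..<b}" using cd by auto
  have F: "F absolutely_integrable_on {c..d}"
    using weak sub unfolding has_weak_partial_def locally_integrable_def by simp
  have bound: "\<bar>integral {s..t} F\<bar> \<le> L * (t - s)" if "c \<le> s" "s \<le> t" "t \<le> d" for s t
    using weak_derivative_integral(2)[OF weak cont, of s t] lip[of s t] that cd by simp
  have nonneg: "AE x in lebesgue. x \<in> cbox c d \<longrightarrow> 0 \<le> L + k * F x" if k: "\<bar>k\<bar> = 1" for k
  proof (rule box_integrals_nonneg_imp_AE_nonneg)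
    have F': "F absolutely_integrable_on cbox c d" using F by simp
    show "(\<lambda>x. L + k * F x) absolutely_integrable_on cbox c d"
      using F' by (intro set_integral_add absolutely_integrable_on_const set_integrable_mult_right) auto
    fix s t assume st: "cbox s t \<subseteq> cbox c d"
    show "0 \<le> integral (cbox s t) (\<lambda>x. L + k * F x)"
    proof (cases "s \<le> t")
      case True
      then have st': "c \<le> s" "t \<le> d" using st by (auto simp: subset_eq)
      have Fi: "F integrable_on {s..t}"
        using set_integrable_subset[OF F, of "{s..t}"] st' by (auto simp: absolutely_integrable_on_def)
      have "integral {s..t} (\<lambda>x. L + k * F x) = L * (t - s) + k * integral {s..t} F"
        using Fi True by (subst integral_add) (auto intro: integrable_on_mult_right)
      moreover have "\<bar>k * integral {s..t} F\<bar> \<le> L * (t - s)"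
        using bound[OF st'(1) True st'(2)] k by (simp add: abs_mult)
      ultimately show ?thesis by auto
    qed simp
  qed
  show "AE x in lebesgue. x \<in> {c..d} \<longrightarrow> \<bar>F x\<bar> \<le> L"
    using nonneg[of 1, simplified] nonneg[of "-1", simplified] by eventually_elim auto
qed

lemma AE_interval_exists:
  fixes P :: "real \<Rightarrow> bool"
  assumes "AE x in lebesgue_on {a<..<b}. P x" "a \<le> c" "c < d" "d \<le> b"
  shows "\<exists>x\<in>{c<..<d}. P x"
proof (rule ccontr)
  assume no: "\<not> (\<exists>x\<in>{c<..<d}. P x)"
  have "AE x in lebesgue. x \<in> {a<..<b} \<longrightarrow> P x" using assms(1) by (simp add: AE_restrict_space_iff)
  then have "AE x in lebesgue. x \<notin> {c<..<d}"
    by eventually_elim (use no assms(2-4) in auto)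
  then have "{c<..<d} \<in> null_sets lebesgue"
    by (subst (asm) AE_iff_null_sets[symmetric]) auto
  then have "emeasure lborel {c<..<d} = 0" by auto
  then show False using assms(3) by simp
qed

section \<open>Regularity in time\<close>

lemma AE_lebesgue_on_iff:
  "S \<in> sets lebesgue \<Longrightarrow> (AE x in lebesgue_on S. P x) \<longleftrightarrow> (AE x in lebesgue. x \<in> S \<longrightarrow> P x)"
  by (simp add: AE_restrict_space_iff)

lemma Ioo_lebesgue: "{a<..<b :: real} \<in> sets lebesgue"
  by simp

context domain
begin

text \<open>A bound in H^s expressed only by pairings with derivatives of test functions. Unlike the
  norm of chosen weak derivatives it passes directly through L^2 limits and scalar time integrals.
  The clause on permutations travels along because the conversion back to \<open>sobolev\<close>
  relies on it.\<close>

definition weakly_bounded :: "nat \<Rightarrow> ('a \<Rightarrow> real) \<Rightarrow> real \<Rightarrow> bool" where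
  "weakly_bounded s v K \<longleftrightarrow> v \<in> L2 \<Omega> \<and>
    (\<forall>vs \<phi>. set vs \<subseteq> Basis \<longrightarrow> length vs \<le> s \<longrightarrow> \<phi> \<in> test_functions \<Omega> \<longrightarrow>
      \<bar>L2_inner \<Omega> v (iter_partial vs \<phi>)\<bar> \<le> K * L2_norm \<Omega> \<phi> \<and>
      (\<forall>ws. mset vs = mset ws \<longrightarrow> L2_inner \<Omega> v (iter_partial vs \<phi>) = L2_inner \<Omega> v (iter_partial ws \<phi>)))"

lemma weakly_boundedD:
  assumes "weakly_bounded s v K"
  shows "v \<in> L2 \<Omega>"
    and "set vs \<subseteq> Basis \<Longrightarrow> length vs \<le> s \<Longrightarrow> \<phi> \<in> test_functions \<Omega> \<Longrightarrow>
      \<bar>L2_inner \<Omega> v (iter_partial vs \<phi>)\<bar> \<le> K * L2_norm \<Omega> \<phi>"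
    and "set vs \<subseteq> Basis \<Longrightarrow> length vs \<le> s \<Longrightarrow> \<phi> \<in> test_functions \<Omega> \<Longrightarrow> mset vs = mset ws \<Longrightarrow>
      L2_inner \<Omega> v (iter_partial vs \<phi>) = L2_inner \<Omega> v (iter_partial ws \<phi>)"
  using assms unfolding weakly_bounded_def by blast+

lemma weakly_boundedI:
  assumes "v \<in> L2 \<Omega>"
    and "\<And>vs \<phi>. set vs \<subseteq> Basis \<Longrightarrow> length vs \<le> s \<Longrightarrow> \<phi> \<in> test_functions \<Omega> \<Longrightarrow>
      \<bar>L2_inner \<Omega> v (iter_partial vs \<phi>)\<bar> \<le> K * L2_norm \<Omega> \<phi>"
    and "\<And>vs ws \<phi>. set vs \<subseteq> Basis \<Longrightarrow> length vs \<le> s \<Longrightarrow> \<phi> \<in> test_functions \<Omega> \<Longrightarrow> mset vs = mset ws \<Longrightarrow>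
      L2_inner \<Omega> v (iter_partial vs \<phi>) = L2_inner \<Omega> v (iter_partial ws \<phi>)"
  shows "weakly_bounded s v K"
  using assms unfolding weakly_bounded_def by blast

lemma weakly_bounded_sobolev:
  assumes "weakly_bounded s v K" "0 \<le> K"
  shows "v \<in> sobolev \<Omega> s" "sobolev_norm \<Omega> s v \<le> sqrt (card (multi_indices s :: 'a multiset set)) * K"
  by (rule sobolev_of_bounded_functionals[OF weakly_boundedD(1)[OF assms(1)] assms(2)
        weakly_boundedD(2)[OF assms(1)] weakly_boundedD(3)[OF assms(1)]]; assumption)+

text \<open>Cauchy-Schwarz gives the bound. The pairing depends on \<open>vs\<close> only through
  its multiset, since that is what indexes the weak derivative.\<close>

lemma sobolev_weakly_bounded:
  assumes v: "v \<in> sobolev \<Omega> s" and K: "sobolev_norm \<Omega> s v \<le> K"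
  shows "weakly_bounded s v K"
proof (rule weakly_boundedI)
  show "v \<in> L2 \<Omega>" using v by (rule sobolev_L2)
next
  fix vs :: "'a list" and \<phi> assume a: "set vs \<subseteq> Basis" "length vs \<le> s" "\<phi> \<in> test_functions \<Omega>"
  then have \<alpha>: "mset vs \<in> multi_indices s" by (simp add: multi_indices_def)
  have "\<bar>L2_inner \<Omega> v (iter_partial vs \<phi>)\<bar> = \<bar>L2_inner \<Omega> (weak_partial \<Omega> (mset vs) v) \<phi>\<bar>"
    using sobolev_weak_partial_inner[OF v a] by (simp add: abs_mult power_abs)
  also have "\<dots> \<le> L2_norm \<Omega> (weak_partial \<Omega> (mset vs) v) * L2_norm \<Omega> \<phi>"
    by (intro L2_cauchy_schwarz weak_partial_L2[OF v \<alpha>] test_functions_L2 a)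
  also have "\<dots> \<le> K * L2_norm \<Omega> \<phi>"
    using order_trans[OF L2_norm_weak_partial_le[OF \<alpha>] K] by (intro mult_right_mono) auto
  finally show "\<bar>L2_inner \<Omega> v (iter_partial vs \<phi>)\<bar> \<le> K * L2_norm \<Omega> \<phi>" .
next
  fix vs ws :: "'a list" and \<phi>
  assume a: "set vs \<subseteq> Basis" "length vs \<le> s" "\<phi> \<in> test_functions \<Omega>" and eq: "mset vs = mset ws"
  have "set ws \<subseteq> Basis" "length ws \<le> s" using a eq by (metis set_mset_mset, metis size_mset)
  then show "L2_inner \<Omega> v (iter_partial vs \<phi>) = L2_inner \<Omega> v (iter_partial ws \<phi>)"
    using sobolev_weak_partial_inner[OF v a] sobolev_weak_partial_inner[OF v, of ws \<phi>] a eq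
    by (metis size_mset)
qed

lemma L2_inner_tendsto:
  assumes X: "\<And>t. t \<in> I \<Longrightarrow> X t \<in> L2 \<Omega>" and x: "x \<in> L2 \<Omega>" and \<psi>: "\<psi> \<in> L2 \<Omega>"
    and ev: "\<forall>\<^sub>F t in F. t \<in> I" and lim: "((\<lambda>t. L2.nrm (X t - x)) \<longlongrightarrow> 0) F"
  shows "((\<lambda>t. L2_inner \<Omega> (X t) \<psi>) \<longlongrightarrow> L2_inner \<Omega> x \<psi>) F"
proof -
  have "((\<lambda>t. ipL2 (X t) \<psi>) \<longlongrightarrow> ipL2 x \<psi>) F"
    by (rule L2.ip_tendsto[OF lim]) simp
  then show ?thesis
    using ev by (simp only: ipL2_eq[OF x \<psi>]) (rule Lim_transform_eventually, assumption,
        auto elim!: eventually_mono simp: ipL2_eq X \<psi>)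
qed

text \<open>Every condition involves one or two L^2-continuous pairings, hence is closed.\<close>

lemma weakly_bounded_limit:
  assumes X: "\<And>t. t \<in> I \<Longrightarrow> weakly_bounded s (X t) (K t)" and v: "v \<in> L2 \<Omega>"
    and ev: "\<forall>\<^sub>F t in F. t \<in> I" and lim: "((\<lambda>t. L2.nrm (X t - v)) \<longlongrightarrow> 0) F"
    and K: "(K \<longlongrightarrow> k) F" and F: "F \<noteq> bot"
  shows "weakly_bounded s v k"
proof (rule weakly_boundedI[OF v])
  note XL = weakly_boundedD(1)[OF X]
  fix vs :: "'a list" and \<phi> assume a: "set vs \<subseteq> Basis" "length vs \<le> s" "\<phi> \<in> test_functions \<Omega>"
  note lim_vs = L2_inner_tendsto[OF XL v iter_partial_test_L2[OF a(3,1)] ev lim]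
  show "\<bar>L2_inner \<Omega> v (iter_partial vs \<phi>)\<bar> \<le> k * L2_norm \<Omega> \<phi>"
  proof (rule tendsto_le[OF F])
    show "((\<lambda>t. K t * L2_norm \<Omega> \<phi>) \<longlongrightarrow> k * L2_norm \<Omega> \<phi>) F" by (intro tendsto_intros K)
    show "((\<lambda>t. \<bar>L2_inner \<Omega> (X t) (iter_partial vs \<phi>)\<bar>) \<longlongrightarrow> \<bar>L2_inner \<Omega> v (iter_partial vs \<phi>)\<bar>) F"
      by (intro tendsto_rabs lim_vs)
    show "\<forall>\<^sub>F t in F. \<bar>L2_inner \<Omega> (X t) (iter_partial vs \<phi>)\<bar> \<le> K t * L2_norm \<Omega> \<phi>"
      using ev by eventually_elim (rule weakly_boundedD(2)[OF X a])
  qed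
  fix ws assume eq: "mset vs = mset ws"
  have ws: "set ws \<subseteq> Basis" using a eq by (metis set_mset_mset)
  note lim_ws = L2_inner_tendsto[OF XL v iter_partial_test_L2[OF a(3) ws] ev lim]
  have "\<forall>\<^sub>F t in F. L2_inner \<Omega> (X t) (iter_partial vs \<phi>) = L2_inner \<Omega> (X t) (iter_partial ws \<phi>)"
    using ev by eventually_elim (rule weakly_boundedD(3)[OF X a eq])
  from Lim_transform_eventually[OF lim_vs this]
  show "L2_inner \<Omega> v (iter_partial vs \<phi>) = L2_inner \<Omega> v (iter_partial ws \<phi>)"
    using tendsto_unique[OF F _ lim_ws] by blast
qed

text \<open>Against each test function the increment of \<open>v\<close> is the integral of a scalar
  function, so no vector-valued integral is formed. Subtracting a fixed \<open>z\<close> lets the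
  same argument yield the Lipschitz bound (z = 0) and the Taylor remainder (z the derivative at
  s).\<close>

lemma weak_time_derivative_weakly_bounded:
  assumes v: "\<And>t. t \<in> {0<..<T} \<Longrightarrow> v t \<in> L2 \<Omega>"
    and cont: "\<And>\<psi>. \<psi> \<in> L2 \<Omega> \<Longrightarrow> continuous_on {0<..<T} (\<lambda>t. L2_inner \<Omega> (v t) \<psi>)"
    and weak: "has_weak_time_derivative T \<Omega> v w"
    and st: "0 < s" "s \<le> t" "t < T" and z: "z \<in> L2 \<Omega>"
    and bd: "AE \<tau> in lebesgue. \<tau> \<in> {s..t} \<longrightarrow> weakly_bounded r (w \<tau> - z) K"
  shows "weakly_bounded r (v t - v s - (t - s) *\<^sub>R z) (K * (t - s))"
proof -
  let ?d = "v t - v s - (t - s) *\<^sub>R z"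
  have vt: "v t \<in> L2 \<Omega>" and vs: "v s \<in> L2 \<Omega>" using v st by auto
  have zL: "(t - s) *\<^sub>R z \<in> L2 \<Omega>" using z by (rule subspace_scale[OF subspace_L2])
  have d: "?d \<in> L2 \<Omega>" by (intro L2_diff vt vs zL)
  define F where "F \<psi> \<tau> = L2_inner \<Omega> (w \<tau>) \<psi> - L2_inner \<Omega> z \<psi>" for \<psi> \<tau>
  have F_int: "F \<psi> absolutely_integrable_on {s..t}" "integral {s..t} (F \<psi>) = L2_inner \<Omega> ?d \<psi>"
    if \<psi>: "\<psi> \<in> L2 \<Omega>" for \<psi>
  proof -
    have wk: "has_weak_partial {0<..<T} {#1#} (\<lambda>t. L2_inner \<Omega> (v t) \<psi>) (\<lambda>t. L2_inner \<Omega> (w t) \<psi>)"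
      using weak \<psi> by (simp add: has_weak_time_derivative_def)
    note I = weak_derivative_integral[OF wk cont[OF \<psi>] st]
    show "F \<psi> absolutely_integrable_on {s..t}"
      unfolding F_def by (intro set_integral_diff(1) I(1) absolutely_integrable_on_const) auto
    have "integral {s..t} (F \<psi>) = integral {s..t} (\<lambda>\<tau>. L2_inner \<Omega> (w \<tau>) \<psi>) - integral {s..t} (\<lambda>\<tau>. L2_inner \<Omega> z \<psi>)"
      unfolding F_def using I(1) by (intro integral_diff) (auto simp: absolutely_integrable_on_def)
    also have "\<dots> = L2_inner \<Omega> (v t) \<psi> - L2_inner \<Omega> (v s) \<psi> - (t - s) * L2_inner \<Omega> z \<psi>"
      using I(2) st by simp
    also have "\<dots> = L2_inner \<Omega> ?d \<psi>"
      using vt vs zL \<psi> by (simp only: L2_inner_diff L2_diff L2_inner_scaleR)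
    finally show "integral {s..t} (F \<psi>) = L2_inner \<Omega> ?d \<psi>" .
  qed
  have F_eq: "F \<psi> \<tau> = L2_inner \<Omega> (w \<tau> - z) \<psi>" if "weakly_bounded r (w \<tau> - z) K" "\<psi> \<in> L2 \<Omega>" for \<psi> \<tau>
  proof -
    have "(w \<tau> - z) + z \<in> L2 \<Omega>" by (rule subspace_add[OF subspace_L2 weakly_boundedD(1)[OF that(1)] z])
    then have "w \<tau> \<in> L2 \<Omega>" by (simp only: diff_add_cancel)
    then show ?thesis unfolding F_def using z that(2) by (simp only: L2_inner_diff)
  qed
  show ?thesis
  proof (rule weakly_boundedI[OF d])
    fix vs :: "'a list" and \<phi> assume a: "set vs \<subseteq> Basis" "length vs \<le> r" "\<phi> \<in> test_functions \<Omega>"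
    note L = iter_partial_test_L2[OF a(3,1)]
    have "\<bar>integral {s..t} (F (iter_partial vs \<phi>))\<bar> \<le> (K * L2_norm \<Omega> \<phi>) * (t - s)"
    proof (rule integral_abs_le_AE[OF F_int(1)[OF L] st(2)])
      show "AE \<tau> in lebesgue. \<tau> \<in> {s..t} \<longrightarrow> \<bar>F (iter_partial vs \<phi>) \<tau>\<bar> \<le> K * L2_norm \<Omega> \<phi>"
        using bd by eventually_elim (use F_eq[OF _ L] weakly_boundedD(2)[OF _ a] in force)
    qed
    then show "\<bar>L2_inner \<Omega> ?d (iter_partial vs \<phi>)\<bar> \<le> K * (t - s) * L2_norm \<Omega> \<phi>"
      by (simp add: F_int(2)[OF L] mult_ac)
    fix ws assume eq: "mset vs = mset ws"
    have "set ws \<subseteq> Basis" using a eq by (metis set_mset_mset)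
    note Lw = iter_partial_test_L2[OF a(3) this]
    \<comment> \<open>Independence of the order of differentiation holds for almost every integrand;
      it is inherited as an integral bound by 0.\<close>
    have "\<bar>integral {s..t} (\<lambda>\<tau>. F (iter_partial vs \<phi>) \<tau> - F (iter_partial ws \<phi>) \<tau>)\<bar> \<le> 0 * (t - s)"
    proof (rule integral_abs_le_AE[OF _ st(2)])
      show "(\<lambda>\<tau>. F (iter_partial vs \<phi>) \<tau> - F (iter_partial ws \<phi>) \<tau>) absolutely_integrable_on {s..t}"
        by (intro set_integral_diff(1) F_int(1) L Lw)
      show "AE \<tau> in lebesgue. \<tau> \<in> {s..t} \<longrightarrow> \<bar>F (iter_partial vs \<phi>) \<tau> - F (iter_partial ws \<phi>) \<tau>\<bar> \<le> 0"
        using bd by eventually_elim (use F_eq[OF _ L] F_eq[OF _ Lw] weakly_boundedD(3)[OF _ a eq] in force)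
    qed
    moreover have "integral {s..t} (\<lambda>\<tau>. F (iter_partial vs \<phi>) \<tau> - F (iter_partial ws \<phi>) \<tau>) =
        integral {s..t} (F (iter_partial vs \<phi>)) - integral {s..t} (F (iter_partial ws \<phi>))"
      using F_int(1)[OF L] F_int(1)[OF Lw] by (intro integral_diff) (auto simp: absolutely_integrable_on_def)
    ultimately show "L2_inner \<Omega> ?d (iter_partial vs \<phi>) = L2_inner \<Omega> ?d (iter_partial ws \<phi>)"
      by (simp add: F_int(2)[OF L] F_int(2)[OF Lw])
  qed
qed

lemma sobolev_tendsto_nrm:
  assumes "\<And>\<tau>. \<tau> \<in> I \<Longrightarrow> v \<tau> \<in> sobolev \<Omega> s" "w \<in> sobolev \<Omega> s"
    and "((\<lambda>\<tau>. sobolev_norm \<Omega> s (\<lambda>x. v \<tau> x - w x)) \<longlongrightarrow> 0) (at t within I)"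
  shows "((\<lambda>\<tau>. semi_inner.nrm (ipH s) (v \<tau> - w)) \<longlongrightarrow> 0) (at t within I)"
proof (rule Lim_transform_eventually[OF assms(3)])
  have "sobolev_norm \<Omega> s (\<lambda>x. v \<tau> x - w x) = semi_inner.nrm (ipH s) (v \<tau> - w)" if "\<tau> \<in> I" for \<tau>
    unfolding nrmH_eq[OF subspace_diff[OF subspace_sobolev assms(1)[OF that] assms(2)]]
    by (simp only: fun_diff_def)
  then show "\<forall>\<^sub>F \<tau> in at t within I. sobolev_norm \<Omega> s (\<lambda>x. v \<tau> x - w x) = semi_inner.nrm (ipH s) (v \<tau> - w)"
    by (auto simp: eventually_at_filter)
qed

lemma continuous_on_sobolev_0D:
  assumes "continuous_on_sobolev \<Omega> 0 I v"
  shows "t \<in> I \<Longrightarrow> v t \<in> L2 \<Omega>"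
    and "t \<in> I \<Longrightarrow> ((\<lambda>\<tau>. L2.nrm (v \<tau> - v t)) \<longlongrightarrow> 0) (at t within I)"
    and "\<psi> \<in> L2 \<Omega> \<Longrightarrow> continuous_on I (\<lambda>t. L2_inner \<Omega> (v t) \<psi>)"
proof -
  show L: "v t \<in> L2 \<Omega>" if "t \<in> I" for t
    using assms that by (auto simp: continuous_on_sobolev_def sobolev_0)
  show lim: "((\<lambda>\<tau>. L2.nrm (v \<tau> - v t)) \<longlongrightarrow> 0) (at t within I)" if t: "t \<in> I" for t
  proof -
    have "((\<lambda>\<tau>. sobolev_norm \<Omega> 0 (\<lambda>x. v \<tau> x - v t x)) \<longlongrightarrow> 0) (at t within I)"
      using assms t by (simp add: continuous_on_sobolev_def)
    moreover have "sobolev_norm \<Omega> 0 (\<lambda>x. v \<tau> x - v t x) = L2.nrm (v \<tau> - v t)" if "\<tau> \<in> I" for \<tau>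
      using sobolev_norm_0[OF L2_diff[OF L[OF that] L[OF t]]] L2_nrm_eq[OF L2_diff[OF L[OF that] L[OF t]]]
      by (simp only: fun_diff_def)
    then have "\<forall>\<^sub>F \<tau> in at t within I. sobolev_norm \<Omega> 0 (\<lambda>x. v \<tau> x - v t x) = L2.nrm (v \<tau> - v t)"
      by (auto simp: eventually_at_filter)
    ultimately show ?thesis by (rule Lim_transform_eventually)
  qed
  show "continuous_on I (\<lambda>t. L2_inner \<Omega> (v t) \<psi>)" if \<psi>: "\<psi> \<in> L2 \<Omega>"
    unfolding continuous_on_def
  proof
    fix t assume t: "t \<in> I"
    show "((\<lambda>t. L2_inner \<Omega> (v t) \<psi>) \<longlongrightarrow> L2_inner \<Omega> (v t) \<psi>) (at t within I)"
      by (rule L2_inner_tendsto[OF L L[OF t] \<psi> _ lim[OF t]]) (auto simp: eventually_at_filter)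
  qed
qed

lemma Linfty_sobolev_bound:
  assumes "v \<in> Linfty_sobolev T \<Omega> s"
  obtains M where "0 \<le> M" "AE t in lebesgue_on {0<..<T}. v t \<in> sobolev \<Omega> s \<and> sobolev_norm \<Omega> s (v t) \<le> M"
proof -
  let ?E = "Linfty_norm T \<Omega> s v"
  have AE1: "AE t in lebesgue_on {0<..<T}. v t \<in> sobolev \<Omega> s" and fin: "?E < \<infinity>"
    using assms by (auto simp: Linfty_sobolev_def)
  have AE2: "AE t in lebesgue_on {0<..<T}. ereal (sobolev_norm \<Omega> s (v t)) \<le> ?E"
    unfolding Linfty_norm_def by (rule esssup_AE)
  show ?thesis
  proof (rule that[of "max 0 (real_of_ereal ?E)"])
    show "AE t in lebesgue_on {0<..<T}. v t \<in> sobolev \<Omega> s \<and> sobolev_norm \<Omega> s (v t) \<le> max 0 (real_of_ereal ?E)"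
      using AE1 AE2
    proof eventually_elim
      case (elim t)
      then show ?case using fin by (cases ?E) auto
    qed
  qed simp
qed

end

locale regular_solution = domain +
  fixes T :: real and r :: nat and u u\<^sub>t u\<^sub>t\<^sub>t :: "real \<Rightarrow> 'a \<Rightarrow> real" and u0 v0 :: "'a \<Rightarrow> real"
  assumes T: "0 < T" and r: "1 \<le> r"
    and u0: "u0 \<in> sobolev \<Omega> r" and v0: "v0 \<in> sobolev \<Omega> r"
    and u_cont: "continuous_on_sobolev \<Omega> 0 {0..<T} u"
    and ut_cont: "continuous_on_sobolev \<Omega> 0 {0..<T} u\<^sub>t"
    and u_weak: "has_weak_time_derivative T \<Omega> u u\<^sub>t"
    and ut_weak: "has_weak_time_derivative T \<Omega> u\<^sub>t u\<^sub>t\<^sub>t"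
    and utt: "u\<^sub>t\<^sub>t \<in> Linfty_sobolev T \<Omega> r"
    and u_H1_0: "AE t in lebesgue_on {0<..<T}. u t \<in> H1_0 \<Omega>"
    and u_init: "AE x in leb. u 0 x = u0 x"
    and ut_init: "AE x in leb. u\<^sub>t 0 x = v0 x"
begin

lemmas u_L2 = continuous_on_sobolev_0D(1)[OF u_cont]
lemmas ut_L2 = continuous_on_sobolev_0D(1)[OF ut_cont]

lemma Ioo_Ico_continuous:
  assumes "continuous_on_sobolev \<Omega> 0 {0..<T} v" "\<psi> \<in> L2 \<Omega>"
  shows "continuous_on {0<..<T} (\<lambda>t. L2_inner \<Omega> (v t) \<psi>)"
  by (rule continuous_on_subset[OF continuous_on_sobolev_0D(3)[OF assms]]) auto

lemma at_right_0:
  assumes "0 < (t :: real)"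
  shows "at_right 0 \<le> at 0 within {0..<T}" "\<forall>\<^sub>F s in at_right 0. s \<in> {0<..<t}"
proof -
  have "at_right 0 = at 0 within {0..T / 2}" using T by (simp add: at_within_Icc_at_right)
  also have "\<dots> \<le> at 0 within {0..<T}" using T by (intro at_le) auto
  finally show "at_right 0 \<le> at 0 within {0..<T}" .
  show "\<forall>\<^sub>F s in at_right 0. s \<in> {0<..<t}" using assms by (rule eventually_at_right_real)
qed

text \<open>The almost-everywhere bound on the second derivative is integrated from a positive time
  s. Time 0 is reached by letting s tend to 0, using continuity of the first derivative with values
  in L^2.\<close>

lemma ut_weakly_lipschitz:
  obtains M where "0 \<le> M"
    "\<And>s t. 0 \<le> s \<Longrightarrow> s < t \<Longrightarrow> t < T \<Longrightarrow> weakly_bounded r (u\<^sub>t t - u\<^sub>t s) (M * (t - s))"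
proof -
  obtain M where M: "0 \<le> M" "AE t in lebesgue_on {0<..<T}. u\<^sub>t\<^sub>t t \<in> sobolev \<Omega> r \<and> sobolev_norm \<Omega> r (u\<^sub>t\<^sub>t t) \<le> M"
    by (rule Linfty_sobolev_bound[OF utt])
  have AE: "AE t in lebesgue. t \<in> {0<..<T} \<longrightarrow> weakly_bounded r (u\<^sub>t\<^sub>t t) M"
    using M(2)[unfolded AE_lebesgue_on_iff[OF Ioo_lebesgue]]
    by eventually_elim (auto intro: sobolev_weakly_bounded)
  have inner: "weakly_bounded r (u\<^sub>t t - u\<^sub>t s) (M * (t - s))" if st: "0 < s" "s < t" "t < T" for s t
  proof -
    have zero: "(0 :: 'a \<Rightarrow> real) \<in> L2 \<Omega>" by (rule subspace_0[OF subspace_L2])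
    have "weakly_bounded r (u\<^sub>t t - u\<^sub>t s - (t - s) *\<^sub>R 0) (M * (t - s))"
    proof (rule weak_time_derivative_weakly_bounded[OF _ _ ut_weak _ _ _ zero])
      show "AE \<tau> in lebesgue. \<tau> \<in> {s..t} \<longrightarrow> weakly_bounded r (u\<^sub>t\<^sub>t \<tau> - 0) M"
        using AE by eventually_elim (use st in auto)
    qed (use st ut_L2 Ioo_Ico_continuous[OF ut_cont] in auto)
    then show ?thesis by (simp only: scaleR_zero_right diff_zero)
  qed
  have "weakly_bounded r (u\<^sub>t t - u\<^sub>t s) (M * (t - s))" if st: "0 \<le> s" "s < t" "t < T" for s t
  proof (cases "s = 0")
    case True
    have t: "0 < t" "t \<in> {0..<T}" "0 \<in> {0..<T}" using st True by auto
    show ?thesis unfolding True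
    proof (rule weakly_bounded_limit[where I="{0<..<t}" and F="at_right 0" and X="\<lambda>s. u\<^sub>t t - u\<^sub>t s" and K="\<lambda>s. M * (t - s)"])
      show "weakly_bounded r (u\<^sub>t t - u\<^sub>t s) (M * (t - s))" if "s \<in> {0<..<t}" for s
        using that st by (intro inner) auto
      show "u\<^sub>t t - u\<^sub>t 0 \<in> L2 \<Omega>" by (intro L2_diff ut_L2 t)
      have "((\<lambda>s. L2.nrm (u\<^sub>t s - u\<^sub>t 0)) \<longlongrightarrow> 0) (at_right 0)"
        by (rule tendsto_mono[OF at_right_0(1)[OF t(1)] continuous_on_sobolev_0D(2)[OF ut_cont t(3)]])
      moreover have "L2.nrm (u\<^sub>t s - u\<^sub>t 0) = L2.nrm ((u\<^sub>t t - u\<^sub>t s) - (u\<^sub>t t - u\<^sub>t 0))" for s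
        using L2.nrm_diff_commute[of "u\<^sub>t s" "u\<^sub>t 0"] by (simp only: diff_diff_eq2 diff_add_eq diff_diff_add) (simp add: algebra_simps)
      ultimately show "((\<lambda>s. L2.nrm ((u\<^sub>t t - u\<^sub>t s) - (u\<^sub>t t - u\<^sub>t 0))) \<longlongrightarrow> 0) (at_right 0)" by (simp only:)
      show "((\<lambda>s. M * (t - s)) \<longlongrightarrow> M * (t - 0)) (at_right 0)" by (intro tendsto_intros)
    qed (use at_right_0(2)[OF t(1)] in auto)
  qed (use inner st in auto)
  then show ?thesis using M(1) that by blast
qed

text \<open>The derivative of the remainder is the increment of \<open>u\<^sub>t\<close> from time
  s, at most M (t - s) on [s, t]; integrating once more gives the square.\<close>

lemma u_weakly_taylor:
  assumes "0 \<le> M"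
    and lip: "\<And>s t. 0 \<le> s \<Longrightarrow> s < t \<Longrightarrow> t < T \<Longrightarrow> weakly_bounded r (u\<^sub>t t - u\<^sub>t s) (M * (t - s))"
    and st: "0 \<le> s" "s < t" "t < T"
  shows "weakly_bounded r (u t - u s - (t - s) *\<^sub>R u\<^sub>t s) (M * (t - s) * (t - s))"
proof -
  have inner: "weakly_bounded r (u t - u s - (t - s) *\<^sub>R u\<^sub>t s) (M * (t - s) * (t - s))"
    if st: "0 < s" "s < t" "t < T" for s t
  proof (rule weak_time_derivative_weakly_bounded[OF _ _ u_weak])
    show "u\<^sub>t s \<in> L2 \<Omega>" using st by (intro ut_L2) auto
    \<comment> \<open>The Lipschitz bound is stated for strictly ordered times, and the single time
      s is a null set.\<close>
    have "AE \<tau> in lebesgue. \<tau> \<noteq> s" by (rule AE_completion) (rule AE_lborel_singleton)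
    then show "AE \<tau> in lebesgue. \<tau> \<in> {s..t} \<longrightarrow> weakly_bounded r (u\<^sub>t \<tau> - u\<^sub>t s) (M * (t - s))"
    proof eventually_elim
      case (elim \<tau>)
      show ?case
      proof
        assume \<tau>: "\<tau> \<in> {s..t}"
        then have w: "weakly_bounded r (u\<^sub>t \<tau> - u\<^sub>t s) (M * (\<tau> - s))" using elim st by (intro lip) auto
        show "weakly_bounded r (u\<^sub>t \<tau> - u\<^sub>t s) (M * (t - s))"
        proof (rule weakly_boundedI[OF weakly_boundedD(1)[OF w] _ weakly_boundedD(3)[OF w]])
          fix vs :: "'a list" and \<phi> assume a: "set vs \<subseteq> Basis" "length vs \<le> r" "\<phi> \<in> test_functions \<Omega>"
          have "M * (\<tau> - s) * L2_norm \<Omega> \<phi> \<le> M * (t - s) * L2_norm \<Omega> \<phi>"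
            using \<tau> \<open>0 \<le> M\<close> by (intro mult_right_mono mult_left_mono) auto
          with weakly_boundedD(2)[OF w a]
          show "\<bar>L2_inner \<Omega> (u\<^sub>t \<tau> - u\<^sub>t s) (iter_partial vs \<phi>)\<bar> \<le> M * (t - s) * L2_norm \<Omega> \<phi>" by linarith
        qed
      qed
    qed
  qed (use st u_L2 Ioo_Ico_continuous[OF u_cont] in auto)
  show ?thesis
  proof (cases "s = 0")
    case True
    have t: "0 < t" "t \<in> {0..<T}" "0 \<in> {0..<T}" using st True by auto
    show ?thesis unfolding True
    proof (rule weakly_bounded_limit[where I="{0<..<t}" and F="at_right 0"
          and X="\<lambda>s. u t - u s - (t - s) *\<^sub>R u\<^sub>t s" and K="\<lambda>s. M * (t - s) * (t - s)"])
      show "weakly_bounded r (u t - u s - (t - s) *\<^sub>R u\<^sub>t s) (M * (t - s) * (t - s))" if "s \<in> {0<..<t}" for s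
        using that st by (intro inner) auto
      show "u t - u 0 - (t - 0) *\<^sub>R u\<^sub>t 0 \<in> L2 \<Omega>"
        by (intro L2_diff ut_L2 u_L2 subspace_scale[OF subspace_L2] t)
      note lim_u = tendsto_mono[OF at_right_0(1)[OF t(1)] continuous_on_sobolev_0D(2)[OF u_cont t(3)]]
      note lim_ut = tendsto_mono[OF at_right_0(1)[OF t(1)] continuous_on_sobolev_0D(2)[OF ut_cont t(3)]]
      have "((\<lambda>s. L2.nrm (u s - u 0) + (\<bar>t - s\<bar> * L2.nrm (u\<^sub>t s - u\<^sub>t 0) + \<bar>s\<bar> * L2.nrm (u\<^sub>t 0))) \<longlongrightarrow>
          0 + (\<bar>t - 0\<bar> * 0 + \<bar>0\<bar> * L2.nrm (u\<^sub>t 0))) (at_right 0)"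
        by (intro tendsto_intros lim_u lim_ut)
      then have null: "((\<lambda>s. L2.nrm (u s - u 0) + (\<bar>t - s\<bar> * L2.nrm (u\<^sub>t s - u\<^sub>t 0) + \<bar>s\<bar> * L2.nrm (u\<^sub>t 0))) \<longlongrightarrow> 0) (at_right 0)"
        by simp
      show "((\<lambda>s. L2.nrm ((u t - u s - (t - s) *\<^sub>R u\<^sub>t s) - (u t - u 0 - (t - 0) *\<^sub>R u\<^sub>t 0))) \<longlongrightarrow> 0) (at_right 0)"
      proof (rule Lim_null_comparison[OF always_eventually null], rule allI)
        fix s :: real
        have eq: "(u t - u s - (t - s) *\<^sub>R u\<^sub>t s) - (u t - u 0 - (t - 0) *\<^sub>R u\<^sub>t 0) =
            (- 1) *\<^sub>R (u s - u 0) + ((- (t - s)) *\<^sub>R (u\<^sub>t s - u\<^sub>t 0) + s *\<^sub>R u\<^sub>t 0)"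
          by (rule ext) (simp add: algebra_simps)
        have "L2.nrm ((u t - u s - (t - s) *\<^sub>R u\<^sub>t s) - (u t - u 0 - (t - 0) *\<^sub>R u\<^sub>t 0)) \<le>
            L2.nrm ((- 1) *\<^sub>R (u s - u 0)) + (L2.nrm ((- (t - s)) *\<^sub>R (u\<^sub>t s - u\<^sub>t 0)) + L2.nrm (s *\<^sub>R u\<^sub>t 0))"
          unfolding eq using L2.nrm_triangle[of "(- 1) *\<^sub>R (u s - u 0)" "(- (t - s)) *\<^sub>R (u\<^sub>t s - u\<^sub>t 0) + s *\<^sub>R u\<^sub>t 0"]
            L2.nrm_triangle[of "(- (t - s)) *\<^sub>R (u\<^sub>t s - u\<^sub>t 0)" "s *\<^sub>R u\<^sub>t 0"] by linarith
        also have "\<dots> = L2.nrm (u s - u 0) + (\<bar>t - s\<bar> * L2.nrm (u\<^sub>t s - u\<^sub>t 0) + \<bar>s\<bar> * L2.nrm (u\<^sub>t 0))"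
          unfolding L2.nrm_scale abs_minus_cancel by simp
        finally show "norm (L2.nrm ((u t - u s - (t - s) *\<^sub>R u\<^sub>t s) - (u t - u 0 - (t - 0) *\<^sub>R u\<^sub>t 0))) \<le>
            L2.nrm (u s - u 0) + (\<bar>t - s\<bar> * L2.nrm (u\<^sub>t s - u\<^sub>t 0) + \<bar>s\<bar> * L2.nrm (u\<^sub>t 0))"
          unfolding real_norm_def abs_of_nonneg[OF L2.nrm_nonneg] .
      qed
      show "((\<lambda>s. M * (t - s) * (t - s)) \<longlongrightarrow> M * (t - 0) * (t - 0)) (at_right 0)" by (intro tendsto_intros)
    qed (use at_right_0(2)[OF t(1)] in auto)
  qed (use inner st in auto)
qed

definition "nr = semi_inner.nrm (ipH r)"

sublocale Hr: semi_inner "ipH r"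
  rewrites "semi_inner.nrm (ipH r) = nr"
  by (rule semi_inner_ipH) (simp add: nr_def)

lemma nr_eq: "f \<in> sobolev \<Omega> r \<Longrightarrow> nr f = sobolev_norm \<Omega> r f"
  unfolding nr_def by (rule nrmH_eq)

lemma H1_le_nr: "f \<in> sobolev \<Omega> r \<Longrightarrow> H1.nrm f \<le> nr f"
  using sobolev_norm_mono[OF r, of f] sobolev_mono[OF r, of f] by (simp only: nr_eq H1_nrm_eq)

text \<open>Increments lie in H^r by the weak bounds, and values do because the initial data lie
  there. The boundary condition reaches every time through closedness of \<open>H1_0\<close>, and
  reaches \<open>u\<^sub>t\<close> because the Taylor bound makes difference quotients of
  \<open>u\<close> converge to it.\<close>

theorem regularity:
  obtains M where "0 \<le> M"
    "\<And>t. t \<in> {0..<T} \<Longrightarrow> u t \<in> H1_0 \<Omega> \<inter> sobolev \<Omega> r" "\<And>t. t \<in> {0..<T} \<Longrightarrow> u\<^sub>t t \<in> H1_0 \<Omega> \<inter> sobolev \<Omega> r"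
    "\<And>t. t \<in> {0..<T} \<Longrightarrow> nr (u t) \<le> M" "\<And>t. t \<in> {0..<T} \<Longrightarrow> nr (u\<^sub>t t) \<le> M"
    "\<And>s t. s \<in> {0..<T} \<Longrightarrow> t \<in> {0..<T} \<Longrightarrow> nr (u t - u s) \<le> M * \<bar>t - s\<bar>"
    "\<And>s t. s \<in> {0..<T} \<Longrightarrow> t \<in> {0..<T} \<Longrightarrow> nr (u\<^sub>t t - u\<^sub>t s) \<le> M * \<bar>t - s\<bar>"
    "\<And>s t. s \<in> {0..<T} \<Longrightarrow> t \<in> {0..<T} \<Longrightarrow> nr (u t - u s - (t - s) *\<^sub>R u\<^sub>t s) \<le> M * \<bar>t - s\<bar> * \<bar>t - s\<bar>"
proof -
  obtain M0 where M0: "0 \<le> M0"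
    "\<And>s t. 0 \<le> s \<Longrightarrow> s < t \<Longrightarrow> t < T \<Longrightarrow> weakly_bounded r (u\<^sub>t t - u\<^sub>t s) (M0 * (t - s))"
    by (rule ut_weakly_lipschitz) (rule that)
  define M1 where "M1 = sqrt (card (multi_indices r :: 'a multiset set)) * M0"
  have M1: "0 \<le> M1" using M0(1) by (simp add: M1_def)
  note sub_diff = subspace_diff[OF subspace_sobolev] and sub_add = subspace_add[OF subspace_sobolev]
    and sub_scale = subspace_scale[OF subspace_sobolev]
  have ut1: "u\<^sub>t t - u\<^sub>t s \<in> sobolev \<Omega> r \<and> nr (u\<^sub>t t - u\<^sub>t s) \<le> M1 * (t - s)" if "0 \<le> s" "s < t" "t < T" for s t
    using weakly_bounded_sobolev[OF M0(2)[OF that]] that M0(1) by (simp add: nr_eq M1_def mult.assoc)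
  have u1: "u t - u s - (t - s) *\<^sub>R u\<^sub>t s \<in> sobolev \<Omega> r \<and> nr (u t - u s - (t - s) *\<^sub>R u\<^sub>t s) \<le> M1 * (t - s) * (t - s)"
    if "0 \<le> s" "s < t" "t < T" for s t
    using weakly_bounded_sobolev[OF u_weakly_taylor[OF M0 that]] that M0(1) by (simp add: nr_eq M1_def mult.assoc)
  have zero_in: "0 \<in> {0..<T}" using T by simp
  have ut0: "u\<^sub>t 0 \<in> sobolev \<Omega> r"
    by (rule sobolev_cong_AE[OF v0 ut_L2[OF zero_in]]) (use ut_init in \<open>auto elim: eventually_mono\<close>)
  have u0': "u 0 \<in> sobolev \<Omega> r"
    by (rule sobolev_cong_AE[OF u0 u_L2[OF zero_in]]) (use u_init in \<open>auto elim: eventually_mono\<close>)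
  have ut_in: "u\<^sub>t t \<in> sobolev \<Omega> r" if t: "t \<in> {0..<T}" for t
  proof (cases "t = 0")
    case False
    then have "(u\<^sub>t t - u\<^sub>t 0) + u\<^sub>t 0 \<in> sobolev \<Omega> r" using ut1[of 0 t] t by (intro sub_add ut0) auto
    then show ?thesis by (simp only: diff_add_cancel)
  qed (simp add: ut0)
  have u_in: "u t \<in> sobolev \<Omega> r" if t: "t \<in> {0..<T}" for t
  proof (cases "t = 0")
    case False
    then have "(u t - u 0 - (t - 0) *\<^sub>R u\<^sub>t 0) + (t - 0) *\<^sub>R u\<^sub>t 0 + u 0 \<in> sobolev \<Omega> r"
      using u1[of 0 t] t by (intro sub_add ut0 u0' sub_scale) auto
    then show ?thesis by (simp only: diff_add_cancel)
  qed (simp add: u0')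
  have ut_lip: "nr (u\<^sub>t t - u\<^sub>t s) \<le> M1 * \<bar>t - s\<bar>" if "s \<in> {0..<T}" "t \<in> {0..<T}" for s t
    using ut1[of s t] ut1[of t s] that Hr.nrm_diff_commute[of "u\<^sub>t t" "u\<^sub>t s"]
    by (cases s t rule: linorder_cases) auto
  have u_taylor: "nr (u t - u s - (t - s) *\<^sub>R u\<^sub>t s) \<le> 2 * M1 * \<bar>t - s\<bar> * \<bar>t - s\<bar>"
    if st: "s \<in> {0..<T}" "t \<in> {0..<T}" for s t
  proof (cases s t rule: linorder_cases)
    case less
    have "0 \<le> M1 * (t - s) * (t - s)" using M1 less by simp
    then show ?thesis using u1[of s t] st less by simp
  next
    case greater
    \<comment> \<open>Backward in time the expansion is made around t instead of s. This costs the
      increment of \<open>u\<^sub>t\<close>, whence the factor 2.\<close>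
    have "u t - u s - (t - s) *\<^sub>R u\<^sub>t s = (s - t) *\<^sub>R (u\<^sub>t s - u\<^sub>t t) - (u s - u t - (s - t) *\<^sub>R u\<^sub>t t)"
      by (rule ext) (simp add: algebra_simps)
    then have "nr (u t - u s - (t - s) *\<^sub>R u\<^sub>t s) \<le> \<bar>s - t\<bar> * nr (u\<^sub>t s - u\<^sub>t t) + nr (u s - u t - (s - t) *\<^sub>R u\<^sub>t t)"
      using Hr.nrm_triangle_diff[of "(s - t) *\<^sub>R (u\<^sub>t s - u\<^sub>t t)" "u s - u t - (s - t) *\<^sub>R u\<^sub>t t"]
      by (simp only: Hr.nrm_scale)
    also have "\<dots> \<le> \<bar>s - t\<bar> * (M1 * \<bar>s - t\<bar>) + M1 * (s - t) * (s - t)"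
      using ut_lip[OF st(2,1)] u1[of t s] st greater by (intro add_mono mult_left_mono) auto
    also have "\<dots> = 2 * M1 * \<bar>t - s\<bar> * \<bar>t - s\<bar>" using greater by (simp add: algebra_simps)
    finally show ?thesis .
  qed simp
  define M2 where "M2 = nr (u\<^sub>t 0) + M1 * T"
  have M2: "0 \<le> M2" using M1 T by (simp add: M2_def)
  have ut_bd: "nr (u\<^sub>t t) \<le> M2" if t: "t \<in> {0..<T}" for t
  proof -
    have "nr (u\<^sub>t t) \<le> nr (u\<^sub>t t - u\<^sub>t 0) + nr (u\<^sub>t 0)"
      using Hr.nrm_triangle[of "u\<^sub>t t - u\<^sub>t 0" "u\<^sub>t 0"] by (simp only: diff_add_cancel)
    also have "nr (u\<^sub>t t - u\<^sub>t 0) \<le> M1 * T"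
      by (rule order_trans[OF ut_lip[OF zero_in t] mult_left_mono]) (use t M1 in auto)
    finally show ?thesis by (simp add: M2_def)
  qed
  define M3 where "M3 = M2 + 2 * M1 * T"
  have M3: "0 \<le> M3" using M1 M2 T by (simp add: M3_def)
  have u_lip: "nr (u t - u s) \<le> M3 * \<bar>t - s\<bar>" if st: "s \<in> {0..<T}" "t \<in> {0..<T}" for s t
  proof -
    have "nr (u t - u s) \<le> nr (u t - u s - (t - s) *\<^sub>R u\<^sub>t s) + nr ((t - s) *\<^sub>R u\<^sub>t s)"
      using Hr.nrm_triangle[of "u t - u s - (t - s) *\<^sub>R u\<^sub>t s" "(t - s) *\<^sub>R u\<^sub>t s"] by (simp only: diff_add_cancel)
    also have "\<dots> \<le> 2 * M1 * \<bar>t - s\<bar> * \<bar>t - s\<bar> + \<bar>t - s\<bar> * M2"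
      unfolding Hr.nrm_scale using u_taylor[OF st] ut_bd[OF st(1)] by (intro add_mono mult_left_mono) auto
    also have "\<dots> \<le> 2 * M1 * \<bar>t - s\<bar> * T + \<bar>t - s\<bar> * M2"
      using st M1 by (intro add_right_mono mult_left_mono) auto
    also have "\<dots> = M3 * \<bar>t - s\<bar>" by (simp add: M3_def algebra_simps)
    finally show ?thesis .
  qed
  define M4 where "M4 = nr (u 0) + M3 * T"
  have u_bd: "nr (u t) \<le> M4" if t: "t \<in> {0..<T}" for t
  proof -
    have "nr (u t) \<le> nr (u t - u 0) + nr (u 0)"
      using Hr.nrm_triangle[of "u t - u 0" "u 0"] by (simp only: diff_add_cancel)
    also have "nr (u t - u 0) \<le> M3 * T"
      by (rule order_trans[OF u_lip[OF zero_in t] mult_left_mono]) (use t M3 in auto)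
    finally show ?thesis by (simp add: M4_def)
  qed
  have u_H: "u s \<in> H1_0 \<Omega>" if s: "s \<in> {0..<T}" for s
  proof (rule H1_0_closed)
    show "u s \<in> sobolev \<Omega> 1" by (rule sobolev_mono[OF r u_in[OF s]])
    fix \<epsilon> :: real assume "0 < \<epsilon>"
    \<comment> \<open>A time at which the boundary condition is known is sought so close to s that
      the Lipschitz bound stays below \<epsilon>; M3 + 1 avoids division by zero.\<close>
    define d where "d = min (T - s) (\<epsilon> / (M3 + 1))"
    have d: "0 < d" using s \<open>0 < \<epsilon>\<close> M3 by (simp add: d_def)
    have "s + d \<le> T" using min.cobounded1[of "T - s" "\<epsilon> / (M3 + 1)"] unfolding d_def by linarith
    then obtain t where t: "t \<in> {s<..<s + d}" "u t \<in> H1_0 \<Omega>"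
      using AE_interval_exists[OF u_H1_0, of s "s + d"] s d by auto
    have tT: "t \<in> {0..<T}" using t(1) s by (auto simp: d_def)
    have "H1.nrm (u s - u t) \<le> nr (u s - u t)" by (rule H1_le_nr[OF sub_diff[OF u_in[OF s] u_in[OF tT]]])
    also have "\<dots> \<le> M3 * \<bar>s - t\<bar>" by (rule u_lip[OF tT s])
    also have "\<dots> \<le> (M3 + 1) * \<bar>s - t\<bar>" by (intro mult_right_mono) auto
    also have "\<dots> < (M3 + 1) * (\<epsilon> / (M3 + 1))"
      using t(1) M3 by (intro mult_strict_left_mono) (auto simp: d_def)
    also have "\<dots> = \<epsilon>" using M3 by simp
    finally show "\<exists>g\<in>H1_0 \<Omega>. H1.nrm (u s - g) < \<epsilon>" using t(2) by blast
  qed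
  have ut_H: "u\<^sub>t s \<in> H1_0 \<Omega>" if s: "s \<in> {0..<T}" for s
  proof (rule H1_0_closed)
    show "u\<^sub>t s \<in> sobolev \<Omega> 1" by (rule sobolev_mono[OF r ut_in[OF s]])
    fix \<epsilon> :: real assume "0 < \<epsilon>"
    \<comment> \<open>The halves keep s + d strictly before T and d strictly below the
      threshold.\<close>
    define d where "d = min ((T - s) / 2) (\<epsilon> / (2 * M1 + 1) / 2)"
    have d: "0 < d" using s \<open>0 < \<epsilon>\<close> M1 by (simp add: d_def)
    have d2: "d < \<epsilon> / (2 * M1 + 1)"
    proof -
      define q where "q = \<epsilon> / (2 * M1 + 1)"
      have "0 < q" using \<open>0 < \<epsilon>\<close> M1 by (simp add: q_def)
      moreover have "d \<le> q / 2" unfolding d_def q_def by (rule min.cobounded2)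
      ultimately have "d < q" by linarith
      then show ?thesis by (simp add: q_def)
    qed
    have "d \<le> (T - s) / 2" unfolding d_def by (rule min.cobounded1)
    then have tT: "s + d \<in> {0..<T}" using d s by auto
    define g where "g = (1 / d) *\<^sub>R (u (s + d) - u s)"
    have g: "g \<in> H1_0 \<Omega>" "g \<in> sobolev \<Omega> r"
      unfolding g_def by (intro subspace_scale[OF subspace_H1_0] subspace_diff[OF subspace_H1_0] u_H tT s
          sub_scale sub_diff u_in)+
    have eq: "u\<^sub>t s - g = (- 1 / d) *\<^sub>R (u (s + d) - u s - ((s + d) - s) *\<^sub>R u\<^sub>t s)"
      using d by (intro ext) (simp add: g_def field_simps)
    have "H1.nrm (u\<^sub>t s - g) \<le> nr (u\<^sub>t s - g)" by (rule H1_le_nr[OF sub_diff[OF ut_in[OF s] g(2)]])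
    also have "\<dots> = (1 / d) * nr (u (s + d) - u s - ((s + d) - s) *\<^sub>R u\<^sub>t s)"
      unfolding eq Hr.nrm_scale using d by simp
    also have "\<dots> \<le> (1 / d) * (2 * M1 * \<bar>(s + d) - s\<bar> * \<bar>(s + d) - s\<bar>)"
      using d by (intro mult_left_mono u_taylor s tT) auto
    also have "\<dots> = 2 * M1 * d" using d by simp
    also have "\<dots> \<le> (2 * M1 + 1) * d" using d by simp
    also have "\<dots> < (2 * M1 + 1) * (\<epsilon> / (2 * M1 + 1))"
      using d2 M1 by (intro mult_strict_left_mono) auto
    also have "\<dots> = \<epsilon>" using M1 by simp
    finally show "\<exists>g\<in>H1_0 \<Omega>. H1.nrm (u\<^sub>t s - g) < \<epsilon>" using g(1) by blast
  qed
  define M where "M = M1 + M1 + M2 + M3 + nr (u 0) + M3 * T"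
  have "0 \<le> M3 * T" using M3 T by simp
  then have M: "0 \<le> M" "M1 \<le> M" "2 * M1 \<le> M" "M2 \<le> M" "M3 \<le> M" "M4 \<le> M"
    using M1 M2 M3 Hr.nrm_nonneg[of "u 0"] by (simp_all add: M_def M4_def)
  show ?thesis
  proof (rule that[of M])
    show "0 \<le> M" by (rule M(1))
    show "u t \<in> H1_0 \<Omega> \<inter> sobolev \<Omega> r" "u\<^sub>t t \<in> H1_0 \<Omega> \<inter> sobolev \<Omega> r" "nr (u t) \<le> M" "nr (u\<^sub>t t) \<le> M"
      if "t \<in> {0..<T}" for t
      using u_H ut_H u_in ut_in order_trans[OF u_bd M(6)] order_trans[OF ut_bd M(4)] that by auto
    fix s t assume st: "s \<in> {0..<T}" "t \<in> {0..<T}"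
    show "nr (u t - u s) \<le> M * \<bar>t - s\<bar>"
      by (rule order_trans[OF u_lip[OF st] mult_right_mono[OF M(5)]]) simp
    show "nr (u\<^sub>t t - u\<^sub>t s) \<le> M * \<bar>t - s\<bar>"
      by (rule order_trans[OF ut_lip[OF st] mult_right_mono[OF M(2)]]) simp
    show "nr (u t - u s - (t - s) *\<^sub>R u\<^sub>t s) \<le> M * \<bar>t - s\<bar> * \<bar>t - s\<bar>"
      by (rule order_trans[OF u_taylor[OF st] mult_right_mono[OF mult_right_mono[OF M(3)]]]) simp_all
  qed
qed

end

section \<open>Coefficients\<close>

text \<open>The continuous extension is bounded because the closure is compact; it is in this form
  that smoothness of the coefficients enters the estimates.\<close>

lemma Ck_closure_bounded:
  fixes f :: "'a::euclidean_space \<Rightarrow> real"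
  assumes "Ck_closure k Q f" "bounded Q" "set vs \<subseteq> Basis" "length vs \<le> k"
  obtains C where "\<And>x. x \<in> Q \<Longrightarrow> \<bar>iter_partial vs f x\<bar> \<le> C" "continuous_on Q (iter_partial vs f)"
proof -
  obtain g where g: "continuous_on (closure Q) g" "\<forall>x\<in>Q. g x = iter_partial vs f x"
    using assms by (auto simp: Ck_closure_def)
  have "compact (closure Q)" using assms(2) by simp
  then have "bounded (g ` closure Q)" using g(1) by (intro compact_imp_bounded compact_continuous_image)
  then obtain C where C: "\<forall>y\<in>g ` closure Q. norm y \<le> C" unfolding bounded_iff by blast
  have "\<bar>iter_partial vs f x\<bar> \<le> C" if "x \<in> Q" for x
    using C g(2) that closure_subset[of Q] by force
  moreover have "continuous_on Q (iter_partial vs f)"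
    using continuous_on_subset[OF g(1) closure_subset] g(2) by (simp cong: continuous_on_cong)
  ultimately show ?thesis by (rule that)
qed

context domain
begin

lemma continuous_measurable: "continuous_on \<Omega> (f :: 'a \<Rightarrow> real) \<Longrightarrow> f \<in> borel_measurable leb"
  by (rule continuous_imp_measurable_on_sets_lebesgue) auto

text \<open>Since -k_t / k^2 is the time derivative of 1/k, the single number |C| hi^2 bounds
  \<open>b_coeff\<close> and, by the mean value inequality, is a Lipschitz constant of the
  reciprocal in time, uniformly in space.\<close>

lemma reciprocal_coefficient:
  fixes k :: "real \<Rightarrow> 'a \<Rightarrow> real"
  assumes Ck: "Ck_closure 1 ({0<..<T} \<times> \<Omega>) (\<lambda>(t, x). k t x)"
    and bounds: "\<forall>t\<in>{0<..<T}. \<forall>x\<in>\<Omega>. 0 < k t x \<and> lo \<le> 1 / k t x \<and> 1 / k t x \<le> hi"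
  obtains L where "0 \<le> L"
    "\<And>t. t \<in> {0<..<T} \<Longrightarrow> (\<lambda>x. 1 / k t x) \<in> borel_measurable leb"
    "\<And>t. t \<in> {0<..<T} \<Longrightarrow> b_coeff k t \<in> borel_measurable leb"
    "\<And>t x. t \<in> {0<..<T} \<Longrightarrow> x \<in> \<Omega> \<Longrightarrow> ((\<lambda>\<tau>. 1 / k \<tau> x) has_real_derivative b_coeff k t x) (at t)"
    "\<And>t x. t \<in> {0<..<T} \<Longrightarrow> x \<in> \<Omega> \<Longrightarrow> \<bar>b_coeff k t x\<bar> \<le> L"
    "\<And>s t x. s \<in> {0<..<T} \<Longrightarrow> t \<in> {0<..<T} \<Longrightarrow> x \<in> \<Omega> \<Longrightarrow> \<bar>1 / k t x - 1 / k s x\<bar> \<le> L * \<bar>t - s\<bar>"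
proof -
  let ?Q = "{0<..<T} \<times> \<Omega>" and ?f = "\<lambda>(t, x). k t x"
  let ?e = "(1, 0) :: real \<times> 'a"
  have bQ: "bounded ?Q" by (intro bounded_Times bounded_\<Omega>) auto
  have oQ: "open ?Q" using open_\<Omega> by (intro open_Times) auto
  have e: "?e \<in> Basis" by (simp add: Basis_prod_def)
  obtain C0 where "\<And>z. z \<in> ?Q \<Longrightarrow> \<bar>iter_partial [] ?f z\<bar> \<le> C0" and k_cont: "continuous_on ?Q (iter_partial [] ?f)"
    by (rule Ck_closure_bounded[OF Ck bQ, of "[]"]) auto
  obtain C where C: "\<And>z. z \<in> ?Q \<Longrightarrow> \<bar>iter_partial [?e] ?f z\<bar> \<le> C" and k'_cont: "continuous_on ?Q (iter_partial [?e] ?f)"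
    by (rule Ck_closure_bounded[OF Ck bQ, of "[?e]"]) (use e in auto)
  define k' where "k' t x = iter_partial [?e] ?f (t, x)" for t x
  have der: "((\<lambda>\<tau>. k \<tau> x) has_real_derivative k' t x) (at t)" if "t \<in> {0<..<T}" "x \<in> \<Omega>" for t x
  proof -
    have "iter_partial [] ?f differentiable_on ?Q"
      using Ck unfolding Ck_closure_def by (auto dest: spec[of _ "[]"])
    then have "?f differentiable (at (t, x))"
      using that oQ by (simp add: differentiable_on_eq_differentiable_at)
    then have D: "(?f has_derivative frechet_derivative ?f (at (t, x))) (at (t, x))"
      by (simp add: frechet_derivative_works)
    have "((\<lambda>\<tau>. (\<tau>, x)) has_derivative (\<lambda>h. (h, 0))) (at t)"
      by (auto intro!: derivative_eq_intros)
    from has_derivative_compose[OF this D]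
    have "((\<lambda>\<tau>. k \<tau> x) has_derivative (\<lambda>h. frechet_derivative ?f (at (t, x)) (h, 0))) (at t)" by simp
    moreover have "frechet_derivative ?f (at (t, x)) (h, 0) = k' t x * h" for h
      using linear_cmul[OF has_derivative_linear[OF D], of h ?e] by (simp add: k'_def)
    ultimately show ?thesis by (simp add: has_field_derivative_def)
  qed
  have pos: "0 < k t x" "1 / k t x \<le> hi" if "t \<in> {0<..<T}" "x \<in> \<Omega>" for t x
    using bounds that by auto
  have b_eq: "b_coeff k t x = - k' t x * (1 / k t x)\<^sup>2" if "t \<in> {0<..<T}" "x \<in> \<Omega>" for t x
    using DERIV_imp_deriv[OF der[OF that]] by (simp add: b_coeff_def power_divide)
  have slice: "continuous_on \<Omega> (\<lambda>x. F (t, x))" if "continuous_on ?Q F" "t \<in> {0<..<T}" for F :: "real \<times> 'a \<Rightarrow> real" and t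
    by (rule continuous_on_compose2[OF that(1)]) (use that(2) in \<open>auto intro!: continuous_intros\<close>)
  have kc: "continuous_on \<Omega> (k t)" if "t \<in> {0<..<T}" for t using slice[OF k_cont that] by simp
  have k'c: "continuous_on \<Omega> (k' t)" if "t \<in> {0<..<T}" for t
    using slice[OF k'_cont that] by (simp add: k'_def[abs_def])
  have rc: "continuous_on \<Omega> (\<lambda>x. 1 / k t x)" if "t \<in> {0<..<T}" for t
    using pos(1)[OF that] by (intro continuous_intros kc[OF that]) force
  define L where "L = \<bar>C\<bar> * hi\<^sup>2"
  have L: "0 \<le> L" by (simp add: L_def)
  have bL: "\<bar>b_coeff k t x\<bar> \<le> L" if tx: "t \<in> {0<..<T}" "x \<in> \<Omega>" for t x
  proof -
    have "\<bar>k' t x\<bar> \<le> \<bar>C\<bar>" using C[of "(t, x)"] tx by (simp add: k'_def)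
    moreover have "(1 / k t x)\<^sup>2 \<le> hi\<^sup>2" using pos[OF tx] by (intro power_mono) auto
    ultimately have "\<bar>k' t x\<bar> * (1 / k t x)\<^sup>2 \<le> \<bar>C\<bar> * hi\<^sup>2" by (intro mult_mono) auto
    then show ?thesis unfolding b_eq[OF tx] L_def by (simp add: abs_mult)
  qed
  have rder: "((\<lambda>\<tau>. 1 / k \<tau> x) has_real_derivative b_coeff k t x) (at t)" if tx: "t \<in> {0<..<T}" "x \<in> \<Omega>" for t x
    using pos(1)[OF tx] unfolding b_eq[OF tx]
    by (auto intro!: derivative_eq_intros der[OF tx] simp: power2_eq_square)
  have lip: "\<bar>1 / k t x - 1 / k s x\<bar> \<le> L * \<bar>t - s\<bar>" if st: "s \<in> {0<..<T}" "t \<in> {0<..<T}" and x: "x \<in> \<Omega>" for s t x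
  proof -
    have "norm (1 / k t x - 1 / k s x) \<le> L * norm (t - s)"
    proof (rule field_differentiable_bound[of "{0<..<T}" "\<lambda>\<tau>. 1 / k \<tau> x" "\<lambda>\<tau>. b_coeff k \<tau> x"])
      show "((\<lambda>\<tau>. 1 / k \<tau> x) has_real_derivative b_coeff k z x) (at z within {0<..<T})" if "z \<in> {0<..<T}" for z
        using rder[OF that x] by (rule has_field_derivative_at_within)
    qed (use bL x st in auto)
    then show ?thesis by simp
  qed
  show ?thesis
  proof (rule that[OF L _ _ rder bL lip])
    show "(\<lambda>x. 1 / k t x) \<in> borel_measurable leb" if "t \<in> {0<..<T}" for t
      by (rule continuous_measurable[OF rc[OF that]])
    show "b_coeff k t \<in> borel_measurable leb" if t: "t \<in> {0<..<T}" for t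
    proof (rule continuous_measurable)
      have "continuous_on \<Omega> (\<lambda>x. - k' t x * (1 / k t x)\<^sup>2)"
        by (intro continuous_on_mult continuous_on_minus continuous_on_power k'c rc t)
      then show "continuous_on \<Omega> (b_coeff k t)" using b_eq[OF t] by (simp cong: continuous_on_cong)
    qed
  qed
qed

section \<open>Inner products with a bounded weight\<close>

lemma L2_coeff_mult:
  "f \<in> L2 \<Omega> \<Longrightarrow> a \<in> borel_measurable leb \<Longrightarrow> \<forall>x\<in>\<Omega>. \<bar>a x\<bar> \<le> C \<Longrightarrow> (\<lambda>x. a x * f x) \<in> L2 \<Omega>"
  by (rule L2_bounded_mult) auto

lemma weighted_inner_bound:
  assumes "f \<in> L2 \<Omega>" "g \<in> L2 \<Omega>" "a \<in> borel_measurable leb" "\<forall>x\<in>\<Omega>. \<bar>a x\<bar> \<le> C" "0 \<le> C"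
  shows "\<bar>L2_inner \<Omega> (\<lambda>x. a x * f x) g\<bar> \<le> C * L2_norm \<Omega> f * L2_norm \<Omega> g"
proof -
  have af: "(\<lambda>x. a x * f x) \<in> L2 \<Omega>" by (rule L2_coeff_mult[OF assms(1,3,4)])
  have "L2_norm \<Omega> (\<lambda>x. a x * f x) \<le> C * L2_norm \<Omega> f"
  proof (rule power2_le_imp_le)
    have "(L2_norm \<Omega> (\<lambda>x. a x * f x))\<^sup>2 = (LINT x|leb. (a x * f x)\<^sup>2)"
      unfolding L2_norm_sq L2_inner_def by (simp add: power2_eq_square)
    also have "\<dots> \<le> (LINT x|leb. C\<^sup>2 * (f x)\<^sup>2)"
    proof (rule integral_mono)
      show "integrable leb (\<lambda>x. (a x * f x)\<^sup>2)" by (rule L2_sq_integrable[OF af])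
      show "integrable leb (\<lambda>x. C\<^sup>2 * (f x)\<^sup>2)" by (intro integrable_mult_right L2_sq_integrable assms)
      fix x assume "x \<in> space leb"
      then have "\<bar>a x\<bar>\<^sup>2 \<le> C\<^sup>2" using assms(4) by (intro power_mono) auto
      then show "(a x * f x)\<^sup>2 \<le> C\<^sup>2 * (f x)\<^sup>2" by (simp add: power_mult_distrib mult_right_mono)
    qed
    also have "\<dots> = (C * L2_norm \<Omega> f)\<^sup>2"
      unfolding power_mult_distrib L2_norm_sq L2_inner_def by (simp add: power2_eq_square)
    finally show "(L2_norm \<Omega> (\<lambda>x. a x * f x))\<^sup>2 \<le> (C * L2_norm \<Omega> f)\<^sup>2" .
  qed (use assms in simp)
  then have "L2_norm \<Omega> (\<lambda>x. a x * f x) * L2_norm \<Omega> g \<le> C * L2_norm \<Omega> f * L2_norm \<Omega> g"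
    by (rule mult_right_mono) simp
  then show ?thesis using L2_cauchy_schwarz[OF af assms(2)] by linarith
qed

lemma weighted_inner_lower:
  assumes "f \<in> L2 \<Omega>" "a \<in> borel_measurable leb" "\<forall>x\<in>\<Omega>. \<bar>a x\<bar> \<le> C" "\<forall>x\<in>\<Omega>. lo \<le> a x"
  shows "lo * (L2_norm \<Omega> f)\<^sup>2 \<le> L2_inner \<Omega> (\<lambda>x. a x * f x) f"
proof -
  have af: "(\<lambda>x. a x * f x) \<in> L2 \<Omega>" by (rule L2_coeff_mult[OF assms(1-3)])
  have "lo * (L2_norm \<Omega> f)\<^sup>2 = (LINT x|leb. lo * (f x * f x))" by (simp add: L2_norm_sq L2_inner_def)
  also have "\<dots> \<le> (LINT x|leb. a x * f x * f x)"
  proof (rule integral_mono)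
    show "integrable leb (\<lambda>x. lo * (f x * f x))" by (intro integrable_mult_right L2_mult_integrable assms)
    show "integrable leb (\<lambda>x. a x * f x * f x)" by (rule L2_mult_integrable[OF af assms(1)])
    fix x assume "x \<in> space leb"
    then show "lo * (f x * f x) \<le> a x * f x * f x" using assms(4) by (simp add: mult.assoc mult_right_mono)
  qed
  finally show ?thesis by (simp add: L2_inner_def)
qed

lemma weighted_inner_add:
  assumes "f \<in> L2 \<Omega>" "g \<in> L2 \<Omega>" "h \<in> L2 \<Omega>" "a \<in> borel_measurable leb" "\<forall>x\<in>\<Omega>. \<bar>a x\<bar> \<le> C"
  shows "L2_inner \<Omega> (\<lambda>x. a x * (f + g) x) h = L2_inner \<Omega> (\<lambda>x. a x * f x) h + L2_inner \<Omega> (\<lambda>x. a x * g x) h"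
proof -
  have "(\<lambda>x. a x * (f + g) x) = (\<lambda>x. a x * f x) + (\<lambda>x. a x * g x)"
    by (rule ext) (simp add: distrib_left)
  then show ?thesis
    using L2_inner_add[OF L2_coeff_mult[OF assms(1,4,5)] L2_coeff_mult[OF assms(2,4,5)] assms(3)] by (simp only:)
qed

lemma weighted_inner_scaleR: "L2_inner \<Omega> (\<lambda>x. a x * (c *\<^sub>R f) x) h = c * L2_inner \<Omega> (\<lambda>x. a x * f x) h"
proof -
  have "(\<lambda>x. a x * (c *\<^sub>R f) x) = c *\<^sub>R (\<lambda>x. a x * f x)" by (rule ext) simp
  then show ?thesis by (simp only: L2_inner_scaleR)
qed

lemma weighted_inner_sym: "L2_inner \<Omega> (\<lambda>x. a x * f x) g = L2_inner \<Omega> (\<lambda>x. a x * g x) f"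
  by (simp add: L2_inner_def mult_ac)

lemma weighted_inner_diff:
  assumes "f \<in> L2 \<Omega>" "g \<in> L2 \<Omega>" "a \<in> borel_measurable leb" "\<forall>x\<in>\<Omega>. \<bar>a x\<bar> \<le> C"
    "b \<in> borel_measurable leb" "\<forall>x\<in>\<Omega>. \<bar>b x\<bar> \<le> C'"
  shows "L2_inner \<Omega> (\<lambda>x. a x * f x) g - L2_inner \<Omega> (\<lambda>x. b x * f x) g = L2_inner \<Omega> (\<lambda>x. (a x - b x) * f x) g"
proof -
  have "(\<lambda>x. (a x - b x) * f x) = (\<lambda>x. a x * f x) - (\<lambda>x. b x * f x)"
    by (rule ext) (simp add: left_diff_distrib)
  then show ?thesis
    using L2_inner_diff[OF L2_coeff_mult[OF assms(1,3,4)] L2_coeff_mult[OF assms(1,5,6)] assms(2)] by (simp only:)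
qed

lemma weighted_inner_cong_AE:
  assumes "f \<in> L2 \<Omega>" "f' \<in> L2 \<Omega>" "g \<in> L2 \<Omega>" "AE x in leb. f x = f' x"
    "a \<in> borel_measurable leb" "\<forall>x\<in>\<Omega>. \<bar>a x\<bar> \<le> C"
  shows "L2_inner \<Omega> (\<lambda>x. a x * f x) g = L2_inner \<Omega> (\<lambda>x. a x * f' x) g"
proof (rule L2_inner_cong_AE)
  show "AE x in leb. a x * f x = a x * f' x" using assms(4) by eventually_elim simp
qed (use assms L2_coeff_mult[OF assms(1,5,6)] L2_coeff_mult[OF assms(2,5,6)] in auto)

section \<open>The stiffness form\<close>

definition partial :: "'a \<Rightarrow> ('a \<Rightarrow> real) \<Rightarrow> 'a \<Rightarrow> real" where
  "partial e = weak_partial \<Omega> {#e#}"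

lemma singleton_multi_index: "e \<in> Basis \<Longrightarrow> {#e#} \<in> multi_indices 1"
  by (simp add: multi_indices_def)

lemma partial_L2: "f \<in> sobolev \<Omega> 1 \<Longrightarrow> e \<in> Basis \<Longrightarrow> partial e f \<in> L2 \<Omega>"
  unfolding partial_def by (rule weak_partial_L2[OF _ singleton_multi_index])

lemma sobolev_norm_1_sq:
  assumes "f \<in> sobolev \<Omega> 1"
  shows "(sobolev_norm \<Omega> 1 f)\<^sup>2 = (L2_norm \<Omega> f)\<^sup>2 + (\<Sum>e\<in>Basis. (L2_norm \<Omega> (partial e f))\<^sup>2)"
proof -
  have "(sobolev_norm \<Omega> 1 f)\<^sup>2 = (\<Sum>\<alpha>\<in>multi_indices 1. (L2_norm \<Omega> (weak_partial \<Omega> \<alpha> f))\<^sup>2)"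
    by (simp add: sobolev_norm_def sum_nonneg)
  also have "\<dots> = (L2_norm \<Omega> (weak_partial \<Omega> {#} f))\<^sup>2 +
      (\<Sum>\<alpha>\<in>(\<lambda>e. {#e#}) ` Basis. (L2_norm \<Omega> (weak_partial \<Omega> \<alpha> f))\<^sup>2)"
    unfolding multi_indices_1 by (rule sum.insert) auto
  also have "(\<Sum>\<alpha>\<in>(\<lambda>e. {#e#}) ` Basis. (L2_norm \<Omega> (weak_partial \<Omega> \<alpha> f))\<^sup>2) =
      (\<Sum>e\<in>Basis. (L2_norm \<Omega> (partial e f))\<^sup>2)"
    unfolding partial_def by (subst sum.reindex) (auto simp: inj_on_def)
  finally show ?thesis by (simp add: L2_norm_weak_partial_empty[OF sobolev_L2[OF assms]])
qed

text \<open>Reduces the gradient form to weighted L^2 products of the components, from which its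
  linearity and bounds are obtained.\<close>

lemma stiffness_eq:
  assumes f: "f \<in> sobolev \<Omega> 1" and g: "g \<in> sobolev \<Omega> 1"
    and a: "a \<in> borel_measurable leb" "\<forall>x\<in>\<Omega>. \<bar>a x\<bar> \<le> C"
  shows "stiffness \<Omega> a f g = (\<Sum>e\<in>Basis. L2_inner \<Omega> (\<lambda>x. a x * partial e f x) (partial e g))"
proof -
  have grad: "weak_grad \<Omega> v x \<bullet> e = partial e v x" if "e \<in> Basis" for v x e
    unfolding weak_grad_def partial_def using that by simp
  have "a x * (weak_grad \<Omega> f x \<bullet> weak_grad \<Omega> g x) = (\<Sum>e\<in>Basis. a x * partial e f x * partial e g x)" for x
    by (subst euclidean_inner) (simp add: grad sum_distrib_left mult.assoc)
  then have "stiffness \<Omega> a f g = (LINT x|leb. (\<Sum>e\<in>Basis. a x * partial e f x * partial e g x))"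
    by (simp add: stiffness_def)
  also have "\<dots> = (\<Sum>e\<in>Basis. (LINT x|leb. a x * partial e f x * partial e g x))"
    by (intro Bochner_Integration.integral_sum L2_mult_integrable L2_coeff_mult[OF _ a] partial_L2 f g)
  finally show ?thesis by (simp add: L2_inner_def)
qed

text \<open>Cauchy-Schwarz is used twice, in L^2 for each component and then over the components, so
  the constant remains \<open>C\<close> in every dimension.\<close>

lemma stiffness_bound:
  assumes f: "f \<in> sobolev \<Omega> 1" and g: "g \<in> sobolev \<Omega> 1"
    and a: "a \<in> borel_measurable leb" "\<forall>x\<in>\<Omega>. \<bar>a x\<bar> \<le> C" "0 \<le> C"
  shows "\<bar>stiffness \<Omega> a f g\<bar> \<le> C * sobolev_norm \<Omega> 1 f * sobolev_norm \<Omega> 1 g"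
proof -
  let ?n = "\<lambda>f e. L2_norm \<Omega> (partial e f)"
  have S: "L2_set (?n h) Basis \<le> sobolev_norm \<Omega> 1 h" if "h \<in> sobolev \<Omega> 1" for h
  proof (rule power2_le_imp_le)
    have "(L2_set (?n h) Basis)\<^sup>2 = (\<Sum>e\<in>Basis. (?n h e)\<^sup>2)" by (simp add: L2_set_def sum_nonneg)
    also have "\<dots> \<le> (sobolev_norm \<Omega> 1 h)\<^sup>2" unfolding sobolev_norm_1_sq[OF that] by simp
    finally show "(L2_set (?n h) Basis)\<^sup>2 \<le> (sobolev_norm \<Omega> 1 h)\<^sup>2" .
  qed simp
  have "\<bar>stiffness \<Omega> a f g\<bar> \<le> (\<Sum>e\<in>Basis. \<bar>L2_inner \<Omega> (\<lambda>x. a x * partial e f x) (partial e g)\<bar>)"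
    unfolding stiffness_eq[OF f g a(1,2)] by (rule sum_abs)
  also have "\<dots> \<le> (\<Sum>e\<in>Basis. C * (\<bar>?n f e\<bar> * \<bar>?n g e\<bar>))"
    using weighted_inner_bound[OF partial_L2[OF f] partial_L2[OF g] a] by (intro sum_mono) (simp add: mult.assoc)
  also have "\<dots> = C * (\<Sum>e\<in>Basis. \<bar>?n f e\<bar> * \<bar>?n g e\<bar>)" by (simp add: sum_distrib_left)
  also have "\<dots> \<le> C * (L2_set (?n f) Basis * L2_set (?n g) Basis)"
    by (intro mult_left_mono L2_set_mult_ineq a)
  also have "\<dots> \<le> C * (sobolev_norm \<Omega> 1 f * sobolev_norm \<Omega> 1 g)"
    by (intro mult_left_mono mult_mono S f g a) (auto simp: L2_set_nonneg)
  finally show ?thesis by (simp add: mult.assoc)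
qed

lemma stiffness_lower:
  assumes f: "f \<in> sobolev \<Omega> 1"
    and a: "a \<in> borel_measurable leb" "\<forall>x\<in>\<Omega>. \<bar>a x\<bar> \<le> C" "\<forall>x\<in>\<Omega>. lo \<le> a x"
  shows "lo * (sobolev_norm \<Omega> 1 f)\<^sup>2 \<le> stiffness \<Omega> a f f + lo * (L2_norm \<Omega> f)\<^sup>2"
proof -
  have "lo * (\<Sum>e\<in>Basis. (L2_norm \<Omega> (partial e f))\<^sup>2) \<le> stiffness \<Omega> a f f"
    unfolding stiffness_eq[OF f f a(1,2)] sum_distrib_left
    by (intro sum_mono weighted_inner_lower[OF partial_L2[OF f] a])
  then show ?thesis unfolding sobolev_norm_1_sq[OF f] by (simp add: distrib_left)
qed

lemma stiffness_add:
  assumes f: "f \<in> sobolev \<Omega> 1" and g: "g \<in> sobolev \<Omega> 1" and h: "h \<in> sobolev \<Omega> 1"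
    and a: "a \<in> borel_measurable leb" "\<forall>x\<in>\<Omega>. \<bar>a x\<bar> \<le> C"
  shows "stiffness \<Omega> a (f + g) h = stiffness \<Omega> a f h + stiffness \<Omega> a g h"
proof -
  have fg: "f + g \<in> sobolev \<Omega> 1" by (rule subspace_add[OF subspace_sobolev f g])
  have "L2_inner \<Omega> (\<lambda>x. a x * partial e (f + g) x) (partial e h) =
      L2_inner \<Omega> (\<lambda>x. a x * partial e f x) (partial e h) + L2_inner \<Omega> (\<lambda>x. a x * partial e g x) (partial e h)"
    if e: "e \<in> Basis" for e
  proof -
    note L = partial_L2[OF f e] partial_L2[OF g e] partial_L2[OF h e]
    have "L2_inner \<Omega> (\<lambda>x. a x * partial e (f + g) x) (partial e h) =
        L2_inner \<Omega> (\<lambda>x. a x * (partial e f + partial e g) x) (partial e h)"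
      using weak_partial_add[OF f g singleton_multi_index[OF e]]
      by (intro weighted_inner_cong_AE[OF partial_L2[OF fg e] subspace_add[OF subspace_L2 L(1,2)] L(3) _ a])
        (simp only: partial_def)
    also note weighted_inner_add[OF L a]
    finally show ?thesis .
  qed
  then show ?thesis
    unfolding stiffness_eq[OF fg h a] stiffness_eq[OF f h a] stiffness_eq[OF g h a]
    by (simp add: sum.distrib)
qed

lemma stiffness_scaleR:
  assumes f: "f \<in> sobolev \<Omega> 1" and h: "h \<in> sobolev \<Omega> 1"
    and a: "a \<in> borel_measurable leb" "\<forall>x\<in>\<Omega>. \<bar>a x\<bar> \<le> C"
  shows "stiffness \<Omega> a (c *\<^sub>R f) h = c * stiffness \<Omega> a f h"
proof -
  have cf: "c *\<^sub>R f \<in> sobolev \<Omega> 1" by (rule subspace_scale[OF subspace_sobolev f])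
  have "L2_inner \<Omega> (\<lambda>x. a x * partial e (c *\<^sub>R f) x) (partial e h) =
      c * L2_inner \<Omega> (\<lambda>x. a x * partial e f x) (partial e h)"
    if e: "e \<in> Basis" for e
  proof -
    have "L2_inner \<Omega> (\<lambda>x. a x * partial e (c *\<^sub>R f) x) (partial e h) =
        L2_inner \<Omega> (\<lambda>x. a x * (c *\<^sub>R partial e f) x) (partial e h)"
      using weak_partial_scaleR[OF f singleton_multi_index[OF e]]
      by (intro weighted_inner_cong_AE[OF partial_L2[OF cf e] subspace_scale[OF subspace_L2 partial_L2[OF f e]] partial_L2[OF h e] _ a])
        (simp only: partial_def)
    also note weighted_inner_scaleR
    finally show ?thesis .
  qed
  then show ?thesis
    unfolding stiffness_eq[OF cf h a] stiffness_eq[OF f h a] by (simp add: sum_distrib_left)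
qed

lemma stiffness_sym: "stiffness \<Omega> a f g = stiffness \<Omega> a g f"
  unfolding stiffness_def by (simp add: inner_commute)

lemma stiffness_diff_coeff:
  assumes f: "f \<in> sobolev \<Omega> 1" and g: "g \<in> sobolev \<Omega> 1"
    and a: "a \<in> borel_measurable leb" "\<forall>x\<in>\<Omega>. \<bar>a x\<bar> \<le> C"
    and b: "b \<in> borel_measurable leb" "\<forall>x\<in>\<Omega>. \<bar>b x\<bar> \<le> C"
  shows "stiffness \<Omega> a f g - stiffness \<Omega> b f g = stiffness \<Omega> (\<lambda>x. a x - b x) f g"
proof -
  have ab1: "(\<lambda>x. a x - b x) \<in> borel_measurable leb" by (intro borel_measurable_diff a b)
  have ab2: "\<forall>x\<in>\<Omega>. \<bar>a x - b x\<bar> \<le> C + C"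
  proof
    fix x assume "x \<in> \<Omega>"
    then show "\<bar>a x - b x\<bar> \<le> C + C"
      using abs_triangle_ineq4[of "a x" "b x"] a(2) b(2) by fastforce
  qed
  show ?thesis
    unfolding stiffness_eq[OF f g a] stiffness_eq[OF f g b] stiffness_eq[OF f g ab1 ab2] sum_subtractf[symmetric]
    by (intro sum.cong refl weighted_inner_diff[OF partial_L2[OF f] partial_L2[OF g] a b])
qed

end

section \<open>Projection and weighted forms\<close>

context semi_inner
begin

text \<open>A relation rather than a map: a semi-inner product determines the projection only up to
  vectors of seminorm zero.\<close>

definition is_projection :: "'v set \<Rightarrow> 'v \<Rightarrow> 'v \<Rightarrow> bool" where
  "is_projection S v p \<longleftrightarrow> p \<in> S \<and> (\<forall>\<xi>\<in>S. ip (v - p) \<xi> = 0)"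

lemma is_projection_diff:
  assumes "subspace S" "is_projection S v p" "is_projection S w q"
  shows "is_projection S (v - w) (p - q)"
proof -
  have "ip ((v - w) - (p - q)) \<xi> = ip (v - p) \<xi> - ip (w - q) \<xi>" for \<xi>
    by (simp add: ip_simps)
  then show ?thesis using assms by (auto simp: is_projection_def subspace_diff)
qed

lemma is_projection_scaleR:
  assumes "subspace S" "is_projection S v p"
  shows "is_projection S (c *\<^sub>R v) (c *\<^sub>R p)"
proof -
  have "ip (c *\<^sub>R v - c *\<^sub>R p) \<xi> = c * ip (v - p) \<xi>" for \<xi>
    by (simp add: ip_simps algebra_simps)
  then show ?thesis using assms by (auto simp: is_projection_def subspace_scale)
qed

lemma projection_best_approximation:
  assumes S: "subspace S" and p: "is_projection S v p" and \<xi>: "\<xi> \<in> S"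
  shows "nrm (v - p) \<le> nrm (v - \<xi>)"
proof (rule power2_le_imp_le)
  have "p - \<xi> \<in> S" using p \<xi> S by (simp add: is_projection_def subspace_diff)
  then have orth: "ip (v - p) (p - \<xi>) = 0" using p by (simp add: is_projection_def)
  have "v - \<xi> = (v - p) + (p - \<xi>)" by simp
  then have "(nrm (v - \<xi>))\<^sup>2 = ip ((v - p) + (p - \<xi>)) ((v - p) + (p - \<xi>))" by (simp only: nrm_sq)
  also have "\<dots> = ip (v - p) (v - p) + 2 * ip (v - p) (p - \<xi>) + ip (p - \<xi>) (p - \<xi>)"
    unfolding bilinear_ladd[OF bilin] bilinear_radd[OF bilin] sym[of "p - \<xi>" "v - p"] by simp
  also have "\<dots> = (nrm (v - p))\<^sup>2 + ip (p - \<xi>) (p - \<xi>)" by (simp only: orth nrm_sq)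
  finally show "(nrm (v - p))\<^sup>2 \<le> (nrm (v - \<xi>))\<^sup>2" using nonneg[of "p - \<xi>"] by simp
qed simp

lemma projection_contraction:
  assumes "is_projection S v p"
  shows "nrm p \<le> nrm v"
proof -
  have "ip (v - p) p = 0" using assms by (auto simp: is_projection_def)
  then have "ip p p = ip v p" by (simp add: ip_simps)
  also have "\<dots> \<le> nrm v * nrm p" using cauchy_schwarz[of v p] by simp
  finally have "nrm p * nrm p \<le> nrm v * nrm p" by (simp add: power2_eq_square flip: nrm_sq)
  then show ?thesis using nrm_nonneg[of p] nrm_nonneg[of v] by (cases "nrm p = 0") (auto simp: mult_le_cancel_right)
qed

end

locale wave_coeffs = domain +
  fixes T lo hi L :: real and \<kappa> \<rho> :: "real \<Rightarrow> 'a \<Rightarrow> real"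
  assumes constants: "0 < T" "0 < lo" "0 \<le> hi" "0 \<le> L"
    and \<kappa>_meas: "t \<in> {0<..<T} \<Longrightarrow> (\<lambda>x. 1 / \<kappa> t x) \<in> borel_measurable leb"
    and \<kappa>_lower: "t \<in> {0<..<T} \<Longrightarrow> \<forall>x\<in>\<Omega>. lo \<le> 1 / \<kappa> t x"
    and \<kappa>_upper: "t \<in> {0<..<T} \<Longrightarrow> \<forall>x\<in>\<Omega>. \<bar>1 / \<kappa> t x\<bar> \<le> hi"
    and \<kappa>_lip: "s \<in> {0<..<T} \<Longrightarrow> t \<in> {0<..<T} \<Longrightarrow> \<forall>x\<in>\<Omega>. \<bar>1 / \<kappa> t x - 1 / \<kappa> s x\<bar> \<le> L * \<bar>t - s\<bar>"
    and b_meas: "t \<in> {0<..<T} \<Longrightarrow> b_coeff \<kappa> t \<in> borel_measurable leb"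
    and b_bound: "t \<in> {0<..<T} \<Longrightarrow> \<forall>x\<in>\<Omega>. \<bar>b_coeff \<kappa> t x\<bar> \<le> L"
    and \<kappa>_deriv: "t \<in> {0<..<T} \<Longrightarrow> x \<in> \<Omega> \<Longrightarrow> ((\<lambda>\<tau>. 1 / \<kappa> \<tau> x) has_real_derivative b_coeff \<kappa> t x) (at t)"
    and \<rho>_meas: "t \<in> {0<..<T} \<Longrightarrow> (\<lambda>x. 1 / \<rho> t x) \<in> borel_measurable leb"
    and \<rho>_lower: "t \<in> {0<..<T} \<Longrightarrow> \<forall>x\<in>\<Omega>. lo \<le> 1 / \<rho> t x"
    and \<rho>_upper: "t \<in> {0<..<T} \<Longrightarrow> \<forall>x\<in>\<Omega>. \<bar>1 / \<rho> t x\<bar> \<le> hi"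
    and \<rho>_lip: "s \<in> {0<..<T} \<Longrightarrow> t \<in> {0<..<T} \<Longrightarrow> \<forall>x\<in>\<Omega>. \<bar>1 / \<rho> t x - 1 / \<rho> s x\<bar> \<le> L * \<bar>t - s\<bar>"
begin

text \<open>The L^2 product is extended through the retraction onto H^1, unlike \<open>ipL2\<close>.
  Both norms then evaluate every function at the same retracted element, so the L^2 norm stays below
  the H^1 norm even off H^1.\<close>

definition ip0 :: "('a \<Rightarrow> real) \<Rightarrow> ('a \<Rightarrow> real) \<Rightarrow> real" where
  "ip0 = extend_form (sobolev \<Omega> 1) (L2_inner \<Omega>)"

definition mass :: "real \<Rightarrow> ('a \<Rightarrow> real) \<Rightarrow> ('a \<Rightarrow> real) \<Rightarrow> real" where
  "mass t = extend_form (sobolev \<Omega> 1) (\<lambda>v w. L2_inner \<Omega> (\<lambda>x. 1 / \<kappa> t x * v x) w)"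

definition stiff :: "real \<Rightarrow> ('a \<Rightarrow> real) \<Rightarrow> ('a \<Rightarrow> real) \<Rightarrow> real" where
  "stiff t = extend_form (sobolev \<Omega> 1) (stiffness \<Omega> (\<lambda>x. 1 / \<rho> t x))"

lemma semi_inner_ip0: "semi_inner ip0"
  unfolding ip0_def
  by (rule semi_inner_extend_form[OF subspace_sobolev])
    (rule L2_inner_add[OF sobolev_L2 sobolev_L2 sobolev_L2] L2_inner_scaleR L2_inner_sym L2_inner_nonneg; assumption)+

abbreviation "R \<equiv> retraction_onto (sobolev \<Omega> 1)"

lemma R_in: "R x \<in> sobolev \<Omega> 1"
  by (rule retraction_in[OF subspace_sobolev])

lemma R_L2: "R x \<in> L2 \<Omega>"
  by (rule sobolev_L2[OF R_in])

lemma n0_R: "semi_inner.nrm ip0 x = L2_norm \<Omega> (R x)"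
  unfolding semi_inner.nrm_def[OF semi_inner_ip0] unfolding ip0_def extend_form_def L2_norm_def ..

lemma n1_R: "H1.nrm x = sobolev_norm \<Omega> 1 (R x)"
  unfolding H1.nrm_def unfolding ipH_def extend_form_def inner_H_def sobolev_norm_def L2_norm_sq ..

text \<open>The bounds are demanded for all functions. Unfolding the extensions replaces every
  argument by its retraction in H^1, where the estimates for weighted products and stiffness
  hold.\<close>

sublocale F: wave_forms ip0 "ipH 1" mass stiff T lo hi L
proof (intro wave_forms.intro semi_inner_ip0 semi_inner_ipH wave_forms_axioms.intro constants)
  show "semi_inner.nrm ip0 x \<le> H1.nrm x" for x
    unfolding n0_R n1_R by (rule L2_norm_le_sobolev_norm[OF R_L2])
next
  fix t assume t: "t \<in> {0<..<T}"
  show "bilinear (mass t)" unfolding mass_def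
  proof (rule bilinear_extend_form[OF subspace_sobolev])
    show "L2_inner \<Omega> (\<lambda>x. 1 / \<kappa> t x * (v + w) x) z = L2_inner \<Omega> (\<lambda>x. 1 / \<kappa> t x * v x) z + L2_inner \<Omega> (\<lambda>x. 1 / \<kappa> t x * w x) z"
      if "v \<in> sobolev \<Omega> 1" "w \<in> sobolev \<Omega> 1" "z \<in> sobolev \<Omega> 1" for v w z
      by (rule weighted_inner_add[OF sobolev_L2[OF that(1)] sobolev_L2[OF that(2)] sobolev_L2[OF that(3)] \<kappa>_meas[OF t] \<kappa>_upper[OF t]])
  qed (rule weighted_inner_scaleR weighted_inner_sym)+
  show "bilinear (stiff t)" unfolding stiff_def
    by (rule bilinear_extend_form[OF subspace_sobolev])
      (rule stiffness_add[OF _ _ _ \<rho>_meas[OF t] \<rho>_upper[OF t]] stiffness_scaleR[OF _ _ \<rho>_meas[OF t] \<rho>_upper[OF t]] stiffness_sym; assumption)+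
  show "mass t x y = mass t y x" for x y
    unfolding mass_def extend_form_def by (rule weighted_inner_sym)
  show "stiff t x y = stiff t y x" for x y
    unfolding stiff_def extend_form_def by (rule stiffness_sym)
  show "lo * (semi_inner.nrm ip0 x)\<^sup>2 \<le> mass t x x" for x
    unfolding mass_def extend_form_def n0_R by (rule weighted_inner_lower[OF R_L2 \<kappa>_meas[OF t] \<kappa>_upper[OF t] \<kappa>_lower[OF t]])
  show "\<bar>mass t x y\<bar> \<le> hi * semi_inner.nrm ip0 x * semi_inner.nrm ip0 y" for x y
    unfolding mass_def extend_form_def n0_R
    by (rule weighted_inner_bound[OF R_L2 R_L2 \<kappa>_meas[OF t] \<kappa>_upper[OF t] constants(3)])
  show "lo * (H1.nrm x)\<^sup>2 \<le> stiff t x x + lo * (semi_inner.nrm ip0 x)\<^sup>2" for x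
    unfolding stiff_def extend_form_def n0_R n1_R
    by (rule stiffness_lower[OF R_in \<rho>_meas[OF t] \<rho>_upper[OF t] \<rho>_lower[OF t]])
  show "\<bar>stiff t x y\<bar> \<le> hi * H1.nrm x * H1.nrm y" for x y
    unfolding stiff_def extend_form_def n1_R
    by (rule stiffness_bound[OF R_in R_in \<rho>_meas[OF t] \<rho>_upper[OF t] constants(3)])
  fix s assume s: "s \<in> {0<..<T}"
  have Lts: "0 \<le> L * \<bar>t - s\<bar>" using constants by simp
  show "\<bar>mass t x y - mass s x y\<bar> \<le> L * \<bar>t - s\<bar> * semi_inner.nrm ip0 x * semi_inner.nrm ip0 y" for x y
    unfolding mass_def extend_form_def n0_R
      weighted_inner_diff[OF R_L2 R_L2 \<kappa>_meas[OF t] \<kappa>_upper[OF t] \<kappa>_meas[OF s] \<kappa>_upper[OF s]]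
    by (rule weighted_inner_bound[OF R_L2 R_L2 borel_measurable_diff[OF \<kappa>_meas[OF t] \<kappa>_meas[OF s]] \<kappa>_lip[OF s t] Lts])
  show "\<bar>stiff t x y - stiff s x y\<bar> \<le> L * \<bar>t - s\<bar> * H1.nrm x * H1.nrm y" for x y
    unfolding stiff_def extend_form_def n1_R
      stiffness_diff_coeff[OF R_in R_in \<rho>_meas[OF t] \<rho>_upper[OF t] \<rho>_meas[OF s] \<rho>_upper[OF s]]
    by (rule stiffness_bound[OF R_in R_in borel_measurable_diff[OF \<rho>_meas[OF t] \<rho>_meas[OF s]] \<rho>_lip[OF s t] Lts])
qed

lemma mass_eq:
  "v \<in> sobolev \<Omega> 1 \<Longrightarrow> w \<in> sobolev \<Omega> 1 \<Longrightarrow> mass t v w = L2_inner \<Omega> (\<lambda>x. 1 / \<kappa> t x * v x) w"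
  unfolding mass_def by (rule extend_form_eq[OF subspace_sobolev])

lemma stiff_eq:
  "v \<in> sobolev \<Omega> 1 \<Longrightarrow> w \<in> sobolev \<Omega> 1 \<Longrightarrow> stiff t v w = stiffness \<Omega> (\<lambda>x. 1 / \<rho> t x) v w"
  unfolding stiff_def by (rule extend_form_eq[OF subspace_sobolev])

lemma n0_eq: "v \<in> sobolev \<Omega> 1 \<Longrightarrow> F.n0 v = L2_norm \<Omega> v"
  unfolding n0_R by (simp add: retraction_id[OF subspace_sobolev])

end

context domain
begin

text \<open>Sampling at the grid points floor(m t) / m gives functions with finitely many values,
  and continuity makes them converge. Rounding down keeps the samples before T but may hit 0, so
  continuity is required on the half-open interval.\<close>

lemma Linfty_sobolev_of_continuous:
  assumes T: "0 < T" and v: "\<And>t. t \<in> {0..<T} \<Longrightarrow> v t \<in> sobolev \<Omega> 1"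
    and cont: "\<And>t. t \<in> {0..<T} \<Longrightarrow> ((\<lambda>\<tau>. H1.nrm (v \<tau> - v t)) \<longlongrightarrow> 0) (at t within {0..<T})"
    and bd: "\<And>t. t \<in> {0<..<T} \<Longrightarrow> H1.nrm (v t) \<le> B"
  shows "v \<in> Linfty_sobolev T \<Omega> 1" "Linfty_norm T \<Omega> 1 v \<le> ereal B"
proof -
  have "continuous_on {0..<T} (\<lambda>t. H1.nrm (v t))"
    unfolding continuous_on_def by (intro ballI H1.nrm_tendsto cont)
  then have "continuous_on {0<..<T} (\<lambda>t. H1.nrm (v t))" by (rule continuous_on_subset) auto
  then have "continuous_on {0<..<T} (\<lambda>t. sobolev_norm \<Omega> 1 (v t))"
    by (rule continuous_on_eq) (simp add: H1_nrm_eq v)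
  then have meas: "(\<lambda>t. sobolev_norm \<Omega> 1 (v t)) \<in> borel_measurable (lebesgue_on {0<..<T})"
    by (rule continuous_imp_measurable_on_sets_lebesgue) simp
  have le: "Linfty_norm T \<Omega> 1 v \<le> ereal B"
    unfolding Linfty_norm_def
  proof (rule esssup_I)
    show "(\<lambda>t. ereal (sobolev_norm \<Omega> 1 (v t))) \<in> borel_measurable (lebesgue_on {0<..<T})"
      using meas by (rule borel_measurable_ereal)
    show "AE t in lebesgue_on {0<..<T}. ereal (sobolev_norm \<Omega> 1 (v t)) \<le> ereal B"
      using bd v by (intro AE_I2) (simp flip: H1_nrm_eq)
  qed
  then show "Linfty_norm T \<Omega> 1 v \<le> ereal B" .
  have "strongly_measurable T \<Omega> 1 v"
    unfolding strongly_measurable_def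
  proof (intro exI[of _ "\<lambda>n t. v (of_int \<lfloor>real (Suc n) * t\<rfloor> / real (Suc n))"] conjI allI)
    fix n
    define m where "m = real (Suc n)"
    define q where "q t = of_int \<lfloor>m * t\<rfloor> / m" for t :: real
    have m: "m > 0" by (simp add: m_def)
    have q_in: "q t \<in> {0..<T}" if "t \<in> {0<..<T}" for t
    proof -
      have "of_int \<lfloor>m * t\<rfloor> \<le> m * t" by simp
      then have "q t \<le> t" using m by (simp add: q_def divide_le_eq mult.commute)
      moreover have "0 \<le> q t" using that m by (simp add: q_def)
      ultimately show ?thesis using that by auto
    qed
    define N where "N = \<lfloor>m * T\<rfloor>"
    have floor_range: "\<lfloor>m * t\<rfloor> \<in> {0..N}" if "t \<in> {0<..<T}" for t
      using that m by (auto simp: N_def intro!: floor_mono)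
    have "(\<lambda>t. v (q t)) ` {0<..<T} \<subseteq> (\<lambda>k. v (of_int k / m)) ` {0..N}"
      using floor_range by (auto simp: q_def)
    then show "finite ((\<lambda>t. v (of_int \<lfloor>real (Suc n) * t\<rfloor> / real (Suc n))) ` {0<..<T})"
      unfolding q_def m_def by (rule finite_subset) simp
    show "(\<lambda>t. v (of_int \<lfloor>real (Suc n) * t\<rfloor> / real (Suc n))) ` {0<..<T} \<subseteq> sobolev \<Omega> 1"
      using q_in v by (auto simp: q_def m_def)
    fix w
    \<comment> \<open>Different grid points may give the same value, so a level set is a finite
      union of intervals, one for each grid point at which \<open>v\<close> equals
      \<open>w\<close>.\<close>
    have "{t \<in> {0<..<T}. v (q t) = w} = (\<Union>k\<in>{k \<in> {0..N}. v (of_int k / m) = w}. {t \<in> {0<..<T}. \<lfloor>m * t\<rfloor> = k})"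
      using floor_range by (auto simp: q_def)
    also have "\<dots> = (\<Union>k\<in>{k \<in> {0..N}. v (of_int k / m) = w}. {0<..<T} \<inter> {of_int k / m..<(of_int k + 1) / m})"
      using m by (intro SUP_cong refl) (auto simp: floor_eq_iff field_simps)
    also have "\<dots> \<in> sets lebesgue"
    proof (rule sets.finite_UN)
      show "finite {k \<in> {0..N}. v (of_int k / m) = w}" by (rule finite_subset[of _ "{0..N}"]) auto
    qed auto
    finally show "{t \<in> {0<..<T}. v (of_int \<lfloor>real (Suc n) * t\<rfloor> / real (Suc n)) = w} \<in> sets lebesgue"
      by (simp add: q_def m_def)
  next
    show "AE t in lebesgue_on {0<..<T}.
        (\<lambda>n. sobolev_norm \<Omega> 1 (\<lambda>x. v t x - v (of_int \<lfloor>real (Suc n) * t\<rfloor> / real (Suc n)) x)) \<longlonglongrightarrow> 0"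
    proof (rule AE_I2)
      fix t assume "t \<in> space (lebesgue_on {0<..<T})"
      then have t: "t \<in> {0<..<T}" by simp
      then have t0: "t \<in> {0..<T}" by auto
      define q where "q n = of_int \<lfloor>real (Suc n) * t\<rfloor> / real (Suc n)" for n
      have q_le: "q n \<le> t" "t - 1 / real (Suc n) \<le> q n" "0 \<le> q n" for n
      proof -
        define m where "m = real (Suc n)"
        have m: "m > 0" by (simp add: m_def)
        have qm: "q n = of_int \<lfloor>m * t\<rfloor> / m" by (simp only: q_def m_def)
        have "of_int \<lfloor>m * t\<rfloor> \<le> m * t" by simp
        then show "q n \<le> t" using m unfolding qm by (simp add: divide_le_eq mult.commute)
        have "m * t - 1 \<le> of_int \<lfloor>m * t\<rfloor>" by linarith
        then have "(m * t - 1) / m \<le> of_int \<lfloor>m * t\<rfloor> / m" using m by (intro divide_right_mono) auto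
        moreover have "(m * t - 1) / m = t - 1 / m" using m by (simp add: diff_divide_distrib)
        ultimately show "t - 1 / real (Suc n) \<le> q n" unfolding qm m_def[symmetric] by (simp only:)
        show "0 \<le> q n" using t m by (simp add: q_def)
      qed
      have q_in: "q n \<in> {0..<T}" for n using q_le[of n] t by auto
      have "(\<lambda>n. t - 1 / real (Suc n)) \<longlonglongrightarrow> t - 0"
        by (intro tendsto_intros LIMSEQ_Suc[OF lim_1_over_n])
      then have lower: "(\<lambda>n. t - 1 / real (Suc n)) \<longlonglongrightarrow> t" by simp
      have q_lim: "q \<longlonglongrightarrow> t"
      proof (rule tendsto_sandwich[OF _ _ lower tendsto_const])
        show "\<forall>\<^sub>F n in sequentially. t - 1 / real (Suc n) \<le> q n"
          by (rule always_eventually, rule allI, rule q_le(2))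
        show "\<forall>\<^sub>F n in sequentially. q n \<le> t"
          by (rule always_eventually, rule allI, rule q_le(1))
      qed
      have c: "((\<lambda>\<tau>. H1.nrm (v \<tau> - v t)) \<longlongrightarrow> H1.nrm (v t - v t)) (at t within {0..<T})"
        using cont[OF t0] by simp
      have "continuous (at t within {0..<T}) (\<lambda>\<tau>. H1.nrm (v \<tau> - v t))"
        using c unfolding continuous_within .
      then have "(\<lambda>n. H1.nrm (v (q n) - v t)) \<longlonglongrightarrow> H1.nrm (v t - v t)"
        unfolding continuous_within_sequentially using q_in q_lim by (auto simp: o_def)
      then have lim: "(\<lambda>n. H1.nrm (v (q n) - v t)) \<longlonglongrightarrow> 0" by simp
      have "H1.nrm (v (q n) - v t) = sobolev_norm \<Omega> 1 (\<lambda>x. v t x - v (q n) x)" for n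
        unfolding H1.nrm_diff_commute[of "v (q n)" "v t"]
          H1_nrm_eq[OF subspace_diff[OF subspace_sobolev v[OF t0] v[OF q_in]]]
        by (simp only: fun_diff_def)
      then show "(\<lambda>n. sobolev_norm \<Omega> 1 (\<lambda>x. v t x - v (of_int \<lfloor>real (Suc n) * t\<rfloor> / real (Suc n)) x)) \<longlonglongrightarrow> 0"
        using lim unfolding q_def by (simp only:)
    qed
  qed
  moreover have "Linfty_norm T \<Omega> 1 v < \<infinity>"
    using le by (rule order.strict_trans1) simp
  ultimately show "v \<in> Linfty_sobolev T \<Omega> 1"
    unfolding Linfty_sobolev_def using v by (auto intro!: AE_I2)
qed

end

section \<open>The momentum equation of the exact solution\<close>

lemma has_weak_partial_cong_on:
  fixes g g' h h' :: "'b::euclidean_space \<Rightarrow> real"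
  assumes g: "\<And>x. x \<in> I \<Longrightarrow> g x = g' x" and h: "\<And>x. x \<in> I \<Longrightarrow> h x = h' x"
    and weak: "has_weak_partial I \<alpha> g h"
  shows "has_weak_partial I \<alpha> g' h'"
proof -
  have loc: "locally_integrable I k'" if k: "\<And>x. x \<in> I \<Longrightarrow> k x = k' x" and "locally_integrable I k" for k k' :: "'b \<Rightarrow> real"
    unfolding locally_integrable_def
  proof (intro allI impI)
    fix K assume K: "compact K" "K \<subseteq> I"
    then have "k absolutely_integrable_on K" using \<open>locally_integrable I k\<close> by (simp add: locally_integrable_def)
    moreover have "k absolutely_integrable_on K \<longleftrightarrow> k' absolutely_integrable_on K"
      using K k by (intro set_integrable_cong) auto
    ultimately show "k' absolutely_integrable_on K" by simp
  qed
  have int: "(LINT x|lebesgue_on I. k x * \<psi> x) = (LINT x|lebesgue_on I. k' x * \<psi> x)"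
    if "\<And>x. x \<in> I \<Longrightarrow> k x = k' x" for k k' \<psi> :: "'b \<Rightarrow> real"
    using that by (intro Bochner_Integration.integral_cong) auto
  show ?thesis
    unfolding has_weak_partial_def
  proof (intro conjI ballI allI impI)
    show "locally_integrable I g'"
      by (rule loc[of g g']) (use g weak in \<open>auto simp: has_weak_partial_def\<close>)
    show "locally_integrable I h'"
      by (rule loc[of h h']) (use h weak in \<open>auto simp: has_weak_partial_def\<close>)
    fix \<phi> and vs :: "'b list" assume \<phi>: "\<phi> \<in> test_functions I" and vs: "mset vs = \<alpha>"
    have "(LINT x|lebesgue_on I. g' x * iter_partial vs \<phi> x) = (LINT x|lebesgue_on I. g x * iter_partial vs \<phi> x)"
      by (rule int[of g g', symmetric]) (rule g)
    also have "\<dots> = (- 1) ^ size \<alpha> * (LINT x|lebesgue_on I. h x * \<phi> x)"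
      using weak \<phi> vs unfolding has_weak_partial_def by blast
    also have "(LINT x|lebesgue_on I. h x * \<phi> x) = (LINT x|lebesgue_on I. h' x * \<phi> x)"
      by (rule int[of h h']) (rule h)
    finally show "(LINT x|lebesgue_on I. g' x * iter_partial vs \<phi> x) =
        (- 1) ^ size \<alpha> * (LINT x|lebesgue_on I. h' x * \<phi> x)" .
  qed
qed

locale wave_setting = wave_coeffs \<Omega> T lo hi L \<kappa> \<rho> + regular_solution \<Omega> T r u u\<^sub>t u\<^sub>t\<^sub>t u0 v0
  for \<Omega> :: "'a::euclidean_space set" and T lo hi L :: real and \<kappa> \<rho> :: "real \<Rightarrow> 'a \<Rightarrow> real"
    and r :: nat and u u\<^sub>t u\<^sub>t\<^sub>t :: "real \<Rightarrow> 'a \<Rightarrow> real" and u0 v0 :: "'a \<Rightarrow> real" +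
  fixes f :: "real \<Rightarrow> 'a \<Rightarrow> real" and M :: real
  assumes f_L2: "t \<in> {0<..<T} \<Longrightarrow> f t \<in> L2 \<Omega>"
    and wave_eq: "\<phi> \<in> test_functions \<Omega> \<Longrightarrow> has_weak_partial {0<..<T} {#1#}
      (\<lambda>t. L2_inner \<Omega> (\<lambda>x. 1 / \<kappa> t x * u\<^sub>t t x) \<phi>)
      (\<lambda>t. L2_inner \<Omega> (f t) \<phi> - stiffness \<Omega> (\<lambda>x. 1 / \<rho> t x) (u t) \<phi>)"
    and M: "0 \<le> M"
    and u_in: "t \<in> {0..<T} \<Longrightarrow> u t \<in> H1_0 \<Omega> \<inter> sobolev \<Omega> r"
    and ut_in: "t \<in> {0..<T} \<Longrightarrow> u\<^sub>t t \<in> H1_0 \<Omega> \<inter> sobolev \<Omega> r"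
    and u_bound: "t \<in> {0..<T} \<Longrightarrow> nr (u t) \<le> M"
    and ut_bound: "t \<in> {0..<T} \<Longrightarrow> nr (u\<^sub>t t) \<le> M"
    and u_lipschitz: "s \<in> {0..<T} \<Longrightarrow> t \<in> {0..<T} \<Longrightarrow> nr (u t - u s) \<le> M * \<bar>t - s\<bar>"
    and ut_lipschitz: "s \<in> {0..<T} \<Longrightarrow> t \<in> {0..<T} \<Longrightarrow> nr (u\<^sub>t t - u\<^sub>t s) \<le> M * \<bar>t - s\<bar>"
    and u_taylor: "s \<in> {0..<T} \<Longrightarrow> t \<in> {0..<T} \<Longrightarrow>
      nr (u t - u s - (t - s) *\<^sub>R u\<^sub>t s) \<le> M * \<bar>t - s\<bar> * \<bar>t - s\<bar>"
begin

lemma u_H: "t \<in> {0..<T} \<Longrightarrow> u t \<in> sobolev \<Omega> r" and u_V: "t \<in> {0..<T} \<Longrightarrow> u t \<in> sobolev \<Omega> 1"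
  and ut_H: "t \<in> {0..<T} \<Longrightarrow> u\<^sub>t t \<in> sobolev \<Omega> r" and ut_V: "t \<in> {0..<T} \<Longrightarrow> u\<^sub>t t \<in> sobolev \<Omega> 1"
  using u_in ut_in H1_0_sobolev by auto

lemma H1_lipschitz:
  assumes "s \<in> {0..<T}" "t \<in> {0..<T}"
  shows "H1.nrm (u t - u s) \<le> M * \<bar>t - s\<bar>" "H1.nrm (u\<^sub>t t - u\<^sub>t s) \<le> M * \<bar>t - s\<bar>"
    "H1.nrm (u t - u s - (t - s) *\<^sub>R u\<^sub>t s) \<le> M * \<bar>t - s\<bar> * \<bar>t - s\<bar>"
proof -
  note sub = subspace_diff[OF subspace_sobolev] subspace_scale[OF subspace_sobolev]
  have in_r: "u t - u s \<in> sobolev \<Omega> r" "u\<^sub>t t - u\<^sub>t s \<in> sobolev \<Omega> r" "u t - u s - (t - s) *\<^sub>R u\<^sub>t s \<in> sobolev \<Omega> r"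
    by (intro sub u_H ut_H assms)+
  show "H1.nrm (u t - u s) \<le> M * \<bar>t - s\<bar>"
    by (rule order_trans[OF H1_le_nr[OF in_r(1)] u_lipschitz[OF assms]])
  show "H1.nrm (u\<^sub>t t - u\<^sub>t s) \<le> M * \<bar>t - s\<bar>"
    by (rule order_trans[OF H1_le_nr[OF in_r(2)] ut_lipschitz[OF assms]])
  show "H1.nrm (u t - u s - (t - s) *\<^sub>R u\<^sub>t s) \<le> M * \<bar>t - s\<bar> * \<bar>t - s\<bar>"
    by (rule order_trans[OF H1_le_nr[OF in_r(3)] u_taylor[OF assms]])
qed

lemma H1_lipschitz_tendsto:
  assumes lip: "\<And>t. t \<in> {0..<T} \<Longrightarrow> H1.nrm (v t - v s) \<le> M * \<bar>t - s\<bar>"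
  shows "((\<lambda>t. H1.nrm (v t - v s)) \<longlongrightarrow> 0) (at s within {0..<T})"
proof (rule Lim_null_comparison)
  show "\<forall>\<^sub>F t in at s within {0..<T}. norm (H1.nrm (v t - v s)) \<le> M * \<bar>t - s\<bar>"
    using lip by (auto simp: eventually_at_filter)
  have "((\<lambda>t. M * \<bar>t - s\<bar>) \<longlongrightarrow> M * \<bar>s - s\<bar>) (at s within {0..<T})" by (intro tendsto_intros)
  then show "((\<lambda>t. M * \<bar>t - s\<bar>) \<longlongrightarrow> 0) (at s within {0..<T})" by simp
qed

lemma u_tendsto: "s \<in> {0..<T} \<Longrightarrow> ((\<lambda>t. H1.nrm (u t - u s)) \<longlongrightarrow> 0) (at s within {0..<T})"
  by (intro H1_lipschitz_tendsto H1_lipschitz)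

lemma ut_tendsto: "s \<in> {0..<T} \<Longrightarrow> ((\<lambda>t. H1.nrm (u\<^sub>t t - u\<^sub>t s)) \<longlongrightarrow> 0) (at s within {0..<T})"
  by (intro H1_lipschitz_tendsto H1_lipschitz)

lemma at_Ico_eq: "s \<in> {0<..<T} \<Longrightarrow> at s within {0..<T} = at s"
  by (rule at_within_open_subset[of _ "{0<..<T}"]) auto

text \<open>First the form is moved in time, then its argument. The constant depends on \<xi> only
  through its H^1 norm, which makes the bounds uniform along a convergent sequence of test
  functions.\<close>

lemma mass_ut_lipschitz:
  assumes s: "s \<in> {0<..<T}" and t: "t \<in> {0<..<T}"
  shows "\<bar>mass t (u\<^sub>t t) \<xi> - mass s (u\<^sub>t s) \<xi>\<bar> \<le> ((L + hi) * M * H1.nrm \<xi>) * \<bar>t - s\<bar>"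
proof -
  have s': "s \<in> {0..<T}" and t': "t \<in> {0..<T}" using s t by auto
  have n0t: "F.n0 (u\<^sub>t t) \<le> M"
    using F.nrm_le[of "u\<^sub>t t"] H1_le_nr[OF ut_H[OF t']] ut_bound[OF t'] by linarith
  have n0d: "F.n0 (u\<^sub>t t - u\<^sub>t s) \<le> M * \<bar>t - s\<bar>"
    using F.nrm_le[of "u\<^sub>t t - u\<^sub>t s"] H1_lipschitz(2)[OF s' t'] by linarith
  have eq: "mass t (u\<^sub>t t) \<xi> - mass s (u\<^sub>t s) \<xi> = (mass t (u\<^sub>t t) \<xi> - mass s (u\<^sub>t t) \<xi>) + mass s (u\<^sub>t t - u\<^sub>t s) \<xi>"
    by (simp add: bilinear_lsub[OF F.M_bilinear[OF s]])
  have "\<bar>mass t (u\<^sub>t t) \<xi> - mass s (u\<^sub>t t) \<xi>\<bar> \<le> L * \<bar>t - s\<bar> * F.n0 (u\<^sub>t t) * F.n0 \<xi>"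
    by (rule F.M_lipschitz[OF s t])
  also have "\<dots> \<le> L * \<bar>t - s\<bar> * M * H1.nrm \<xi>"
    using constants n0t M by (intro mult_mono mult_left_mono F.nrm_le mult_nonneg_nonneg) auto
  finally have 1: "\<bar>mass t (u\<^sub>t t) \<xi> - mass s (u\<^sub>t t) \<xi>\<bar> \<le> L * \<bar>t - s\<bar> * M * H1.nrm \<xi>" .
  have "\<bar>mass s (u\<^sub>t t - u\<^sub>t s) \<xi>\<bar> \<le> hi * F.n0 (u\<^sub>t t - u\<^sub>t s) * F.n0 \<xi>"
    by (rule F.M_upper[OF s])
  also have "\<dots> \<le> hi * (M * \<bar>t - s\<bar>) * H1.nrm \<xi>"
    using constants n0d M by (intro mult_mono mult_left_mono F.nrm_le mult_nonneg_nonneg) auto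
  finally have 2: "\<bar>mass s (u\<^sub>t t - u\<^sub>t s) \<xi>\<bar> \<le> hi * (M * \<bar>t - s\<bar>) * H1.nrm \<xi>" .
  have "((L + hi) * M * H1.nrm \<xi>) * \<bar>t - s\<bar> = L * \<bar>t - s\<bar> * M * H1.nrm \<xi> + hi * (M * \<bar>t - s\<bar>) * H1.nrm \<xi>"
    by (simp add: algebra_simps)
  then show ?thesis unfolding eq using 1 2 abs_triangle_ineq[of "mass t (u\<^sub>t t) \<xi> - mass s (u\<^sub>t t) \<xi>" "mass s (u\<^sub>t t - u\<^sub>t s) \<xi>"]
    by linarith
qed

lemma mass_ut_continuous:
  "continuous_on {0<..<T} (\<lambda>t. mass t (u\<^sub>t t) \<xi>)"
proof -
  have "((L + hi) * M * H1.nrm \<xi>)-lipschitz_on {0<..<T} (\<lambda>t. mass t (u\<^sub>t t) \<xi>)"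
    using constants M mass_ut_lipschitz by (intro lipschitz_onI) (auto simp: dist_real_def)
  then show ?thesis by (rule lipschitz_on_continuous_on)
qed

text \<open>The right-hand sides obtained from a sequence of test functions converging to \<open>\<xi>\<close> in
  \<open>H\<^sup>1\<close> are bounded uniformly, because they are weak derivatives of uniformly Lipschitz functions.\<close>

lemma exact_momentum:
  assumes \<xi>: "\<xi> \<in> H1_0 \<Omega>" and st: "0 < s" "s \<le> t" "t < T"
  shows "((\<lambda>\<tau>. L2_inner \<Omega> (f \<tau>) \<xi> - stiff \<tau> (u \<tau>) \<xi>) has_integral mass t (u\<^sub>t t) \<xi> - mass s (u\<^sub>t s) \<xi>) {s..t}"
proof -
  have \<xi>V: "\<xi> \<in> sobolev \<Omega> 1" by (rule H1_0_sobolev[OF \<xi>])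
  obtain \<phi> where \<phi>: "\<And>n. \<phi> n \<in> test_functions \<Omega>" and lim: "(\<lambda>n. H1.nrm (\<phi> n - \<xi>)) \<longlonglongrightarrow> 0"
    by (rule H1_0_test_sequence[OF \<xi>]) (rule that)
  have \<phi>V: "\<phi> n \<in> sobolev \<Omega> 1" for n by (rule test_functions_sobolev[OF \<phi>])
  have nlim: "(\<lambda>n. H1.nrm (\<phi> n)) \<longlonglongrightarrow> H1.nrm \<xi>" by (rule H1.nrm_tendsto[OF lim])
  then obtain B where B: "\<And>n. H1.nrm (\<phi> n) \<le> B"
    using Bseq_eq_bounded[of "\<lambda>n. H1.nrm (\<phi> n)"] convergentI[THEN convergent_imp_Bseq, OF nlim]
    by (auto simp: Bseq_def)
  define G where "G n \<tau> = L2_inner \<Omega> (f \<tau>) (\<phi> n) - stiff \<tau> (u \<tau>) (\<phi> n)" for n \<tau>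
  define G0 where "G0 \<tau> = L2_inner \<Omega> (f \<tau>) \<xi> - stiff \<tau> (u \<tau>) \<xi>" for \<tau>
  have weak: "has_weak_partial {0<..<T} {#1#} (\<lambda>t. mass t (u\<^sub>t t) (\<phi> n)) (G n)" for n
    by (rule has_weak_partial_cong_on[OF _ _ wave_eq[OF \<phi>[of n]]])
      (auto simp: G_def mass_eq stiff_eq u_V ut_V \<phi>V)
  have sub: "{s..t} \<subseteq> {0<..<T}" using st by auto
  note I = weak_derivative_integral[OF weak mass_ut_continuous st]
  have bound: "AE \<tau> in lebesgue_on {0<..<T}. \<bar>G n \<tau>\<bar> \<le> (L + hi) * M * B" for n
  proof -
    have "AE \<tau> in lebesgue_on {0<..<T}. \<bar>G n \<tau>\<bar> \<le> (L + hi) * M * H1.nrm (\<phi> n)"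
      by (rule weak_derivative_AE_bounded[OF weak mass_ut_lipschitz])
    moreover have "(L + hi) * M * H1.nrm (\<phi> n) \<le> (L + hi) * M * B"
      using constants M B by (intro mult_left_mono) auto
    ultimately show ?thesis by (auto elim!: eventually_mono)
  qed
  have pointwise: "(\<lambda>n. G n \<tau>) \<longlonglongrightarrow> G0 \<tau>" if \<tau>: "\<tau> \<in> {0<..<T}" for \<tau>
  proof -
    have const: "(\<lambda>n. H1.nrm (x - x)) \<longlonglongrightarrow> 0" for x by simp
    have "(\<lambda>n. stiff \<tau> (u \<tau>) (\<phi> n)) \<longlonglongrightarrow> stiff \<tau> (u \<tau>) \<xi>"
      by (rule H1.bounded_form_tendsto[OF F.A_bilinear[OF \<tau>] F.A_upper[OF \<tau>] const lim])
    moreover have "(\<lambda>n. L2_inner \<Omega> (\<phi> n) (f \<tau>)) \<longlonglongrightarrow> L2_inner \<Omega> \<xi> (f \<tau>)"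
    proof (rule L2_inner_tendsto[of UNIV])
      show "(\<lambda>n. L2.nrm (\<phi> n - \<xi>)) \<longlonglongrightarrow> 0"
      proof (rule Lim_null_comparison[OF always_eventually lim], rule allI)
        fix n
        have d: "\<phi> n - \<xi> \<in> sobolev \<Omega> 1" by (rule subspace_diff[OF subspace_sobolev \<phi>V \<xi>V])
        show "norm (L2.nrm (\<phi> n - \<xi>)) \<le> H1.nrm (\<phi> n - \<xi>)"
          unfolding real_norm_def L2_nrm_eq[OF sobolev_L2[OF d]] H1_nrm_eq[OF d] abs_of_nonneg[OF L2_norm_nonneg]
          by (rule L2_norm_le_sobolev_norm[OF sobolev_L2[OF d]])
      qed
    qed (use sobolev_L2[OF \<phi>V] sobolev_L2[OF \<xi>V] f_L2[OF \<tau>] in auto)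
    ultimately show ?thesis unfolding G_def G0_def L2_inner_sym[of "f \<tau>"] by (intro tendsto_diff)
  qed
  let ?N = "lebesgue_on {s..t}"
  have G_int: "integrable ?N (G n)" for n
    by (rule absolutely_integrable_imp_integrable[OF I(1)]) simp
  \<comment> \<open>Integrability in time is known from the weak equation only for pairings with
    test functions; for \<xi> even measurability has to come from the pointwise limit.\<close>
  have G0_meas: "G0 \<in> borel_measurable ?N"
    by (rule borel_measurable_LIMSEQ_real[where u=G]) (use pointwise sub G_int in auto)
  interpret N: finite_measure ?N
    by (rule finite_measureI) (use st in \<open>simp add: emeasure_restrict_space\<close>)
  have bound': "AE \<tau> in ?N. norm (G n \<tau>) \<le> (L + hi) * M * B" for n
    using bound[of n] sub
    unfolding AE_lebesgue_on_iff[OF Ioo_lebesgue] by (simp add: AE_restrict_space_iff) (auto elim!: eventually_mono)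
  have conv: "AE \<tau> in ?N. (\<lambda>n. G n \<tau>) \<longlonglongrightarrow> G0 \<tau>"
    using pointwise sub by (intro AE_I2) auto
  have wint: "integrable ?N (\<lambda>_. (L + hi) * M * B)" by simp
  have Gm: "G n \<in> borel_measurable ?N" for n using G_int by (rule borel_measurable_integrable)
  have G0_int: "integrable ?N G0"
    by (rule integrable_dominated_convergence[OF G0_meas Gm wint conv bound'])
  have "(\<lambda>n. LINT \<tau>|?N. G n \<tau>) \<longlonglongrightarrow> (LINT \<tau>|?N. G0 \<tau>)"
    by (rule integral_dominated_convergence[OF G0_meas Gm wint conv bound'])
  moreover have "(LINT \<tau>|?N. G n \<tau>) = mass t (u\<^sub>t t) (\<phi> n) - mass s (u\<^sub>t s) (\<phi> n)" for n
    using lebesgue_integral_eq_integral[OF G_int[of n]] I(2) by simp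
  ultimately have "(\<lambda>n. mass t (u\<^sub>t t) (\<phi> n) - mass s (u\<^sub>t s) (\<phi> n)) \<longlonglongrightarrow> (LINT \<tau>|?N. G0 \<tau>)" by simp
  moreover have "(\<lambda>n. mass \<tau> v (\<phi> n)) \<longlonglongrightarrow> mass \<tau> v \<xi>" if \<tau>: "\<tau> \<in> {0<..<T}" for \<tau> v
  proof -
    have const: "(\<lambda>n. F.n0 (x - x)) \<longlonglongrightarrow> 0" for x by simp
    show ?thesis
      by (rule F.H0.bounded_form_tendsto[OF F.M_bilinear[OF \<tau>] F.M_upper[OF \<tau>] const F.n0_null[OF lim]])
  qed
  then have "(\<lambda>n. mass t (u\<^sub>t t) (\<phi> n) - mass s (u\<^sub>t s) (\<phi> n)) \<longlonglongrightarrow> mass t (u\<^sub>t t) \<xi> - mass s (u\<^sub>t s) \<xi>"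
    using st by (intro tendsto_diff) auto
  ultimately have "(LINT \<tau>|?N. G0 \<tau>) = mass t (u\<^sub>t t) \<xi> - mass s (u\<^sub>t s) \<xi>" by (rule LIMSEQ_unique)
  then show ?thesis using has_integral_integral_lebesgue_on[OF G0_int] by (simp add: G0_def[abs_def])
qed

text \<open>Differentiation under the integral: the difference quotients of 1/\<kappa> are bounded
  by L and converge pointwise to b. The limit is reduced to sequences so that dominated convergence
  applies.\<close>

lemma mass_coefficient_derivative:
  assumes v: "v \<in> sobolev \<Omega> 1" and \<xi>: "\<xi> \<in> sobolev \<Omega> 1" and s: "s \<in> {0<..<T}"
  shows "((\<lambda>t. (mass t v \<xi> - mass s v \<xi>) / (t - s)) \<longlongrightarrow> L2_inner \<Omega> (\<lambda>x. b_coeff \<kappa> s x * v x) \<xi>) (at s)"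
proof -
  have "((\<lambda>t. (mass t v \<xi> - mass s v \<xi>) / (t - s)) \<circ> X) \<longlonglongrightarrow> L2_inner \<Omega> (\<lambda>x. b_coeff \<kappa> s x * v x) \<xi>"
    if X: "\<forall>i. X i \<in> {0<..<T} - {s}" "X \<longlonglongrightarrow> s" for X
  proof -
    have XT: "X i \<in> {0<..<T}" and Xs: "X i \<noteq> s" for i using X(1) by auto
    define q where "q i x = (1 / \<kappa> (X i) x - 1 / \<kappa> s x) / (X i - s)" for i x
    have vL: "v \<in> L2 \<Omega>" and \<xi>L: "\<xi> \<in> L2 \<Omega>" using v \<xi> by (auto intro: sobolev_L2)
    have q_meas: "q i \<in> borel_measurable leb" for i
      unfolding q_def by (intro borel_measurable_divide borel_measurable_diff \<kappa>_meas XT s borel_measurable_const)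
    have q_bd: "\<forall>x\<in>\<Omega>. \<bar>q i x\<bar> \<le> L" for i
    proof
      fix x assume "x \<in> \<Omega>"
      then have "\<bar>1 / \<kappa> (X i) x - 1 / \<kappa> s x\<bar> \<le> L * \<bar>X i - s\<bar>" using \<kappa>_lip[OF s XT] by blast
      then show "\<bar>q i x\<bar> \<le> L" using Xs[of i] by (simp add: q_def abs_divide divide_le_eq)
    qed
    have eq: "(mass (X i) v \<xi> - mass s v \<xi>) / (X i - s) = (LINT x|leb. q i x * v x * \<xi> x)" for i
    proof -
      have "mass (X i) v \<xi> - mass s v \<xi> = L2_inner \<Omega> (\<lambda>x. (1 / \<kappa> (X i) x - 1 / \<kappa> s x) * v x) \<xi>"
        unfolding mass_eq[OF v \<xi>]
        by (rule weighted_inner_diff[OF vL \<xi>L \<kappa>_meas[OF XT] \<kappa>_upper[OF XT] \<kappa>_meas[OF s] \<kappa>_upper[OF s]])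
      also have "\<dots> = L2_inner \<Omega> (\<lambda>x. (X i - s) * (q i x * v x)) \<xi>"
        using Xs[of i] by (simp add: q_def)
      also have "\<dots> = (X i - s) * (LINT x|leb. q i x * v x * \<xi> x)"
        by (simp add: L2_inner_def mult.assoc)
      finally show ?thesis using Xs[of i] by simp
    qed
    have "(\<lambda>i. LINT x|leb. q i x * v x * \<xi> x) \<longlonglongrightarrow> (LINT x|leb. b_coeff \<kappa> s x * v x * \<xi> x)"
    proof (rule integral_dominated_convergence[where w="\<lambda>x. L * \<bar>v x * \<xi> x\<bar>"])
      show "(\<lambda>x. b_coeff \<kappa> s x * v x * \<xi> x) \<in> borel_measurable leb"
        by (intro borel_measurable_times b_meas s L2_measurable vL \<xi>L)
      show "(\<lambda>x. q i x * v x * \<xi> x) \<in> borel_measurable leb" for i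
        by (intro borel_measurable_times q_meas L2_measurable vL \<xi>L)
      show "integrable leb (\<lambda>x. L * \<bar>v x * \<xi> x\<bar>)"
        by (intro integrable_mult_right integrable_abs L2_mult_integrable vL \<xi>L)
      show "AE x in leb. norm (q i x * v x * \<xi> x) \<le> L * \<bar>v x * \<xi> x\<bar>" for i
        using q_bd[of i] by (intro AE_I2) (simp add: abs_mult mult.assoc mult_right_mono)
      show "AE x in leb. (\<lambda>i. q i x * v x * \<xi> x) \<longlonglongrightarrow> b_coeff \<kappa> s x * v x * \<xi> x"
      proof (rule AE_I2)
        fix x assume "x \<in> space leb"
        then have x: "x \<in> \<Omega>" by simp
        have "((\<lambda>t. (1 / \<kappa> t x - 1 / \<kappa> s x) / (t - s)) \<longlongrightarrow> b_coeff \<kappa> s x) (at s)"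
          using \<kappa>_deriv[OF s x] unfolding has_field_derivative_iff .
        moreover have "filterlim X (at s) sequentially"
          using X(2) Xs by (intro filterlim_atI) auto
        ultimately have "(\<lambda>i. q i x) \<longlonglongrightarrow> b_coeff \<kappa> s x" unfolding q_def by (rule filterlim_compose)
        then show "(\<lambda>i. q i x * v x * \<xi> x) \<longlonglongrightarrow> b_coeff \<kappa> s x * v x * \<xi> x" by (intro tendsto_mult_right)
      qed
    qed
    then show ?thesis by (simp add: eq o_def L2_inner_def)
  qed
  then have "((\<lambda>t. (mass t v \<xi> - mass s v \<xi>) / (t - s)) \<longlongrightarrow> L2_inner \<Omega> (\<lambda>x. b_coeff \<kappa> s x * v x) \<xi>) (at s within {0<..<T})"
    unfolding tendsto_at_iff_sequentially by blast
  then show ?thesis using s by (simp add: at_within_open[OF s])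
qed

end

section \<open>The error of the Galerkin solution\<close>

lemma sum_fun_apply: "(\<Sum>i\<in>I. f i) x = (\<Sum>i\<in>I. f i x)"
  by (induction I rule: infinite_finite_induct) auto

lemma finite_dim_space_span:
  assumes "finite_dim_space S"
  obtains B where "finite B" "S = span B"
proof -
  obtain B where B: "finite B" "S = {(\<lambda>x. \<Sum>b\<in>B. c b * b x) | c. True}"
    using assms by (auto simp: finite_dim_space_def)
  have "(\<lambda>x. \<Sum>b\<in>B. c b * b x) = (\<Sum>b\<in>B. c b *\<^sub>R b)" for c
    by (rule ext) (simp add: sum_fun_apply)
  then have "S = span B"
    unfolding B(2) span_finite[OF B(1)] by auto
  with B(1) show ?thesis by (rule that)
qed

context domain
begin

lemma sobolev_quotient_tendsto:
  assumes der: "has_derivative_on_sobolev \<Omega> 1 I v w" and t: "t \<in> I"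
  shows "((\<lambda>\<tau>. H1.nrm ((1 / (\<tau> - t)) *\<^sub>R (v \<tau> - v t) - w t)) \<longlongrightarrow> 0) (at t within I)"
proof -
  have V: "v \<tau> \<in> sobolev \<Omega> 1" "w \<tau> \<in> sobolev \<Omega> 1" if "\<tau> \<in> I" for \<tau>
    using der that by (auto simp: has_derivative_on_sobolev_def)
  have "((\<lambda>\<tau>. sobolev_norm \<Omega> 1 (\<lambda>x. (v \<tau> x - v t x) / (\<tau> - t) - w t x)) \<longlongrightarrow> 0) (at t within I)"
    using der t by (simp add: has_derivative_on_sobolev_def)
  moreover have "sobolev_norm \<Omega> 1 (\<lambda>x. (v \<tau> x - v t x) / (\<tau> - t) - w t x) =
      H1.nrm ((1 / (\<tau> - t)) *\<^sub>R (v \<tau> - v t) - w t)" if "\<tau> \<in> I" for \<tau>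
  proof -
    have "(1 / (\<tau> - t)) *\<^sub>R (v \<tau> - v t) - w t \<in> sobolev \<Omega> 1"
      by (intro subspace_diff[OF subspace_sobolev] subspace_scale[OF subspace_sobolev] V t that)
    moreover have "(\<lambda>x. (v \<tau> x - v t x) / (\<tau> - t) - w t x) = (1 / (\<tau> - t)) *\<^sub>R (v \<tau> - v t) - w t"
      by (rule ext) simp
    ultimately show ?thesis by (simp only: H1_nrm_eq)
  qed
  then have "\<forall>\<^sub>F \<tau> in at t within I. sobolev_norm \<Omega> 1 (\<lambda>x. (v \<tau> x - v t x) / (\<tau> - t) - w t x) =
      H1.nrm ((1 / (\<tau> - t)) *\<^sub>R (v \<tau> - v t) - w t)"
    by (auto simp: eventually_at_filter)
  ultimately show ?thesis by (rule Lim_transform_eventually)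
qed

lemma sobolev_quotient_continuous:
  assumes der: "has_derivative_on_sobolev \<Omega> 1 I v w" and t: "t \<in> I"
  shows "((\<lambda>\<tau>. H1.nrm (v \<tau> - v t)) \<longlongrightarrow> 0) (at t within I)"
proof -
  have "((\<lambda>\<tau>. \<bar>\<tau> - t\<bar> * (H1.nrm ((1 / (\<tau> - t)) *\<^sub>R (v \<tau> - v t) - w t) + H1.nrm (w t))) \<longlongrightarrow>
      \<bar>t - t\<bar> * (0 + H1.nrm (w t))) (at t within I)"
    by (intro tendsto_intros sobolev_quotient_tendsto[OF der t])
  then have null: "((\<lambda>\<tau>. \<bar>\<tau> - t\<bar> * (H1.nrm ((1 / (\<tau> - t)) *\<^sub>R (v \<tau> - v t) - w t) + H1.nrm (w t))) \<longlongrightarrow> 0) (at t within I)"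
    by simp
  show ?thesis
  proof (rule Lim_null_comparison[OF _ null])
    have "H1.nrm (v \<tau> - v t) \<le> \<bar>\<tau> - t\<bar> * (H1.nrm ((1 / (\<tau> - t)) *\<^sub>R (v \<tau> - v t) - w t) + H1.nrm (w t))"
      if "\<tau> \<noteq> t" for \<tau>
    proof -
      have "v \<tau> - v t = (\<tau> - t) *\<^sub>R (((1 / (\<tau> - t)) *\<^sub>R (v \<tau> - v t) - w t) + w t)"
        using that by (simp only: diff_add_cancel scaleR_scaleR) simp
      then have "H1.nrm (v \<tau> - v t) = \<bar>\<tau> - t\<bar> * H1.nrm (((1 / (\<tau> - t)) *\<^sub>R (v \<tau> - v t) - w t) + w t)"
        by (metis H1.nrm_scale)
      also have "\<dots> \<le> \<bar>\<tau> - t\<bar> * (H1.nrm ((1 / (\<tau> - t)) *\<^sub>R (v \<tau> - v t) - w t) + H1.nrm (w t))"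
        by (intro mult_left_mono H1.nrm_triangle) simp
      finally show ?thesis .
    qed
    then show "\<forall>\<^sub>F \<tau> in at t within I. norm (H1.nrm (v \<tau> - v t)) \<le>
        \<bar>\<tau> - t\<bar> * (H1.nrm ((1 / (\<tau> - t)) *\<^sub>R (v \<tau> - v t) - w t) + H1.nrm (w t))"
      unfolding real_norm_def abs_of_nonneg[OF H1.nrm_nonneg] by (simp add: eventually_at_filter)
  qed
qed

end

context wave_setting
begin

text \<open>The quotient is split at the vector V(s): the moving argument contributes the mass of
  W(s), the moving coefficient the term with b. Together these are the two inertial terms of the
  Galerkin equation, which thereby become one derivative.\<close>

lemma discrete_momentum:
  assumes der: "has_derivative_on_sobolev \<Omega> 1 {0<..<T} V W" and \<xi>: "\<xi> \<in> sobolev \<Omega> 1" and s: "s \<in> {0<..<T}"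
  shows "((\<lambda>t. mass t (V t) \<xi>) has_real_derivative
    mass s (W s) \<xi> + L2_inner \<Omega> (\<lambda>x. b_coeff \<kappa> s x * V s x) \<xi>) (at s)"
proof -
  have V: "V s \<in> sobolev \<Omega> 1" using der s by (auto simp: has_derivative_on_sobolev_def)
  have at: "at s within {0<..<T} = at s" using s by (simp add: at_within_open[OF s])
  have lim1: "((\<lambda>t. mass t ((1 / (t - s)) *\<^sub>R (V t - V s)) \<xi>) \<longlongrightarrow> mass s (W s) \<xi>) (at s)"
    by (rule F.M_tendsto[OF s]) (use F.n0_null[OF sobolev_quotient_tendsto[OF der s, unfolded at]] in simp_all)
  have lim: "((\<lambda>t. mass t ((1 / (t - s)) *\<^sub>R (V t - V s)) \<xi> + (mass t (V s) \<xi> - mass s (V s) \<xi>) / (t - s)) \<longlongrightarrow>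
      mass s (W s) \<xi> + L2_inner \<Omega> (\<lambda>x. b_coeff \<kappa> s x * V s x) \<xi>) (at s)"
    by (intro tendsto_add lim1 mass_coefficient_derivative V \<xi> s)
  have "\<forall>\<^sub>F t in at s. t \<in> {0<..<T}" using s by (intro eventually_at_in_open') auto
  then have "\<forall>\<^sub>F t in at s. mass t ((1 / (t - s)) *\<^sub>R (V t - V s)) \<xi> + (mass t (V s) \<xi> - mass s (V s) \<xi>) / (t - s) =
      (mass t (V t) \<xi> - mass s (V s) \<xi>) / (t - s)"
  proof eventually_elim
    case (elim t)
    have "mass t ((1 / (t - s)) *\<^sub>R (V t - V s)) \<xi> = (mass t (V t) \<xi> - mass t (V s) \<xi>) / (t - s)"
      unfolding bilinear_lmul[OF F.M_bilinear[OF elim]] bilinear_lsub[OF F.M_bilinear[OF elim]] by simp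
    then show ?case by (simp add: diff_divide_distrib)
  qed
  from Lim_transform_eventually[OF lim this] show ?thesis unfolding has_field_derivative_iff .
qed

lemma error_momentum:
  assumes \<xi>: "\<xi> \<in> H1_0 \<Omega>"
    and U: "\<And>s. s \<in> {0<..<T} \<Longrightarrow> ((\<lambda>t. H1.nrm (U t - U s)) \<longlongrightarrow> 0) (at s)"
    and der: "\<And>s. s \<in> {0<..<T} \<Longrightarrow>
      ((\<lambda>t. mass t (V t) \<xi>) has_real_derivative L2_inner \<Omega> (f s) \<xi> - stiff s (U s) \<xi>) (at s)"
    and t: "t \<in> {0<..<T}"
  shows "((\<lambda>t. mass t (V t - u\<^sub>t t) \<xi>) has_real_derivative - stiff t (U t - u t) \<xi>) (at t)"
proof -
  define h where "h \<tau> = - stiff \<tau> (U \<tau> - u \<tau>) \<xi>" for \<tau>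
  define E where "E \<tau> = mass \<tau> (V \<tau> - u\<^sub>t \<tau>) \<xi>" for \<tau>
  have E_eq: "E \<tau> = mass \<tau> (V \<tau>) \<xi> - mass \<tau> (u\<^sub>t \<tau>) \<xi>" if "\<tau> \<in> {0<..<T}" for \<tau>
    unfolding E_def by (rule bilinear_lsub[OF F.M_bilinear[OF that]])
  have const: "((\<lambda>t. H1.nrm (x - x)) \<longlongrightarrow> 0) G" for x and G :: "real filter" by simp
  have h_cont: "continuous_on {0<..<T} h"
  proof (rule continuous_at_imp_continuous_on, rule ballI)
    fix s assume s: "s \<in> {0<..<T}"
    then have s0: "s \<in> {0..<T}" by auto
    have "((\<lambda>t. H1.nrm (U t - U s) + H1.nrm (u t - u s)) \<longlongrightarrow> 0 + 0) (at s)"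
      by (intro tendsto_add U s u_tendsto[OF s0, unfolded at_Ico_eq[OF s]])
    then have null: "((\<lambda>t. H1.nrm (U t - U s) + H1.nrm (u t - u s)) \<longlongrightarrow> 0) (at s)" by simp
    have "((\<lambda>t. H1.nrm ((U t - u t) - (U s - u s))) \<longlongrightarrow> 0) (at s)"
    proof (rule Lim_null_comparison[OF always_eventually null], rule allI)
      fix t
      have "(U t - u t) - (U s - u s) = (U t - U s) - (u t - u s)" by simp
      then show "norm (H1.nrm ((U t - u t) - (U s - u s))) \<le> H1.nrm (U t - U s) + H1.nrm (u t - u s)"
        unfolding real_norm_def abs_of_nonneg[OF H1.nrm_nonneg]
        using H1.nrm_triangle_diff[of "U t - U s" "u t - u s"] by (simp only:)
    qed
    from tendsto_minus[OF F.A_tendsto[OF s this const]]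
    show "isCont h s" unfolding isCont_def h_def .
  qed
  \<comment> \<open>The source cancels between the two momentum equations, and with it the only term
    not known to be continuous in time.\<close>
  have inc: "E b - E a = integral {a..b} h" if ab: "0 < a" "a \<le> b" "b < T" for a b
  proof -
    have "((\<lambda>\<tau>. L2_inner \<Omega> (f \<tau>) \<xi> - stiff \<tau> (U \<tau>) \<xi>) has_integral mass b (V b) \<xi> - mass a (V a) \<xi>) {a..b}"
    proof (rule fundamental_theorem_of_calculus[OF ab(2)])
      fix \<tau> assume "\<tau> \<in> {a..b}"
      then have "\<tau> \<in> {0<..<T}" using ab by auto
      from der[OF this] show "((\<lambda>t. mass t (V t) \<xi>) has_vector_derivative L2_inner \<Omega> (f \<tau>) \<xi> - stiff \<tau> (U \<tau>) \<xi>) (at \<tau> within {a..b})"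
        unfolding has_real_derivative_iff_has_vector_derivative by (rule has_vector_derivative_at_within)
    qed
    from has_integral_diff[OF this exact_momentum[OF \<xi> ab]]
    have D: "((\<lambda>\<tau>. (L2_inner \<Omega> (f \<tau>) \<xi> - stiff \<tau> (U \<tau>) \<xi>) - (L2_inner \<Omega> (f \<tau>) \<xi> - stiff \<tau> (u \<tau>) \<xi>)) has_integral
        (mass b (V b) \<xi> - mass a (V a) \<xi>) - (mass b (u\<^sub>t b) \<xi> - mass a (u\<^sub>t a) \<xi>)) {a..b}" .
    have v: "(mass b (V b) \<xi> - mass a (V a) \<xi>) - (mass b (u\<^sub>t b) \<xi> - mass a (u\<^sub>t a) \<xi>) = E b - E a"
      using E_eq[of a] E_eq[of b] ab by simp
    have "(L2_inner \<Omega> (f \<tau>) \<xi> - stiff \<tau> (U \<tau>) \<xi>) - (L2_inner \<Omega> (f \<tau>) \<xi> - stiff \<tau> (u \<tau>) \<xi>) = h \<tau>"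
      if "\<tau> \<in> {a..b}" for \<tau>
    proof -
      have \<tau>: "\<tau> \<in> {0<..<T}" using that ab by auto
      show ?thesis unfolding h_def bilinear_lsub[OF F.A_bilinear[OF \<tau>]] by simp
    qed
    from has_integral_eq[OF this D] have "(h has_integral E b - E a) {a..b}" unfolding v .
    then show ?thesis by (simp add: integral_unique)
  qed
  \<comment> \<open>An interval inside (0, T) with t in its interior, so that the derivative within
    the interval is a derivative at t.\<close>
  define a b where "a = t / 2" and "b = (t + T) / 2"
  have ab: "0 < a" "a < t" "t < b" "b < T" using t by (auto simp: a_def b_def)
  have "((\<lambda>x. integral {a..x} h) has_real_derivative h t) (at t within {a..b})"
    using ab by (intro integral_has_real_derivative continuous_on_subset[OF h_cont]) auto
  then have "((\<lambda>x. integral {a..x} h) has_real_derivative h t) (at t)"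
    using ab by (subst (asm) at_within_Icc_at) auto
  then have "((\<lambda>x. E a + integral {a..x} h) has_real_derivative h t) (at t)"
    by (auto intro!: derivative_eq_intros)
  then have "(E has_real_derivative h t) (at t)"
  proof (rule has_field_derivative_transform_within_open[of _ _ _ "{a<..<b}"])
    show "E a + integral {a..x} h = E x" if "x \<in> {a<..<b}" for x using inc[of a x] that ab by auto
  qed (use ab in auto)
  then show ?thesis by (simp add: E_def[abs_def] h_def)
qed

text \<open>The estimate for a single mesh size, with explicit constants so that their dependence on
  h is visible: \<open>energy_const\<close> involves only T and the coefficient bounds, and h enters
  through \<epsilon> and \<delta>.\<close>

theorem galerkin_error:
  assumes S: "finite_dim_space S" "S \<subseteq> H1_0 \<Omega>" and h: "0 < h" and c: "0 \<le> c"
    and approx: "\<forall>v \<in> H1_0 \<Omega> \<inter> sobolev \<Omega> r. \<exists>w\<in>S.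
      L2_norm \<Omega> (\<lambda>x. v x - w x) + h * sobolev_norm \<Omega> 1 (\<lambda>x. v x - w x) \<le> c * h ^ r * sobolev_norm \<Omega> r v"
    and galerkin: "galerkin_solution T \<Omega> \<kappa> \<rho> f S u0h v0h U"
    and init: "u0h \<in> S" "v0h \<in> S" "sobolev_norm \<Omega> 1 (\<lambda>x. u0h x - u0 x) \<le> \<delta>" "L2_norm \<Omega> (\<lambda>x. v0h x - v0 x) \<le> \<delta>"
    and \<epsilon>_def: "\<epsilon> = c * h ^ (r - 1) * M"
  shows "(\<lambda>t x. u t x - U t x) \<in> Linfty_sobolev T \<Omega> 1"
    and "Linfty_norm T \<Omega> 1 (\<lambda>t x. u t x - U t x) \<le>
      ereal (\<epsilon> + sqrt (F.energy_const * ((\<delta> + \<epsilon>)\<^sup>2 + (\<delta> + \<epsilon>)\<^sup>2 + \<epsilon>\<^sup>2)))"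
proof -
  obtain B where B: "finite B" "S = span B" by (rule finite_dim_space_span[OF S(1)])
  have sub_S: "subspace S" unfolding B(2) by (rule subspace_span)
  have S_V: "w \<in> sobolev \<Omega> 1" if "w \<in> S" for w using S(2) that H1_0_sobolev by blast
  obtain U\<^sub>t U\<^sub>t\<^sub>t where US: "\<forall>t\<in>{0..<T}. U t \<in> S \<and> U\<^sub>t t \<in> S" "\<forall>t\<in>{0<..<T}. U\<^sub>t\<^sub>t t \<in> S"
    and U_der: "has_derivative_on_sobolev \<Omega> 1 {0..<T} U U\<^sub>t"
    and Ut_cont: "continuous_on_sobolev \<Omega> 1 {0..<T} U\<^sub>t"
    and Ut_der: "has_derivative_on_sobolev \<Omega> 1 {0<..<T} U\<^sub>t U\<^sub>t\<^sub>t"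
    and eq: "\<forall>t\<in>{0<..<T}. \<forall>w\<in>S. L2_inner \<Omega> (\<lambda>x. 1 / \<kappa> t x * U\<^sub>t\<^sub>t t x) w
        + stiffness \<Omega> (\<lambda>x. 1 / \<rho> t x) (U t) w + L2_inner \<Omega> (\<lambda>x. b_coeff \<kappa> t x * U\<^sub>t t x) w = L2_inner \<Omega> (f t) w"
    and U_init: "AE x in leb. U 0 x = u0h x" and Ut_init: "AE x in leb. U\<^sub>t 0 x = v0h x"
    using galerkin unfolding galerkin_solution_def by blast
  \<comment> \<open>The choice need not be linear. Every use goes through
    \<open>is_projection\<close>, which is compatible with differences and multiples.\<close>
  define P where "P v = (SOME p. H1.is_projection S v p)" for v
  have P: "H1.is_projection S v (P v)" for v
  proof -
    have "\<exists>p. H1.is_projection S v p"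
      using H1.projection_exists[OF B(1), of v] unfolding B(2) H1.is_projection_def by blast
    then show ?thesis unfolding P_def by (rule someI_ex)
  qed
  have PS: "P v \<in> S" for v using P[of v] by (simp add: H1.is_projection_def)
  have P_diff: "H1.is_projection S (v - w) (P v - P w)" for v w
    by (rule H1.is_projection_diff[OF sub_S P P])
  define k where "k = c * h ^ (r - 1)"
  have k: "0 \<le> k" using c h by (simp add: k_def)
  \<comment> \<open>The projection is at least as close in H^1 as the given approximant, and
    division by h turns h^r into h^(r-1). Allowing any projection \<open>p\<close> makes the
    estimate applicable to time increments.\<close>
  have approx1: "H1.nrm (v - p) \<le> k * nr v"
    if v: "v \<in> H1_0 \<Omega>" "v \<in> sobolev \<Omega> r" and p: "H1.is_projection S v p" for v p
  proof -
    obtain w where w: "w \<in> S"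
      "L2_norm \<Omega> (\<lambda>x. v x - w x) + h * sobolev_norm \<Omega> 1 (\<lambda>x. v x - w x) \<le> c * h ^ r * sobolev_norm \<Omega> r v"
      using approx v by blast
    have vw: "v - w \<in> sobolev \<Omega> 1"
      by (rule subspace_diff[OF subspace_sobolev H1_0_sobolev[OF v(1)] S_V[OF w(1)]])
    have "H1.nrm (v - w) = sobolev_norm \<Omega> 1 (\<lambda>x. v x - w x)"
      unfolding H1_nrm_eq[OF vw] by (simp only: fun_diff_def)
    moreover have "c * h ^ r * sobolev_norm \<Omega> r v = h * (k * nr v)"
      using r by (simp add: k_def nr_eq[OF v(2)] power_eq_if)
    ultimately have "h * H1.nrm (v - w) \<le> h * (k * nr v)"
      using w(2) L2_norm_nonneg[of "\<lambda>x. v x - w x"] by (simp only:)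
    then have "H1.nrm (v - w) \<le> k * nr v" using h by simp
    then show ?thesis using H1.projection_best_approximation[OF sub_S p w(1)] by linarith
  qed
  define \<theta> where "\<theta> t = U t - P (u t)" for t
  define \<omega> where "\<omega> t = U\<^sub>t t - P (u\<^sub>t t)" for t
  define \<eta> where "\<eta> t = u t - P (u t)" for t
  define \<zeta> where "\<zeta> t = u\<^sub>t t - P (u\<^sub>t t)" for t
  have Ico: "t \<in> {0..<T}" if "t \<in> {0<..<T}" for t using that by auto
  have \<epsilon>_k: "\<epsilon> = k * M" by (simp add: \<epsilon>_def k_def)
  have \<eta>_bd: "H1.nrm (\<eta> t) \<le> \<epsilon>" if t: "t \<in> {0..<T}" for t
  proof -
    have "H1.nrm (\<eta> t) \<le> k * nr (u t)" unfolding \<eta>_def using u_in[OF t] by (intro approx1 P) auto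
    also have "\<dots> \<le> \<epsilon>" unfolding \<epsilon>_k by (intro mult_left_mono u_bound t k)
    finally show ?thesis .
  qed
  have \<zeta>_bd: "H1.nrm (\<zeta> t) \<le> \<epsilon>" if t: "t \<in> {0..<T}" for t
  proof -
    have "H1.nrm (\<zeta> t) \<le> k * nr (u\<^sub>t t)" unfolding \<zeta>_def using ut_in[OF t] by (intro approx1 P) auto
    also have "\<dots> \<le> \<epsilon>" unfolding \<epsilon>_k by (intro mult_left_mono ut_bound t k)
    finally show ?thesis .
  qed
  have \<eta>_lip: "H1.nrm (\<eta> t - \<eta> s) \<le> \<epsilon> * \<bar>t - s\<bar>" if s: "s \<in> {0..<T}" and t: "t \<in> {0..<T}" for s t
  proof -
    have "\<eta> t - \<eta> s = (u t - u s) - (P (u t) - P (u s))" by (simp add: \<eta>_def)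
    then have "H1.nrm (\<eta> t - \<eta> s) = H1.nrm ((u t - u s) - (P (u t) - P (u s)))" by (simp only:)
    also have "\<dots> \<le> k * nr (u t - u s)"
      using u_in[OF s] u_in[OF t]
      by (intro approx1 P_diff subspace_diff[OF subspace_H1_0] subspace_diff[OF subspace_sobolev]) auto
    also have "\<dots> \<le> k * (M * \<bar>t - s\<bar>)" by (intro mult_left_mono u_lipschitz s t k)
    finally show ?thesis by (simp add: \<epsilon>_k)
  qed
  have \<zeta>_lip: "H1.nrm (\<zeta> t - \<zeta> s) \<le> \<epsilon> * \<bar>t - s\<bar>" if s: "s \<in> {0..<T}" and t: "t \<in> {0..<T}" for s t
  proof -
    have "\<zeta> t - \<zeta> s = (u\<^sub>t t - u\<^sub>t s) - (P (u\<^sub>t t) - P (u\<^sub>t s))" by (simp add: \<zeta>_def)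
    then have "H1.nrm (\<zeta> t - \<zeta> s) = H1.nrm ((u\<^sub>t t - u\<^sub>t s) - (P (u\<^sub>t t) - P (u\<^sub>t s)))" by (simp only:)
    also have "\<dots> \<le> k * nr (u\<^sub>t t - u\<^sub>t s)"
      using ut_in[OF s] ut_in[OF t]
      by (intro approx1 P_diff subspace_diff[OF subspace_H1_0] subspace_diff[OF subspace_sobolev]) auto
    also have "\<dots> \<le> k * (M * \<bar>t - s\<bar>)" by (intro mult_left_mono ut_lipschitz s t k)
    finally show ?thesis by (simp add: \<epsilon>_k)
  qed
  have U_V: "U t \<in> sobolev \<Omega> 1" "U\<^sub>t t \<in> sobolev \<Omega> 1" if "t \<in> {0..<T}" for t
    using US(1) that S_V by auto
  have U_lim: "((\<lambda>t. H1.nrm (U t - U s)) \<longlongrightarrow> 0) (at s within {0..<T})" if "s \<in> {0..<T}" for s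
    by (rule sobolev_quotient_continuous[OF U_der that])
  have Ut_lim: "((\<lambda>t. H1.nrm (U\<^sub>t t - U\<^sub>t s)) \<longlongrightarrow> 0) (at s within {0..<T})" if s: "s \<in> {0..<T}" for s
    by (rule sobolev_tendsto_nrm[OF U_V(2) U_V(2)[OF s]]) (use Ut_cont s in \<open>auto simp: continuous_on_sobolev_def\<close>)
  \<comment> \<open>Projection does not increase the norm, so it preserves continuity in
    time.\<close>
  have diff_lim: "((\<lambda>t. H1.nrm ((X t - P (Y t)) - (X s - P (Y s)))) \<longlongrightarrow> 0) (at s within {0..<T})"
    if X: "((\<lambda>t. H1.nrm (X t - X s)) \<longlongrightarrow> 0) (at s within {0..<T})"
      and Y: "((\<lambda>t. H1.nrm (Y t - Y s)) \<longlongrightarrow> 0) (at s within {0..<T})" for X Y s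
  proof -
    have null: "((\<lambda>t. H1.nrm (X t - X s) + H1.nrm (Y t - Y s)) \<longlongrightarrow> 0) (at s within {0..<T})"
      using tendsto_add[OF X Y] by simp
    show ?thesis
    proof (rule Lim_null_comparison[OF always_eventually null], rule allI)
      fix t
      have "(X t - P (Y t)) - (X s - P (Y s)) = (X t - X s) - (P (Y t) - P (Y s))" by simp
      then have 1: "H1.nrm ((X t - P (Y t)) - (X s - P (Y s))) \<le> H1.nrm (X t - X s) + H1.nrm (P (Y t) - P (Y s))"
        using H1.nrm_triangle_diff[of "X t - X s" "P (Y t) - P (Y s)"] by (simp only:)
      have 2: "H1.nrm (P (Y t) - P (Y s)) \<le> H1.nrm (Y t - Y s)" by (rule H1.projection_contraction[OF P_diff])
      show "norm (H1.nrm ((X t - P (Y t)) - (X s - P (Y s)))) \<le> H1.nrm (X t - X s) + H1.nrm (Y t - Y s)"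
        unfolding real_norm_def abs_of_nonneg[OF H1.nrm_nonneg] by (rule order_trans[OF 1 add_left_mono[OF 2]])
    qed
  qed
  interpret E: wave_error ip0 "ipH 1" mass stiff T lo hi L S \<theta> \<omega> \<eta> \<zeta> \<epsilon>
  proof (intro wave_error.intro F.wave_forms_axioms wave_error_axioms.intro)
    show "subspace S" by (rule sub_S)
    show "\<theta> t \<in> S" "\<omega> t \<in> S" if "t \<in> {0..<T}" for t
      unfolding \<theta>_def \<omega>_def using US(1) that by (auto intro: subspace_diff[OF sub_S] PS)
    show "0 \<le> \<epsilon>" using k M by (simp add: \<epsilon>_k)
    show "H1.nrm (\<eta> t) \<le> \<epsilon>" if "t \<in> {0<..<T}" for t by (rule \<eta>_bd[OF Ico[OF that]])
    show "H1.nrm (\<eta> t - \<eta> s) \<le> \<epsilon> * \<bar>t - s\<bar>" if "s \<in> {0<..<T}" "t \<in> {0<..<T}" for s t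
      by (rule \<eta>_lip[OF Ico[OF that(1)] Ico[OF that(2)]])
    show "F.n0 (\<zeta> t) \<le> \<epsilon>" if "t \<in> {0<..<T}" for t
      by (rule order_trans[OF F.nrm_le \<zeta>_bd[OF Ico[OF that]]])
    show "F.n0 (\<zeta> t - \<zeta> s) \<le> \<epsilon> * \<bar>t - s\<bar>" if "s \<in> {0<..<T}" "t \<in> {0<..<T}" for s t
      by (rule order_trans[OF F.nrm_le \<zeta>_lip[OF Ico[OF that(1)] Ico[OF that(2)]]])
    show "((\<lambda>t. H1.nrm (\<theta> t - \<theta> s)) \<longlongrightarrow> 0) (at s within {0..<T})" if "s \<in> {0..<T}" for s
      unfolding \<theta>_def by (rule diff_lim[OF U_lim[OF that] u_tendsto[OF that]])
    show "((\<lambda>t. H1.nrm (\<omega> t - \<omega> s)) \<longlongrightarrow> 0) (at s within {0..<T})" if "s \<in> {0..<T}" for s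
      unfolding \<omega>_def by (rule diff_lim[OF Ut_lim[OF that] ut_tendsto[OF that]])
    show "((\<lambda>t. H1.nrm ((1 / (t - s)) *\<^sub>R (\<theta> t - \<theta> s) - \<omega> s)) \<longlongrightarrow> 0) (at s within {0..<T})"
      if s': "s \<in> {0<..<T}" for s
    proof -
      note s = Ico[OF s']
      have "((\<lambda>t. H1.nrm ((1 / (t - s)) *\<^sub>R (U t - U s) - U\<^sub>t s) + M * \<bar>t - s\<bar>) \<longlongrightarrow> 0 + M * \<bar>s - s\<bar>) (at s within {0..<T})"
        by (intro tendsto_intros sobolev_quotient_tendsto[OF U_der s])
      then have null: "((\<lambda>t. H1.nrm ((1 / (t - s)) *\<^sub>R (U t - U s) - U\<^sub>t s) + M * \<bar>t - s\<bar>) \<longlongrightarrow> 0) (at s within {0..<T})"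
        by simp
      have "H1.nrm ((1 / (t - s)) *\<^sub>R (\<theta> t - \<theta> s) - \<omega> s) \<le> H1.nrm ((1 / (t - s)) *\<^sub>R (U t - U s) - U\<^sub>t s) + M * \<bar>t - s\<bar>"
        if t: "t \<in> {0..<T}" "t \<noteq> s" for t
      proof -
        define z where "z = 1 / (t - s)"
        \<comment> \<open>\<open>w\<close> is the Taylor remainder of \<open>u\<close> divided by t
          - s, and \<open>q\<close> is a projection of it. Contraction bounds by M \<bar>t - s\<bar>
          the gap between the difference quotient of the projected solution and the projection of
          \<open>u\<^sub>t\<close>.\<close>
        define q where "q = z *\<^sub>R (P (u t) - P (u s)) - P (u\<^sub>t s)"
        define w where "w = z *\<^sub>R (u t - u s) - u\<^sub>t s"
        have z: "z * (t - s) = 1" using t by (simp add: z_def)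
        have "H1.is_projection S w q"
          unfolding w_def q_def by (intro H1.is_projection_diff H1.is_projection_scaleR sub_S P)
        then have "H1.nrm q \<le> H1.nrm w" by (rule H1.projection_contraction)
        also have "w = z *\<^sub>R (u t - u s - (t - s) *\<^sub>R u\<^sub>t s)"
          unfolding w_def scaleR_diff_right scaleR_scaleR z by simp
        also have "H1.nrm \<dots> \<le> \<bar>z\<bar> * (M * \<bar>t - s\<bar> * \<bar>t - s\<bar>)"
          unfolding H1.nrm_scale by (intro mult_left_mono H1_lipschitz(3) s t) simp
        also have "\<dots> = M * \<bar>t - s\<bar> * \<bar>z * (t - s)\<bar>" by (simp add: abs_mult)
        also have "\<dots> = M * \<bar>t - s\<bar>" by (simp add: z)
        finally have q: "H1.nrm q \<le> M * \<bar>t - s\<bar>" .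
        have "z *\<^sub>R (\<theta> t - \<theta> s) - \<omega> s = (z *\<^sub>R (U t - U s) - U\<^sub>t s) - q"
          by (rule ext) (simp add: \<theta>_def \<omega>_def q_def algebra_simps)
        then have "H1.nrm (z *\<^sub>R (\<theta> t - \<theta> s) - \<omega> s) \<le> H1.nrm (z *\<^sub>R (U t - U s) - U\<^sub>t s) + H1.nrm q"
          using H1.nrm_triangle_diff[of "z *\<^sub>R (U t - U s) - U\<^sub>t s" q] by (simp only:)
        then show ?thesis using q unfolding z_def by linarith
      qed
      then have "\<forall>\<^sub>F t in at s within {0..<T}. norm (H1.nrm ((1 / (t - s)) *\<^sub>R (\<theta> t - \<theta> s) - \<omega> s)) \<le>
          H1.nrm ((1 / (t - s)) *\<^sub>R (U t - U s) - U\<^sub>t s) + M * \<bar>t - s\<bar>"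
        unfolding real_norm_def abs_of_nonneg[OF H1.nrm_nonneg] by (simp add: eventually_at_filter)
      then show ?thesis by (rule Lim_null_comparison[OF _ null])
    qed
    show "((\<lambda>t. mass t (\<omega> t - \<zeta> t) \<xi>) has_real_derivative - stiff t (\<theta> t - \<eta> t) \<xi>) (at t)"
      if t: "t \<in> {0<..<T}" and \<xi>: "\<xi> \<in> S" for t \<xi>
    proof -
      have \<xi>V: "\<xi> \<in> sobolev \<Omega> 1" by (rule S_V[OF \<xi>])
      have "((\<lambda>t. mass t (U\<^sub>t t - u\<^sub>t t) \<xi>) has_real_derivative - stiff t (U t - u t) \<xi>) (at t)"
      proof (rule error_momentum)
        show "\<xi> \<in> H1_0 \<Omega>" using \<xi> S(2) by blast
        show "((\<lambda>t. H1.nrm (U t - U s)) \<longlongrightarrow> 0) (at s)" if s: "s \<in> {0<..<T}" for s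
          using U_lim[OF Ico[OF s]] by (simp only: at_Ico_eq[OF s])
        show "((\<lambda>t. mass t (U\<^sub>t t) \<xi>) has_real_derivative L2_inner \<Omega> (f s) \<xi> - stiff s (U s) \<xi>) (at s)"
          if s: "s \<in> {0<..<T}" for s
        proof (rule DERIV_cong[OF discrete_momentum[OF Ut_der \<xi>V s]])
          have "U\<^sub>t\<^sub>t s \<in> sobolev \<Omega> 1" using US(2) s S_V by blast
          then show "mass s (U\<^sub>t\<^sub>t s) \<xi> + L2_inner \<Omega> (\<lambda>x. b_coeff \<kappa> s x * U\<^sub>t s x) \<xi> = L2_inner \<Omega> (f s) \<xi> - stiff s (U s) \<xi>"
            using eq[rule_format, OF s \<xi>] by (simp add: mass_eq[OF _ \<xi>V] stiff_eq[OF U_V(1)[OF Ico[OF s]] \<xi>V])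
        qed
      qed (rule t)
      moreover have "\<omega> t - \<zeta> t = U\<^sub>t t - u\<^sub>t t" "\<theta> t - \<eta> t = U t - u t" for t
        by (simp_all add: \<omega>_def \<zeta>_def \<theta>_def \<eta>_def)
      ultimately show ?thesis by (simp only:)
    qed
  qed
  have zero: "0 \<in> {0..<T}" using T by simp
  \<comment> \<open>Initial values are prescribed only up to null sets, which the norms do not
    see.\<close>
  have \<theta>0: "H1.nrm (\<theta> 0) \<le> \<delta> + \<epsilon>"
  proof -
    have u0V: "u0 \<in> sobolev \<Omega> 1" by (rule sobolev_mono[OF r u0])
    have d: "U 0 - u 0 \<in> sobolev \<Omega> 1" by (rule subspace_diff[OF subspace_sobolev U_V(1)[OF zero] u_V[OF zero]])
    have "AE x in leb. (u0h - u0) x = (U 0 - u 0) x" using U_init u_init by eventually_elim simp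
    from sobolev_norm_cong_AE[OF subspace_diff[OF subspace_sobolev S_V[OF init(1)] u0V] sobolev_L2[OF d] this]
    have "H1.nrm (U 0 - u 0) = sobolev_norm \<Omega> 1 (\<lambda>x. u0h x - u0 x)"
      unfolding H1_nrm_eq[OF d] by (simp only: fun_diff_def)
    moreover have "\<theta> 0 = (U 0 - u 0) + \<eta> 0" by (simp add: \<theta>_def \<eta>_def)
    ultimately show ?thesis
      using H1.nrm_triangle[of "U 0 - u 0" "\<eta> 0"] \<eta>_bd[OF zero] init(3) by (simp only:)
  qed
  have \<omega>0: "F.n0 (\<omega> 0) \<le> \<delta> + \<epsilon>"
  proof -
    have d: "U\<^sub>t 0 - u\<^sub>t 0 \<in> sobolev \<Omega> 1" by (rule subspace_diff[OF subspace_sobolev U_V(2)[OF zero] ut_V[OF zero]])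
    have "AE x in leb. (U\<^sub>t 0 - u\<^sub>t 0) x = (v0h - v0) x" using Ut_init ut_init by eventually_elim simp
    from L2_norm_cong_AE[OF sobolev_L2[OF d] L2_diff[OF sobolev_L2[OF S_V[OF init(2)]] sobolev_L2[OF v0]] this]
    have "F.n0 (U\<^sub>t 0 - u\<^sub>t 0) = L2_norm \<Omega> (\<lambda>x. v0h x - v0 x)"
      unfolding n0_eq[OF d] by (simp only: fun_diff_def)
    moreover have "\<omega> 0 = (U\<^sub>t 0 - u\<^sub>t 0) + \<zeta> 0" by (simp add: \<omega>_def \<zeta>_def)
    moreover have "F.n0 (\<zeta> 0) \<le> \<epsilon>" by (rule order_trans[OF F.nrm_le \<zeta>_bd[OF zero]])
    ultimately show ?thesis
      using F.H0.nrm_triangle[of "U\<^sub>t 0 - u\<^sub>t 0" "\<zeta> 0"] init(4) by (simp only:)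
  qed
  have bound: "H1.nrm (u t - U t) \<le> \<epsilon> + sqrt (F.energy_const * ((\<delta> + \<epsilon>)\<^sup>2 + (\<delta> + \<epsilon>)\<^sup>2 + \<epsilon>\<^sup>2))"
    if t: "t \<in> {0<..<T}" for t
  proof -
    have "(H1.nrm (\<theta> t))\<^sup>2 \<le> F.energy_const * ((F.n0 (\<omega> 0))\<^sup>2 + (H1.nrm (\<theta> 0))\<^sup>2 + \<epsilon>\<^sup>2)"
      by (rule E.energy_estimate[OF t])
    also have "\<dots> \<le> F.energy_const * ((\<delta> + \<epsilon>)\<^sup>2 + (\<delta> + \<epsilon>)\<^sup>2 + \<epsilon>\<^sup>2)"
      using F.energy_const_pos \<theta>0 \<omega>0 by (intro mult_left_mono add_mono power_mono order_refl) auto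
    finally have "H1.nrm (\<theta> t) \<le> sqrt (F.energy_const * ((\<delta> + \<epsilon>)\<^sup>2 + (\<delta> + \<epsilon>)\<^sup>2 + \<epsilon>\<^sup>2))"
      by (rule real_le_rsqrt)
    moreover have "u t - U t = \<eta> t - \<theta> t" by (simp add: \<eta>_def \<theta>_def)
    ultimately show ?thesis
      using H1.nrm_triangle_diff[of "\<eta> t" "\<theta> t"] \<eta>_bd[OF Ico[OF t]] by (simp only:)
  qed
  have V: "u t - U t \<in> sobolev \<Omega> 1" if "t \<in> {0..<T}" for t
    by (rule subspace_diff[OF subspace_sobolev u_V[OF that] U_V(1)[OF that]])
  have cont: "((\<lambda>\<tau>. H1.nrm ((u \<tau> - U \<tau>) - (u t - U t))) \<longlongrightarrow> 0) (at t within {0..<T})" if t: "t \<in> {0..<T}" for t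
  proof -
    have null: "((\<lambda>\<tau>. H1.nrm (u \<tau> - u t) + H1.nrm (U \<tau> - U t)) \<longlongrightarrow> 0) (at t within {0..<T})"
      using tendsto_add[OF u_tendsto[OF t] U_lim[OF t]] by simp
    show ?thesis
    proof (rule Lim_null_comparison[OF always_eventually null], rule allI)
      fix \<tau>
      have "(u \<tau> - U \<tau>) - (u t - U t) = (u \<tau> - u t) - (U \<tau> - U t)" by simp
      then show "norm (H1.nrm ((u \<tau> - U \<tau>) - (u t - U t))) \<le> H1.nrm (u \<tau> - u t) + H1.nrm (U \<tau> - U t)"
        unfolding real_norm_def abs_of_nonneg[OF H1.nrm_nonneg]
        using H1.nrm_triangle_diff[of "u \<tau> - u t" "U \<tau> - U t"] by (simp only:)
    qed
  qed
  have eq_fun: "(\<lambda>t x. u t x - U t x) = (\<lambda>t. u t - U t)" by (simp only: fun_diff_def)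
  show "(\<lambda>t x. u t x - U t x) \<in> Linfty_sobolev T \<Omega> 1"
    unfolding eq_fun by (rule Linfty_sobolev_of_continuous(1)[OF T V cont bound])
  show "Linfty_norm T \<Omega> 1 (\<lambda>t x. u t x - U t x) \<le>
      ereal (\<epsilon> + sqrt (F.energy_const * ((\<delta> + \<epsilon>)\<^sup>2 + (\<delta> + \<epsilon>)\<^sup>2 + \<epsilon>\<^sup>2)))"
    unfolding eq_fun by (rule Linfty_sobolev_of_continuous(2)[OF T V cont bound])
qed

end

text \<open>All constants are fixed before h is: L comes from the coefficients and M from the exact
  solution and its data. Membership of the error in the Bochner space is part of the conclusion,
  since a bound on the norm alone would not express strong measurability.\<close>

theorem theorem5p1:
  fixes \<Omega> :: "(real ^ 'd) set"
    and T C_lo C_hi c C\<^sub>0 h\<^sub>0 :: real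
    and r :: nat
    and \<kappa> \<rho> f u u\<^sub>t u\<^sub>t\<^sub>t :: "real \<Rightarrow> real ^ 'd \<Rightarrow> real"
    and u0 v0 :: "real ^ 'd \<Rightarrow> real"
    and S :: "real \<Rightarrow> (real ^ 'd \<Rightarrow> real) set"
    and U :: "real \<Rightarrow> real \<Rightarrow> real ^ 'd \<Rightarrow> real"
    and u0h v0h :: "real \<Rightarrow> real ^ 'd \<Rightarrow> real"
  assumes domain: "open \<Omega>" "connected \<Omega>" "\<Omega> \<noteq> {}" "bounded \<Omega>" "lipschitz_boundary \<Omega>"
      "convex \<Omega> \<or> smooth_boundary \<Omega>"
    and T: "0 < T"
    and r: "2 \<le> r"
    and coeffs_smooth: "Ck_closure 1 ({0<..<T} \<times> \<Omega>) (\<lambda>(t, x). \<kappa> t x)"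
      "Ck_closure 1 ({0<..<T} \<times> \<Omega>) (\<lambda>(t, x). \<rho> t x)"
    and coeffs_bounds: "0 < C_lo" "0 < C_hi"
      "\<forall>t\<in>{0<..<T}. \<forall>x\<in>\<Omega>. 0 < \<kappa> t x \<and> C_lo \<le> 1 / \<kappa> t x \<and> 1 / \<kappa> t x \<le> C_hi"
      "\<forall>t\<in>{0<..<T}. \<forall>x\<in>\<Omega>. 0 < \<rho> t x \<and> C_lo \<le> 1 / \<rho> t x \<and> 1 / \<rho> t x \<le> C_hi"
    and data: "u0 \<in> sobolev \<Omega> r" "v0 \<in> sobolev \<Omega> r" "\<forall>t\<in>{0<..<T}. f t \<in> L2 \<Omega>"
    and solution: "wave_solution T \<Omega> \<kappa> \<rho> f u0 v0 u u\<^sub>t"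
    and regularity: "has_weak_time_derivative T \<Omega> u\<^sub>t u\<^sub>t\<^sub>t"
      "u\<^sub>t \<in> Linfty_sobolev T \<Omega> r" "u\<^sub>t\<^sub>t \<in> Linfty_sobolev T \<Omega> r"
    and mesh: "0 < h\<^sub>0"
    and spaces: "\<forall>h\<in>{0<..h\<^sub>0}. finite_dim_space (S h) \<and> S h \<subseteq> H1_0 \<Omega>"
    and approximation: "0 < c"
      "\<forall>h\<in>{0<..h\<^sub>0}. \<forall>v \<in> H1_0 \<Omega> \<inter> sobolev \<Omega> r. \<exists>w\<in>S h.
         L2_norm \<Omega> (\<lambda>x. v x - w x) + h * sobolev_norm \<Omega> 1 (\<lambda>x. v x - w x)
         \<le> c * h ^ r * sobolev_norm \<Omega> r v"
    and initial: "\<forall>h\<in>{0<..h\<^sub>0}. u0h h \<in> S h \<and> v0h h \<in> S h \<and>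
         sobolev_norm \<Omega> 1 (\<lambda>x. u0h h x - u0 x) \<le> C\<^sub>0 * h ^ (r - 1) * sobolev_norm \<Omega> r u0 \<and>
         L2_norm \<Omega> (\<lambda>x. v0h h x - v0 x) \<le> C\<^sub>0 * h ^ r * sobolev_norm \<Omega> r v0"
    and galerkin: "\<forall>h\<in>{0<..h\<^sub>0}. galerkin_solution T \<Omega> \<kappa> \<rho> f (S h) (u0h h) (v0h h) (U h)"
  shows "\<exists>C>0. \<forall>h\<in>{0<..h\<^sub>0}.
    (\<lambda>t x. u t x - U h t x) \<in> Linfty_sobolev T \<Omega> 1 \<and>
    Linfty_norm T \<Omega> 1 (\<lambda>t x. u t x - U h t x) \<le> ereal (C * h ^ (r - 1))"
proof -
  interpret domain \<Omega> by unfold_locales (use domain in auto)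
  obtain L\<^sub>1 where L\<^sub>1: "0 \<le> L\<^sub>1"
    "\<And>t. t \<in> {0<..<T} \<Longrightarrow> (\<lambda>x. 1 / \<kappa> t x) \<in> borel_measurable leb"
    "\<And>t. t \<in> {0<..<T} \<Longrightarrow> b_coeff \<kappa> t \<in> borel_measurable leb"
    "\<And>t x. t \<in> {0<..<T} \<Longrightarrow> x \<in> \<Omega> \<Longrightarrow> ((\<lambda>\<tau>. 1 / \<kappa> \<tau> x) has_real_derivative b_coeff \<kappa> t x) (at t)"
    "\<And>t x. t \<in> {0<..<T} \<Longrightarrow> x \<in> \<Omega> \<Longrightarrow> \<bar>b_coeff \<kappa> t x\<bar> \<le> L\<^sub>1"
    "\<And>s t x. s \<in> {0<..<T} \<Longrightarrow> t \<in> {0<..<T} \<Longrightarrow> x \<in> \<Omega> \<Longrightarrow> \<bar>1 / \<kappa> t x - 1 / \<kappa> s x\<bar> \<le> L\<^sub>1 * \<bar>t - s\<bar>"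
    by (rule reciprocal_coefficient[OF coeffs_smooth(1) coeffs_bounds(3)]) (rule that)
  obtain L\<^sub>2 where L\<^sub>2: "0 \<le> L\<^sub>2"
    "\<And>t. t \<in> {0<..<T} \<Longrightarrow> (\<lambda>x. 1 / \<rho> t x) \<in> borel_measurable leb"
    "\<And>s t x. s \<in> {0<..<T} \<Longrightarrow> t \<in> {0<..<T} \<Longrightarrow> x \<in> \<Omega> \<Longrightarrow> \<bar>1 / \<rho> t x - 1 / \<rho> s x\<bar> \<le> L\<^sub>2 * \<bar>t - s\<bar>"
    by (rule reciprocal_coefficient[OF coeffs_smooth(2) coeffs_bounds(4)]) (rule that)
  \<comment> \<open>The abstract setting has one Lipschitz constant for both coefficients.\<close>
  define L where "L = L\<^sub>1 + L\<^sub>2"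
  have L: "L\<^sub>1 * \<bar>t - s\<bar> \<le> L * \<bar>t - s\<bar>" "L\<^sub>2 * \<bar>t - s\<bar> \<le> L * \<bar>t - s\<bar>" "L\<^sub>1 \<le> L" for s t :: real
    unfolding L_def using L\<^sub>1(1) L\<^sub>2(1) by (auto intro!: mult_right_mono)
  interpret wave_coeffs \<Omega> T C_lo C_hi L \<kappa> \<rho>
  proof unfold_locales
    show "0 < T" "0 < C_lo" "0 \<le> C_hi" "0 \<le> L"
      using T coeffs_bounds L\<^sub>1(1) L\<^sub>2(1) by (auto simp: L_def)
    fix t assume t: "t \<in> {0<..<T}"
    show "(\<lambda>x. 1 / \<kappa> t x) \<in> borel_measurable leb" "b_coeff \<kappa> t \<in> borel_measurable leb"
      "(\<lambda>x. 1 / \<rho> t x) \<in> borel_measurable leb"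
      by (rule L\<^sub>1 L\<^sub>2 t)+
    show "((\<lambda>\<tau>. 1 / \<kappa> \<tau> x) has_real_derivative b_coeff \<kappa> t x) (at t)" if "x \<in> \<Omega>" for x
      by (rule L\<^sub>1(4)[OF t that])
    show "\<forall>x\<in>\<Omega>. C_lo \<le> 1 / \<kappa> t x" "\<forall>x\<in>\<Omega>. \<bar>1 / \<kappa> t x\<bar> \<le> C_hi"
      "\<forall>x\<in>\<Omega>. C_lo \<le> 1 / \<rho> t x" "\<forall>x\<in>\<Omega>. \<bar>1 / \<rho> t x\<bar> \<le> C_hi"
      using bspec[OF coeffs_bounds(3) t] bspec[OF coeffs_bounds(4) t] by (auto simp: abs_of_pos)
    show "\<forall>x\<in>\<Omega>. \<bar>b_coeff \<kappa> t x\<bar> \<le> L" using L\<^sub>1(5)[OF t] L(3) by (meson order_trans)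
    fix s assume s: "s \<in> {0<..<T}"
    show "\<forall>x\<in>\<Omega>. \<bar>1 / \<kappa> s x - 1 / \<kappa> t x\<bar> \<le> L * \<bar>s - t\<bar>" "\<forall>x\<in>\<Omega>. \<bar>1 / \<rho> s x - 1 / \<rho> t x\<bar> \<le> L * \<bar>s - t\<bar>"
      using L\<^sub>1(6)[OF t s] L\<^sub>2(3)[OF t s] L by (meson order_trans)+
  qed
  note sol = solution[unfolded wave_solution_def]
  interpret regular_solution \<Omega> T r u u\<^sub>t u\<^sub>t\<^sub>t u0 v0
    by unfold_locales (use T r data regularity sol in auto)
  obtain M where M: "0 \<le> M"
    "\<And>t. t \<in> {0..<T} \<Longrightarrow> u t \<in> H1_0 \<Omega> \<inter> sobolev \<Omega> r" "\<And>t. t \<in> {0..<T} \<Longrightarrow> u\<^sub>t t \<in> H1_0 \<Omega> \<inter> sobolev \<Omega> r"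
    "\<And>t. t \<in> {0..<T} \<Longrightarrow> nr (u t) \<le> M" "\<And>t. t \<in> {0..<T} \<Longrightarrow> nr (u\<^sub>t t) \<le> M"
    "\<And>s t. s \<in> {0..<T} \<Longrightarrow> t \<in> {0..<T} \<Longrightarrow> nr (u t - u s) \<le> M * \<bar>t - s\<bar>"
    "\<And>s t. s \<in> {0..<T} \<Longrightarrow> t \<in> {0..<T} \<Longrightarrow> nr (u\<^sub>t t - u\<^sub>t s) \<le> M * \<bar>t - s\<bar>"
    "\<And>s t. s \<in> {0..<T} \<Longrightarrow> t \<in> {0..<T} \<Longrightarrow> nr (u t - u s - (t - s) *\<^sub>R u\<^sub>t s) \<le> M * \<bar>t - s\<bar> * \<bar>t - s\<bar>"
    by (rule regular_solution.regularity[OF regular_solution_axioms]) (rule that)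
  have f: "f t \<in> L2 \<Omega>" if "t \<in> {0<..<T}" for t using data(3) that by blast
  have eq: "has_weak_partial {0<..<T} {#1#} (\<lambda>t. L2_inner \<Omega> (\<lambda>x. 1 / \<kappa> t x * u\<^sub>t t x) \<phi>)
      (\<lambda>t. L2_inner \<Omega> (f t) \<phi> - stiffness \<Omega> (\<lambda>x. 1 / \<rho> t x) (u t) \<phi>)" if "\<phi> \<in> test_functions \<Omega>" for \<phi>
    using sol that by blast
  interpret wave_setting \<Omega> T C_lo C_hi L \<kappa> \<rho> r u u\<^sub>t u\<^sub>t\<^sub>t u0 v0 f M
    by (intro wave_setting.intro wave_coeffs_axioms regular_solution_axioms wave_setting_axioms.intro f eq M)
  \<comment> \<open>Both initial errors are at most D h^(r-1): the velocity error gives up one power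
    of h, which becomes the factor \<open>h\<^sub>0\<close>. The sign of \<open>C\<^sub>0\<close> is
    unspecified, hence the absolute values.\<close>
  define D where "D = \<bar>C\<^sub>0\<bar> * sobolev_norm \<Omega> r u0 + \<bar>C\<^sub>0\<bar> * h\<^sub>0 * sobolev_norm \<Omega> r v0"
  define b where "b = c * M"
  define a where "a = D + b"
  \<comment> \<open>Here \<open>b\<close> and \<open>a\<close> are \<epsilon> and \<delta> +
    \<epsilon> with the factor h^(r-1) removed, and the square root is homogeneous in that factor.
    The summand 1 makes \<open>C\<close> positive even if both vanish.\<close>
  define C where "C = b + sqrt (F.energy_const * (a\<^sup>2 + a\<^sup>2 + b\<^sup>2)) + 1"
  have b: "0 \<le> b" using approximation(1) M(1) by (simp add: b_def)
  have EC: "0 \<le> F.energy_const" using F.energy_const_pos by simp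
  then have "0 < C" using b by (auto simp: C_def intro!: add_nonneg_pos)
  moreover have "(\<lambda>t x. u t x - U h t x) \<in> Linfty_sobolev T \<Omega> 1 \<and>
      Linfty_norm T \<Omega> 1 (\<lambda>t x. u t x - U h t x) \<le> ereal (C * h ^ (r - 1))" if h: "h \<in> {0<..h\<^sub>0}" for h
  proof -
    define k where "k = h ^ (r - 1)"
    have k: "0 \<le> k" using h by (simp add: k_def)
    have "h ^ r = h * k" using r power_eq_if[of h r] by (simp add: k_def)
    also have "\<dots> \<le> h\<^sub>0 * k" using h by (intro mult_right_mono k) auto
    finally have hk: "h ^ r \<le> h\<^sub>0 * k" .
    have nn: "0 \<le> sobolev_norm \<Omega> r w" for w by (rule sobolev_norm_nonneg)
    have u0: "sobolev_norm \<Omega> 1 (\<lambda>x. u0h h x - u0 x) \<le> D * k"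
    proof -
      have "sobolev_norm \<Omega> 1 (\<lambda>x. u0h h x - u0 x) \<le> C\<^sub>0 * k * sobolev_norm \<Omega> r u0"
        using initial h unfolding k_def by blast
      also have "\<dots> \<le> \<bar>C\<^sub>0\<bar> * k * sobolev_norm \<Omega> r u0" by (intro mult_right_mono k nn) simp
      also have "\<dots> \<le> D * k"
        using mesh k nn[of v0] by (simp add: D_def algebra_simps)
      finally show ?thesis .
    qed
    have v0: "L2_norm \<Omega> (\<lambda>x. v0h h x - v0 x) \<le> D * k"
    proof -
      have "L2_norm \<Omega> (\<lambda>x. v0h h x - v0 x) \<le> C\<^sub>0 * h ^ r * sobolev_norm \<Omega> r v0"
        using initial h by blast
      also have "\<dots> \<le> \<bar>C\<^sub>0\<bar> * (h\<^sub>0 * k) * sobolev_norm \<Omega> r v0"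
        using h hk by (intro mult_right_mono mult_mono nn) auto
      also have "\<dots> \<le> D * k"
        using k nn[of u0] by (simp add: D_def algebra_simps)
      finally show ?thesis .
    qed
    have sum: "D * k + b * k = a * k" by (simp add: a_def algebra_simps)
    have "F.energy_const * ((a * k)\<^sup>2 + (a * k)\<^sup>2 + (b * k)\<^sup>2) = F.energy_const * (a\<^sup>2 + a\<^sup>2 + b\<^sup>2) * k\<^sup>2"
      by (simp add: power_mult_distrib algebra_simps)
    then have root: "sqrt (F.energy_const * ((a * k)\<^sup>2 + (a * k)\<^sup>2 + (b * k)\<^sup>2)) =
        sqrt (F.energy_const * (a\<^sup>2 + a\<^sup>2 + b\<^sup>2)) * k"
      using k by (simp only: real_sqrt_mult real_sqrt_abs abs_of_nonneg)
    have sp: "finite_dim_space (S h)" "S h \<subseteq> H1_0 \<Omega>" "u0h h \<in> S h" "v0h h \<in> S h"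
      using spaces initial h by blast+
    have "0 < h" "0 \<le> c" using h approximation(1) by auto
    note err = galerkin_error[OF sp(1,2) this bspec[OF approximation(2) h] bspec[OF galerkin h] sp(3,4) u0 v0, of "b * k"]
    have ek: "b * k = c * h ^ (r - 1) * M" by (simp add: b_def k_def)
    have "Linfty_norm T \<Omega> 1 (\<lambda>t x. u t x - U h t x) \<le> ereal (b * k + sqrt (F.energy_const * (a\<^sup>2 + a\<^sup>2 + b\<^sup>2)) * k)"
      using err(2)[OF ek] by (simp only: sum root)
    also have "\<dots> \<le> ereal (C * h ^ (r - 1))"
      using k by (simp add: C_def algebra_simps k_def[symmetric])
    finally show ?thesis using err(1)[OF ek] by blast
  qed
  ultimately show ?thesis by blast
qed

end
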